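(* Let $n$ be a positive integer. Every idempotent complete additive category $\mathcal C$ has a unique maximal $n$-exact structure (maximal with respect to inclusion of classes of conflations). Its conflations are precisely all complexes $X_\bullet: X_{n+1}\to X_n\to\cdots\to X_1\to X_0$ in $\mathcal C$ whose Yoneda embedding $\mathcal C(-,X_\bullet)$ is a projective resolution of a functor in $\mathsf{max}_n\,\mathcal C$; that is, the maximal $n$-exact structure is the class of all $n$-exact sequences $X_\bullet$ with $\operatorname{Cok}\mathcal C(-,d^X_1)\in\mathsf{max}_n\,\mathcal C$.
   Context: **Modules.** A $\mathcal C$-module is an additive functor $\mathcal C^{\mathrm{op}}\to\mathsf{Ab}$; a $\mathcal C$-morphism is a natural transformation. Kernels, images, cokernels and exactness are pointwise. $\mathsf{mod}\,\mathcal C$ is the category of all $\mathcal C$-modules $F$ admitting an infinite pointwise exact sequence $\cdots\to\mathcal C(-,X_1)\to\mathcal C(-,X_0)\to F\to 0$ with $X_i\in\mathcal C$. With the pointwise short exact sequences it is an exact category with enough projectives, the projectives being up to isomorphism the representables $\mathcal C(-,X)$; $\operatorname{Ext}^i_{\mathsf{mod}\,\mathcal C}$ and $\operatorname{pdim}_{\mathsf{mod}\,\mathcal C}$ refer to this exact category ($\operatorname{Ext}^0=\operatorname{Hom}$). **$n$-exact sequences.** A complex $X_\bullet: X_{n+1}\xrightarrow{d^X_{n+1}}X_n\to\cdots\to X_1\xrightarrow{d^X_1}X_0$ in $\mathcal C$ is $n$-exact if for all $Y\in\mathcal C$ both $0\to\mathcal C(Y,X_{n+1})\to\cdots\to\mathcal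 C(Y,X_0)$ and $0\to\mathcal C(X_0,Y)\to\cdots\to\mathcal C(X_{n+1},Y)$ are exact. $\mathbf K^{\mathrm{ex}}_n(\mathcal C)$ is the homotopy category of $n$-exact sequences. A class $\mathscr X$ closed under isomorphism in $\mathbf K^{\mathrm{ex}}_n(\mathcal C)$ is the same as a class of $n$-exact sequences closed under homotopy equivalence. **$n$-exact structures.** Let $\mathscr X\subseteq\mathbf K^{\mathrm{ex}}_n(\mathcal C)$ be a class closed under isomorphism. Members of $\mathscr X$ are $\mathscr X$-conflations; the first morphism $d^X_{n+1}$ (resp. last morphism $d^X_1$) of an $\mathscr X$-conflation is an $\mathscr X$-inflation (resp. $\mathscr X$-deflation). $\mathscr X$ is an $n$-exact structure on $\mathcal C$ if: (Ex0) the zero complex is in $\mathscr X$; (Ex1) $\mathscr X$-inflations are closed under composition; (Ex1$^{\mathrm{op}}$) $\mathscr X$-deflations are closed under composition; (Ex2) for every $\mathscr X$-inflation $d^X_{n+1}:X_{n+1}\to X_n$ and every $f_{n+1}:X_{n+1}\to Y_{n+1}$, the morphism $\begin{bmatrix}-d^X_{n+1}\\ f_{n+1}\end{bmatrix}:X_{n+1}\to X_n\oplus Y_{n+1}$ is an $\mathscr X$-inflation admitting a weak cokernel $[f_n\ \ d^Y_{n+1}]:X_n\oplus Y_{n+1}\to Y_n$ such that $d^Y_{n+1}$ is an $\mathscr X$-inflation; (Ex2$^{\mathrm{op}}$) for every $\mathscr X$-deflation $d^X_1:X_1\to X_0$ and every $f_0:Y_0\to X_0$, the morphism $[-d^X_1\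 \ f_0]:X_1\oplus Y_0\to X_0$ is an $\mathscr X$-deflation admitting a weak kernel $\begin{bmatrix}f_1\\ d^Y_1\end{bmatrix}:Y_1\to X_1\oplus Y_0$ such that $d^Y_1$ is an $\mathscr X$-deflation. (A weak kernel of $f$ is a morphism $g$ with $fg=0$ through which every $h$ with $fh=0$ factors, not necessarily uniquely; weak cokernels are dual.) **The category $\mathsf{ex}_n\,\mathcal C$ and functors.** $\mathsf{ex}_n\,\mathcal C\subseteq\mathsf{mod}\,\mathcal C$ is the full subcategory of all $F$ with $\operatorname{pdim}_{\mathsf{mod}\,\mathcal C}F\le n+1$ and $\operatorname{Ext}^i_{\mathsf{mod}\,\mathcal C}(F,\mathcal C(-,Y))=0$ for all $0\le i\le n$, $Y\in\mathcal C$. $\operatorname{Fun}^{\mathcal C}_n:\mathbf K^{\mathrm{ex}}_n(\mathcal C)\to\mathsf{ex}_n\,\mathcal C$ sends $X_\bullet$ to $\operatorname{Cok}\mathcal C(-,d^X_1)$ and a chain map to the induced map on cokernels; it is an equivalence. $\operatorname{Res}^{\mathcal C}_n$ is a quasi-inverse, sending $F$ to an $n$-exact sequence $X_\bullet$ such that $\mathcal C(-,X_\bullet)$ is a projective resolution of $F$. The image of a class under a functor always means its essential image. **$\mathsf{Pb}$, $\mathsf{Po}$, $\mathsf{max}_n$.** For an isomorphism closed full subcategory $\mathscr F\subseteq\mathsf{ex}_n\,\mathcal C$, $\mathsf{Pb}^{\mathcal C}_n(\mathscr F)$ is the full subcategory of all $F\in\mathscr F$ such that for every $G\in\mathsf{mod}\,\mathcal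 C$ and every $\alpha:G\to F$ both $\operatorname{Im}\alpha$ and $F/\operatorname{Im}\alpha$ are in $\mathscr F$. Let $\operatorname{Op}^{\mathcal C}_n:\mathbf K^{\mathrm{ex}}_n(\mathcal C)\to\mathbf K^{\mathrm{ex}}_n(\mathcal C^{\mathrm{op}})$ be the duality reversing all arrows (sending $X_\bullet$ to $X_{n+1-\bullet}$), and $\operatorname{Tr}^{\mathcal C}_{n+1}=\operatorname{Fun}^{\mathcal C^{\mathrm{op}}}_n\circ\operatorname{Op}^{\mathcal C}_n\circ\operatorname{Res}^{\mathcal C}_n$. Then $\mathsf{Po}^{\mathcal C}_n(\mathscr F)=\operatorname{Tr}^{\mathcal C^{\mathrm{op}}}_{n+1}(\mathsf{Pb}^{\mathcal C^{\mathrm{op}}}_n(\operatorname{Tr}^{\mathcal C}_{n+1}(\mathscr F)))$. Let $(\mathsf{Pb}^{\mathcal C}_n)^i$ be the $i$-fold application, $(\mathsf{Pb}^{\mathcal C}_n)^\infty(\mathscr F)=\bigcap_{i\in\mathbb N}(\mathsf{Pb}^{\mathcal C}_n)^i(\mathscr F)$, and similarly $(\mathsf{Po}^{\mathcal C}_n)^i$, $(\mathsf{Po}^{\mathcal C}_n)^\infty$. Put $\mathsf{max}_n\,\mathcal C=(\mathsf{Po}^{\mathcal C}_n)^\infty\big((\mathsf{Pb}^{\mathcal C}_n)^\infty(\mathsf{ex}_n\,\mathcal C)\big)$. *)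

theory Defs
  imports "HOL-Algebra.Elementary_Groups"
begin

section \<open>Additive categories\<close>

text \<open>
  A category has its objects and arrows in arbitrary subsets of two types. Composition is written
  in the usual order, so \<open>g \<cdot>\<^bsub>C\<^esub> f\<close> is \<open>f\<close> followed by \<open>g\<close>. Abelian groups are the
  commutative groups of HOL-Algebra, written multiplicatively: the product of \<open>Hom C A B\<close> is the
  addition of arrows and \<open>inv\<^bsub>Hom C A B\<^esub> f\<close> is \<open>- f\<close>.
\<close>

record ('o, 'm) cat =
  Obj :: "'o set"
  Arr :: "'m set"
  Dom :: "'m \<Rightarrow> 'o"
  Cod :: "'m \<Rightarrow> 'o"
  Id :: "'o \<Rightarrow> 'm"
  Comp :: "'m \<Rightarrow> 'm \<Rightarrow> 'm" (infixl "\<cdot>\<index>" 70)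
  Add :: "'m \<Rightarrow> 'm \<Rightarrow> 'm"
  Zero :: "'o \<Rightarrow> 'o \<Rightarrow> 'm"

definition mor :: "('o, 'm) cat \<Rightarrow> 'o \<Rightarrow> 'o \<Rightarrow> 'm set" where
  "mor C A B = {f \<in> Arr C. Dom C f = A \<and> Cod C f = B}"

definition Hom :: "('o, 'm) cat \<Rightarrow> 'o \<Rightarrow> 'o \<Rightarrow> 'm monoid" where
  "Hom C A B = \<lparr>carrier = mor C A B, mult = Add C, one = Zero C A B\<rparr>"

locale category =
  fixes C :: "('o, 'm) cat" (structure)
  assumes Dom_Obj: "f \<in> Arr C \<Longrightarrow> Dom C f \<in> Obj C"
    and Cod_Obj: "f \<in> Arr C \<Longrightarrow> Cod C f \<in> Obj C"
    and Id_mor: "A \<in> Obj C \<Longrightarrow> Id C A \<in> mor C A A"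
    and Comp_mor: "\<lbrakk>f \<in> mor C A B; g \<in> mor C B D\<rbrakk> \<Longrightarrow> g \<cdot> f \<in> mor C A D"
    and Comp_Id: "f \<in> mor C A B \<Longrightarrow> f \<cdot> Id C A = f"
    and Id_Comp: "f \<in> mor C A B \<Longrightarrow> Id C B \<cdot> f = f"
    and Comp_assoc: "\<lbrakk>f \<in> mor C A B; g \<in> mor C B D; h \<in> mor C D E\<rbrakk> \<Longrightarrow> h \<cdot> (g \<cdot> f) = h \<cdot> g \<cdot> f"

definition zero_object :: "('o, 'm) cat \<Rightarrow> 'o \<Rightarrow> bool" where
  "zero_object C Z \<longleftrightarrow>
     Z \<in> Obj C \<and> (\<forall>A\<in>Obj C. (\<exists>!f. f \<in> mor C A Z) \<and> (\<exists>!f. f \<in> mor C Z A))"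

definition biproduct ::
  "('o, 'm) cat \<Rightarrow> 'o \<Rightarrow> 'o \<Rightarrow> 'o \<Rightarrow> 'm \<Rightarrow> 'm \<Rightarrow> 'm \<Rightarrow> 'm \<Rightarrow> bool" where
  "biproduct C A B S i1 i2 p1 p2 \<longleftrightarrow>
     A \<in> Obj C \<and> B \<in> Obj C \<and> S \<in> Obj C \<and>
     i1 \<in> mor C A S \<and> i2 \<in> mor C B S \<and> p1 \<in> mor C S A \<and> p2 \<in> mor C S B \<and>
     p1 \<cdot>\<^bsub>C\<^esub> i1 = Id C A \<and> p2 \<cdot>\<^bsub>C\<^esub> i2 = Id C B \<and>
     p1 \<cdot>\<^bsub>C\<^esub> i2 = Zero C B A \<and> p2 \<cdot>\<^bsub>C\<^esub> i1 = Zero C A B \<and>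
     Add C (i1 \<cdot>\<^bsub>C\<^esub> p1) (i2 \<cdot>\<^bsub>C\<^esub> p2) = Id C S"

locale additive_category = category +
  assumes Hom_group: "\<lbrakk>A \<in> Obj C; B \<in> Obj C\<rbrakk> \<Longrightarrow> comm_group (Hom C A B)"
    and Comp_Add: "\<lbrakk>f \<in> mor C A B; f' \<in> mor C A B; g \<in> mor C B D\<rbrakk>
      \<Longrightarrow> g \<cdot> Add C f f' = Add C (g \<cdot> f) (g \<cdot> f')"
    and Add_Comp: "\<lbrakk>f \<in> mor C A B; g \<in> mor C B D; g' \<in> mor C B D\<rbrakk>
      \<Longrightarrow> Add C g g' \<cdot> f = Add C (g \<cdot> f) (g' \<cdot> f)"
    and ex_zero_object: "\<exists>Z. zero_object C Z"
    and ex_biproduct: "\<lbrakk>A \<in> Obj C; B \<in> Obj C\<rbrakk>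
      \<Longrightarrow> \<exists>S i1 i2 p1 p2. biproduct C A B S i1 i2 p1 p2"

definition idempotent_complete :: "('o, 'm) cat \<Rightarrow> bool" where
  "idempotent_complete C \<longleftrightarrow>
     (\<forall>A\<in>Obj C. \<forall>e\<in>mor C A A. e \<cdot>\<^bsub>C\<^esub> e = e \<longrightarrow>
       (\<exists>B\<in>Obj C. \<exists>r\<in>mor C A B. \<exists>s\<in>mor C B A. r \<cdot>\<^bsub>C\<^esub> s = Id C B \<and> s \<cdot>\<^bsub>C\<^esub> r = e))"

definition op_cat :: "('o, 'm) cat \<Rightarrow> ('o, 'm) cat" where
  "op_cat C = C\<lparr>Dom := Cod C, Cod := Dom C, Comp := \<lambda>g f. f \<cdot>\<^bsub>C\<^esub> g, Zero := \<lambda>A B. Zero C B A\<rparr>"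

definition weak_kernel :: "('o, 'm) cat \<Rightarrow> 'm \<Rightarrow> 'm \<Rightarrow> bool" where
  "weak_kernel C f g \<longleftrightarrow>
     f \<in> Arr C \<and> g \<in> Arr C \<and> Cod C g = Dom C f \<and> f \<cdot>\<^bsub>C\<^esub> g = Zero C (Dom C g) (Cod C f) \<and>
     (\<forall>h\<in>Arr C. Cod C h = Dom C f \<and> f \<cdot>\<^bsub>C\<^esub> h = Zero C (Dom C h) (Cod C f) \<longrightarrow>
       (\<exists>k\<in>mor C (Dom C h) (Dom C g). h = g \<cdot>\<^bsub>C\<^esub> k))"

definition weak_cokernel :: "('o, 'm) cat \<Rightarrow> 'm \<Rightarrow> 'm \<Rightarrow> bool" where
  "weak_cokernel C f g \<longleftrightarrow>
     f \<in> Arr C \<and> g \<in> Arr C \<and> Dom C g = Cod C f \<and> g \<cdot>\<^bsub>C\<^esub> f = Zero C (Dom C f) (Cod C g) \<and>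
     (\<forall>h\<in>Arr C. Dom C h = Cod C f \<and> h \<cdot>\<^bsub>C\<^esub> f = Zero C (Dom C f) (Cod C h) \<longrightarrow>
       (\<exists>k\<in>mor C (Cod C g) (Cod C h). h = k \<cdot>\<^bsub>C\<^esub> g))"


section \<open>\<open>n\<close>-exact sequences\<close>

text \<open>
  A complex \<open>X\<^sub>n\<^sub>+\<^sub>1 \<rightarrow> \<dots> \<rightarrow> X\<^sub>0\<close> uses only \<open>cobj X i\<close> for \<open>i \<le> n + 1\<close> and
  \<open>cdiff X i : X\<^sub>i \<rightarrow> X\<^sub>i\<^sub>-\<^sub>1\<close> for \<open>1 \<le> i \<le> n + 1\<close>; values at other indices are irrelevant.
  Two records that agree on the relevant indices are homotopy equivalent, so that they are not
  distinguished by the classes of complexes considered below.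
\<close>

record ('o, 'm) cplx =
  cobj :: "nat \<Rightarrow> 'o"
  cdiff :: "nat \<Rightarrow> 'm"

definition is_complex :: "nat \<Rightarrow> ('o, 'm) cat \<Rightarrow> ('o, 'm) cplx \<Rightarrow> bool" where
  "is_complex n C X \<longleftrightarrow>
     (\<forall>i\<le>n+1. cobj X i \<in> Obj C) \<and>
     (\<forall>i\<le>n. cdiff X (i+1) \<in> mor C (cobj X (i+1)) (cobj X i)) \<and>
     (\<forall>i<n. cdiff X (i+1) \<cdot>\<^bsub>C\<^esub> cdiff X (i+2) = Zero C (cobj X (i+2)) (cobj X i))"

definition n_exact :: "nat \<Rightarrow> ('o, 'm) cat \<Rightarrow> ('o, 'm) cplx \<Rightarrow> bool" where
  "n_exact n C X \<longleftrightarrow> is_complex n C X \<and>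
     (\<forall>Y\<in>Obj C.
       kernel (Hom C Y (cobj X (n+1))) (Hom C Y (cobj X n)) (\<lambda>f. cdiff X (n+1) \<cdot>\<^bsub>C\<^esub> f)
         = {Zero C Y (cobj X (n+1))} \<and>
       (\<forall>i<n. kernel (Hom C Y (cobj X (i+1))) (Hom C Y (cobj X i)) (\<lambda>f. cdiff X (i+1) \<cdot>\<^bsub>C\<^esub> f)
         = (\<lambda>g. cdiff X (i+2) \<cdot>\<^bsub>C\<^esub> g) ` mor C Y (cobj X (i+2))) \<and>
       kernel (Hom C (cobj X 0) Y) (Hom C (cobj X 1) Y) (\<lambda>f. f \<cdot>\<^bsub>C\<^esub> cdiff X 1)
         = {Zero C (cobj X 0) Y} \<and>
       (\<forall>i<n. kernel (Hom C (cobj X (i+1)) Y) (Hom C (cobj X (i+2)) Y) (\<lambda>f. f \<cdot>\<^bsub>C\<^esub> cdiff X (i+2))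
         = (\<lambda>g. g \<cdot>\<^bsub>C\<^esub> cdiff X (i+1)) ` mor C (cobj X i) Y))"

definition op_cplx :: "nat \<Rightarrow> ('o, 'm) cplx \<Rightarrow> ('o, 'm) cplx" where
  "op_cplx n X = \<lparr>cobj = \<lambda>i. cobj X (n + 1 - i), cdiff = \<lambda>i. cdiff X (n + 2 - i)\<rparr>"

definition chain_map ::
  "nat \<Rightarrow> ('o, 'm) cat \<Rightarrow> ('o, 'm) cplx \<Rightarrow> ('o, 'm) cplx \<Rightarrow> (nat \<Rightarrow> 'm) \<Rightarrow> bool" where
  "chain_map n C X Y \<phi> \<longleftrightarrow>
     (\<forall>i\<le>n+1. \<phi> i \<in> mor C (cobj X i) (cobj Y i)) \<and>
     (\<forall>i\<le>n. cdiff Y (i+1) \<cdot>\<^bsub>C\<^esub> \<phi> (i+1) = \<phi> i \<cdot>\<^bsub>C\<^esub> cdiff X (i+1))"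

definition homotopic ::
  "nat \<Rightarrow> ('o, 'm) cat \<Rightarrow> ('o, 'm) cplx \<Rightarrow> ('o, 'm) cplx \<Rightarrow> (nat \<Rightarrow> 'm) \<Rightarrow> (nat \<Rightarrow> 'm) \<Rightarrow> bool" where
  "homotopic n C X Y \<phi> \<psi> \<longleftrightarrow>
     (\<exists>s. (\<forall>i\<le>n. s i \<in> mor C (cobj X i) (cobj Y (i+1))) \<and>
       \<phi> 0 = Add C (\<psi> 0) (cdiff Y 1 \<cdot>\<^bsub>C\<^esub> s 0) \<and>
       (\<forall>i<n. \<phi> (i+1) = Add C (\<psi> (i+1))
          (Add C (cdiff Y (i+2) \<cdot>\<^bsub>C\<^esub> s (i+1)) (s i \<cdot>\<^bsub>C\<^esub> cdiff X (i+1)))) \<and>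
       \<phi> (n+1) = Add C (\<psi> (n+1)) (s n \<cdot>\<^bsub>C\<^esub> cdiff X (n+1)))"

definition homotopy_equivalent ::
  "nat \<Rightarrow> ('o, 'm) cat \<Rightarrow> ('o, 'm) cplx \<Rightarrow> ('o, 'm) cplx \<Rightarrow> bool" where
  "homotopy_equivalent n C X Y \<longleftrightarrow>
     (\<exists>\<phi> \<psi>. chain_map n C X Y \<phi> \<and> chain_map n C Y X \<psi> \<and>
       homotopic n C X X (\<lambda>i. \<psi> i \<cdot>\<^bsub>C\<^esub> \<phi> i) (\<lambda>i. Id C (cobj X i)) \<and>
       homotopic n C Y Y (\<lambda>i. \<phi> i \<cdot>\<^bsub>C\<^esub> \<psi> i) (\<lambda>i. Id C (cobj Y i)))"


section \<open>\<open>n\<close>-exact structures\<close>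

definition inflation :: "nat \<Rightarrow> ('o, 'm) cplx set \<Rightarrow> 'm \<Rightarrow> bool" where
  "inflation n \<X> f \<longleftrightarrow> (\<exists>X\<in>\<X>. f = cdiff X (n+1))"

definition deflation :: "('o, 'm) cplx set \<Rightarrow> 'm \<Rightarrow> bool" where
  "deflation \<X> f \<longleftrightarrow> (\<exists>X\<in>\<X>. f = cdiff X 1)"

text \<open>
  In the two axioms on weak pushouts and weak pullbacks the direct sum is an arbitrary biproduct
  \<open>S\<close>; the column \<open>[u, v]\<^sup>T\<close> is \<open>i\<^sub>1 u + i\<^sub>2 v\<close> and the row \<open>[u, v]\<close> is \<open>u p\<^sub>1 + v p\<^sub>2\<close>.
\<close>

definition n_exact_structure :: "nat \<Rightarrow> ('o, 'm) cat \<Rightarrow> ('o, 'm) cplx set \<Rightarrow> bool" where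
  "n_exact_structure n C \<X> \<longleftrightarrow>
     (\<forall>X\<in>\<X>. n_exact n C X) \<and>
     (\<forall>X\<in>\<X>. \<forall>Y. n_exact n C Y \<and> homotopy_equivalent n C X Y \<longrightarrow> Y \<in> \<X>) \<and>
     \<comment> \<open>Ex0\<close>
     (\<forall>X. is_complex n C X \<and> (\<forall>i\<le>n+1. zero_object C (cobj X i)) \<longrightarrow> X \<in> \<X>) \<and>
     \<comment> \<open>Ex1 and its dual\<close>
     (\<forall>f g. inflation n \<X> f \<and> inflation n \<X> g \<and> Cod C f = Dom C g \<longrightarrow> inflation n \<X> (g \<cdot>\<^bsub>C\<^esub> f)) \<and>
     (\<forall>f g. deflation \<X> f \<and> deflation \<X> g \<and> Cod C f = Dom C g \<longrightarrow> deflation \<X> (g \<cdot>\<^bsub>C\<^esub> f)) \<and>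
     \<comment> \<open>Ex2\<close>
     (\<forall>d f A B Y S i1 i2 p1 p2.
        inflation n \<X> d \<and> d \<in> mor C A B \<and> f \<in> mor C A Y \<and> biproduct C B Y S i1 i2 p1 p2 \<longrightarrow>
        (let c = Add C (i1 \<cdot>\<^bsub>C\<^esub> (inv\<^bsub>Hom C A B\<^esub> d)) (i2 \<cdot>\<^bsub>C\<^esub> f) in
         inflation n \<X> c \<and>
         (\<exists>Z\<in>Obj C. \<exists>f'\<in>mor C B Z. \<exists>d'\<in>mor C Y Z.
            weak_cokernel C c (Add C (f' \<cdot>\<^bsub>C\<^esub> p1) (d' \<cdot>\<^bsub>C\<^esub> p2)) \<and> inflation n \<X> d'))) \<and>
     \<comment> \<open>the dual of Ex2\<close>
     (\<forall>d f A B Y S i1 i2 p1 p2.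
        deflation \<X> d \<and> d \<in> mor C A B \<and> f \<in> mor C Y B \<and> biproduct C A Y S i1 i2 p1 p2 \<longrightarrow>
        (let r = Add C ((inv\<^bsub>Hom C A B\<^esub> d) \<cdot>\<^bsub>C\<^esub> p1) (f \<cdot>\<^bsub>C\<^esub> p2) in
         deflation \<X> r \<and>
         (\<exists>Z\<in>Obj C. \<exists>f'\<in>mor C Z A. \<exists>d'\<in>mor C Z Y.
            weak_kernel C r (Add C (i1 \<cdot>\<^bsub>C\<^esub> f') (i2 \<cdot>\<^bsub>C\<^esub> d')) \<and> deflation \<X> d')))"

definition maximal_n_exact_structure :: "nat \<Rightarrow> ('o, 'm) cat \<Rightarrow> ('o, 'm) cplx set \<Rightarrow> bool" where
  "maximal_n_exact_structure n C \<X> \<longleftrightarrow>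
     n_exact_structure n C \<X> \<and> (\<forall>\<Y>. n_exact_structure n C \<Y> \<and> \<X> \<subseteq> \<Y> \<longrightarrow> \<Y> = \<X>)"


section \<open>Modules over a category\<close>

text \<open>
  The values of a module lie in a type \<open>'v\<close>. The representables have values in the type \<open>'m\<close> of
  arrows, and so, up to isomorphism, have their direct summands; quotients of representables have
  values in \<open>'m set\<close>. Hence \<open>'m\<close> is large enough for the projectives and \<open>'m set\<close> is large
  enough for all objects of \<open>mod C\<close>, up to isomorphism.
\<close>

record ('o, 'm, 'v) cmod =
  val :: "'o \<Rightarrow> 'v monoid"
  act :: "'m \<Rightarrow> 'v \<Rightarrow> 'v"

definition is_module :: "('o, 'm) cat \<Rightarrow> ('o, 'm, 'v) cmod \<Rightarrow> bool" where
  "is_module C F \<longleftrightarrow>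
     (\<forall>A\<in>Obj C. comm_group (val F A)) \<and>
     (\<forall>A\<in>Obj C. \<forall>B\<in>Obj C. \<forall>h\<in>mor C A B. act F h \<in> hom (val F B) (val F A)) \<and>
     (\<forall>A\<in>Obj C. \<forall>x\<in>carrier (val F A). act F (Id C A) x = x) \<and>
     (\<forall>A\<in>Obj C. \<forall>B\<in>Obj C. \<forall>D\<in>Obj C. \<forall>h\<in>mor C A B. \<forall>k\<in>mor C B D. \<forall>x\<in>carrier (val F D).
        act F (k \<cdot>\<^bsub>C\<^esub> h) x = act F h (act F k x)) \<and>
     (\<forall>A\<in>Obj C. \<forall>B\<in>Obj C. \<forall>h\<in>mor C A B. \<forall>k\<in>mor C A B. \<forall>x\<in>carrier (val F B).
        act F (Add C h k) x = act F h x \<otimes>\<^bsub>val F A\<^esub> act F k x)"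

definition Nat ::
  "('o, 'm) cat \<Rightarrow> ('o, 'm, 'v) cmod \<Rightarrow> ('o, 'm, 'w) cmod \<Rightarrow> ('o \<Rightarrow> 'v \<Rightarrow> 'w) set" where
  "Nat C F G = {\<alpha> \<in> (\<Pi>\<^sub>E A\<in>Obj C. carrier (val F A) \<rightarrow>\<^sub>E carrier (val G A)).
     (\<forall>A\<in>Obj C. \<alpha> A \<in> hom (val F A) (val G A)) \<and>
     (\<forall>A\<in>Obj C. \<forall>B\<in>Obj C. \<forall>h\<in>mor C A B. \<forall>x\<in>carrier (val F B).
        \<alpha> A (act F h x) = act G h (\<alpha> B x))}"

definition Nat_group ::
  "('o, 'm) cat \<Rightarrow> ('o, 'm, 'v) cmod \<Rightarrow> ('o, 'm, 'w) cmod \<Rightarrow> ('o \<Rightarrow> 'v \<Rightarrow> 'w) monoid" where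
  "Nat_group C F G =
     \<lparr>carrier = Nat C F G,
      mult = \<lambda>\<alpha> \<beta>. \<lambda>A\<in>Obj C. \<lambda>x\<in>carrier (val F A). \<alpha> A x \<otimes>\<^bsub>val G A\<^esub> \<beta> A x,
      one = \<lambda>A\<in>Obj C. \<lambda>x\<in>carrier (val F A). \<one>\<^bsub>val G A\<^esub>\<rparr>"

definition Nat_comp ::
  "('o, 'm) cat \<Rightarrow> ('o, 'm, 'u) cmod \<Rightarrow> ('o \<Rightarrow> 'v \<Rightarrow> 'w) \<Rightarrow> ('o \<Rightarrow> 'u \<Rightarrow> 'v) \<Rightarrow> 'o \<Rightarrow> 'u \<Rightarrow> 'w" where
  "Nat_comp C F \<beta> \<alpha> = (\<lambda>A\<in>Obj C. compose (carrier (val F A)) (\<beta> A) (\<alpha> A))"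

definition mod_iso :: "('o, 'm) cat \<Rightarrow> ('o, 'm, 'v) cmod \<Rightarrow> ('o, 'm, 'w) cmod \<Rightarrow> bool" where
  "mod_iso C F G \<longleftrightarrow>
     (\<exists>\<alpha>\<in>Nat C F G. \<forall>A\<in>Obj C. bij_betw (\<alpha> A) (carrier (val F A)) (carrier (val G A)))"

definition Ker_at ::
  "('o, 'm, 'v) cmod \<Rightarrow> ('o, 'm, 'w) cmod \<Rightarrow> ('o \<Rightarrow> 'v \<Rightarrow> 'w) \<Rightarrow> 'o \<Rightarrow> 'v set" where
  "Ker_at F G \<alpha> A = kernel (val F A) (val G A) (\<alpha> A)"

definition Im_at :: "('o, 'm, 'v) cmod \<Rightarrow> ('o \<Rightarrow> 'v \<Rightarrow> 'w) \<Rightarrow> 'o \<Rightarrow> 'w set" where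
  "Im_at F \<alpha> A = \<alpha> A ` carrier (val F A)"

definition submodule :: "('o, 'm, 'v) cmod \<Rightarrow> ('o \<Rightarrow> 'v set) \<Rightarrow> ('o, 'm, 'v) cmod" where
  "submodule F U = F\<lparr>val := \<lambda>A. (val F A)\<lparr>carrier := U A\<rparr>\<rparr>"

definition quotient_module ::
  "('o, 'm) cat \<Rightarrow> ('o, 'm, 'v) cmod \<Rightarrow> ('o \<Rightarrow> 'v set) \<Rightarrow> ('o, 'm, 'v set) cmod" where
  "quotient_module C F U =
     \<lparr>val = \<lambda>A. val F A Mod U A,
      act = \<lambda>h S. \<Union>x\<in>S. U (Dom C h) #>\<^bsub>val F (Dom C h)\<^esub> act F h x\<rparr>"

definition exact_at :: "('o, 'm) cat \<Rightarrow> ('o, 'm, 'u) cmod \<Rightarrow> ('o, 'm, 'v) cmod \<Rightarrow> ('o, 'm, 'w) cmod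
    \<Rightarrow> ('o \<Rightarrow> 'u \<Rightarrow> 'v) \<Rightarrow> ('o \<Rightarrow> 'v \<Rightarrow> 'w) \<Rightarrow> bool" where
  "exact_at C F G H \<alpha> \<beta> \<longleftrightarrow> (\<forall>A\<in>Obj C. Im_at F \<alpha> A = Ker_at G H \<beta> A)"

definition epi_at ::
  "('o, 'm) cat \<Rightarrow> ('o, 'm, 'v) cmod \<Rightarrow> ('o, 'm, 'w) cmod \<Rightarrow> ('o \<Rightarrow> 'v \<Rightarrow> 'w) \<Rightarrow> bool" where
  "epi_at C F G \<alpha> \<longleftrightarrow> (\<forall>A\<in>Obj C. Im_at F \<alpha> A = carrier (val G A))"

definition mono_at ::
  "('o, 'm) cat \<Rightarrow> ('o, 'm, 'v) cmod \<Rightarrow> ('o, 'm, 'w) cmod \<Rightarrow> ('o \<Rightarrow> 'v \<Rightarrow> 'w) \<Rightarrow> bool" where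
  "mono_at C F G \<alpha> \<longleftrightarrow> (\<forall>A\<in>Obj C. Ker_at F G \<alpha> A = {\<one>\<^bsub>val F A\<^esub>})"

definition rep :: "('o, 'm) cat \<Rightarrow> 'o \<Rightarrow> ('o, 'm, 'm) cmod" where
  "rep C X = \<lparr>val = \<lambda>A. Hom C A X, act = \<lambda>h f. f \<cdot>\<^bsub>C\<^esub> h\<rparr>"

definition rep_map :: "('o, 'm) cat \<Rightarrow> 'm \<Rightarrow> 'o \<Rightarrow> 'm \<Rightarrow> 'm" where
  "rep_map C d = (\<lambda>A\<in>Obj C. \<lambda>f\<in>mor C A (Dom C d). d \<cdot>\<^bsub>C\<^esub> f)"


section \<open>The exact category of modules with a resolution by representables\<close>

definition resolution :: "('o, 'm) cat \<Rightarrow> (nat \<Rightarrow> ('o, 'm, 'p) cmod)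
    \<Rightarrow> (nat \<Rightarrow> 'o \<Rightarrow> 'p \<Rightarrow> 'p) \<Rightarrow> ('o \<Rightarrow> 'p \<Rightarrow> 'v) \<Rightarrow> ('o, 'm, 'v) cmod \<Rightarrow> bool" where
  "resolution C P \<delta> \<epsilon> F \<longleftrightarrow>
     \<epsilon> \<in> Nat C (P 0) F \<and> epi_at C (P 0) F \<epsilon> \<and>
     (\<forall>i. \<delta> (i+1) \<in> Nat C (P (i+1)) (P i)) \<and>
     exact_at C (P 1) (P 0) F (\<delta> 1) \<epsilon> \<and>
     (\<forall>i. exact_at C (P (i+2)) (P (i+1)) (P i) (\<delta> (i+2)) (\<delta> (i+1)))"

text \<open>The same for \<open>0 \<rightarrow> P\<^sub>m \<rightarrow> \<dots> \<rightarrow> P\<^sub>0 \<rightarrow> F \<rightarrow> 0\<close>.\<close>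

definition finite_resolution :: "('o, 'm) cat \<Rightarrow> nat \<Rightarrow> (nat \<Rightarrow> ('o, 'm, 'p) cmod)
    \<Rightarrow> (nat \<Rightarrow> 'o \<Rightarrow> 'p \<Rightarrow> 'p) \<Rightarrow> ('o \<Rightarrow> 'p \<Rightarrow> 'v) \<Rightarrow> ('o, 'm, 'v) cmod \<Rightarrow> bool" where
  "finite_resolution C m P \<delta> \<epsilon> F \<longleftrightarrow>
     \<epsilon> \<in> Nat C (P 0) F \<and> epi_at C (P 0) F \<epsilon> \<and>
     (\<forall>i<m. \<delta> (i+1) \<in> Nat C (P (i+1)) (P i)) \<and>
     (0 < m \<longrightarrow> exact_at C (P 1) (P 0) F (\<delta> 1) \<epsilon>) \<and>
     (\<forall>i. i + 2 \<le> m \<longrightarrow> exact_at C (P (i+2)) (P (i+1)) (P i) (\<delta> (i+2)) (\<delta> (i+1))) \<and>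
     (if m = 0 then mono_at C (P 0) F \<epsilon> else mono_at C (P m) (P (m-1)) (\<delta> m))"

definition in_mod :: "('o, 'm) cat \<Rightarrow> ('o, 'm, 'v) cmod \<Rightarrow> bool" where
  "in_mod C F \<longleftrightarrow> is_module C F \<and>
     (\<exists>X \<delta> \<epsilon>. (\<forall>i. X i \<in> Obj C) \<and> resolution C (\<lambda>i. rep C (X i)) \<delta> \<epsilon> F)"

text \<open>Deflations and projectives of the exact category \<open>mod C\<close>.\<close>

definition mod_deflation ::
  "('o, 'm) cat \<Rightarrow> ('o, 'm, 'v) cmod \<Rightarrow> ('o, 'm, 'w) cmod \<Rightarrow> ('o \<Rightarrow> 'v \<Rightarrow> 'w) \<Rightarrow> bool" where
  "mod_deflation C E B p \<longleftrightarrow>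
     in_mod C E \<and> in_mod C B \<and> p \<in> Nat C E B \<and> epi_at C E B p \<and>
     in_mod C (submodule E (Ker_at E B p))"

definition projective :: "('o, 'm) cat \<Rightarrow> ('o, 'm, 'p) cmod \<Rightarrow> bool" where
  "projective C P \<longleftrightarrow> in_mod C P \<and>
     (\<forall>(E :: ('o, 'm, 'm set) cmod) (B :: ('o, 'm, 'm set) cmod) p.
        mod_deflation C E B p \<longrightarrow>
        (\<forall>f\<in>Nat C P B. \<exists>g\<in>Nat C P E. Nat_comp C P p g = f))"

definition projective_resolution :: "('o, 'm) cat \<Rightarrow> (nat \<Rightarrow> ('o, 'm, 'p) cmod)
    \<Rightarrow> (nat \<Rightarrow> 'o \<Rightarrow> 'p \<Rightarrow> 'p) \<Rightarrow> ('o \<Rightarrow> 'p \<Rightarrow> 'v) \<Rightarrow> ('o, 'm, 'v) cmod \<Rightarrow> bool" where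
  "projective_resolution C P \<delta> \<epsilon> F \<longleftrightarrow> (\<forall>i. projective C (P i)) \<and> resolution C P \<delta> \<epsilon> F"

definition finite_projective_resolution ::
  "('o, 'm) cat \<Rightarrow> nat \<Rightarrow> (nat \<Rightarrow> ('o, 'm, 'p) cmod)
    \<Rightarrow> (nat \<Rightarrow> 'o \<Rightarrow> 'p \<Rightarrow> 'p) \<Rightarrow> ('o \<Rightarrow> 'p \<Rightarrow> 'v) \<Rightarrow> ('o, 'm, 'v) cmod \<Rightarrow> bool" where
  "finite_projective_resolution C m P \<delta> \<epsilon> F \<longleftrightarrow>
     (\<forall>i\<le>m. projective C (P i)) \<and> finite_resolution C m P \<delta> \<epsilon> F"

definition pdim_le :: "('o, 'm) cat \<Rightarrow> ('o, 'm, 'v) cmod \<Rightarrow> nat \<Rightarrow> bool" where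
  "pdim_le C F m \<longleftrightarrow>
     (\<exists>(P :: nat \<Rightarrow> ('o, 'm, 'm) cmod) \<delta> \<epsilon>. finite_projective_resolution C m P \<delta> \<epsilon> F)"

text \<open>
  \<open>Ext\<^sup>i(F, G)\<close> is the \<open>i\<close>-th cohomology group of \<open>Hom(P\<^sub>\<bullet>, G)\<close> for a chosen projective
  resolution \<open>P\<^sub>\<bullet> \<rightarrow> F\<close>; in degree \<open>0\<close> it is the kernel of \<open>Hom(P\<^sub>0, G) \<rightarrow> Hom(P\<^sub>1, G)\<close>
  modulo the trivial subgroup, which is \<open>Hom(F, G)\<close> up to isomorphism.
\<close>

definition cocycles :: "('o, 'm) cat \<Rightarrow> (nat \<Rightarrow> ('o, 'm, 'p) cmod) \<Rightarrow> (nat \<Rightarrow> 'o \<Rightarrow> 'p \<Rightarrow> 'p)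
    \<Rightarrow> ('o, 'm, 'w) cmod \<Rightarrow> nat \<Rightarrow> ('o \<Rightarrow> 'p \<Rightarrow> 'w) set" where
  "cocycles C P \<delta> G i =
     kernel (Nat_group C (P i) G) (Nat_group C (P (i+1)) G) (\<lambda>\<alpha>. Nat_comp C (P (i+1)) \<alpha> (\<delta> (i+1)))"

fun coboundaries :: "('o, 'm) cat \<Rightarrow> (nat \<Rightarrow> ('o, 'm, 'p) cmod) \<Rightarrow> (nat \<Rightarrow> 'o \<Rightarrow> 'p \<Rightarrow> 'p)
    \<Rightarrow> ('o, 'm, 'w) cmod \<Rightarrow> nat \<Rightarrow> ('o \<Rightarrow> 'p \<Rightarrow> 'w) set" where
  "coboundaries C P \<delta> G 0 = {\<one>\<^bsub>Nat_group C (P 0) G\<^esub>}"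
| "coboundaries C P \<delta> G (Suc i) = (\<lambda>\<beta>. Nat_comp C (P (Suc i)) \<beta> (\<delta> (Suc i))) ` Nat C (P i) G"

definition Ext :: "('o, 'm) cat \<Rightarrow> nat \<Rightarrow> ('o, 'm, 'v) cmod \<Rightarrow> ('o, 'm, 'w) cmod
    \<Rightarrow> ('o \<Rightarrow> 'm \<Rightarrow> 'w) set monoid" where
  "Ext C i F G =
     (let (P, \<delta>, \<epsilon>) = (SOME (P :: nat \<Rightarrow> ('o, 'm, 'm) cmod, \<delta>, \<epsilon>). projective_resolution C P \<delta> \<epsilon> F)
      in (Nat_group C (P i) G)\<lparr>carrier := cocycles C P \<delta> G i\<rparr> Mod coboundaries C P \<delta> G i)"

definition mod_cat :: "('o, 'm) cat \<Rightarrow> ('o, 'm, 'm set) cmod set" where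
  "mod_cat C = {F. in_mod C F}"

definition ex_cat :: "nat \<Rightarrow> ('o, 'm) cat \<Rightarrow> ('o, 'm, 'm set) cmod set" where
  "ex_cat n C = {F \<in> mod_cat C. pdim_le C F (n+1) \<and>
     (\<forall>i\<le>n. \<forall>Y\<in>Obj C. trivial_group (Ext C i F (rep C Y)))}"


section \<open>The operations on classes of modules\<close>

text \<open>\<open>Fun C X\<close> is the cokernel of \<open>C(-, d\<^sub>1)\<close>.\<close>

definition Fun :: "('o, 'm) cat \<Rightarrow> ('o, 'm) cplx \<Rightarrow> ('o, 'm, 'm set) cmod" where
  "Fun C X =
     quotient_module C (rep C (cobj X 0)) (Im_at (rep C (cobj X 1)) (rep_map C (cdiff X 1)))"

definition yoneda_resolves ::
  "nat \<Rightarrow> ('o, 'm) cat \<Rightarrow> ('o, 'm) cplx \<Rightarrow> ('o, 'm, 'v) cmod \<Rightarrow> bool" where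
  "yoneda_resolves n C X F \<longleftrightarrow>
     (\<exists>\<epsilon>. finite_projective_resolution C (n+1)
        (\<lambda>i. rep C (cobj X i)) (\<lambda>i. rep_map C (cdiff X i)) \<epsilon> F)"

definition Res :: "nat \<Rightarrow> ('o, 'm) cat \<Rightarrow> ('o, 'm, 'm set) cmod \<Rightarrow> ('o, 'm) cplx" where
  "Res n C F = (SOME X. n_exact n C X \<and> yoneda_resolves n C X F)"

definition Tr :: "nat \<Rightarrow> ('o, 'm) cat \<Rightarrow> ('o, 'm, 'm set) cmod \<Rightarrow> ('o, 'm, 'm set) cmod" where
  "Tr n C F = Fun (op_cat C) (op_cplx n (Res n C F))"

definition Tr_image ::
  "nat \<Rightarrow> ('o, 'm) cat \<Rightarrow> ('o, 'm, 'm set) cmod set \<Rightarrow> ('o, 'm, 'm set) cmod set" where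
  "Tr_image n C \<F> = {H \<in> ex_cat n (op_cat C). \<exists>F\<in>\<F>. mod_iso (op_cat C) (Tr n C F) H}"

text \<open>
  The values of \<open>F / Im \<alpha>\<close> lie in \<open>'m set set\<close>, so its membership in the isomorphism closed
  class \<open>\<F>\<close> is expressed by an isomorphic member of \<open>\<F>\<close>.
\<close>

definition Pb ::
  "('o, 'm) cat \<Rightarrow> ('o, 'm, 'm set) cmod set \<Rightarrow> ('o, 'm, 'm set) cmod set" where
  "Pb C \<F> = {F \<in> \<F>. \<forall>G\<in>mod_cat C. \<forall>\<alpha>\<in>Nat C G F.
     submodule F (Im_at G \<alpha>) \<in> \<F> \<and> (\<exists>H\<in>\<F>. mod_iso C (quotient_module C F (Im_at G \<alpha>)) H)}"

definition Po ::
  "nat \<Rightarrow> ('o, 'm) cat \<Rightarrow> ('o, 'm, 'm set) cmod set \<Rightarrow> ('o, 'm, 'm set) cmod set" where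
  "Po n C \<F> = Tr_image n (op_cat C) (Pb (op_cat C) (Tr_image n C \<F>))"

definition Pb_inf ::
  "('o, 'm) cat \<Rightarrow> ('o, 'm, 'm set) cmod set \<Rightarrow> ('o, 'm, 'm set) cmod set" where
  "Pb_inf C \<F> = (\<Inter>i. (Pb C ^^ i) \<F>)"

definition Po_inf ::
  "nat \<Rightarrow> ('o, 'm) cat \<Rightarrow> ('o, 'm, 'm set) cmod set \<Rightarrow> ('o, 'm, 'm set) cmod set" where
  "Po_inf n C \<F> = (\<Inter>i. (Po n C ^^ i) \<F>)"

definition max_cat :: "nat \<Rightarrow> ('o, 'm) cat \<Rightarrow> ('o, 'm, 'm set) cmod set" where
  "max_cat n C = Po_inf n C (Pb_inf C (ex_cat n C))"

end

theory Submission
  imports Defs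
begin

text \<open>
  A module with a resolution by an \<open>n\<close>-exact sequence \<open>X\<close> is \<open>C(-, X\<^sub>0)\<close> modulo the arrows
  that factor through \<open>d\<^sub>1\<close>. So \<open>Pb\<close> and \<open>Po\<close> can be described by arrows of \<open>C\<close>: a class of
  sequences is closed under \<open>Pb\<close> if the image of any arrow into \<open>X\<^sub>0\<close>, taken modulo
  boundaries, and the quotient by this image are again presented by members of the class.
  As \<open>Po\<close> preserves closedness under \<open>Pb\<close>, the limit \<open>M\<close> of the iteration is closed under
  both operations, and it contains every class with these two closure properties. The extensions
  of members of \<open>M\<close> by members of \<open>M\<close> form such a class, hence \<open>M\<close> is closed under
  extensions. For deflations \<open>f\<close> and \<open>g\<close> the cokernel of \<open>C(-, g f)\<close> is an extension of the
  cokernel of \<open>C(-, g)\<close> by a quotient of the cokernel of \<open>C(-, f)\<close>; this gives the composition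
  axioms, while the weak pullback axiom concerns images of arrows. Both use idempotent
  completeness, by which every presentation of the module of an \<open>n\<close>-exact sequence starts a
  resolution of that module by another \<open>n\<close>-exact sequence. Conversely, any \<open>n\<close>-exact structure
  is closed under \<open>Pb\<close> and \<open>Po\<close> and hence contained in \<open>M\<close>.
\<close>

text \<open>A stage of either iteration need not be closed under the operation that produced it. The
  countable intersection is closed because the image of an arrow and the quotient by it are unique
  up to isomorphism, so that witnesses found at one stage serve at all of them. The second obstacle
  is the interplay with duality: the transpose sees an arrow into \<open>X_0\<close> only through a
  lift to complexes. It is controlled by replacing a short exact sequence of modules by a degreewise
  split sequence of complexes, whose reversal is again degreewise split. So transposition is exact
  on short exact sequences between modules of n-exact sequences, and images in one category can be
  compared with images in the opposite one. Until then a module is just an object with a set of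
  arrows; actual functors and their value types enter only when this description is compared with
  \<open>max_cat\<close>. Idempotent completeness is used there once more: it makes every projective
  representable, so that the resolutions behind \<open>Ext\<close> and the projective dimension
  become complexes in \<open>C\<close>.\<close>

definition neg :: "('o, 'm) cat \<Rightarrow> 'm \<Rightarrow> 'm" where
  "neg C f = inv\<^bsub>Hom C (Dom C f) (Cod C f)\<^esub> f"

abbreviation sub :: "('o, 'm) cat \<Rightarrow> 'm \<Rightarrow> 'm \<Rightarrow> 'm" where
  "sub C f g \<equiv> Add C f (neg C g)"

lemma mor_iff: "f \<in> mor C A B \<longleftrightarrow> f \<in> Arr C \<and> Dom C f = A \<and> Cod C f = B"
  by (auto simp: mor_def)

section \<open>Calculus of arrows in an additive category\<close>

context additive_category begin

abbreviation arr where "arr f \<equiv> f \<in> Arr C"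
abbreviation obj where "obj A \<equiv> A \<in> Obj C"
abbreviation dom where "dom \<equiv> Dom C"
abbreviation cod where "cod \<equiv> Cod C"
abbreviation Cop where "Cop \<equiv> op_cat C"

abbreviation add (infixl "\<boxplus>" 65) where "f \<boxplus> g \<equiv> Add C f g"

lemma arr_Dom [simp]: "arr f \<Longrightarrow> dom f \<in> Obj C" by (rule Dom_Obj)
lemma arr_Cod [simp]: "arr f \<Longrightarrow> cod f \<in> Obj C" by (rule Cod_Obj)

lemma arr_Id [simp]: "obj A \<Longrightarrow> Id C A \<in> Arr C" "obj A \<Longrightarrow> dom (Id C A) = A"
    "obj A \<Longrightarrow> cod (Id C A) = A"
  using Id_mor by (auto simp: mor_iff)

lemma arr_comp [simp]:
  assumes "arr f" "arr g" "cod f = dom g"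
  shows "arr (g \<cdot> f)" "dom (g \<cdot> f) = dom f" "cod (g \<cdot> f) = cod g"
  using Comp_mor[of f "dom f" "cod f" g "cod g"] assms by (auto simp: mor_iff)

lemma comp_assoc [simp]:
  assumes "arr f" "arr g" "arr h" "cod f = dom g" "cod g = dom h"
  shows "h \<cdot> g \<cdot> f = h \<cdot> (g \<cdot> f)"
  using Comp_assoc[of f "dom f" "cod f" g "cod g" h "cod h"] assms by (simp add: mor_iff)

lemma comp_Id [simp]: "arr f \<Longrightarrow> dom f = A \<Longrightarrow> f \<cdot> Id C A = f"
  using Comp_Id[of f "dom f" "cod f"] by (simp add: mor_iff)

lemma Id_comp [simp]: "arr f \<Longrightarrow> cod f = B \<Longrightarrow> Id C B \<cdot> f = f"
  using Id_Comp[of f "dom f" "cod f"] by (simp add: mor_iff)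

lemma Hom_comm_group: "obj A \<Longrightarrow> obj B \<Longrightarrow> comm_group (Hom C A B)"
  by (rule Hom_group)

lemma Hom_simps: "carrier (Hom C A B) = mor C A B" "mult (Hom C A B) = Add C" "one (Hom C A B) = Zero C A B"
  by (simp_all add: Hom_def)

lemma arr_add [simp]:
  assumes "arr f" "arr g" "dom f = dom g" "cod f = cod g"
  shows "arr (f \<boxplus> g)" "dom (f \<boxplus> g) = dom f" "cod (f \<boxplus> g) = cod f"
proof -
  interpret G: comm_group "Hom C (dom f) (cod f)" using assms Hom_comm_group by simp
  have "f \<boxplus> g \<in> mor C (dom f) (cod f)"
    using G.m_closed[of f g] assms by (simp add: Hom_simps mor_iff)
  then show "arr (f \<boxplus> g)" "dom (f \<boxplus> g) = dom f" "cod (f \<boxplus> g) = cod f"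
    by (auto simp: mor_iff)
qed

lemma arr_Zero [simp]:
  assumes "obj A" "obj B"
  shows "arr (Zero C A B)" "dom (Zero C A B) = A" "cod (Zero C A B) = B"
proof -
  interpret G: comm_group "Hom C A B" using assms Hom_comm_group by simp
  have "Zero C A B \<in> mor C A B" using G.one_closed by (simp add: Hom_simps)
  then show "arr (Zero C A B)" "dom (Zero C A B) = A" "cod (Zero C A B) = B"
    by (auto simp: mor_iff)
qed

lemma arr_neg [simp]:
  assumes "arr f"
  shows "arr (neg C f)" "dom (neg C f) = dom f" "cod (neg C f) = cod f"
proof -
  interpret G: comm_group "Hom C (dom f) (cod f)" using assms Hom_comm_group by simp
  have "neg C f \<in> mor C (dom f) (cod f)"
    using G.inv_closed[of f] assms by (simp add: Hom_simps mor_iff neg_def)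
  then show "arr (neg C f)" "dom (neg C f) = dom f" "cod (neg C f) = cod f"
    by (auto simp: mor_iff)
qed

lemma add_assoc [simp]:
  assumes "arr f" "arr g" "arr h" "dom f = dom g" "cod f = cod g"
    "dom g = dom h" "cod g = cod h"
  shows "f \<boxplus> g \<boxplus> h = f \<boxplus> (g \<boxplus> h)"
proof -
  interpret G: comm_group "Hom C (dom f) (cod f)" using assms Hom_comm_group by simp
  show ?thesis using G.m_assoc[of f g h] assms by (simp add: Hom_simps mor_iff)
qed

lemma add_comm:
  assumes "arr f" "arr g" "dom f = dom g" "cod f = cod g"
  shows "f \<boxplus> g = g \<boxplus> f"
proof -
  interpret G: comm_group "Hom C (dom f) (cod f)" using assms Hom_comm_group by simp
  show ?thesis using G.m_comm[of f g] assms by (simp add: Hom_simps mor_iff)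
qed

lemma add_left_comm:
  assumes "arr f" "arr g" "arr h" "dom f = dom g" "cod f = cod g"
    "dom g = dom h" "cod g = cod h"
  shows "f \<boxplus> (g \<boxplus> h) = g \<boxplus> (f \<boxplus> h)"
  using assms by (metis add_assoc add_comm)

lemma add_neg [simp]:
  assumes "arr f"
  shows "f \<boxplus> neg C f = Zero C (dom f) (cod f)" "neg C f \<boxplus> f = Zero C (dom f) (cod f)"
proof -
  interpret G: comm_group "Hom C (dom f) (cod f)" using assms Hom_comm_group by simp
  show "f \<boxplus> neg C f = Zero C (dom f) (cod f)" "neg C f \<boxplus> f = Zero C (dom f) (cod f)"
    using G.r_inv[of f] G.l_inv[of f] assms by (simp_all add: Hom_simps mor_iff neg_def)
qed

lemma add_Zero [simp]:
  assumes "arr f" "dom f = A" "cod f = B"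
  shows "f \<boxplus> Zero C A B = f" "Zero C A B \<boxplus> f = f"
proof -
  interpret G: comm_group "Hom C (dom f) (cod f)" by (rule Hom_comm_group) (use assms(1) in simp_all)
  show "f \<boxplus> Zero C A B = f" "Zero C A B \<boxplus> f = f"
    using G.r_one[of f] G.l_one[of f] assms by (simp_all add: Hom_simps mor_iff)
qed

lemma add_neg_left [simp]:
  assumes "arr f" "arr g" "dom f = dom g" "cod f = cod g"
  shows "f \<boxplus> (neg C f \<boxplus> g) = g" "neg C f \<boxplus> (f \<boxplus> g) = g"
  using assms add_assoc[of f "neg C f" g] add_assoc[of "neg C f" f g] by simp_all

lemma add_neg_swap [simp]:
  assumes "arr f" "arr g" "dom f = dom g" "cod f = cod g"
  shows "f \<boxplus> (g \<boxplus> neg C f) = g" "neg C f \<boxplus> (g \<boxplus> f) = g"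
  using assms by (simp_all add: add_left_comm[of f g] add_left_comm[of _ g])

lemma add_left_cancel:
  assumes "arr f" "arr g" "arr h" "dom f = dom g" "cod f = cod g"
    "dom g = dom h" "cod g = cod h" "f \<boxplus> g = f \<boxplus> h"
  shows "g = h"
proof -
  have "g = neg C f \<boxplus> (f \<boxplus> g)" using assms(1-7) by simp
  also have "\<dots> = neg C f \<boxplus> (f \<boxplus> h)" by (simp only: assms(8))
  also have "\<dots> = h" using assms(1-7) by simp
  finally show ?thesis .
qed

lemma neg_unique:
  assumes "arr f" "arr g" "dom f = dom g" "cod f = cod g"
    "f \<boxplus> g = Zero C (dom f) (cod f)"
  shows "g = neg C f"
  by (rule add_left_cancel[of f]) (use assms in simp_all)

lemma neg_neg [simp]: "arr f \<Longrightarrow> neg C (neg C f) = f"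
  by (rule neg_unique[symmetric]) simp_all

lemma neg_Zero [simp]: "obj A \<Longrightarrow> obj B \<Longrightarrow> neg C (Zero C A B) = Zero C A B"
  by (rule neg_unique[symmetric]) simp_all

lemma neg_add [simp]:
  assumes "arr f" "arr g" "dom f = dom g" "cod f = cod g"
  shows "neg C (f \<boxplus> g) = neg C f \<boxplus> neg C g"
  by (rule neg_unique[symmetric]) (use assms in \<open>simp_all add: add_left_comm\<close>)

lemma comp_add [simp]:
  assumes "arr f" "arr g" "arr h" "dom f = dom g" "cod f = cod g" "cod g = dom h"
  shows "h \<cdot> (f \<boxplus> g) = h \<cdot> f \<boxplus> h \<cdot> g"
  using Comp_Add[of f "dom f" "cod f" g h "cod h"] assms by (simp add: mor_iff)

lemma add_comp [simp]:
  assumes "arr f" "arr g" "arr h" "dom f = dom g" "cod f = cod g" "cod h = dom g"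
  shows "(f \<boxplus> g) \<cdot> h = f \<cdot> h \<boxplus> g \<cdot> h"
  using Add_Comp[of h "dom h" "cod h" f "cod f" g] assms by (simp add: mor_iff)

text \<open>Composition is bilinear, so a composite with a zero arrow equals its own double; this is
  how such composites are seen to vanish.\<close>

lemma idem_Zero:
  assumes "arr f" "f \<boxplus> f = f"
  shows "f = Zero C (dom f) (cod f)"
  by (rule add_left_cancel[of f]) (use assms in simp_all)

lemma comp_Zero [simp]:
  assumes "arr h" "dom h = B" "obj A"
  shows "h \<cdot> Zero C A B = Zero C A (cod h)"
proof -
  have "h \<cdot> Zero C A B = Zero C (dom (h \<cdot> Zero C A B)) (cod (h \<cdot> Zero C A B))"
    by (rule idem_Zero) (use assms comp_add[of "Zero C A B" "Zero C A B" h, symmetric] in \<open>auto simp del: comp_add\<close>)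
  then show ?thesis using assms by auto
qed

lemma Zero_comp [simp]:
  assumes "arr h" "cod h = A" "obj B"
  shows "Zero C A B \<cdot> h = Zero C (dom h) B"
proof -
  have "Zero C A B \<cdot> h = Zero C (dom (Zero C A B \<cdot> h)) (cod (Zero C A B \<cdot> h))"
    by (rule idem_Zero) (use assms add_comp[of "Zero C A B" "Zero C A B" h, symmetric] in \<open>auto simp del: add_comp\<close>)
  then show ?thesis using assms by auto
qed

lemma comp_neg [simp]:
  assumes "arr f" "arr h" "cod f = dom h"
  shows "h \<cdot> neg C f = neg C (h \<cdot> f)"
  by (rule neg_unique) (use assms comp_add[of f "neg C f" h, symmetric] in simp_all)

lemma neg_comp [simp]:
  assumes "arr f" "arr h" "cod f = dom h"
  shows "neg C h \<cdot> f = neg C (h \<cdot> f)"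
  by (rule neg_unique) (use assms add_comp[of h "neg C h" f, symmetric] in simp_all)

lemmas add_ac = add_comm add_left_comm

lemma sub_eq_Zero:
  assumes "arr f" "arr g" "dom f = dom g" "cod f = cod g"
  shows "sub C f g = Zero C (dom f) (cod f) \<longleftrightarrow> f = g"
proof
  assume "sub C f g = Zero C (dom f) (cod f)"
  then have "f \<boxplus> (neg C g \<boxplus> g) = Zero C (dom f) (cod f) \<boxplus> g"
    using assms by (metis add_assoc arr_neg)
  then show "f = g" using assms by simp
qed (use assms in simp)

lemma sub_eq_iff:
  assumes "arr f" "arr g" "arr h" "dom f = dom g" "cod f = cod g"
    "dom g = dom h" "cod g = cod h"
  shows "sub C f g = h \<longleftrightarrow> f = h \<boxplus> g"
proof
  assume "sub C f g = h"
  then have "f \<boxplus> (neg C g \<boxplus> g) = h \<boxplus> g" using assms by (metis add_assoc arr_neg)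
  then show "f = h \<boxplus> g" using assms by simp
qed (use assms in simp)

end

subsection \<open>The opposite category\<close>

lemma op_cat_sel [simp]:
  "Obj (op_cat C) = Obj C" "Arr (op_cat C) = Arr C" "Dom (op_cat C) = Cod C" "Cod (op_cat C) = Dom C"
  "Id (op_cat C) = Id C" "Add (op_cat C) = Add C" "Zero (op_cat C) A B = Zero C B A"
  "g \<cdot>\<^bsub>op_cat C\<^esub> f = f \<cdot>\<^bsub>C\<^esub> g"
  by (simp_all add: op_cat_def)

lemma op_op [simp]: "op_cat (op_cat C) = C"
  by (simp add: op_cat_def)

lemma mor_op [simp]: "mor (op_cat C) A B = mor C B A"
  by (auto simp: mor_def)

lemma Hom_op [simp]: "Hom (op_cat C) A B = Hom C B A"
  by (simp add: Hom_def)

lemma neg_op [simp]: "neg (op_cat C) f = neg C f"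
  by (simp add: neg_def)

lemma zero_object_op [simp]: "zero_object (op_cat C) Z = zero_object C Z"
  by (auto simp: zero_object_def)

lemma biproduct_op [simp]: "biproduct (op_cat C) A B S i1 i2 p1 p2 = biproduct C A B S p1 p2 i1 i2"
  by (auto simp: biproduct_def)

lemma idempotent_complete_op:
  assumes "idempotent_complete C" shows "idempotent_complete (op_cat C)"
  using assms unfolding idempotent_complete_def by simp blast

text \<open>Allows a second interpretation \<open>op\<close> inside later proofs, through which
  statements about deflations and degree 0 become statements about inflations and degree
  n+1.\<close>

lemma (in additive_category) op_additive: "additive_category (op_cat C)"
proof (intro additive_category.intro category.intro additive_category_axioms.intro)
  fix A B assume "A \<in> Obj (op_cat C)" "B \<in> Obj (op_cat C)"
  then show "\<exists>S i1 i2 p1 p2. biproduct (op_cat C) A B S i1 i2 p1 p2"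
    using ex_biproduct[of A B] by simp blast
qed (use ex_zero_object in \<open>auto simp: mor_iff Hom_comm_group\<close>)

section \<open>Quotients of representables\<close>

text \<open>
  A pair \<open>(P, N)\<close> stands for the module \<open>C(-, P) / N\<close>. An arrow \<open>u\<close> is a \<open>qiso\<close> if it induces
  an isomorphism of such modules, and \<open>ses\<close> describes their short exact sequences.
\<close>

definition right_ideal :: "('o, 'm) cat \<Rightarrow> 'o \<Rightarrow> 'm set \<Rightarrow> bool" where
  "right_ideal C P N \<longleftrightarrow> P \<in> Obj C \<and> (\<forall>a\<in>N. a \<in> Arr C \<and> Cod C a = P) \<and>
     (\<forall>A\<in>Obj C. Zero C A P \<in> N) \<and>
     (\<forall>a\<in>N. \<forall>b\<in>N. Dom C a = Dom C b \<longrightarrow> Add C a b \<in> N) \<and>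
     (\<forall>a\<in>N. \<forall>h\<in>Arr C. Cod C h = Dom C a \<longrightarrow> a \<cdot>\<^bsub>C\<^esub> h \<in> N)"

text \<open>Equality of two elements of \<open>C(-, P) / N\<close> at the same object. The typing
  conditions are part of the relation, so that a congruence in hand also supplies sources and
  targets.\<close>

definition eqm :: "('o, 'm) cat \<Rightarrow> 'm set \<Rightarrow> 'm \<Rightarrow> 'm \<Rightarrow> bool" where
  "eqm C N a b \<longleftrightarrow>
     a \<in> Arr C \<and> b \<in> Arr C \<and> Dom C a = Dom C b \<and> Cod C a = Cod C b \<and> sub C a b \<in> N"

definition qiso :: "('o, 'm) cat \<Rightarrow> 'o \<Rightarrow> 'm set \<Rightarrow> 'o \<Rightarrow> 'm set \<Rightarrow> 'm \<Rightarrow> bool" where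
  "qiso C P N P' N' u \<longleftrightarrow> right_ideal C P N \<and> right_ideal C P' N' \<and> u \<in> mor C P P' \<and>
     (\<forall>a\<in>Arr C. Cod C a = P \<longrightarrow> (u \<cdot>\<^bsub>C\<^esub> a \<in> N' \<longleftrightarrow> a \<in> N)) \<and>
     (\<exists>v\<in>mor C P' P. eqm C N' (u \<cdot>\<^bsub>C\<^esub> v) (Id C P'))"

definition ses ::
  "('o, 'm) cat \<Rightarrow> 'o \<Rightarrow> 'm set \<Rightarrow> 'm \<Rightarrow> 'o \<Rightarrow> 'm set \<Rightarrow> 'm \<Rightarrow> 'o \<Rightarrow> 'm set \<Rightarrow> bool" where
  "ses C P1 N1 y P N w P2 N2 \<longleftrightarrow>
     right_ideal C P1 N1 \<and> right_ideal C P N \<and> right_ideal C P2 N2 \<and>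
     y \<in> mor C P1 P \<and> w \<in> mor C P P2 \<and>
     (\<forall>a\<in>Arr C. Cod C a = P1 \<longrightarrow> (y \<cdot>\<^bsub>C\<^esub> a \<in> N \<longleftrightarrow> a \<in> N1)) \<and>
     (\<forall>x\<in>Arr C. Cod C x = P \<longrightarrow>
        (w \<cdot>\<^bsub>C\<^esub> x \<in> N2 \<longleftrightarrow> (\<exists>a\<in>mor C (Dom C x) P1. eqm C N x (y \<cdot>\<^bsub>C\<^esub> a)))) \<and>
     (\<exists>v\<in>mor C P2 P. eqm C N2 (w \<cdot>\<^bsub>C\<^esub> v) (Id C P2))"

lemma right_idealD:
  assumes "right_ideal C P N"
  shows "P \<in> Obj C" "a \<in> N \<Longrightarrow> a \<in> Arr C" "a \<in> N \<Longrightarrow> Cod C a = P"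
    "A \<in> Obj C \<Longrightarrow> Zero C A P \<in> N"
    "a \<in> N \<Longrightarrow> b \<in> N \<Longrightarrow> Dom C a = Dom C b \<Longrightarrow> Add C a b \<in> N"
    "a \<in> N \<Longrightarrow> h \<in> Arr C \<Longrightarrow> Cod C h = Dom C a \<Longrightarrow> a \<cdot>\<^bsub>C\<^esub> h \<in> N"
  using assms unfolding right_ideal_def by blast+

lemma eqmD:
  assumes "eqm C N a b"
  shows "a \<in> Arr C" "b \<in> Arr C" "Dom C a = Dom C b" "Cod C a = Cod C b" "sub C a b \<in> N"
  using assms by (auto simp: eqm_def)

context additive_category begin

text \<open>Negation is precomposition with the negated identity, under which a right ideal is
  closed.\<close>

lemma right_ideal_neg:
  assumes "right_ideal C P N" "a \<in> N"
  shows "neg C a \<in> N"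
proof -
  have "arr a" "cod a = P" by (simp_all add: right_idealD[OF assms(1)] assms(2))
  then show ?thesis using right_idealD(6)[OF assms, of "neg C (Id C (dom a))"] by simp
qed

lemma eqm_refl: "right_ideal C P N \<Longrightarrow> arr a \<Longrightarrow> cod a = P \<Longrightarrow> eqm C N a a"
  by (simp add: eqm_def right_idealD)

lemma eqm_sym:
  assumes "right_ideal C P N" "eqm C N a b"
  shows "eqm C N b a"
  using assms right_ideal_neg[OF assms(1) eqmD(5)[OF assms(2)]]
  by (auto simp: eqm_def add_comm)

lemma eqm_trans:
  assumes "right_ideal C P N" "eqm C N a b" "eqm C N b c"
  shows "eqm C N a c"
  using assms right_idealD(5)[OF assms(1) eqmD(5)[OF assms(2)] eqmD(5)[OF assms(3)]]
  by (auto simp: eqm_def)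

lemma eqm_comp:
  assumes "right_ideal C P N" "eqm C N a b" "arr h" "cod h = dom a"
  shows "eqm C N (a \<cdot> h) (b \<cdot> h)"
  using assms right_idealD(6)[OF assms(1) eqmD(5)[OF assms(2)], of h]
  by (auto simp: eqm_def)

lemma eqm_add:
  assumes "right_ideal C P N" "eqm C N a b" "eqm C N c d" "dom a = dom c"
  shows "eqm C N (a \<boxplus> c) (b \<boxplus> d)"
proof -
  have "cod a = P" "cod c = P"
    using assms right_idealD(3)[OF assms(1) eqmD(5)[OF assms(2)]]
      right_idealD(3)[OF assms(1) eqmD(5)[OF assms(3)]] by (auto simp: eqm_def)
  then show ?thesis
    using assms right_idealD(5)[OF assms(1) eqmD(5)[OF assms(2)] eqmD(5)[OF assms(3)]]
    by (auto simp: eqm_def add_ac)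
qed

lemma eqm_mem:
  assumes "right_ideal C P N" "eqm C N a b"
  shows "a \<in> N \<longleftrightarrow> b \<in> N"
proof
  assume "a \<in> N"
  then show "b \<in> N"
    using right_idealD(5)[OF assms(1) _ eqmD(5)[OF eqm_sym[OF assms]], of a] assms(2)
    by (auto simp: eqm_def add_ac)
next
  assume "b \<in> N"
  then show "a \<in> N"
    using right_idealD(5)[OF assms(1) _ eqmD(5)[OF assms(2)], of b] assms(2)
    by (auto simp: eqm_def add_ac)
qed

lemma eqm_Zero:
  assumes "right_ideal C P N" "a \<in> N"
  shows "eqm C N a (Zero C (dom a) P)"
  using assms right_idealD[OF assms(1)] by (auto simp: eqm_def)

lemma eqm_map:
  assumes "eqm C N a b" "arr u" "dom u = cod a" "\<And>x. x \<in> N \<Longrightarrow> u \<cdot> x \<in> N'"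
  shows "eqm C N' (u \<cdot> a) (u \<cdot> b)"
  using assms(4)[OF eqmD(5)[OF assms(1)]] assms by (auto simp: eqm_def)

text \<open>The inverse is the section \<open>v\<close> from \<open>qiso\<close>:
  \<open>u v u\<close> and \<open>u\<close> agree modulo \<open>N'\<close>, and since
  \<open>u\<close> reflects \<open>N'\<close> to \<open>N\<close>, also \<open>v u\<close> is the
  identity modulo \<open>N\<close>.\<close>

lemma qiso_sym:
  assumes "qiso C P N P' N' u"
  obtains v where "qiso C P' N' P N v" "eqm C N (v \<cdot> u) (Id C P)" "eqm C N' (u \<cdot> v) (Id C P')"
proof -
  from assms obtain v where v: "v \<in> mor C P' P" "eqm C N' (u \<cdot> v) (Id C P')"
    and R: "right_ideal C P N" "right_ideal C P' N'" and u: "u \<in> mor C P P'"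
    and m: "\<And>a. a \<in> Arr C \<Longrightarrow> cod a = P \<Longrightarrow> (u \<cdot> a \<in> N' \<longleftrightarrow> a \<in> N)"
    unfolding qiso_def by blast
  have P: "obj P" "obj P'" by (simp_all add: right_idealD(1)[OF R(1)] right_idealD(1)[OF R(2)])
  have t: "arr u" "dom u = P" "cod u = P'" "arr v" "dom v = P'" "cod v = P"
    using u v by (auto simp: mor_iff)
  have "eqm C N' (u \<cdot> v \<cdot> u) (Id C P' \<cdot> u)"
    by (rule eqm_comp[OF R(2) v(2)]) (use t in auto)
  then have "eqm C N' (u \<cdot> (v \<cdot> u)) (u \<cdot> Id C P)" using t P by simp
  then have "u \<cdot> sub C (v \<cdot> u) (Id C P) \<in> N'" using t P by (simp add: eqm_def)
  then have "sub C (v \<cdot> u) (Id C P) \<in> N" by (subst (asm) m) (use t P in auto)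
  then have 1: "eqm C N (v \<cdot> u) (Id C P)" using t P by (simp add: eqm_def)
  have "v \<cdot> a \<in> N \<longleftrightarrow> a \<in> N'" if a: "arr a" "cod a = P'" for a
  proof -
    have "v \<cdot> a \<in> N \<longleftrightarrow> u \<cdot> v \<cdot> a \<in> N'" using t a by (simp add: m)
    also have "\<dots> \<longleftrightarrow> Id C P' \<cdot> a \<in> N'"
      by (rule eqm_mem[OF R(2) eqm_comp[OF R(2) v(2)]]) (use t a in auto)
    finally show ?thesis using a by simp
  qed
  then have "qiso C P' N' P N v"
    unfolding qiso_def using R v u 1 by blast
  then show ?thesis using 1 v(2) that by blast
qed

lemma qiso_Id: "right_ideal C P N \<Longrightarrow> qiso C P N P N (Id C P)"
  unfolding qiso_def using right_idealD(1)[of C P N]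
  by (auto simp: mor_iff intro!: bexI[of _ "Id C P"] eqm_refl)

end

section \<open>Complexes\<close>

text \<open>The image of \<open>C(-, d_1)\<close> in \<open>C(-, X_0)\<close>. Modulo it an arrow
  into \<open>X_0\<close> is an element of the module that \<open>X\<close> presents.\<close>

definition bd :: "('o, 'm) cat \<Rightarrow> ('o, 'm) cplx \<Rightarrow> 'm set" where
  "bd C X = {cdiff X 1 \<cdot>\<^bsub>C\<^esub> t | t. t \<in> Arr C \<and> Cod C t = cobj X 1}"

abbreviation eqb :: "('o, 'm) cat \<Rightarrow> ('o, 'm) cplx \<Rightarrow> 'm \<Rightarrow> 'm \<Rightarrow> bool" where
  "eqb C X \<equiv> eqm C (bd C X)"

abbreviation cqiso :: "('o, 'm) cat \<Rightarrow> ('o, 'm) cplx \<Rightarrow> ('o, 'm) cplx \<Rightarrow> 'm \<Rightarrow> bool" where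
  "cqiso C X Z \<equiv> qiso C (cobj X 0) (bd C X) (cobj Z 0) (bd C Z)"

abbreviation cses :: "('o, 'm) cat \<Rightarrow> ('o, 'm) cplx \<Rightarrow> 'm \<Rightarrow> ('o, 'm) cplx \<Rightarrow> 'm \<Rightarrow> ('o, 'm) cplx \<Rightarrow> bool" where
  "cses C Y y X w W \<equiv> ses C (cobj Y 0) (bd C Y) y (cobj X 0) (bd C X) w (cobj W 0) (bd C W)"

text \<open>Exactness of \<open>C(-, X)\<close> in degrees 1 to n, with nothing said about the
  kernel of \<open>d_(n+1)\<close>. Truncations of infinite resolutions have this property, and the
  lifting of chain maps rests on it alone.\<close>

definition exact0 :: "nat \<Rightarrow> ('o, 'm) cat \<Rightarrow> ('o, 'm) cplx \<Rightarrow> bool" where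
  "exact0 n C X \<longleftrightarrow> is_complex n C X \<and> (\<forall>i<n. \<forall>a\<in>Arr C. Cod C a = cobj X (Suc i) \<longrightarrow>
     cdiff X (Suc i) \<cdot>\<^bsub>C\<^esub> a = Zero C (Dom C a) (cobj X i) \<longrightarrow>
     (\<exists>t\<in>mor C (Dom C a) (cobj X (Suc (Suc i))). a = cdiff X (Suc (Suc i)) \<cdot>\<^bsub>C\<^esub> t))"

definition lexact :: "nat \<Rightarrow> ('o, 'm) cat \<Rightarrow> ('o, 'm) cplx \<Rightarrow> bool" where
  "lexact n C X \<longleftrightarrow> exact0 n C X \<and> (\<forall>a\<in>Arr C. Cod C a = cobj X (Suc n) \<longrightarrow>
     cdiff X (Suc n) \<cdot>\<^bsub>C\<^esub> a = Zero C (Dom C a) (cobj X n) \<longrightarrow> a = Zero C (Dom C a) (cobj X (Suc n)))"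

text \<open>The contravariant half of n-exactness. For a resolution \<open>X\<close> of
  \<open>F\<close> it says that \<open>Ext^i(F, C(-, Y))\<close> vanishes for i from 0 to n.\<close>

definition coexact :: "nat \<Rightarrow> ('o, 'm) cat \<Rightarrow> ('o, 'm) cplx \<Rightarrow> bool" where
  "coexact n C X \<longleftrightarrow>
     (\<forall>b\<in>Arr C. Dom C b = cobj X 0 \<longrightarrow> b \<cdot>\<^bsub>C\<^esub> cdiff X 1 = Zero C (cobj X 1) (Cod C b) \<longrightarrow>
        b = Zero C (cobj X 0) (Cod C b)) \<and>
     (\<forall>i<n. \<forall>b\<in>Arr C. Dom C b = cobj X (Suc i) \<longrightarrow>
        b \<cdot>\<^bsub>C\<^esub> cdiff X (Suc (Suc i)) = Zero C (cobj X (Suc (Suc i))) (Cod C b) \<longrightarrow>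
        (\<exists>c\<in>mor C (cobj X i) (Cod C b). b = c \<cdot>\<^bsub>C\<^esub> cdiff X (Suc i)))"

lemma exact0D:
  assumes "exact0 n C X"
  shows "is_complex n C X"
    "i < n \<Longrightarrow> a \<in> Arr C \<Longrightarrow> Cod C a = cobj X (Suc i) \<Longrightarrow>
      cdiff X (Suc i) \<cdot>\<^bsub>C\<^esub> a = Zero C (Dom C a) (cobj X i) \<Longrightarrow>
     (\<exists>t\<in>mor C (Dom C a) (cobj X (Suc (Suc i))). a = cdiff X (Suc (Suc i)) \<cdot>\<^bsub>C\<^esub> t)"
  using assms unfolding exact0_def by blast+

lemma lexactD:
  assumes "lexact n C X"
  shows "exact0 n C X" "is_complex n C X"
    "a \<in> Arr C \<Longrightarrow> Cod C a = cobj X (Suc n) \<Longrightarrow>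
     cdiff X (Suc n) \<cdot>\<^bsub>C\<^esub> a = Zero C (Dom C a) (cobj X n) \<Longrightarrow> a = Zero C (Dom C a) (cobj X (Suc n))"
  using assms unfolding lexact_def exact0_def by blast+

lemma coexactD:
  assumes "coexact n C X"
  shows "b \<in> Arr C \<Longrightarrow> Dom C b = cobj X 0 \<Longrightarrow> b \<cdot>\<^bsub>C\<^esub> cdiff X 1 = Zero C (cobj X 1) (Cod C b) \<Longrightarrow>
      b = Zero C (cobj X 0) (Cod C b)"
    "i < n \<Longrightarrow> b \<in> Arr C \<Longrightarrow> Dom C b = cobj X (Suc i) \<Longrightarrow>
      b \<cdot>\<^bsub>C\<^esub> cdiff X (Suc (Suc i)) = Zero C (cobj X (Suc (Suc i))) (Cod C b) \<Longrightarrow>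
      \<exists>c\<in>mor C (cobj X i) (Cod C b). b = c \<cdot>\<^bsub>C\<^esub> cdiff X (Suc i)"
  using assms unfolding coexact_def by blast+

lemma bdI: "t \<in> Arr C \<Longrightarrow> Cod C t = cobj X 1 \<Longrightarrow> cdiff X 1 \<cdot>\<^bsub>C\<^esub> t \<in> bd C X"
  unfolding bd_def by blast

lemma is_complex_op:
  assumes "is_complex n C X" shows "is_complex n (op_cat C) (op_cplx n X)"
proof -
  have "cdiff X (Suc (n - i)) \<in> mor C (cobj X (Suc n - i)) (cobj X (n - i))" if "i \<le> n" for i
    using assms that unfolding is_complex_def by (metis Suc_diff_le Suc_eq_plus1 diff_le_self)
  moreover have "cdiff X (n - i) \<cdot>\<^bsub>C\<^esub> cdiff X (Suc (n - i)) = Zero C (cobj X (Suc n - i)) (cobj X (n - Suc i))"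
    if "i < n" for i
  proof -
    have "n - i = Suc (n - Suc i)" "Suc n - i = Suc (Suc (n - Suc i))" "n - Suc i < n"
      using that by auto
    then show ?thesis using assms unfolding is_complex_def by (metis Suc_eq_plus1 add_2_eq_Suc')
  qed
  ultimately show ?thesis
    using assms unfolding is_complex_def op_cplx_def by (auto simp: Suc_diff_le)
qed

context additive_category begin

lemma bd_iff:
  "a \<in> bd C X \<longleftrightarrow> (\<exists>t. t \<in> Arr C \<and> cod t = cobj X 1 \<and> a = cdiff X 1 \<cdot> t)"
  unfolding bd_def by blast

lemma cx:
  assumes "is_complex n C X"
  shows "i \<le> Suc n \<Longrightarrow> cobj X i \<in> Obj C" "i \<le> n \<Longrightarrow> cdiff X (Suc i) \<in> Arr C"
    "i \<le> n \<Longrightarrow> dom (cdiff X (Suc i)) = cobj X (Suc i)" "i \<le> n \<Longrightarrow> cod (cdiff X (Suc i)) = cobj X i"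
    "i < n \<Longrightarrow> cdiff X (Suc i) \<cdot> cdiff X (Suc (Suc i)) = Zero C (cobj X (Suc (Suc i))) (cobj X i)"
    "i < n \<Longrightarrow> arr h \<Longrightarrow> cod h = cobj X (Suc (Suc i)) \<Longrightarrow>
      cdiff X (Suc i) \<cdot> (cdiff X (Suc (Suc i)) \<cdot> h) = Zero C (dom h) (cobj X i)"
proof -
  show 1: "i \<le> Suc n \<Longrightarrow> cobj X i \<in> Obj C" for i
    using assms unfolding is_complex_def by auto
  have m: "i \<le> n \<Longrightarrow> cdiff X (Suc i) \<in> mor C (cobj X (Suc i)) (cobj X i)" for i
    using assms unfolding is_complex_def by auto
  show 2: "i \<le> n \<Longrightarrow> cdiff X (Suc i) \<in> Arr C" "i \<le> n \<Longrightarrow> dom (cdiff X (Suc i)) = cobj X (Suc i)"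
    "i \<le> n \<Longrightarrow> cod (cdiff X (Suc i)) = cobj X i" for i
    using m by (auto simp: mor_iff)
  show 3: "i < n \<Longrightarrow> cdiff X (Suc i) \<cdot> cdiff X (Suc (Suc i)) = Zero C (cobj X (Suc (Suc i))) (cobj X i)"
    using assms unfolding is_complex_def by (auto simp: mor_iff)
  show "i < n \<Longrightarrow> arr h \<Longrightarrow> cod h = cobj X (Suc (Suc i)) \<Longrightarrow>
      cdiff X (Suc i) \<cdot> (cdiff X (Suc (Suc i)) \<cdot> h) = Zero C (dom h) (cobj X i)"
    using 1 2 3 comp_assoc[of h "cdiff X (Suc (Suc i))" "cdiff X (Suc i)"] by simp
qed

lemma right_ideal_bd:
  assumes "is_complex n C X"
  shows "right_ideal C (cobj X 0) (bd C X)"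
proof -
  note X = cx[OF assms]
  have "Zero C A (cobj X 0) \<in> bd C X" if "obj A" for A
    unfolding bd_iff by (rule exI[of _ "Zero C A (cobj X 1)"]) (use that X in simp)
  moreover have "a \<boxplus> b \<in> bd C X" if ab: "a \<in> bd C X" "b \<in> bd C X" and D: "dom a = dom b" for a b
  proof -
    obtain s t where "arr s" "cod s = cobj X 1" "a = cdiff X 1 \<cdot> s"
      "arr t" "cod t = cobj X 1" "b = cdiff X 1 \<cdot> t"
      using ab unfolding bd_iff by blast
    then show ?thesis
      unfolding bd_iff using X D by (intro exI[of _ "s \<boxplus> t"]) simp
  qed
  moreover have "a \<cdot> h \<in> bd C X" if a: "a \<in> bd C X" and h: "arr h" "cod h = dom a" for a h
  proof -
    obtain s where "arr s" "cod s = cobj X 1" "a = cdiff X 1 \<cdot> s"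
      using a unfolding bd_iff by blast
    then show ?thesis
      unfolding bd_iff using X h by (intro exI[of _ "s \<cdot> h"]) simp
  qed
  moreover have "\<forall>a\<in>bd C X. a \<in> Arr C \<and> cod a = cobj X 0"
    using X by (auto simp: bd_iff)
  ultimately show ?thesis
    unfolding right_ideal_def using X by auto
qed

lemma cdiff_bd: "is_complex n C X \<Longrightarrow> cdiff X (Suc 0) \<in> bd C X"
  using cx[of n X] unfolding bd_iff by (intro exI[of _ "Id C (cobj X 1)"]) simp

section \<open>Chain maps, the comparison theorem and homotopies\<close>

lemma cm:
  assumes "chain_map n C X Y \<phi>"
  shows "i \<le> Suc n \<Longrightarrow> \<phi> i \<in> Arr C" "i \<le> Suc n \<Longrightarrow> dom (\<phi> i) = cobj X i"
    "i \<le> Suc n \<Longrightarrow> cod (\<phi> i) = cobj Y i"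
    "i \<le> n \<Longrightarrow> cdiff Y (Suc i) \<cdot> \<phi> (Suc i) = \<phi> i \<cdot> cdiff X (Suc i)"
  using assms by (auto simp: chain_map_def mor_iff)

lemma cm_right:
  assumes "chain_map n C X Y \<phi>" "is_complex n C X" "is_complex n C Y"
    "i \<le> n" "arr h" "cod h = cobj X (Suc i)"
  shows "cdiff Y (Suc i) \<cdot> (\<phi> (Suc i) \<cdot> h) = \<phi> i \<cdot> (cdiff X (Suc i) \<cdot> h)"
proof -
  note t = cm[OF assms(1)] cx[OF assms(2)] cx[OF assms(3)] assms
  have "cdiff Y (Suc i) \<cdot> (\<phi> (Suc i) \<cdot> h) = cdiff Y (Suc i) \<cdot> \<phi> (Suc i) \<cdot> h"
    by (rule comp_assoc[symmetric]) (use t in auto)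
  also have "\<dots> = \<phi> i \<cdot> cdiff X (Suc i) \<cdot> h" using t by (simp only: cm(4))
  also have "\<dots> = \<phi> i \<cdot> (cdiff X (Suc i) \<cdot> h)" using t by simp
  finally show ?thesis .
qed

lemma chain_mapI:
  assumes "\<And>i. i \<le> Suc n \<Longrightarrow> \<phi> i \<in> mor C (cobj X i) (cobj Y i)"
    "\<And>i. i \<le> n \<Longrightarrow> cdiff Y (Suc i) \<cdot> \<phi> (Suc i) = \<phi> i \<cdot> cdiff X (Suc i)"
  shows "chain_map n C X Y \<phi>"
  using assms by (auto simp: chain_map_def)

lemma chain_map_Id: "is_complex n C X \<Longrightarrow> chain_map n C X X (\<lambda>i. Id C (cobj X i))"
  by (rule chain_mapI) (use cx[of n X] in \<open>auto simp: mor_iff\<close>)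

lemma chain_map_comp:
  assumes "chain_map n C X Y \<phi>" "chain_map n C Y Z \<psi>" "is_complex n C X" "is_complex n C Y" "is_complex n C Z"
  shows "chain_map n C X Z (\<lambda>i. \<psi> i \<cdot> \<phi> i)"
proof (rule chain_mapI)
  note t = cm[OF assms(1)] cm[OF assms(2)] cx[OF assms(3)] cx[OF assms(4)] cx[OF assms(5)]
  show "\<psi> i \<cdot> \<phi> i \<in> mor C (cobj X i) (cobj Z i)" if "i \<le> Suc n" for i
    using t that by (simp add: mor_iff)
  show "cdiff Z (Suc i) \<cdot> (\<psi> (Suc i) \<cdot> \<phi> (Suc i)) = \<psi> i \<cdot> \<phi> i \<cdot> cdiff X (Suc i)" if "i \<le> n" for i
  proof -
    have "cdiff Z (Suc i) \<cdot> (\<psi> (Suc i) \<cdot> \<phi> (Suc i)) = \<psi> i \<cdot> (cdiff Y (Suc i) \<cdot> \<phi> (Suc i))"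
      by (rule cm_right[OF assms(2,4,5)]) (use t that in auto)
    then show ?thesis using t that by simp
  qed
qed

lemma chain_map_sub:
  assumes "chain_map n C X Y \<phi>" "chain_map n C X Y \<psi>" "is_complex n C X" "is_complex n C Y"
  shows "chain_map n C X Y (\<lambda>i. sub C (\<phi> i) (\<psi> i))"
  by (rule chain_mapI)
    (use cm[OF assms(1)] cm[OF assms(2)] cx[OF assms(3)] cx[OF assms(4)] in \<open>auto simp: mor_iff\<close>)

text \<open>The comparison theorem for a complex of projectives over an exact complex:
  \<open>u\<close> extends degree by degree once it maps boundaries to boundaries.\<close>

lemma chain_lift:
  assumes X: "is_complex n C X" and Z: "exact0 n C Z" and u: "u \<in> mor C (cobj X 0) (cobj Z 0)"
    and b: "u \<cdot> cdiff X 1 \<in> bd C Z"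
  shows "\<exists>\<phi>. chain_map n C X Z \<phi> \<and> \<phi> 0 = u"
proof -
  note x = cx[OF X] and z = cx[OF exact0D(1)[OF Z]]
  \<comment> \<open>The invariant \<open>P\<close> keeps the cycle condition that makes the next
    lift possible. It is void above degree n+1, and \<open>Q\<close> is void above n, so the
    recursion may run through all natural numbers.\<close>
  define P where "P k f \<longleftrightarrow> (k = 0 \<longrightarrow> f = u) \<and> (k \<le> Suc n \<longrightarrow> f \<in> mor C (cobj X k) (cobj Z k)) \<and>
    (\<forall>j. k = Suc j \<longrightarrow> j < n \<longrightarrow> cdiff Z (Suc j) \<cdot> (f \<cdot> cdiff X (Suc (Suc j))) = Zero C (cobj X (Suc (Suc j))) (cobj Z j))"
    for k f
  define Q where "Q k f g \<longleftrightarrow> (k \<le> n \<longrightarrow> cdiff Z (Suc k) \<cdot> g = f \<cdot> cdiff X (Suc k))" for k f g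
  have "\<exists>\<phi>. \<forall>k. P k (\<phi> k) \<and> Q k (\<phi> k) (\<phi> (Suc k))"
  proof (rule dependent_nat_choice)
    show "\<exists>f. P 0 f" using u by (auto simp: P_def)
  next
    fix f k assume P: "P k f"
    show "\<exists>g. P (Suc k) g \<and> Q k f g"
    proof (cases "k \<le> n")
      case False then show ?thesis by (auto simp: P_def Q_def)
    next
      case kn: True
      have f: "arr f" "dom f = cobj X k" "cod f = cobj Z k"
        using P kn by (auto simp: P_def mor_iff)
      have "\<exists>g\<in>mor C (cobj X (Suc k)) (cobj Z (Suc k)). f \<cdot> cdiff X (Suc k) = cdiff Z (Suc k) \<cdot> g"
      proof (cases k)
        case 0
        then have "f = u" using P by (simp add: P_def)
        with b obtain t where t: "arr t" "cod t = cobj Z 1" "f \<cdot> cdiff X 1 = cdiff Z 1 \<cdot> t"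
          by (auto simp: bd_iff)
        from arg_cong[OF t(3), of "dom"] have "dom t = cobj X 1"
          using t f x z 0 by simp
        then show ?thesis using t 0 by (auto simp: mor_iff)
      next
        case (Suc j)
        have "\<exists>g\<in>mor C (dom (f \<cdot> cdiff X (Suc k))) (cobj Z (Suc (Suc j))).
            f \<cdot> cdiff X (Suc k) = cdiff Z (Suc (Suc j)) \<cdot> g"
          by (rule exact0D(2)[OF Z]) (use Suc kn f x z P in \<open>auto simp: P_def\<close>)
        then show ?thesis using f x kn Suc by simp
      qed
      then obtain g where g: "arr g" "dom g = cobj X (Suc k)" "cod g = cobj Z (Suc k)"
        and e: "cdiff Z (Suc k) \<cdot> g = f \<cdot> cdiff X (Suc k)" by (auto simp: mor_iff)
      have "cdiff Z (Suc k) \<cdot> (g \<cdot> cdiff X (Suc (Suc k))) = Zero C (cobj X (Suc (Suc k))) (cobj Z k)" if "k < n"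
      proof -
        have "cdiff Z (Suc k) \<cdot> (g \<cdot> cdiff X (Suc (Suc k))) = cdiff Z (Suc k) \<cdot> g \<cdot> cdiff X (Suc (Suc k))"
          using g x z that by simp
        also have "\<dots> = f \<cdot> cdiff X (Suc k) \<cdot> cdiff X (Suc (Suc k))" by (simp only: e)
        also have "\<dots> = Zero C (cobj X (Suc (Suc k))) (cobj Z k)" using f x z that by simp
        finally show ?thesis .
      qed
      then have "P (Suc k) g" "Q k f g" using g e by (auto simp: P_def Q_def mor_iff)
      then show ?thesis by blast
    qed
  qed
  then obtain \<phi> where "\<And>k. P k (\<phi> k)" "\<And>k. Q k (\<phi> k) (\<phi> (Suc k))" by blast
  then have "chain_map n C X Z \<phi>" "\<phi> 0 = u"
    by (auto simp: P_def Q_def chain_map_def)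
  then show ?thesis by blast
qed

text \<open>A lift of the zero map is null-homotopic. Up to degree n exactness gives the homotopy;
  the last equation needs that \<open>d_(n+1)\<close> of \<open>Z\<close> is mono, hence the
  separate condition \<open>lexact\<close>.\<close>

lemma chain_null:
  assumes X: "is_complex n C X" and Z: "exact0 n C Z" and c: "chain_map n C X Z \<phi>"
    and b: "\<phi> 0 \<in> bd C Z"
  shows "\<exists>s. (\<forall>i\<le>n. s i \<in> mor C (cobj X i) (cobj Z (Suc i))) \<and> \<phi> 0 = cdiff Z (Suc 0) \<cdot> s 0 \<and>
    (\<forall>i<n. \<phi> (Suc i) = cdiff Z (Suc (Suc i)) \<cdot> s (Suc i) \<boxplus> s i \<cdot> cdiff X (Suc i)) \<and>
    (lexact n C Z \<longrightarrow> \<phi> (Suc n) = s n \<cdot> cdiff X (Suc n))"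
proof -
  note x = cx[OF X] and z = cx[OF exact0D(1)[OF Z]] and p = cm[OF c]
  \<comment> \<open>What remains of \<open>\<phi>\<close> in degree k+1 after the homotopy
    \<open>f\<close> in degree k is a cycle, so exactness of \<open>Z\<close> provides the next
    component.\<close>
  have cyc: "cdiff Z (Suc k) \<cdot> sub C (\<phi> (Suc k)) (f \<cdot> cdiff X (Suc k)) = Zero C (cobj X (Suc k)) (cobj Z k)"
    if k: "k \<le> n" and f: "f \<in> mor C (cobj X k) (cobj Z (Suc k))"
      and g: "k = 0 \<Longrightarrow> \<phi> 0 = cdiff Z (Suc 0) \<cdot> f"
         "\<And>j. k = Suc j \<Longrightarrow> \<exists>g\<in>mor C (cobj X j) (cobj Z k). \<phi> k = cdiff Z (Suc k) \<cdot> f \<boxplus> g \<cdot> cdiff X k"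
    for k f
  proof -
    have f': "arr f" "dom f = cobj X k" "cod f = cobj Z (Suc k)" using f by (auto simp: mor_iff)
    have "cdiff Z (Suc k) \<cdot> (f \<cdot> cdiff X (Suc k)) = \<phi> k \<cdot> cdiff X (Suc k)"
    proof (cases k)
      case 0 then show ?thesis using f' g x z k by simp
    next
      case (Suc j)
      with g obtain h where h: "arr h" "dom h = cobj X j" "cod h = cobj Z k"
        "\<phi> k = cdiff Z (Suc k) \<cdot> f \<boxplus> h \<cdot> cdiff X k" by (auto simp: mor_iff)
      then show ?thesis using f' x z k Suc by simp
    qed
    then show ?thesis using f' x z p k by simp
  qed
  define P where "P k f \<longleftrightarrow> k \<le> n \<longrightarrow> f \<in> mor C (cobj X k) (cobj Z (Suc k)) \<and>
    (k = 0 \<longrightarrow> \<phi> 0 = cdiff Z (Suc 0) \<cdot> f) \<and>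
    (\<forall>j. k = Suc j \<longrightarrow> (\<exists>g\<in>mor C (cobj X j) (cobj Z k). \<phi> k = cdiff Z (Suc k) \<cdot> f \<boxplus> g \<cdot> cdiff X k))"
    for k f
  define Q where "Q k f g \<longleftrightarrow> (k < n \<longrightarrow> \<phi> (Suc k) = cdiff Z (Suc (Suc k)) \<cdot> g \<boxplus> f \<cdot> cdiff X (Suc k))" for k f g
  have "\<exists>s. \<forall>k. P k (s k) \<and> Q k (s k) (s (Suc k))"
  proof (rule dependent_nat_choice)
    obtain t where t: "arr t" "cod t = cobj Z 1" "\<phi> 0 = cdiff Z 1 \<cdot> t"
      using b by (auto simp: bd_iff)
    have "dom t = dom (cdiff Z 1 \<cdot> t)" using t z by simp
    also have "\<dots> = cobj X 0" by (simp only: t(3)[symmetric]) (simp add: p)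
    finally have "dom t = cobj X 0" .
    then show "\<exists>f. P 0 f" using t by (auto simp: P_def mor_iff)
  next
    fix f k assume P: "P k f"
    show "\<exists>g. P (Suc k) g \<and> Q k f g"
    proof (cases "k < n")
      case False then show ?thesis by (auto simp: P_def Q_def)
    next
      case kn: True
      have f: "arr f" "dom f = cobj X k" "cod f = cobj Z (Suc k)"
        using P kn by (auto simp: P_def mor_iff)
      let ?a = "sub C (\<phi> (Suc k)) (f \<cdot> cdiff X (Suc k))"
      have "cdiff Z (Suc k) \<cdot> ?a = Zero C (cobj X (Suc k)) (cobj Z k)"
        by (rule cyc) (use P kn in \<open>auto simp: P_def\<close>)
      then have "\<exists>g\<in>mor C (dom ?a) (cobj Z (Suc (Suc k))). ?a = cdiff Z (Suc (Suc k)) \<cdot> g"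
        by (intro exact0D(2)[OF Z kn]) (use kn f x z p in simp_all)
      then obtain g where g: "arr g" "dom g = cobj X (Suc k)" "cod g = cobj Z (Suc (Suc k))"
        "?a = cdiff Z (Suc (Suc k)) \<cdot> g" using f x z p kn by (auto simp: mor_iff)
      then have e: "\<phi> (Suc k) = cdiff Z (Suc (Suc k)) \<cdot> g \<boxplus> f \<cdot> cdiff X (Suc k)"
        using f x z p kn by (subst sub_eq_iff[symmetric]) simp_all
      then have "P (Suc k) g" "Q k f g" unfolding P_def Q_def using f g by (auto simp: mor_iff)
      then show ?thesis by blast
    qed
  qed
  then obtain s where s: "\<And>k. P k (s k)" "\<And>k. Q k (s k) (s (Suc k))" by blast
  have "\<phi> (Suc n) = s n \<cdot> cdiff X (Suc n)" if L: "lexact n C Z"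
  proof -
    have f: "arr (s n)" "dom (s n) = cobj X n" "cod (s n) = cobj Z (Suc n)"
      using s(1)[of n] by (auto simp: P_def mor_iff)
    let ?a = "sub C (\<phi> (Suc n)) (s n \<cdot> cdiff X (Suc n))"
    have "cdiff Z (Suc n) \<cdot> ?a = Zero C (cobj X (Suc n)) (cobj Z n)"
      by (rule cyc) (use s(1)[of n] in \<open>auto simp: P_def\<close>)
    then have "?a = Zero C (dom ?a) (cobj Z (Suc n))"
      by (intro lexactD(3)[OF L]) (use f x z p in simp_all)
    then show ?thesis using f x z p sub_eq_Zero[of "\<phi> (Suc n)" "s n \<cdot> cdiff X (Suc n)"] by simp
  qed
  then show ?thesis using s by (intro exI[of _ s]) (auto simp: P_def Q_def)
qed

lemma chain_homotopic:
  assumes X: "is_complex n C X" and Z: "lexact n C Z"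
    and f: "chain_map n C X Z \<phi>" and g: "chain_map n C X Z \<psi>" and b: "eqb C Z (\<phi> 0) (\<psi> 0)"
  shows "homotopic n C X Z \<phi> \<psi>"
proof -
  note x = cx[OF X] and z = cx[OF lexactD(2)[OF Z]] and p = cm[OF f] and q = cm[OF g]
  obtain s where s: "\<And>i. i \<le> n \<Longrightarrow> s i \<in> mor C (cobj X i) (cobj Z (Suc i))"
    "sub C (\<phi> 0) (\<psi> 0) = cdiff Z (Suc 0) \<cdot> s 0"
    "\<And>i. i < n \<Longrightarrow> sub C (\<phi> (Suc i)) (\<psi> (Suc i)) = cdiff Z (Suc (Suc i)) \<cdot> s (Suc i) \<boxplus> s i \<cdot> cdiff X (Suc i)"
    "sub C (\<phi> (Suc n)) (\<psi> (Suc n)) = s n \<cdot> cdiff X (Suc n)"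
    using chain_null[OF X lexactD(1)[OF Z] chain_map_sub[OF f g X lexactD(2)[OF Z]] eqmD(5)[OF b]] Z
    by (elim exE) blast
  have t: "i \<le> n \<Longrightarrow> s i \<in> Arr C" "i \<le> n \<Longrightarrow> dom (s i) = cobj X i" "i \<le> n \<Longrightarrow> cod (s i) = cobj Z (Suc i)" for i
    using s(1) by (auto simp: mor_iff)
  have "\<phi> 0 = \<psi> 0 \<boxplus> cdiff Z (Suc 0) \<cdot> s 0"
    using s(2) by (subst (asm) sub_eq_iff) (use p q t x z in \<open>simp_all add: add_comm\<close>)
  moreover have "\<phi> (Suc i) = \<psi> (Suc i) \<boxplus> (cdiff Z (Suc (Suc i)) \<cdot> s (Suc i) \<boxplus> s i \<cdot> cdiff X (Suc i))"
    if "i < n" for i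
    using s(3)[OF that] by (subst (asm) sub_eq_iff) (use p q t x z that in \<open>simp_all add: add_ac\<close>)
  moreover have "\<phi> (Suc n) = \<psi> (Suc n) \<boxplus> s n \<cdot> cdiff X (Suc n)"
    using s(4) by (subst (asm) sub_eq_iff) (use p q t x z in \<open>simp_all add: add_comm\<close>)
  ultimately show ?thesis unfolding homotopic_def using s(1) by (intro exI[of _ s]) simp
qed

lemma homotopic_eqm:
  assumes X: "is_complex n C X" and Z: "is_complex n C Z"
    and a: "arr (\<phi> 0)" "arr (\<psi> 0)" "dom (\<psi> 0) = cobj X 0" "cod (\<psi> 0) = cobj Z 0"
    and h: "homotopic n C X Z \<phi> \<psi>"
  shows "eqb C Z (\<phi> 0) (\<psi> 0)"
proof -
  note x = cx[OF X] and z = cx[OF Z]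
  obtain s where s: "arr s" "dom s = cobj X 0" "cod s = cobj Z 1" "\<phi> 0 = \<psi> 0 \<boxplus> cdiff Z 1 \<cdot> s"
    using h unfolding homotopic_def by (auto simp: mor_iff)
  then have "sub C (\<phi> 0) (\<psi> 0) = cdiff Z 1 \<cdot> s" using a z by (subst sub_eq_iff) (simp_all add: add_comm)
  then have "sub C (\<phi> 0) (\<psi> 0) \<in> bd C Z" using s by (auto simp: bd_iff)
  then show ?thesis using s a z by (simp add: eqm_def)
qed

section \<open>Homotopy type of a complex and isomorphism type of its cokernel\<close>

lemma qisoI:
  assumes R: "right_ideal C P N" "right_ideal C P' N'" and u: "u \<in> mor C P P'" and v: "v \<in> mor C P' P"
    and a: "\<And>a. a \<in> N \<Longrightarrow> u \<cdot> a \<in> N'" and b: "\<And>b. b \<in> N' \<Longrightarrow> v \<cdot> b \<in> N"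
    and e: "eqm C N' (u \<cdot> v) (Id C P')" "eqm C N (v \<cdot> u) (Id C P)"
  shows "qiso C P N P' N' u"
proof -
  have t: "arr u" "dom u = P" "cod u = P'" "arr v" "dom v = P'" "cod v = P"
    using u v by (auto simp: mor_iff)
  have "a \<in> N" if "arr a" "cod a = P" "u \<cdot> a \<in> N'" for a
  proof -
    have "v \<cdot> u \<cdot> a \<in> N" using b[OF that(3)] t that by simp
    moreover have "eqm C N (v \<cdot> u \<cdot> a) (Id C P \<cdot> a)"
      by (rule eqm_comp[OF R(1) e(2)]) (use t that in auto)
    ultimately show ?thesis using eqm_mem[OF R(1)] that by fastforce
  qed
  then show ?thesis unfolding qiso_def using assms by blast
qed

lemma qisoD:
  assumes "qiso C P N P' N' u"
  shows "right_ideal C P N" "right_ideal C P' N'" "arr u" "dom u = P" "cod u = P'"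
    "a \<in> N \<Longrightarrow> u \<cdot> a \<in> N'" "arr a \<Longrightarrow> cod a = P \<Longrightarrow> u \<cdot> a \<in> N' \<longleftrightarrow> a \<in> N"
proof -
  show 1: "right_ideal C P N" "right_ideal C P' N'" "arr u" "dom u = P" "cod u = P'"
    using assms by (auto simp: qiso_def mor_iff)
  show 2: "u \<cdot> a \<in> N' \<longleftrightarrow> a \<in> N" if "arr a" "cod a = P" for a
    using assms that by (auto simp: qiso_def)
  show "u \<cdot> a \<in> N'" if "a \<in> N"
    using 2 right_idealD[OF 1(1)] that by blast
qed

lemma qiso_lift:
  assumes "is_complex n C X" "exact0 n C Z" "cqiso C X Z u"
  obtains \<phi> where "chain_map n C X Z \<phi>" "\<phi> 0 = u"
proof -
  have "u \<cdot> cdiff X 1 \<in> bd C Z" using qisoD(6)[OF assms(3) cdiff_bd[OF assms(1)]] by simp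
  then show ?thesis using chain_lift[OF assms(1,2), of u] assms(3) that by (auto simp: qiso_def)
qed

text \<open>A left exact complex is a resolution of its cokernel by projectives, so homotopy classes
  of chain maps are the same as maps of cokernels. Closure under homotopy equivalence is henceforth
  tested on \<open>qiso\<close>.\<close>

lemma homotopy_equivalent_iff:
  assumes X: "lexact n C X" and Z: "lexact n C Z"
  shows "homotopy_equivalent n C X Z \<longleftrightarrow> (\<exists>u. cqiso C X Z u)"
proof
  note cX = lexactD(2)[OF X] and cZ = lexactD(2)[OF Z]
  note RX = right_ideal_bd[OF cX] and RZ = right_ideal_bd[OF cZ]
  note x = cx[OF cX] and z = cx[OF cZ]
  {
    assume "homotopy_equivalent n C X Z"
    then obtain \<phi> \<psi> where f: "chain_map n C X Z \<phi>" and g: "chain_map n C Z X \<psi>"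
      and h: "homotopic n C X X (\<lambda>i. \<psi> i \<cdot> \<phi> i) (\<lambda>i. Id C (cobj X i))"
       "homotopic n C Z Z (\<lambda>i. \<phi> i \<cdot> \<psi> i) (\<lambda>i. Id C (cobj Z i))"
      unfolding homotopy_equivalent_def by blast
    note p = cm[OF f] and q = cm[OF g]
    have e: "eqb C X (\<psi> 0 \<cdot> \<phi> 0) (Id C (cobj X 0))" "eqb C Z (\<phi> 0 \<cdot> \<psi> 0) (Id C (cobj Z 0))"
      using homotopic_eqm[OF cX cX _ _ _ _ h(1)] homotopic_eqm[OF cZ cZ _ _ _ _ h(2)] p q x z by simp_all
    have "\<phi> 0 \<cdot> a \<in> bd C Z" if "a \<in> bd C X" for a
    proof -
      from that obtain t where t: "arr t" "cod t = cobj X 1" "a = cdiff X 1 \<cdot> t" by (auto simp: bd_iff)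
      then have "\<phi> 0 \<cdot> a = cdiff Z 1 \<cdot> (\<phi> 1 \<cdot> t)" using cm_right[OF f cX cZ, of 0 t] by simp
      then show ?thesis unfolding bd_iff using t p by (intro exI[of _ "\<phi> 1 \<cdot> t"]) simp
    qed
    moreover have "\<psi> 0 \<cdot> a \<in> bd C X" if "a \<in> bd C Z" for a
    proof -
      from that obtain t where t: "arr t" "cod t = cobj Z 1" "a = cdiff Z 1 \<cdot> t" by (auto simp: bd_iff)
      then have "\<psi> 0 \<cdot> a = cdiff X 1 \<cdot> (\<psi> 1 \<cdot> t)" using cm_right[OF g cZ cX, of 0 t] by simp
      then show ?thesis unfolding bd_iff using t q by (intro exI[of _ "\<psi> 1 \<cdot> t"]) simp
    qed
    ultimately have "cqiso C X Z (\<phi> 0)"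
      using e p q by (intro qisoI[OF RX RZ, of _ "\<psi> 0"]) (auto simp: mor_iff)
    then show "\<exists>u. cqiso C X Z u" by blast
  next
    assume "\<exists>u. cqiso C X Z u"
    then obtain u where u: "cqiso C X Z u" by blast
    then obtain v where v: "cqiso C Z X v"
      "eqb C X (v \<cdot> u) (Id C (cobj X 0))" "eqb C Z (u \<cdot> v) (Id C (cobj Z 0))"
      by (rule qiso_sym)
    obtain \<phi> where f: "chain_map n C X Z \<phi>" "\<phi> 0 = u" using qiso_lift[OF cX lexactD(1)[OF Z] u] .
    obtain \<psi> where g: "chain_map n C Z X \<psi>" "\<psi> 0 = v" using qiso_lift[OF cZ lexactD(1)[OF X] v(1)] .
    show "homotopy_equivalent n C X Z"
      unfolding homotopy_equivalent_def
      using f g v(2,3)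
        chain_homotopic[OF cX X chain_map_comp[OF f(1) g(1) cX cZ cX] chain_map_Id[OF cX]]
        chain_homotopic[OF cZ Z chain_map_comp[OF g(1) f(1) cZ cX cZ] chain_map_Id[OF cZ]]
      by auto
  }
qed

text \<open>Coexactness is vanishing of Ext and depends only on the module. An arrow out of
  \<open>X\<close> is composed with \<open>\<psi>\<close>, treated on \<open>Z\<close>, composed
  with \<open>\<phi>\<close>, and the homotopy from \<open>\<psi> \<phi>\<close> to the identity
  corrects the result.\<close>

lemma coexact_transfer:
  assumes X: "exact0 n C X" and Z: "exact0 n C Z"
    and u: "cqiso C X Z u" and coZ: "coexact n C Z"
  shows "coexact n C X"
proof -
  note cX = exact0D(1)[OF X] and cZ = exact0D(1)[OF Z]
  note x = cx[OF cX] and z = cx[OF cZ]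
  obtain v where v: "cqiso C Z X v"
      "eqb C X (v \<cdot> u) (Id C (cobj X 0))" "eqb C Z (u \<cdot> v) (Id C (cobj Z 0))"
    using u by (rule qiso_sym)
  obtain \<phi> where f: "chain_map n C X Z \<phi>" "\<phi> 0 = u" using qiso_lift[OF cX Z u] .
  obtain \<psi> where g: "chain_map n C Z X \<psi>" "\<psi> 0 = v" using qiso_lift[OF cZ X v(1)] .
  note p = cm[OF f(1)] and q = cm[OF g(1)]
  have "sub C (\<psi> 0 \<cdot> \<phi> 0) (Id C (cobj X 0)) \<in> bd C X" using eqmD(5)[OF v(2)] f(2) g(2) by simp
  note N = chain_null[OF cX X chain_map_sub[OF chain_map_comp[OF f(1) g(1) cX cZ cX] chain_map_Id[OF cX] cX cX] this]
  obtain s where s: "\<And>i. i \<le> n \<Longrightarrow> s i \<in> mor C (cobj X i) (cobj X (Suc i))"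
    "sub C (\<psi> 0 \<cdot> \<phi> 0) (Id C (cobj X 0)) = cdiff X (Suc 0) \<cdot> s 0"
    "\<And>i. i < n \<Longrightarrow> sub C (\<psi> (Suc i) \<cdot> \<phi> (Suc i)) (Id C (cobj X (Suc i))) =
        cdiff X (Suc (Suc i)) \<cdot> s (Suc i) \<boxplus> s i \<cdot> cdiff X (Suc i)"
    using N by (elim exE) blast
  have t: "i \<le> n \<Longrightarrow> s i \<in> Arr C" "i \<le> n \<Longrightarrow> dom (s i) = cobj X i" "i \<le> n \<Longrightarrow> cod (s i) = cobj X (Suc i)" for i
    using s(1) by (auto simp: mor_iff)
  have z1: "\<psi> i \<cdot> cdiff Z (Suc i) = cdiff X (Suc i) \<cdot> \<psi> (Suc i)" if "i \<le> n" for i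
    using q(4) that by simp
  have first: "b = Zero C (cobj X 0) (cod b)"
    if b: "arr b" "dom b = cobj X 0" "b \<cdot> cdiff X 1 = Zero C (cobj X 1) (cod b)" for b
  proof -
    have "b \<cdot> \<psi> 0 \<cdot> cdiff Z 1 = b \<cdot> (\<psi> 0 \<cdot> cdiff Z 1)" using b q z by simp
    also have "\<dots> = b \<cdot> cdiff X 1 \<cdot> \<psi> 1" using b(1,2) q x z1[of 0] by simp
    also have "\<dots> = Zero C (cobj Z 1) (cod (b \<cdot> \<psi> 0))" by (simp only: b(3)) (use b q x in simp)
    finally have "b \<cdot> \<psi> 0 = Zero C (cobj Z 0) (cod b)"
      using coZ b q unfolding coexact_def by (metis arr_comp One_nat_def le0)
    then have "b \<cdot> \<psi> 0 \<cdot> \<phi> 0 = Zero C (cobj X 0) (cod b)" using b p by simp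
    moreover have "b \<cdot> \<psi> 0 \<cdot> \<phi> 0 = b \<cdot> (\<psi> 0 \<cdot> \<phi> 0)" using b p q by simp
    ultimately have "neg C b = b \<cdot> sub C (\<psi> 0 \<cdot> \<phi> 0) (Id C (cobj X 0))"
      using b p q x by simp
    also have "\<dots> = b \<cdot> cdiff X 1 \<cdot> s 0" using s(2) b(1,2) t x by simp
    also have "\<dots> = Zero C (cobj X 0) (cod b)" by (simp only: b(3)) (use b t x in simp)
    finally have "neg C (neg C b) = neg C (Zero C (cobj X 0) (cod b))" by simp
    then show ?thesis using b x by simp
  qed
  have second: "\<exists>c\<in>mor C (cobj X i) (cod b). b = c \<cdot> cdiff X (Suc i)"
    if i: "i < n" and b: "arr b" "dom b = cobj X (Suc i)"
     "b \<cdot> cdiff X (Suc (Suc i)) = Zero C (cobj X (Suc (Suc i))) (cod b)" for b i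
  proof -
    have "b \<cdot> \<psi> (Suc i) \<cdot> cdiff Z (Suc (Suc i)) = b \<cdot> (\<psi> (Suc i) \<cdot> cdiff Z (Suc (Suc i)))" using i b q z by simp
    also have "\<dots> = b \<cdot> cdiff X (Suc (Suc i)) \<cdot> \<psi> (Suc (Suc i))" using i b(1,2) q x z1[of "Suc i"] by simp
    also have "\<dots> = Zero C (cobj Z (Suc (Suc i))) (cod (b \<cdot> \<psi> (Suc i)))"
      by (simp only: b(3)) (use i b q x in simp)
    finally have "\<exists>c\<in>mor C (cobj Z i) (cod (b \<cdot> \<psi> (Suc i))). b \<cdot> \<psi> (Suc i) = c \<cdot> cdiff Z (Suc i)"
      by (intro coexactD(2)[OF coZ i]) (use i b(1,2) q x in simp_all)
    then obtain c where c: "arr c" "dom c = cobj Z i" "cod c = cod b" "b \<cdot> \<psi> (Suc i) = c \<cdot> cdiff Z (Suc i)"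
      using i b q by (auto simp: mor_iff)
    have "b \<cdot> \<psi> (Suc i) \<cdot> \<phi> (Suc i) = c \<cdot> (cdiff Z (Suc i) \<cdot> \<phi> (Suc i))" unfolding c(4) using c p z i by simp
    also have "\<dots> = c \<cdot> \<phi> i \<cdot> cdiff X (Suc i)" using i c p x by simp
    finally have e: "b \<cdot> (\<psi> (Suc i) \<cdot> \<phi> (Suc i)) = c \<cdot> \<phi> i \<cdot> cdiff X (Suc i)" using b p q i by simp
    \<comment> \<open>The homotopy contributes \<open>b d s + b s d\<close>; the first summand
      vanishes with \<open>b d\<close>, the second factors through \<open>d\<close> as
      desired.\<close>
    have "sub C (b \<cdot> (\<psi> (Suc i) \<cdot> \<phi> (Suc i))) b = b \<cdot> sub C (\<psi> (Suc i) \<cdot> \<phi> (Suc i)) (Id C (cobj X (Suc i)))"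
      using b p q x i by simp
    also have "\<dots> = b \<cdot> cdiff X (Suc (Suc i)) \<cdot> s (Suc i) \<boxplus> b \<cdot> s i \<cdot> cdiff X (Suc i)"
      unfolding s(3)[OF i] using b(1,2) t x i by simp
    also have "\<dots> = b \<cdot> s i \<cdot> cdiff X (Suc i)" by (simp only: b(3)) (use b t x i in simp)
    finally have "sub C (c \<cdot> \<phi> i \<cdot> cdiff X (Suc i)) b = b \<cdot> s i \<cdot> cdiff X (Suc i)" unfolding e .
    then have "c \<cdot> \<phi> i \<cdot> cdiff X (Suc i) = b \<cdot> s i \<cdot> cdiff X (Suc i) \<boxplus> b"
      by (subst (asm) sub_eq_iff) (use b c p t x i in simp_all)
    then have "sub C (c \<cdot> \<phi> i \<cdot> cdiff X (Suc i)) (b \<cdot> s i \<cdot> cdiff X (Suc i)) = b"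
      by (subst sub_eq_iff) (use b c p t x i in \<open>simp_all add: add_comm\<close>)
    then have "b = sub C (c \<cdot> \<phi> i) (b \<cdot> s i) \<cdot> cdiff X (Suc i)" using b c p t x i by simp
    moreover have "sub C (c \<cdot> \<phi> i) (b \<cdot> s i) \<in> mor C (cobj X i) (cod b)"
      using b c p t x i by (simp add: mor_iff)
    ultimately show ?thesis by blast
  qed
  show ?thesis unfolding coexact_def using first second by blast
qed

end

section \<open>Exact sequences and duality\<close>

text \<open>Reversing a complex twice restores it only at the indices that count, so double duals
  are compared by this relation instead of by equality.\<close>

definition cagree :: "nat \<Rightarrow> ('o, 'm) cplx \<Rightarrow> ('o, 'm) cplx \<Rightarrow> bool" where
  "cagree n X Y \<longleftrightarrow> (\<forall>i\<le>Suc n. cobj X i = cobj Y i) \<and> (\<forall>i\<le>n. cdiff X (Suc i) = cdiff Y (Suc i))"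

lemma cagree_op_op: "cagree n (op_cplx n (op_cplx n X)) X"
  unfolding cagree_def op_cplx_def by auto

lemma cagree_is_complex: "cagree n X Y \<Longrightarrow> is_complex n C X \<longleftrightarrow> is_complex n C Y"
  unfolding cagree_def is_complex_def by auto

lemma cagree_lexact: "cagree n X Y \<Longrightarrow> lexact n C X \<longleftrightarrow> lexact n C Y"
  using cagree_is_complex[of n X Y C] unfolding cagree_def lexact_def exact0_def by simp

lemma cagree_bd: "cagree n X Y \<Longrightarrow> bd C X = bd C Y"
  unfolding cagree_def bd_def by auto

lemma all_reindex: "(\<forall>i<n. R (n - Suc i)) \<longleftrightarrow> (\<forall>j<n::nat. R j)"
proof
  assume *: "\<forall>i<n. R (n - Suc i)"
  show "\<forall>j<n. R j"
  proof (intro allI impI)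
    fix j assume "j < n"
    then have "n - Suc (n - Suc j) = j" "n - Suc j < n" by auto
    then show "R j" using * by metis
  qed
qed auto

text \<open>Degree i of the reversed complex is degree n+1-i of \<open>X\<close>, so its exactness
  conditions are those of \<open>coexact\<close> in the opposite order.\<close>

lemma lexact_op:
  assumes "is_complex n C X"
  shows "lexact n (op_cat C) (op_cplx n X) \<longleftrightarrow> coexact n C X"
proof -
  let ?R = "\<lambda>i. \<forall>b\<in>Arr C. Dom C b = cobj X (Suc i) \<longrightarrow>
        b \<cdot>\<^bsub>C\<^esub> cdiff X (Suc (Suc i)) = Zero C (cobj X (Suc (Suc i))) (Cod C b) \<longrightarrow>
        (\<exists>c\<in>mor C (cobj X i) (Cod C b). b = c \<cdot>\<^bsub>C\<^esub> cdiff X (Suc i))"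
  have "exact0 n (op_cat C) (op_cplx n X) \<longleftrightarrow> (\<forall>i<n. ?R (n - Suc i))"
    unfolding exact0_def using is_complex_op[OF assms]
    by (simp add: op_cplx_def Suc_diff_Suc Suc_diff_le less_imp_le cong: all_cong1)
  also have "\<dots> \<longleftrightarrow> (\<forall>i<n. ?R i)" by (rule all_reindex)
  finally show ?thesis unfolding lexact_def coexact_def by (auto simp: op_cplx_def)
qed

context additive_category begin

text \<open>Replaces equalities of kernels and images of Hom groups by conditions on single arrows,
  split into the half about arrows into \<open>X\<close> and the half about arrows out of
  \<open>X\<close>.\<close>

lemma n_exact_iff: "n_exact n C X \<longleftrightarrow> lexact n C X \<and> coexact n C X"
proof -
  have k: "a \<in> kernel (Hom C Y A) (Hom C Y' B) h \<longleftrightarrow> arr a \<and> dom a = Y \<and> cod a = A \<and> h a = Zero C Y' B"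
    for a Y Y' A B h by (auto simp: kernel_def Hom_def mor_iff)
  show ?thesis
  proof
    assume E: "n_exact n C X"
    then have cX: "is_complex n C X" by (simp add: n_exact_def)
    note x = cx[OF cX]
    have 1: "a = Zero C (dom a) (cobj X (Suc n))"
      if "arr a" "cod a = cobj X (Suc n)" "cdiff X (Suc n) \<cdot> a = Zero C (dom a) (cobj X n)" for a
    proof -
      have "kernel (Hom C (dom a) (cobj X (n+1))) (Hom C (dom a) (cobj X n)) (\<lambda>f. cdiff X (n+1) \<cdot> f)
         = {Zero C (dom a) (cobj X (n+1))}" using E that unfolding n_exact_def by simp
      moreover have "a \<in> kernel (Hom C (dom a) (cobj X (n+1))) (Hom C (dom a) (cobj X n)) (\<lambda>f. cdiff X (n+1) \<cdot> f)"
        using that by (simp add: k)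
      ultimately show ?thesis by auto
    qed
    have 2: "\<exists>t\<in>mor C (dom a) (cobj X (Suc (Suc i))). a = cdiff X (Suc (Suc i)) \<cdot> t"
      if "i < n" "arr a" "cod a = cobj X (Suc i)" "cdiff X (Suc i) \<cdot> a = Zero C (dom a) (cobj X i)" for a i
    proof -
      have "kernel (Hom C (dom a) (cobj X (i+1))) (Hom C (dom a) (cobj X i)) (\<lambda>f. cdiff X (i+1) \<cdot> f)
         = (\<lambda>g. cdiff X (i+2) \<cdot> g) ` mor C (dom a) (cobj X (i+2))" using E that unfolding n_exact_def by simp
      moreover have "a \<in> kernel (Hom C (dom a) (cobj X (i+1))) (Hom C (dom a) (cobj X i)) (\<lambda>f. cdiff X (i+1) \<cdot> f)"
        using that by (simp add: k)
      ultimately show ?thesis by auto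
    qed
    have 3: "b = Zero C (cobj X 0) (cod b)"
      if "arr b" "dom b = cobj X 0" "b \<cdot> cdiff X 1 = Zero C (cobj X 1) (cod b)" for b
    proof -
      have "kernel (Hom C (cobj X 0) (cod b)) (Hom C (cobj X 1) (cod b)) (\<lambda>f. f \<cdot> cdiff X 1)
         = {Zero C (cobj X 0) (cod b)}" using E that unfolding n_exact_def by simp
      moreover have "b \<in> kernel (Hom C (cobj X 0) (cod b)) (Hom C (cobj X 1) (cod b)) (\<lambda>f. f \<cdot> cdiff X 1)"
        using that by (simp add: k)
      ultimately show ?thesis by auto
    qed
    have 4: "\<exists>c\<in>mor C (cobj X i) (cod b). b = c \<cdot> cdiff X (Suc i)"
      if "i < n" "arr b" "dom b = cobj X (Suc i)"
        "b \<cdot> cdiff X (Suc (Suc i)) = Zero C (cobj X (Suc (Suc i))) (cod b)" for b i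
    proof -
      have "kernel (Hom C (cobj X (i+1)) (cod b)) (Hom C (cobj X (i+2)) (cod b)) (\<lambda>f. f \<cdot> cdiff X (i+2))
         = (\<lambda>g. g \<cdot> cdiff X (i+1)) ` mor C (cobj X i) (cod b)" using E that unfolding n_exact_def by simp
      moreover have "b \<in> kernel (Hom C (cobj X (i+1)) (cod b)) (Hom C (cobj X (i+2)) (cod b)) (\<lambda>f. f \<cdot> cdiff X (i+2))"
        using that by (simp add: k)
      ultimately show ?thesis by auto
    qed
    show "lexact n C X \<and> coexact n C X"
      unfolding lexact_def exact0_def coexact_def using cX 1 2 3 4 by blast
  next
    assume E: "lexact n C X \<and> coexact n C X"
    then have L: "lexact n C X" and co: "coexact n C X" by auto
    note cX = lexactD(2)[OF L]
    note x = cx[OF cX]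
    show "n_exact n C X"
      unfolding n_exact_def
    proof (intro conjI ballI allI impI cX)
      fix Y assume Y: "obj Y"
      show "kernel (Hom C Y (cobj X (n+1))) (Hom C Y (cobj X n)) (\<lambda>f. cdiff X (n+1) \<cdot> f)
         = {Zero C Y (cobj X (n+1))}"
        using lexactD(3)[OF L] x Y by (auto simp: k)
      show "kernel (Hom C (cobj X 0) Y) (Hom C (cobj X 1) Y) (\<lambda>f. f \<cdot> cdiff X 1) = {Zero C (cobj X 0) Y}"
        using co x Y unfolding coexact_def by (auto simp: k)
      fix i assume i: "i < n"
      show "kernel (Hom C Y (cobj X (i+1))) (Hom C Y (cobj X i)) (\<lambda>f. cdiff X (i+1) \<cdot> f)
         = (\<lambda>g. cdiff X (i+2) \<cdot> g) ` mor C Y (cobj X (i+2))"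
      proof (rule Set.set_eqI)
        fix a
        show "a \<in> kernel (Hom C Y (cobj X (i+1))) (Hom C Y (cobj X i)) (\<lambda>f. cdiff X (i+1) \<cdot> f) \<longleftrightarrow>
          a \<in> (\<lambda>g. cdiff X (i+2) \<cdot> g) ` mor C Y (cobj X (i+2))"
          using exact0D(2)[OF lexactD(1)[OF L] i, of a] x i Y by (auto simp: k mor_iff image_iff)
      qed
      show "kernel (Hom C (cobj X (i+1)) Y) (Hom C (cobj X (i+2)) Y) (\<lambda>f. f \<cdot> cdiff X (i+2))
         = (\<lambda>g. g \<cdot> cdiff X (i+1)) ` mor C (cobj X i) Y"
      proof (rule Set.set_eqI)
        fix a
        have "\<exists>c\<in>mor C (cobj X i) (cod a). a = c \<cdot> cdiff X (Suc i)"
          if "arr a" "dom a = cobj X (Suc i)"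
            "a \<cdot> cdiff X (Suc (Suc i)) = Zero C (cobj X (Suc (Suc i))) (cod a)"
          using co i that unfolding coexact_def by blast
        then show "a \<in> kernel (Hom C (cobj X (i+1)) Y) (Hom C (cobj X (i+2)) Y) (\<lambda>f. f \<cdot> cdiff X (i+2)) \<longleftrightarrow>
          a \<in> (\<lambda>g. g \<cdot> cdiff X (i+1)) ` mor C (cobj X i) Y"
          using x i Y by (auto simp: k mor_iff image_iff)
      qed
    qed
  qed
qed

text \<open>In this form n-exactness is visibly self-dual, and a construction that commutes with
  reversal has to be checked for left exactness only.\<close>

lemma n_exact_lexact:
  "n_exact n C X \<longleftrightarrow> lexact n C X \<and> lexact n Cop (op_cplx n X)"
  using n_exact_iff lexact_op lexactD(2) by blast

end

lemma n_exact_op: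
  assumes "additive_category C"
  shows "n_exact n (op_cat C) (op_cplx n X) \<longleftrightarrow> n_exact n C X"
  using additive_category.n_exact_lexact[OF assms, of n X]
    additive_category.n_exact_lexact[OF additive_category.op_additive[OF assms], of n "op_cplx n X"]
    cagree_lexact[OF cagree_op_op, of n C X] by auto

lemma cagree_n_exact:
  assumes "additive_category C" "cagree n X Y"
  shows "n_exact n C X \<longleftrightarrow> n_exact n C Y"
proof -
  have "cagree n (op_cplx n X) (op_cplx n Y)"
    using assms(2) unfolding cagree_def op_cplx_def by (auto simp: Suc_diff_le)
  then show ?thesis
    using additive_category.n_exact_lexact[OF assms(1)] cagree_lexact assms(2) by metis
qed

section \<open>Transposes of maps and isomorphisms\<close>

context additive_category begin

lemma bd_op: "a \<in> bd Cop (op_cplx n X) \<longleftrightarrow> (\<exists>t. t \<in> Arr C \<and> dom t = cobj X n \<and> a = t \<cdot> cdiff X (Suc n))"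
  by (auto simp: bd_def op_cplx_def)

lemma chain_map_op:
  assumes "chain_map n C X Z \<phi>"
  shows "chain_map n Cop (op_cplx n Z) (op_cplx n X) (\<lambda>i. \<phi> (Suc n - i))"
proof -
  note p = cm[OF assms]
  have "\<phi> (Suc n - i) \<in> mor C (cobj X (Suc n - i)) (cobj Z (Suc n - i))" for i using p by (simp add: mor_iff)
  moreover have "\<phi> (n - i) \<cdot> cdiff X (Suc (n - i)) = cdiff Z (Suc (n - i)) \<cdot> \<phi> (Suc (n - i))" for i
    using p by simp
  ultimately show ?thesis unfolding chain_map_def op_cplx_def by (auto simp: Suc_diff_le)
qed

text \<open>Two lifts of one map of modules are homotopic, so their last components differ by an
  arrow factoring through \<open>d_(n+1)\<close>. Hence the transpose of a map is well defined
  modulo boundaries of the reversed complex.\<close>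

lemma chain_top:
  assumes X: "is_complex n C X" and Z: "lexact n C Z"
    and f: "chain_map n C X Z \<phi>" and g: "chain_map n C X Z \<psi>" and b: "eqb C Z (\<phi> 0) (\<psi> 0)"
  shows "eqb Cop (op_cplx n X) (\<phi> (Suc n)) (\<psi> (Suc n))"
proof -
  note x = cx[OF X] and z = cx[OF lexactD(2)[OF Z]] and p = cm[OF f] and q = cm[OF g]
  obtain s where s: "s n \<in> mor C (cobj X n) (cobj Z (Suc n))"
    "sub C (\<phi> (Suc n)) (\<psi> (Suc n)) = s n \<cdot> cdiff X (Suc n)"
    using chain_null[OF X lexactD(1)[OF Z] chain_map_sub[OF f g X lexactD(2)[OF Z]] eqmD(5)[OF b]] Z
    by (elim exE) blast
  then show ?thesis unfolding eqm_def using p q by (auto simp: bd_op mor_iff)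
qed

text \<open>The last components of lifts of an isomorphism and of its inverse are mutually inverse
  modulo boundaries, by \<open>chain_top\<close> for the two composites.\<close>

lemma qiso_op:
  assumes X: "n_exact n C X" and Z: "n_exact n C Z" and f: "chain_map n C X Z \<phi>"
    and u: "cqiso C X Z (\<phi> 0)"
  shows "qiso Cop (cobj Z (Suc n)) (bd Cop (op_cplx n Z))
    (cobj X (Suc n)) (bd Cop (op_cplx n X)) (\<phi> (Suc n))"
proof -
  interpret op: additive_category "op_cat C" by (rule op_additive)
  have L: "lexact n C X" "lexact n C Z" using X Z n_exact_iff by auto
  note cX = lexactD(2)[OF L(1)] and cZ = lexactD(2)[OF L(2)]
  note x = cx[OF cX] and z = cx[OF cZ]
  obtain v where v: "cqiso C Z X v"
      "eqb C X (v \<cdot> \<phi> 0) (Id C (cobj X 0))" "eqb C Z (\<phi> 0 \<cdot> v) (Id C (cobj Z 0))"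
    using u by (rule qiso_sym)
  obtain \<psi> where g: "chain_map n C Z X \<psi>" "\<psi> 0 = v" using qiso_lift[OF cZ lexactD(1)[OF L(1)] v(1)] .
  note p = cm[OF f(1)] and q = cm[OF g(1)]
  have e: "eqb Cop (op_cplx n X) (\<psi> (Suc n) \<cdot> \<phi> (Suc n)) (Id C (cobj X (Suc n)))"
    "eqb Cop (op_cplx n Z) (\<phi> (Suc n) \<cdot> \<psi> (Suc n)) (Id C (cobj Z (Suc n)))"
    using chain_top[OF cX L(1) chain_map_comp[OF f(1) g(1) cX cZ cX] chain_map_Id[OF cX]]
      chain_top[OF cZ L(2) chain_map_comp[OF g(1) f(1) cZ cX cZ] chain_map_Id[OF cZ]] v g by auto
  have R: "right_ideal Cop (cobj X (Suc n)) (bd Cop (op_cplx n X))"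
    "right_ideal Cop (cobj Z (Suc n)) (bd Cop (op_cplx n Z))"
    using op.right_ideal_bd[OF is_complex_op[OF cX]] op.right_ideal_bd[OF is_complex_op[OF cZ]]
    by (simp_all add: op_cplx_def)
  have "a \<cdot> \<phi> (Suc n) \<in> bd Cop (op_cplx n X)" if "a \<in> bd Cop (op_cplx n Z)" for a
  proof -
    obtain t where "arr t" "dom t = cobj Z n" "a = t \<cdot> cdiff Z (Suc n)" using \<open>a \<in> _\<close> by (auto simp: bd_op)
    then show ?thesis unfolding bd_op using p z x by (intro exI[of _ "t \<cdot> \<phi> n"]) simp
  qed
  moreover have "a \<cdot> \<psi> (Suc n) \<in> bd Cop (op_cplx n Z)" if "a \<in> bd Cop (op_cplx n X)" for a
  proof -
    obtain t where "arr t" "dom t = cobj X n" "a = t \<cdot> cdiff X (Suc n)" using \<open>a \<in> _\<close> by (auto simp: bd_op)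
    then show ?thesis unfolding bd_op using q z x by (intro exI[of _ "t \<cdot> \<psi> n"]) simp
  qed
  ultimately show ?thesis
    using e p q by (intro op.qisoI[OF R(2,1), of _ "\<psi> (Suc n)"]) (auto simp: mor_iff)
qed

end

section \<open>Degreewise split extensions\<close>

text \<open>\<open>H\<close> is an extension of \<open>W\<close> by \<open>Y\<close> that splits in every degree, but not as a complex.\<close>

definition twist :: "nat \<Rightarrow> ('o, 'm) cat \<Rightarrow> ('o, 'm) cplx \<Rightarrow> ('o, 'm) cplx \<Rightarrow> ('o, 'm) cplx \<Rightarrow>
    (nat \<Rightarrow> 'm) \<Rightarrow> (nat \<Rightarrow> 'm) \<Rightarrow> (nat \<Rightarrow> 'm) \<Rightarrow> (nat \<Rightarrow> 'm) \<Rightarrow> bool" where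
  "twist n C Y W H i j p q \<longleftrightarrow> is_complex n C H \<and>
     (\<forall>k\<le>Suc n. biproduct C (cobj Y k) (cobj W k) (cobj H k) (i k) (j k) (p k) (q k)) \<and>
     chain_map n C Y H i \<and> chain_map n C H W q"

context additive_category begin

lemma bp:
  assumes "biproduct C A B S i j p q"
  shows "obj A" "obj B" "obj S"
    "arr i" "dom i = A" "cod i = S" "arr j" "dom j = B" "cod j = S"
    "arr p" "dom p = S" "cod p = A" "arr q" "dom q = S" "cod q = B"
    "p \<cdot> i = Id C A" "q \<cdot> j = Id C B" "p \<cdot> j = Zero C B A" "q \<cdot> i = Zero C A B"
    "arr h \<Longrightarrow> cod h = A \<Longrightarrow> p \<cdot> (i \<cdot> h) = h" "arr h \<Longrightarrow> cod h = B \<Longrightarrow> q \<cdot> (j \<cdot> h) = h"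
    "arr h \<Longrightarrow> cod h = B \<Longrightarrow> p \<cdot> (j \<cdot> h) = Zero C (dom h) A"
    "arr h \<Longrightarrow> cod h = A \<Longrightarrow> q \<cdot> (i \<cdot> h) = Zero C (dom h) B"
proof -
  show 1: "obj A" "obj B" "obj S"
    "arr i" "dom i = A" "cod i = S" "arr j" "dom j = B" "cod j = S"
    "arr p" "dom p = S" "cod p = A" "arr q" "dom q = S" "cod q = B"
    "p \<cdot> i = Id C A" "q \<cdot> j = Id C B" "p \<cdot> j = Zero C B A" "q \<cdot> i = Zero C A B"
    using assms by (auto simp: biproduct_def mor_iff)
  show "arr h \<Longrightarrow> cod h = A \<Longrightarrow> p \<cdot> (i \<cdot> h) = h" "arr h \<Longrightarrow> cod h = B \<Longrightarrow> q \<cdot> (j \<cdot> h) = h"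
    "arr h \<Longrightarrow> cod h = B \<Longrightarrow> p \<cdot> (j \<cdot> h) = Zero C (dom h) A"
    "arr h \<Longrightarrow> cod h = A \<Longrightarrow> q \<cdot> (i \<cdot> h) = Zero C (dom h) B"
    using 1 comp_assoc[of h i p] comp_assoc[of h j q] comp_assoc[of h j p] comp_assoc[of h i q] by simp_all
qed

lemma bp_sum:
  assumes "biproduct C A B S i j p q" "arr x" "cod x = S"
  shows "i \<cdot> (p \<cdot> x) \<boxplus> j \<cdot> (q \<cdot> x) = x"
proof -
  have "(i \<cdot> p \<boxplus> j \<cdot> q) \<cdot> x = x" using assms by (simp add: biproduct_def)
  then show ?thesis using bp[OF assms(1)] assms by simp
qed

lemma biproduct_swap:
  assumes "biproduct C A B S i j p q" shows "biproduct C B A S j i q p"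
  using assms add_comm[of "i \<cdot> p" "j \<cdot> q"] bp[OF assms] by (auto simp: biproduct_def)

text \<open>Inclusions and projections exchange roles, so the reversal of an extension of
  \<open>W\<close> by \<open>Y\<close> is an extension of the reversed \<open>Y\<close> by the
  reversed \<open>W\<close>.\<close>

lemma twist_op:
  assumes "twist n C Y W H i j p q"
  shows "twist n Cop (op_cplx n W) (op_cplx n Y) (op_cplx n H)
    (\<lambda>k. q (Suc n - k)) (\<lambda>k. p (Suc n - k)) (\<lambda>k. j (Suc n - k)) (\<lambda>k. i (Suc n - k))"
  using assms is_complex_op chain_map_op biproduct_swap unfolding twist_def
  by (auto simp: op_cplx_def)

lemma twist_kernel:
  assumes T: "twist n C Y W H i j p q" and Y: "is_complex n C Y" and k: "k \<le> Suc n"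
    and x: "arr x" "cod x = cobj H k" "q k \<cdot> x = Zero C (dom x) (cobj W k)"
  shows "\<exists>z\<in>Arr C. cod z = cobj Y k \<and> dom z = dom x \<and> x = i k \<cdot> z"
proof -
  have b: "biproduct C (cobj Y k) (cobj W k) (cobj H k) (i k) (j k) (p k) (q k)"
    using T k by (auto simp: twist_def)
  have "i k \<cdot> (p k \<cdot> x) = x" using bp_sum[OF b x(1,2)] x bp[OF b] by simp
  then show ?thesis using bp[OF b] x by (intro bexI[of _ "p k \<cdot> x"]) simp_all
qed

lemma twist_lexact:
  assumes T: "twist n C Y W H i j p q" and Y: "lexact n C Y" and W: "lexact n C W"
  shows "lexact n C H"
proof -
  have cH: "is_complex n C H" and f: "chain_map n C Y H i" and g: "chain_map n C H W q"
    and b: "\<And>k. k \<le> Suc n \<Longrightarrow> biproduct C (cobj Y k) (cobj W k) (cobj H k) (i k) (j k) (p k) (q k)"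
    using T by (auto simp: twist_def)
  note cY = lexactD(2)[OF Y] and cW = lexactD(2)[OF W]
  note y = cx[OF cY] and w = cx[OF cW] and h = cx[OF cH] and ip = cm[OF f] and qp = cm[OF g]
  have "exact0 n C H"
    unfolding exact0_def
  proof (intro conjI allI impI ballI cH)
    fix k a assume k: "k < n" and a: "arr a" "cod a = cobj H (Suc k)"
      "cdiff H (Suc k) \<cdot> a = Zero C (dom a) (cobj H k)"
    note b0 = bp[OF b[of k]] and b1 = bp[OF b[of "Suc k"]] and b2 = bp[OF b[of "Suc (Suc k)"]]
    have "cdiff W (Suc k) \<cdot> (q (Suc k) \<cdot> a) = q k \<cdot> (cdiff H (Suc k) \<cdot> a)"
      using cm_right[OF g cH cW _ a(1,2)] k by simp
    also have "\<dots> = Zero C (dom a) (cobj W k)" unfolding a(3) using a qp k h by simp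
    finally have "\<exists>t\<in>mor C (dom (q (Suc k) \<cdot> a)) (cobj W (Suc (Suc k))). q (Suc k) \<cdot> a = cdiff W (Suc (Suc k)) \<cdot> t"
      by (intro exact0D(2)[OF lexactD(1)[OF W] k]) (use a b1 k in simp_all)
    then obtain t where t: "arr t" "dom t = dom a" "cod t = cobj W (Suc (Suc k))"
      "q (Suc k) \<cdot> a = cdiff W (Suc (Suc k)) \<cdot> t" using a b1 k by (auto simp: mor_iff)
    \<comment> \<open>\<open>j\<close> is not a chain map. Still the boundary of \<open>j t\<close>
      has the same \<open>W\<close> part as \<open>a\<close>, so the difference comes from
      \<open>Y\<close>, where it is a cycle.\<close>
    let ?j = "j (Suc (Suc k)) \<cdot> t"
    let ?x = "sub C a (cdiff H (Suc (Suc k)) \<cdot> ?j)"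
    have "q (Suc k) \<cdot> (cdiff H (Suc (Suc k)) \<cdot> ?j) = cdiff W (Suc (Suc k)) \<cdot> (q (Suc (Suc k)) \<cdot> ?j)"
      using cm_right[OF g cH cW, of "Suc k" ?j] k t b2 by simp
    also have "\<dots> = cdiff W (Suc (Suc k)) \<cdot> t" using k t b2 by simp
    finally have e: "q (Suc k) \<cdot> (cdiff H (Suc (Suc k)) \<cdot> ?j) = cdiff W (Suc (Suc k)) \<cdot> t" .
    have xt: "arr ?x" "cod ?x = cobj H (Suc k)" "dom ?x = dom a" using a k t b2 h by simp_all
    have "q (Suc k) \<cdot> ?x = Zero C (dom ?x) (cobj W (Suc k))"
      using e t(4) a k t(1-3) b2 b1 h w by simp
    then have "\<exists>z\<in>Arr C. cod z = cobj Y (Suc k) \<and> dom z = dom ?x \<and> ?x = i (Suc k) \<cdot> z"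
      by (rule twist_kernel[OF T cY _ xt(1,2), rotated]) (use k in simp)
    then obtain z where z0: "arr z" "cod z = cobj Y (Suc k)" "dom z = dom ?x"
      and xe: "?x = i (Suc k) \<cdot> z" by blast
    note z = z0(1,2) z0(3)[unfolded xt(3)]
    have "i k \<cdot> (cdiff Y (Suc k) \<cdot> z) = cdiff H (Suc k) \<cdot> (i (Suc k) \<cdot> z)"
      using cm_right[OF f cY cH, of k z] z k by simp
    also have "\<dots> = cdiff H (Suc k) \<cdot> ?x" by (simp only: xe)
    also have "\<dots> = Zero C (dom a) (cobj H k)" using a k t(1-3) b2 h by simp
    finally have "p k \<cdot> (i k \<cdot> (cdiff Y (Suc k) \<cdot> z)) = p k \<cdot> Zero C (dom a) (cobj H k)" by simp
    then have "cdiff Y (Suc k) \<cdot> z = Zero C (dom z) (cobj Y k)" using z k b0 y a by simp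
    then have "\<exists>t\<in>mor C (dom z) (cobj Y (Suc (Suc k))). z = cdiff Y (Suc (Suc k)) \<cdot> t"
      by (intro exact0D(2)[OF lexactD(1)[OF Y] k z(1,2)])
    then obtain s where s: "arr s" "dom s = dom a" "cod s = cobj Y (Suc (Suc k))"
      "z = cdiff Y (Suc (Suc k)) \<cdot> s" using z by (auto simp: mor_iff)
    have "a = ?x \<boxplus> cdiff H (Suc (Suc k)) \<cdot> ?j" using a k t(1-3) b2 h by simp
    also have "?x = i (Suc k) \<cdot> (cdiff Y (Suc (Suc k)) \<cdot> s)" by (simp only: xe s(4))
    also have "\<dots> = cdiff H (Suc (Suc k)) \<cdot> (i (Suc (Suc k)) \<cdot> s)"
      using cm_right[OF f cY cH, of "Suc k" s] s k by simp
    also have "cdiff H (Suc (Suc k)) \<cdot> (i (Suc (Suc k)) \<cdot> s) \<boxplus> cdiff H (Suc (Suc k)) \<cdot> ?j =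
        cdiff H (Suc (Suc k)) \<cdot> (i (Suc (Suc k)) \<cdot> s \<boxplus> ?j)"
      using s(1-3) t(1-3) k b2 h by simp
    finally have "a = cdiff H (Suc (Suc k)) \<cdot> (i (Suc (Suc k)) \<cdot> s \<boxplus> ?j)" .
    moreover have "i (Suc (Suc k)) \<cdot> s \<boxplus> ?j \<in> mor C (dom a) (cobj H (Suc (Suc k)))"
      using s t k b2 by (simp add: mor_iff)
    ultimately show "\<exists>t\<in>mor C (dom a) (cobj H (Suc (Suc k))). a = cdiff H (Suc (Suc k)) \<cdot> t" by blast
  qed
  moreover have "a = Zero C (dom a) (cobj H (Suc n))"
    if a: "arr a" "cod a = cobj H (Suc n)" "cdiff H (Suc n) \<cdot> a = Zero C (dom a) (cobj H n)" for a
  proof -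
    note b0 = bp[OF b[of n]] and b1 = bp[OF b[of "Suc n"]]
    have "cdiff W (Suc n) \<cdot> (q (Suc n) \<cdot> a) = q n \<cdot> (cdiff H (Suc n) \<cdot> a)"
      using cm_right[OF g cH cW _ a(1,2)] by simp
    also have "\<dots> = Zero C (dom a) (cobj W n)" unfolding a(3) using a qp h by simp
    finally have "q (Suc n) \<cdot> a = Zero C (dom (q (Suc n) \<cdot> a)) (cobj W (Suc n))"
      by (intro lexactD(3)[OF W]) (use a b1 in simp_all)
    then have "q (Suc n) \<cdot> a = Zero C (dom a) (cobj W (Suc n))" using a b1 by simp
    then have "\<exists>z\<in>Arr C. cod z = cobj Y (Suc n) \<and> dom z = dom a \<and> a = i (Suc n) \<cdot> z"
      by (rule twist_kernel[OF T cY _ a(1,2), rotated]) simp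
    then obtain z where z: "arr z" "cod z = cobj Y (Suc n)" "dom z = dom a"
      and ae: "a = i (Suc n) \<cdot> z" by blast
    have "i n \<cdot> (cdiff Y (Suc n) \<cdot> z) = cdiff H (Suc n) \<cdot> (i (Suc n) \<cdot> z)"
      using cm_right[OF f cY cH, of n z] z by simp
    also have "\<dots> = Zero C (dom a) (cobj H n)" by (simp only: ae[symmetric] a(3))
    finally have "p n \<cdot> (i n \<cdot> (cdiff Y (Suc n) \<cdot> z)) = p n \<cdot> Zero C (dom a) (cobj H n)" by simp
    then have "cdiff Y (Suc n) \<cdot> z = Zero C (dom z) (cobj Y n)" using z b0 y a by simp
    then have "z = Zero C (dom a) (cobj Y (Suc n))"
      using lexactD(3)[OF Y z(1,2)] z(3) by simp
    then have "i (Suc n) \<cdot> z = i (Suc n) \<cdot> Zero C (dom a) (cobj Y (Suc n))" by (rule arg_cong)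
    also have "\<dots> = Zero C (dom a) (cobj H (Suc n))" using b1 a(1) by simp
    finally show ?thesis by (simp only: ae[symmetric])
  qed
  ultimately show ?thesis unfolding lexact_def by blast
qed

text \<open>That \<open>i 0\<close> reflects boundaries uses exactness of \<open>W\<close> in degree
  1: an arrow into \<open>H_1\<close> whose boundary lies in \<open>Y\<close> can be changed by a
  boundary into an arrow coming from \<open>Y_1\<close>. This is where n >= 1 enters.\<close>

lemma twist_ses:
  assumes T: "twist n C Y W H i j p q" and Y: "lexact n C Y" and W: "lexact n C W" and n: "n \<ge> 1"
  shows "cses C Y (i 0) H (q 0) W"
proof -
  have cH: "is_complex n C H" and f: "chain_map n C Y H i" and g: "chain_map n C H W q"
    and b: "\<And>k. k \<le> Suc n \<Longrightarrow> biproduct C (cobj Y k) (cobj W k) (cobj H k) (i k) (j k) (p k) (q k)"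
    using T by (auto simp: twist_def)
  note cY = lexactD(2)[OF Y] and cW = lexactD(2)[OF W]
  note y = cx[OF cY] and w = cx[OF cW] and h = cx[OF cH] and ip = cm[OF f] and qp = cm[OF g]
  note b0 = bp[OF b[of 0]] and b1 = bp[OF b[of 1]] and b2 = bp[OF b[of "Suc 1"]]
  note R = right_ideal_bd[OF cY] right_ideal_bd[OF cH] right_ideal_bd[OF cW]
  have lift: "\<exists>s\<in>Arr C. dom s = dom t \<and> cod s = cobj Y 1 \<and>
      cdiff H 1 \<cdot> t = i 0 \<cdot> (cdiff Y 1 \<cdot> s)"
    if t: "arr t" "cod t = cobj H 1" "q 0 \<cdot> (cdiff H 1 \<cdot> t) = Zero C (dom t) (cobj W 0)" for t
  proof -
    have "cdiff W (Suc 0) \<cdot> (q (Suc 0) \<cdot> t) = Zero C (dom t) (cobj W 0)"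
      using cm_right[OF g cH cW, of 0 t] t by simp
    then have "\<exists>s\<in>mor C (dom (q (Suc 0) \<cdot> t)) (cobj W (Suc (Suc 0))). q (Suc 0) \<cdot> t = cdiff W (Suc (Suc 0)) \<cdot> s"
      by (intro exact0D(2)[OF lexactD(1)[OF W]]) (use n t b1 in simp_all)
    then obtain s where s: "arr s" "dom s = dom t" "cod s = cobj W (Suc (Suc 0))"
      "q (Suc 0) \<cdot> t = cdiff W (Suc (Suc 0)) \<cdot> s" using t b1 by (auto simp: mor_iff)
    let ?j = "j (Suc (Suc 0)) \<cdot> s"
    let ?x = "sub C t (cdiff H (Suc (Suc 0)) \<cdot> ?j)"
    have "q (Suc 0) \<cdot> (cdiff H (Suc (Suc 0)) \<cdot> ?j) = cdiff W (Suc (Suc 0)) \<cdot> (q (Suc (Suc 0)) \<cdot> ?j)"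
      using cm_right[OF g cH cW, of "Suc 0" ?j] n s b2 by simp
    also have "\<dots> = cdiff W (Suc (Suc 0)) \<cdot> s" using s n b2 by simp
    finally have e: "q (Suc 0) \<cdot> (cdiff H (Suc (Suc 0)) \<cdot> ?j) = cdiff W (Suc (Suc 0)) \<cdot> s" .
    have xt: "arr ?x" "cod ?x = cobj H (Suc 0)" "dom ?x = dom t" using t s n b2 h by simp_all
    have "q (Suc 0) \<cdot> ?x = Zero C (dom ?x) (cobj W (Suc 0))"
      using e s(4) t(1,2) s(1-3) n b2 b1 h w by simp
    then have "\<exists>z\<in>Arr C. cod z = cobj Y (Suc 0) \<and> dom z = dom ?x \<and> ?x = i (Suc 0) \<cdot> z"
      by (rule twist_kernel[OF T cY _ xt(1,2), rotated]) simp
    then obtain z where z0: "arr z" "cod z = cobj Y (Suc 0)" "dom z = dom ?x"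
      and xe: "?x = i (Suc 0) \<cdot> z" by blast
    note z = z0(1,2) z0(3)[unfolded xt(3)]
    have "cdiff H 1 \<cdot> t = cdiff H 1 \<cdot> ?x" using t(1,2) s(1-3) n b2 h by simp
    also have "\<dots> = cdiff H (Suc 0) \<cdot> (i (Suc 0) \<cdot> z)" by (simp only: xe One_nat_def)
    also have "\<dots> = i 0 \<cdot> (cdiff Y 1 \<cdot> z)"
      using cm_right[OF f cY cH, of 0 z] z by simp
    finally show ?thesis using z by (intro bexI[of _ z]) simp_all
  qed
  have "i 0 \<cdot> a \<in> bd C H \<longleftrightarrow> a \<in> bd C Y" if a: "arr a" "cod a = cobj Y 0" for a
  proof
    assume "i 0 \<cdot> a \<in> bd C H"
    then obtain t where t: "arr t" "cod t = cobj H 1" "i 0 \<cdot> a = cdiff H 1 \<cdot> t" by (auto simp: bd_iff)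
    have "dom t = dom (cdiff H 1 \<cdot> t)" using t h by simp
    also have "\<dots> = dom a" unfolding t(3)[symmetric] using a b0 by simp
    finally have d: "dom t = dom a" .
    have "q 0 \<cdot> (cdiff H 1 \<cdot> t) = Zero C (dom t) (cobj W 0)"
      unfolding t(3)[symmetric] using a b0 d by simp
    from lift[OF t(1,2) this] obtain s where s: "arr s" "cod s = cobj Y 1"
      "i 0 \<cdot> a = i 0 \<cdot> (cdiff Y 1 \<cdot> s)" using t by auto
    have "a = p 0 \<cdot> (i 0 \<cdot> a)" using a b0 by simp
    also have "\<dots> = cdiff Y 1 \<cdot> s" unfolding s(3) using s y b0 by simp
    finally show "a \<in> bd C Y" using s by (auto simp: bd_iff)
  next
    assume "a \<in> bd C Y"
    then obtain t where t: "arr t" "cod t = cobj Y 1" "a = cdiff Y 1 \<cdot> t" by (auto simp: bd_iff)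
    then have "i 0 \<cdot> a = cdiff H 1 \<cdot> (i 1 \<cdot> t)" using cm_right[OF f cY cH, of 0 t] by simp
    then show "i 0 \<cdot> a \<in> bd C H" unfolding bd_iff using t b1 by (intro exI[of _ "i 1 \<cdot> t"]) simp
  qed
  moreover have "q 0 \<cdot> x \<in> bd C W \<longleftrightarrow> (\<exists>a\<in>mor C (dom x) (cobj Y 0). eqb C H x (i 0 \<cdot> a))"
    if x: "arr x" "cod x = cobj H 0" for x
  proof
    assume "q 0 \<cdot> x \<in> bd C W"
    then obtain t where t: "arr t" "cod t = cobj W 1" "q 0 \<cdot> x = cdiff W 1 \<cdot> t" by (auto simp: bd_iff)
    have "dom t = dom (cdiff W 1 \<cdot> t)" using t w by simp
    also have "\<dots> = dom x" unfolding t(3)[symmetric] using x b0 by simp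
    finally have d: "dom t = dom x" .
    let ?x = "sub C x (cdiff H 1 \<cdot> (j 1 \<cdot> t))"
    have "q 0 \<cdot> (cdiff H 1 \<cdot> (j 1 \<cdot> t)) = cdiff W 1 \<cdot> (q 1 \<cdot> (j 1 \<cdot> t))"
      using cm_right[OF g cH cW, of 0 "j 1 \<cdot> t"] t b1 by simp
    also have "\<dots> = q 0 \<cdot> x" using t b1 by simp
    finally have e: "q 0 \<cdot> (cdiff H 1 \<cdot> (j 1 \<cdot> t)) = q 0 \<cdot> x" .
    have xt: "arr ?x" "cod ?x = cobj H 0" "dom ?x = dom x" using t d x b1 h by simp_all
    have "q 0 \<cdot> ?x = Zero C (dom ?x) (cobj W 0)" using e t(1,2) d x b1 b0 h by simp
    then have "\<exists>z\<in>Arr C. cod z = cobj Y 0 \<and> dom z = dom ?x \<and> ?x = i 0 \<cdot> z"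
      by (rule twist_kernel[OF T cY _ xt(1,2), rotated]) simp
    then obtain z where z0: "arr z" "cod z = cobj Y 0" "dom z = dom ?x"
      and xe: "?x = i 0 \<cdot> z" by blast
    note z = z0(1,2) z0(3)[unfolded xt(3)]
    have "eqb C H x ?x"
      using x t(1,2) d b1 h bdI[of "j 1 \<cdot> t" C H] by (simp add: eqm_def)
    then have "eqb C H x (i 0 \<cdot> z)" by (simp only: xe)
    then show "\<exists>a\<in>mor C (dom x) (cobj Y 0). eqb C H x (i 0 \<cdot> a)"
      using z by (intro bexI[of _ z]) (simp_all add: mor_iff)
  next
    assume "\<exists>a\<in>mor C (dom x) (cobj Y 0). eqb C H x (i 0 \<cdot> a)"
    then obtain a where a: "arr a" "dom a = dom x" "cod a = cobj Y 0" "sub C x (i 0 \<cdot> a) \<in> bd C H"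
      by (auto simp: mor_iff eqm_def)
    then obtain t where t: "arr t" "cod t = cobj H 1" "sub C x (i 0 \<cdot> a) = cdiff H 1 \<cdot> t"
      by (auto simp: bd_iff)
    have "q 0 \<cdot> x = q 0 \<cdot> sub C x (i 0 \<cdot> a)" using x a b0 by simp
    also have "\<dots> = cdiff W 1 \<cdot> (q 1 \<cdot> t)" unfolding t(3) using cm_right[OF g cH cW, of 0 t] t by simp
    finally show "q 0 \<cdot> x \<in> bd C W" unfolding bd_iff using t b1 by (intro exI[of _ "q 1 \<cdot> t"]) simp
  qed
  moreover have "eqb C W (q 0 \<cdot> j 0) (Id C (cobj W 0))"
    using b0 w by (simp add: eqm_refl[OF R(3)])
  ultimately show ?thesis
    unfolding ses_def using R b0 by (auto simp: mor_iff intro!: bexI[of _ "j 0"])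
qed

text \<open>By \<open>twist_op\<close> both halves of n-exactness are instances of the left
  exactness of an extension.\<close>

lemma twist_n_exact:
  assumes T: "twist n C Y W H i j p q" and Y: "n_exact n C Y" and W: "n_exact n C W"
  shows "n_exact n C H"
proof -
  interpret op: additive_category "op_cat C" by (rule op_additive)
  show ?thesis
    using twist_lexact[OF T] op.twist_lexact[OF twist_op[OF T]] Y W n_exact_lexact by blast
qed

section \<open>Short exact sequences of presented modules and their duals\<close>

lemma sesD:
  assumes "ses C P1 N1 y P N w P2 N2"
  shows "right_ideal C P1 N1" "right_ideal C P N" "right_ideal C P2 N2"
    "arr y" "dom y = P1" "cod y = P" "arr w" "dom w = P" "cod w = P2"
    "arr a \<Longrightarrow> cod a = P1 \<Longrightarrow> y \<cdot> a \<in> N \<longleftrightarrow> a \<in> N1"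
    "arr x \<Longrightarrow> cod x = P \<Longrightarrow> w \<cdot> x \<in> N2 \<longleftrightarrow> (\<exists>a\<in>mor C (dom x) P1. eqm C N x (y \<cdot> a))"
    "\<exists>v\<in>mor C P2 P. eqm C N2 (w \<cdot> v) (Id C P2)"
    "a \<in> N1 \<Longrightarrow> y \<cdot> a \<in> N" "x \<in> N \<Longrightarrow> w \<cdot> x \<in> N2" "w \<cdot> y \<in> N2"
    "obj P1" "obj P" "obj P2"
proof -
  show 1: "right_ideal C P1 N1" "right_ideal C P N" "right_ideal C P2 N2"
    "arr y" "dom y = P1" "cod y = P" "arr w" "dom w = P" "cod w = P2"
    using assms by (auto simp: ses_def mor_iff)
  show 2: "obj P1" "obj P" "obj P2" using 1 right_idealD(1)[of C P1] right_idealD(1)[of C P] right_idealD(1)[of C P2] by auto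
  show 3: "arr a \<Longrightarrow> cod a = P1 \<Longrightarrow> y \<cdot> a \<in> N \<longleftrightarrow> a \<in> N1"
    "arr x \<Longrightarrow> cod x = P \<Longrightarrow> w \<cdot> x \<in> N2 \<longleftrightarrow> (\<exists>a\<in>mor C (dom x) P1. eqm C N x (y \<cdot> a))"
    "\<exists>v\<in>mor C P2 P. eqm C N2 (w \<cdot> v) (Id C P2)" for a x
    using assms by (auto simp: ses_def)
  show "a \<in> N1 \<Longrightarrow> y \<cdot> a \<in> N" using 3(1) right_idealD[OF 1(1)] by blast
  show "w \<cdot> x \<in> N2" if x: "x \<in> N"
  proof -
    have xa: "arr x" "cod x = P" using right_idealD[OF 1(2)] x by auto
    have "eqm C N x (y \<cdot> Zero C (dom x) P1)" using eqm_Zero[OF 1(2) x] xa 1 2 by simp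
    then show ?thesis using 3(2)[OF xa] xa 2 by (auto simp: mor_iff)
  qed
  have "eqm C N y (y \<cdot> Id C P1)" using 1 eqm_refl[OF 1(2), of y] by simp
  moreover have "Id C P1 \<in> mor C (dom y) P1" using 1 2 by (simp add: mor_iff)
  ultimately show "w \<cdot> y \<in> N2" using 3(2)[of y] 1(4,6) by blast
qed

text \<open>Exchanges the middle term for an isomorphic one. The new maps agree with the old ones
  only modulo relations, which is all that lifts to complexes determine.\<close>

lemma ses_qiso:
  assumes S: "ses C P1 N1 y' Q M w' P2 N2" and E: "qiso C P N Q M e"
    and y: "y \<in> mor C P1 P" "eqm C M (e \<cdot> y) y'" and w: "w \<in> mor C P P2" "eqm C N2 (w' \<cdot> e) w"
  shows "ses C P1 N1 y P N w P2 N2"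
proof -
  note s = sesD[OF S] and eD = qisoD[OF E]
  have t: "arr y" "dom y = P1" "cod y = P" "arr w" "dom w = P" "cod w = P2"
    using y w by (auto simp: mor_iff)
  have wx: "w \<cdot> x \<in> N2 \<longleftrightarrow> w' \<cdot> (e \<cdot> x) \<in> N2" if x: "arr x" "cod x = P" for x
  proof -
    have "eqm C N2 (w' \<cdot> e \<cdot> x) (w \<cdot> x)" by (rule eqm_comp[OF s(3) w(2)]) (use x s eD t in auto)
    then show ?thesis using eqm_mem[OF s(3)] x s(4-9) eD(3-5) by fastforce
  qed
  have yx: "eqm C M (e \<cdot> (y \<cdot> a)) (y' \<cdot> a)" if a: "arr a" "cod a = P1" for a
    using eqm_comp[OF s(2) y(2) a(1)] a t eD(3-5) by simp
  have "y \<cdot> a \<in> N \<longleftrightarrow> a \<in> N1" if a: "arr a" "cod a = P1" for a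
    using eqm_mem[OF s(2) yx[OF a]] s(10)[OF a] eD(7)[of "y \<cdot> a"] a t by simp
  moreover have "w \<cdot> x \<in> N2 \<longleftrightarrow> (\<exists>a\<in>mor C (dom x) P1. eqm C N x (y \<cdot> a))" if x: "arr x" "cod x = P" for x
  proof -
    have "eqm C M (e \<cdot> x) (y' \<cdot> a) \<longleftrightarrow> eqm C N x (y \<cdot> a)" if a: "a \<in> mor C (dom x) P1" for a
    proof -
      have at: "arr a" "dom a = dom x" "cod a = P1" using a by (auto simp: mor_iff)
      have "eqm C M (e \<cdot> x) (y' \<cdot> a) \<longleftrightarrow> eqm C M (e \<cdot> x) (e \<cdot> (y \<cdot> a))"
        using yx[OF at(1,3)] eqm_trans[OF s(2)] eqm_sym[OF s(2)] by blast
      also have "\<dots> \<longleftrightarrow> e \<cdot> sub C x (y \<cdot> a) \<in> M" using x at t eD(3-5) by (simp add: eqm_def)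
      also have "\<dots> \<longleftrightarrow> sub C x (y \<cdot> a) \<in> N" by (rule eD(7)) (use x at t in auto)
      finally show ?thesis using x at t by (simp add: eqm_def)
    qed
    then show ?thesis unfolding wx[OF x] using s(11)[of "e \<cdot> x"] x eD(3-5) by simp
  qed
  moreover have "\<exists>v\<in>mor C P2 P. eqm C N2 (w \<cdot> v) (Id C P2)"
  proof -
    obtain v' where v': "arr v'" "dom v' = P2" "cod v' = Q" "eqm C N2 (w' \<cdot> v') (Id C P2)"
      using s(12) by (auto simp: mor_iff)
    obtain f where f: "arr f" "dom f = Q" "cod f = P" "eqm C M (e \<cdot> f) (Id C Q)"
      using E by (auto simp: qiso_def mor_iff)
    have ft: "arr (f \<cdot> v')" "cod (f \<cdot> v') = P" "dom (f \<cdot> v') = P2" using f v' by auto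
    have "eqm C N2 (w' \<cdot> e \<cdot> (f \<cdot> v')) (w \<cdot> (f \<cdot> v'))"
      by (rule eqm_comp[OF s(3) w(2)]) (use ft s eD t in auto)
    then have 1: "eqm C N2 (w \<cdot> (f \<cdot> v')) (w' \<cdot> e \<cdot> (f \<cdot> v'))" by (rule eqm_sym[OF s(3)])
    have "eqm C M (e \<cdot> f \<cdot> v') (Id C Q \<cdot> v')" by (rule eqm_comp[OF s(2) f(4)]) (use f v' eD in auto)
    then have "eqm C N2 (w' \<cdot> (e \<cdot> f \<cdot> v')) (w' \<cdot> (Id C Q \<cdot> v'))"
      by (rule eqm_map) (use f v' eD s in auto)
    then have 2: "eqm C N2 (w' \<cdot> e \<cdot> (f \<cdot> v')) (w' \<cdot> v')" using f v' eD(3-5) s(4-9) by simp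
    have "eqm C N2 (w \<cdot> (f \<cdot> v')) (Id C P2)"
      using eqm_trans[OF s(3) 1 eqm_trans[OF s(3) 2 v'(4)]] .
    then show ?thesis using ft by (auto simp: mor_iff)
  qed
  ultimately show ?thesis unfolding ses_def using s(1,3) eD(1) y w by blast
qed

text \<open>The horseshoe lemma with the off-diagonal entries \<open>g k\<close> from
  \<open>W_(k+1)\<close> to \<open>Y_k\<close> made explicit. The section \<open>v\<close> of
  \<open>w\<close> need not respect boundaries; \<open>g 0\<close> repairs this modulo
  \<open>N\<close>, and the later entries continue \<open>g 0\<close> as a chain map up to
  sign.\<close>

lemma horseshoe:
  assumes n: "n \<ge> 1" and Y: "lexact n C Y" and W: "lexact n C W"
    and S: "ses C (cobj Y 0) (bd C Y) y P N w (cobj W 0) (bd C W)"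
  obtains H i j p q u where "twist n C Y W H i j p q" "qiso C (cobj H 0) (bd C H) P N u"
    "u \<cdot> i 0 = y" "eqb C W (w \<cdot> u) (q 0)"
proof -
  note cY = lexactD(2)[OF Y] and cW = lexactD(2)[OF W]
  note yx = cx[OF cY] and wx = cx[OF cW] and s = sesD[OF S]
  obtain v where v: "arr v" "dom v = cobj W 0" "cod v = P" "eqb C W (w \<cdot> v) (Id C (cobj W 0))"
    using s(12) by (auto simp: mor_iff)
  \<comment> \<open>In degree 0 the requirement is that \<open>[y, v]\<close> maps the boundaries of
    \<open>H\<close> into \<open>N\<close>; above degree 0 it is the cycle condition that yields the
    next entry.\<close>
  define Pp where "Pp k f \<longleftrightarrow> (k \<le> n \<longrightarrow> f \<in> mor C (cobj W (Suc k)) (cobj Y k) \<and>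
    (k = 0 \<longrightarrow> y \<cdot> f \<boxplus> v \<cdot> cdiff W (Suc 0) \<in> N) \<and>
    (\<forall>j. k = Suc j \<longrightarrow> k < n \<longrightarrow> cdiff Y (Suc j) \<cdot> (f \<cdot> cdiff W (Suc (Suc k))) = Zero C (cobj W (Suc (Suc k))) (cobj Y j)))"
    for k f
  define Q where "Q k f f' \<longleftrightarrow> (k < n \<longrightarrow> cdiff Y (Suc k) \<cdot> f' = neg C (f \<cdot> cdiff W (Suc (Suc k))))" for k f f'
  have "\<exists>g. \<forall>k. Pp k (g k) \<and> Q k (g k) (g (Suc k))"
  proof (rule dependent_nat_choice)
    have vd: "arr (v \<cdot> cdiff W (Suc 0))" "cod (v \<cdot> cdiff W (Suc 0)) = P" "dom (v \<cdot> cdiff W (Suc 0)) = cobj W (Suc 0)"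
      using v wx by simp_all
    have "eqb C W (w \<cdot> v \<cdot> cdiff W (Suc 0)) (Id C (cobj W 0) \<cdot> cdiff W (Suc 0))"
      by (rule eqm_comp[OF s(3) v(4)]) (use v wx s in auto)
    then have "w \<cdot> (v \<cdot> cdiff W (Suc 0)) \<in> bd C W"
      using eqm_mem[OF s(3)] cdiff_bd[OF cW] v wx s(4-9) by (metis Id_comp comp_assoc le0)
    then obtain a where a: "arr a" "dom a = cobj W (Suc 0)" "cod a = cobj Y 0"
      "eqm C N (v \<cdot> cdiff W (Suc 0)) (y \<cdot> a)"
      using s(11)[of "v \<cdot> cdiff W (Suc 0)"] vd by (auto simp: mor_iff)
    then have "y \<cdot> neg C a \<boxplus> v \<cdot> cdiff W (Suc 0) \<in> N"
      using vd s(4-9) by (simp add: eqm_def add_comm)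
    then show "\<exists>f. Pp 0 f" unfolding Pp_def using a by (intro exI[of _ "neg C a"]) (simp add: mor_iff)
  next
    fix f k assume P: "Pp k f"
    show "\<exists>g. Pp (Suc k) g \<and> Q k f g"
    proof (cases "k < n")
      case False then show ?thesis by (auto simp: Pp_def Q_def)
    next
      case kn: True
      have f: "arr f" "dom f = cobj W (Suc k)" "cod f = cobj Y k"
        using P kn by (auto simp: Pp_def mor_iff)
      let ?z = "neg C (f \<cdot> cdiff W (Suc (Suc k)))"
      have "\<exists>g\<in>mor C (cobj W (Suc (Suc k))) (cobj Y (Suc k)). ?z = cdiff Y (Suc k) \<cdot> g"
      proof (cases k)
        case 0
        let ?d = "cdiff W (Suc (Suc 0))"
        have f0: "dom f = cobj W (Suc 0)" "cod f = cobj Y 0" using f 0 by auto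
        have "(y \<cdot> f \<boxplus> v \<cdot> cdiff W (Suc 0)) \<cdot> ?d \<in> N"
          using P 0 n f(1) f0 s(4-9) wx v by (intro right_idealD(6)[OF s(2)]) (auto simp: Pp_def)
        then have "y \<cdot> (f \<cdot> ?d) \<in> N" using f(1) f0 s(4-9) wx v n by simp
        then have "f \<cdot> ?d \<in> bd C Y" using s(10)[of "f \<cdot> ?d"] f(1) f0 wx n by simp
        then have "?z \<in> bd C Y" using right_ideal_neg[OF s(1)] 0 by simp
        then obtain t where t: "arr t" "cod t = cobj Y 1" "?z = cdiff Y 1 \<cdot> t"
          by (auto simp: bd_iff)
        have "dom t = dom (cdiff Y 1 \<cdot> t)" using t(1,2) yx by simp
        also have "\<dots> = cobj W (Suc (Suc 0))" unfolding t(3)[symmetric] using f(1) f0 wx n 0 by simp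
        finally show ?thesis using t 0 by (auto simp: mor_iff)
      next
        case (Suc j)
        have "\<exists>g\<in>mor C (dom ?z) (cobj Y (Suc (Suc j))). ?z = cdiff Y (Suc (Suc j)) \<cdot> g"
        proof (rule exact0D(2)[OF lexactD(1)[OF Y]])
          have "cdiff Y (Suc j) \<cdot> (f \<cdot> cdiff W (Suc (Suc k))) = Zero C (cobj W (Suc (Suc k))) (cobj Y j)"
            using P Suc kn by (auto simp: Pp_def)
          then show "cdiff Y (Suc j) \<cdot> ?z = Zero C (dom ?z) (cobj Y j)"
            using Suc kn f yx wx by simp
        qed (use Suc kn f wx in auto)
        then show ?thesis using Suc kn f wx by simp
      qed
      then obtain g where g: "arr g" "dom g = cobj W (Suc (Suc k))" "cod g = cobj Y (Suc k)"
        "cdiff Y (Suc k) \<cdot> g = ?z" by (auto simp: mor_iff)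
      have "cdiff Y (Suc k) \<cdot> (g \<cdot> cdiff W (Suc (Suc (Suc k)))) = Zero C (cobj W (Suc (Suc (Suc k)))) (cobj Y k)"
        if "Suc k < n"
      proof -
        have "cdiff Y (Suc k) \<cdot> (g \<cdot> cdiff W (Suc (Suc (Suc k)))) = cdiff Y (Suc k) \<cdot> g \<cdot> cdiff W (Suc (Suc (Suc k)))"
          by (rule comp_assoc[symmetric]) (use that g yx wx in auto)
        also have "\<dots> = Zero C (cobj W (Suc (Suc (Suc k)))) (cobj Y k)"
          unfolding g(4) using that f wx yx by simp
        finally show ?thesis .
      qed
      then have "Pp (Suc k) g" "Q k f g" unfolding Pp_def Q_def using g by (auto simp: mor_iff)
      then show ?thesis by blast
    qed
  qed
  then obtain g where gP: "\<And>k. Pp k (g k)" and gQ: "\<And>k. Q k (g k) (g (Suc k))" by blast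
  have g: "k \<le> n \<Longrightarrow> g k \<in> Arr C" "k \<le> n \<Longrightarrow> dom (g k) = cobj W (Suc k)" "k \<le> n \<Longrightarrow> cod (g k) = cobj Y k" for k
    using gP[of k] by (auto simp: Pp_def mor_iff)
  have gd: "cdiff Y (Suc k) \<cdot> g (Suc k) = neg C (g k \<cdot> cdiff W (Suc (Suc k)))" if "k < n" for k
    using gQ[of k] that by (auto simp: Q_def)
  have "\<forall>k. \<exists>t. k \<le> Suc n \<longrightarrow> (case t of (S, i, j, p, q) \<Rightarrow> biproduct C (cobj Y k) (cobj W k) S i j p q)"
    using ex_biproduct yx(1) wx(1) by (auto split: prod.splits)
  then obtain t where t: "\<And>k. k \<le> Suc n \<Longrightarrow> (case t k of (S, i, j, p, q) \<Rightarrow> biproduct C (cobj Y k) (cobj W k) S i j p q)"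
    by metis
  define S where "S k = fst (t k)" for k
  define i where "i k = fst (snd (t k))" for k
  define j where "j k = fst (snd (snd (t k)))" for k
  define p where "p k = fst (snd (snd (snd (t k))))" for k
  define q where "q k = snd (snd (snd (snd (t k))))" for k
  have b: "biproduct C (cobj Y k) (cobj W k) (S k) (i k) (j k) (p k) (q k)" if "k \<le> Suc n" for k
    using t[OF that] by (simp add: S_def i_def j_def p_def q_def split: prod.splits)
  \<comment> \<open>The upper triangular matrix with diagonal \<open>d_Y\<close>, \<open>d_W\<close>
    and corner \<open>g\<close>; the sign in \<open>gd\<close> makes its square zero.\<close>
  define d where "d k = i k \<cdot> (cdiff Y (Suc k) \<cdot> p (Suc k) \<boxplus> g k \<cdot> q (Suc k)) \<boxplus> j k \<cdot> (cdiff W (Suc k) \<cdot> q (Suc k))" for k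
  define H where "H = \<lparr>cobj = S, cdiff = \<lambda>m. d (m - 1)\<rparr>"
  have Hs: "cobj H k = S k" "cdiff H (Suc k) = d k" for k by (simp_all add: H_def)
  have dt: "arr (d k)" "dom (d k) = S (Suc k)" "cod (d k) = S k" if "k \<le> n" for k
    using that bp[OF b[of k]] bp[OF b[of "Suc k"]] yx wx g by (simp_all add: d_def)
  have pd: "p k \<cdot> d k = cdiff Y (Suc k) \<cdot> p (Suc k) \<boxplus> g k \<cdot> q (Suc k)"
    and qd: "q k \<cdot> d k = cdiff W (Suc k) \<cdot> q (Suc k)"
    and di: "d k \<cdot> i (Suc k) = i k \<cdot> cdiff Y (Suc k)" if "k \<le> n" for k
    using that bp[OF b[of k]] bp[OF b[of "Suc k"]] yx wx g by (simp_all add: d_def)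
  have dd: "d k \<cdot> d (Suc k) = Zero C (S (Suc (Suc k))) (S k)" if k: "k < n" for k
  proof -
    note b0 = bp[OF b[of k]] and b1 = bp[OF b[of "Suc k"]] and b2 = bp[OF b[of "Suc (Suc k)"]]
    have e: "cdiff Y (Suc k) \<cdot> (g (Suc k) \<cdot> q (Suc (Suc k))) = neg C (g k \<cdot> (cdiff W (Suc (Suc k)) \<cdot> q (Suc (Suc k))))"
    proof -
      have "cdiff Y (Suc k) \<cdot> (g (Suc k) \<cdot> q (Suc (Suc k))) = cdiff Y (Suc k) \<cdot> g (Suc k) \<cdot> q (Suc (Suc k))"
        by (rule comp_assoc[symmetric]) (use k g b2 yx in auto)
      then show ?thesis unfolding gd[OF k] using k g b2 wx by simp
    qed
    have "d k \<cdot> d (Suc k) = i k \<cdot> (cdiff Y (Suc k) \<cdot> (p (Suc k) \<cdot> d (Suc k)) \<boxplus> g k \<cdot> (q (Suc k) \<cdot> d (Suc k)))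
        \<boxplus> j k \<cdot> (cdiff W (Suc k) \<cdot> (q (Suc k) \<cdot> d (Suc k)))"
      unfolding d_def[of k] using k b0 b1 dt[of "Suc k"] yx wx g by simp
    also have "\<dots> = Zero C (S (Suc (Suc k))) (S k)"
      using k pd[of "Suc k"] qd[of "Suc k"] b0 b1 b2 yx wx g e by simp
    finally show ?thesis .
  qed
  have cH: "is_complex n C H"
    unfolding is_complex_def using bp(3)[OF b] dt dd by (auto simp: H_def mor_iff)
  have f1: "chain_map n C Y H i"
    by (rule chain_mapI) (use bp[OF b] di in \<open>auto simp: Hs mor_iff\<close>)
  have f2: "chain_map n C H W q"
    by (rule chain_mapI) (use bp[OF b] qd in \<open>auto simp: Hs mor_iff\<close>)
  have T: "twist n C Y W H i j p q" unfolding twist_def using cH f1 f2 b by (simp add: Hs)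
  note b0 = bp[OF b[of 0]] and b1 = bp[OF b[of 1]]
  define u where "u = y \<cdot> p 0 \<boxplus> v \<cdot> q 0"
  have u: "arr u" "dom u = S 0" "cod u = P" using b0 s(4-9) v(1-3) by (simp_all add: u_def)
  have g0: "y \<cdot> g 0 \<boxplus> v \<cdot> cdiff W (Suc 0) \<in> N" using gP[of 0] by (auto simp: Pp_def)
  have ud: "u \<cdot> d 0 \<in> N"
  proof -
    have "u \<cdot> d 0 = y \<cdot> (p 0 \<cdot> d 0) \<boxplus> v \<cdot> (q 0 \<cdot> d 0)"
      unfolding u_def using b0 s(4-9) v(1-3) dt[of 0] by simp
    also have "\<dots> = y \<cdot> (cdiff Y (Suc 0) \<cdot> p 1) \<boxplus> (y \<cdot> g 0 \<boxplus> v \<cdot> cdiff W (Suc 0)) \<cdot> q 1"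
      using pd[of 0] qd[of 0] b1 s(4-9) v(1-3) yx wx g by simp
    also have "\<dots> \<in> N"
    proof (rule right_idealD(5)[OF s(2)])
      show "y \<cdot> (cdiff Y (Suc 0) \<cdot> p 1) \<in> N"
        using bdI[of "p 1" C Y] b1 by (intro s(13)) simp
      show "(y \<cdot> g 0 \<boxplus> v \<cdot> cdiff W (Suc 0)) \<cdot> q 1 \<in> N"
        by (rule right_idealD(6)[OF s(2) g0]) (use b1 s(4-9) v(1-3) wx g in auto)
    qed (use b1 s(4-9) v(1-3) yx wx g in auto)
    finally show ?thesis .
  qed
  have uN: "u \<cdot> x \<in> N" if "x \<in> bd C H" for x
  proof -
    from that obtain t where t: "arr t" "cod t = S 1" "x = d 0 \<cdot> t" by (auto simp: bd_iff H_def)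
    have "u \<cdot> d 0 \<cdot> t \<in> N" by (rule right_idealD(6)[OF s(2) ud]) (use t u dt[of 0] in auto)
    then show ?thesis using t u dt[of 0] by simp
  qed
  have wu: "eqb C W (w \<cdot> u) (q 0)"
  proof -
    have "eqb C W (w \<cdot> y \<cdot> p 0) (Zero C (S 0) (cobj W 0))"
      using eqm_Zero[OF s(3) right_idealD(6)[OF s(3) s(15), of "p 0"]] b0 s(4-9) by simp
    moreover have "eqb C W (w \<cdot> v \<cdot> q 0) (Id C (cobj W 0) \<cdot> q 0)"
      by (rule eqm_comp[OF s(3) v(4)]) (use b0 s(4-9) v(1-3) in auto)
    ultimately have "eqb C W (w \<cdot> y \<cdot> p 0 \<boxplus> w \<cdot> v \<cdot> q 0) (Zero C (S 0) (cobj W 0) \<boxplus> Id C (cobj W 0) \<cdot> q 0)"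
      by (rule eqm_add[OF s(3)]) (use b0 s(4-9) v(1-3) in auto)
    then show ?thesis unfolding u_def using b0 s(4-9) v(1-3) by simp
  qed
  \<comment> \<open>If \<open>u x\<close> is a relation, the \<open>W\<close> part of
    \<open>x\<close> is a boundary \<open>d_W t\<close>. After subtracting \<open>g 0 t\<close> the
    \<open>Y\<close> part is a boundary too, and one arrow into \<open>H_1\<close> accounts for
    both.\<close>
  have mono: "x \<in> bd C H" if x: "arr x" "cod x = S 0" "u \<cdot> x \<in> N" for x
  proof -
    have "w \<cdot> (u \<cdot> x) \<in> bd C W" using s(14)[OF x(3)] .
    moreover have "eqb C W (w \<cdot> u \<cdot> x) (q 0 \<cdot> x)"
      by (rule eqm_comp[OF s(3) wu]) (use u x s(4-9) in auto)
    ultimately have "q 0 \<cdot> x \<in> bd C W" using eqm_mem[OF s(3)] u x s(4-9) by simp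
    then obtain t where t: "arr t" "cod t = cobj W 1" "q 0 \<cdot> x = cdiff W 1 \<cdot> t" by (auto simp: bd_iff)
    have "dom t = dom (cdiff W 1 \<cdot> t)" using t(1,2) wx by simp
    also have "\<dots> = dom x" unfolding t(3)[symmetric] using x b0 by simp
    finally have tD: "dom t = dom x" .
    let ?g = "g 0 \<cdot> t" let ?a = "sub C (p 0 \<cdot> x) ?g"
    have ux: "u \<cdot> x = y \<cdot> ?a \<boxplus> (y \<cdot> g 0 \<boxplus> v \<cdot> cdiff W (Suc 0)) \<cdot> t"
    proof -
      have "u \<cdot> x = y \<cdot> (p 0 \<cdot> x) \<boxplus> v \<cdot> (q 0 \<cdot> x)" unfolding u_def using x b0 s(4-9) v(1-3) by simp
      also have "\<dots> = y \<cdot> ?a \<boxplus> (y \<cdot> g 0 \<boxplus> v \<cdot> cdiff W (Suc 0)) \<cdot> t"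
        unfolding t(3) using x(1,2) t(1,2) tD b0 s(4-9) v(1-3) wx g by (simp add: add_ac)
      finally show ?thesis .
    qed
    have g0t: "(y \<cdot> g 0 \<boxplus> v \<cdot> cdiff W (Suc 0)) \<cdot> t \<in> N"
      by (rule right_idealD(6)[OF s(2) g0]) (use t s(4-9) v(1-3) wx g in auto)
    have "y \<cdot> ?a = u \<cdot> x \<boxplus> neg C ((y \<cdot> g 0 \<boxplus> v \<cdot> cdiff W (Suc 0)) \<cdot> t)"
      unfolding ux using x(1,2) t(1,2) tD b0 s(4-9) v(1-3) wx g by simp
    also have "\<dots> \<in> N"
      by (rule right_idealD(5)[OF s(2) x(3) right_ideal_neg[OF s(2) g0t]])
        (use x t(1,2) tD u s(4-9) v(1-3) wx g in auto)
    finally have "?a \<in> bd C Y" using s(10)[of ?a] x(1,2) t(1,2) tD b0 wx g by simp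
    then obtain r where r: "arr r" "cod r = cobj Y 1" "?a = cdiff Y 1 \<cdot> r" by (auto simp: bd_iff)
    have "dom r = dom (cdiff Y 1 \<cdot> r)" using r(1,2) yx by simp
    also have "\<dots> = dom x" unfolding r(3)[symmetric] using x(1,2) t(1,2) tD b0 wx g by simp
    finally have rD: "dom r = dom x" .
    have px: "p 0 \<cdot> x = cdiff Y 1 \<cdot> r \<boxplus> g 0 \<cdot> t"
      using r(3) by (subst (asm) sub_eq_iff) (use x(1,2) t(1,2) r(1,2) tD rD b0 wx yx g in auto)
    have "d 0 \<cdot> (i 1 \<cdot> r \<boxplus> j 1 \<cdot> t) = i 0 \<cdot> (cdiff Y 1 \<cdot> r \<boxplus> g 0 \<cdot> t) \<boxplus> j 0 \<cdot> (cdiff W 1 \<cdot> t)"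
      unfolding d_def using x(1) t(1,2) r(1,2) tD rD b0 b1 wx yx g by simp
    also have "\<dots> = x" using bp_sum[OF b[of 0] x(1,2)] unfolding px t(3) by simp
    finally have xx: "cdiff H 1 \<cdot> (i 1 \<cdot> r \<boxplus> j 1 \<cdot> t) = x" by (simp add: H_def)
    have "cdiff H 1 \<cdot> (i 1 \<cdot> r \<boxplus> j 1 \<cdot> t) \<in> bd C H"
      by (rule bdI) (use t(1,2) r(1,2) tD rD b1 in \<open>auto simp: H_def\<close>)
    then show ?thesis unfolding xx .
  qed
  have "\<exists>u'\<in>mor C P (S 0). eqm C N (u \<cdot> u') (Id C P)"
  proof -
    \<comment> \<open>The identity is \<open>v w\<close> plus a part that \<open>w\<close> kills and
      that therefore factors through \<open>y\<close>; this gives the section of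
      \<open>u\<close>.\<close>
    let ?x = "sub C (Id C P) (v \<cdot> w)"
    have xt: "arr ?x" "cod ?x = P" "dom ?x = P" using v(1-3) s(4-9,16-18) by simp_all
    have "eqb C W (w \<cdot> v \<cdot> w) (Id C (cobj W 0) \<cdot> w)"
      by (rule eqm_comp[OF s(3) v(4)]) (use s(4-9) v(1-3) in auto)
    then have "eqb C W w (w \<cdot> (v \<cdot> w))" using eqm_sym[OF s(3)] s(4-9) v(1-3) by simp
    then have "w \<cdot> ?x \<in> bd C W" using s(4-9,16-18) v(1-3) by (simp add: eqm_def)
    then obtain a where a: "arr a" "dom a = P" "cod a = cobj Y 0" "eqm C N ?x (y \<cdot> a)"
      using s(11)[OF xt(1,2)] xt(3) by (auto simp: mor_iff)
    let ?u = "i 0 \<cdot> a \<boxplus> j 0 \<cdot> w"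
    have ut: "arr ?u" "dom ?u = P" "cod ?u = S 0" using a(1-3) b0 s(4-9) by simp_all
    have e: "u \<cdot> ?u = y \<cdot> a \<boxplus> v \<cdot> w" unfolding u_def using a(1-3) b0 s(4-9,16-18) v(1-3) by simp
    have "eqm C N (y \<cdot> a \<boxplus> v \<cdot> w) (?x \<boxplus> v \<cdot> w)"
      by (rule eqm_add[OF s(2) eqm_sym[OF s(2) a(4)] eqm_refl[OF s(2)]]) (use a(1-3) s(4-9) v(1-3) in auto)
    then have "eqm C N (u \<cdot> ?u) (Id C P)" unfolding e using s(4-9,16-18) v(1-3) by simp
    then show ?thesis using ut by (auto simp: mor_iff)
  qed
  then have "qiso C (cobj H 0) (bd C H) P N u"
    unfolding qiso_def using right_ideal_bd[OF cH] s(2) u uN mono by (auto simp: Hs mor_iff)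
  moreover have "u \<cdot> i 0 = y" unfolding u_def using b0 s(4-9) v(1-3) by simp
  ultimately show ?thesis using that T wu by blast
qed

text \<open>Exactness of the transpose. The middle complex is replaced by the degreewise split
  extension from \<open>horseshoe\<close>; reversal keeps it degreewise split, so
  \<open>twist_ses\<close> applies in the opposite category, and \<open>chain_top\<close> identifies
  the maps.\<close>

lemma ses_dual:
  assumes n: "n \<ge> 1" and Y: "n_exact n C Y" and X: "n_exact n C X" and W: "n_exact n C W"
    and S: "cses C Y (\<phi> 0) X (\<psi> 0) W"
    and f: "chain_map n C Y X \<phi>" and g: "chain_map n C X W \<psi>"
  shows "ses Cop (cobj W (Suc n)) (bd Cop (op_cplx n W)) (\<psi> (Suc n))
    (cobj X (Suc n)) (bd Cop (op_cplx n X)) (\<phi> (Suc n))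
    (cobj Y (Suc n)) (bd Cop (op_cplx n Y))"
proof -
  interpret op: additive_category "op_cat C" by (rule op_additive)
  have L: "lexact n C Y" "lexact n C X" "lexact n C W" and
    L': "lexact n Cop (op_cplx n Y)" "lexact n Cop (op_cplx n X)" "lexact n Cop (op_cplx n W)"
    using Y X W n_exact_lexact by auto
  note cY = lexactD(2)[OF L(1)] and cX = lexactD(2)[OF L(2)] and cW = lexactD(2)[OF L(3)]
  obtain H i j p q u where T: "twist n C Y W H i j p q" and u: "cqiso C H X u"
    and ui: "u \<cdot> i 0 = \<phi> 0" and wu: "eqb C W (\<psi> 0 \<cdot> u) (q 0)"
    by (rule horseshoe[OF n L(1,3) S])
  have H: "n_exact n C H" by (rule twist_n_exact[OF T Y W])
  have fi: "chain_map n C Y H i" and fq: "chain_map n C H W q" and cH: "is_complex n C H"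
    using T by (auto simp: twist_def)
  obtain \<eta> where e: "chain_map n C H X \<eta>" "\<eta> 0 = u" using qiso_lift[OF cH lexactD(1)[OF L(2)] u] .
  have 1: "ses Cop (cobj W (Suc n)) (bd Cop (op_cplx n W)) (q (Suc n))
    (cobj H (Suc n)) (bd Cop (op_cplx n H)) (i (Suc n))
    (cobj Y (Suc n)) (bd Cop (op_cplx n Y))"
    using op.twist_ses[OF twist_op[OF T] L'(3,1) n] by (simp add: op_cplx_def)
  have 2: "qiso Cop (cobj X (Suc n)) (bd Cop (op_cplx n X))
    (cobj H (Suc n)) (bd Cop (op_cplx n H)) (\<eta> (Suc n))"
    by (rule qiso_op[OF H X e(1)]) (simp add: e(2) u)
  have "eqb C X (u \<cdot> i 0) (\<phi> 0)" unfolding ui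
    using eqm_refl[OF right_ideal_bd[OF cX]] cm[OF f] by simp
  then have 3: "eqb Cop (op_cplx n Y) (\<eta> (Suc n) \<cdot> i (Suc n)) (\<phi> (Suc n))"
    using chain_top[OF cY L(2) chain_map_comp[OF fi e(1) cY cH cX] f] e(2) by simp
  have 4: "eqb Cop (op_cplx n H) (\<psi> (Suc n) \<cdot> \<eta> (Suc n)) (q (Suc n))"
    using chain_top[OF cH L(3) chain_map_comp[OF e(1) g cH cX cW] fq] e(2) wu by simp
  show ?thesis
    by (rule op.ses_qiso[OF 1 2]) (use cm[OF f] cm[OF g] 3 4 in \<open>auto simp: mor_iff\<close>)
qed

end

section \<open>Changing the presentation of an exact sequence\<close>

text \<open>The image of \<open>C(-, e)\<close>. It plays for a single arrow, not yet part of a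
  complex, the role that \<open>bd\<close> plays for a complex.\<close>

definition ran :: "('o, 'm) cat \<Rightarrow> 'm \<Rightarrow> 'm set" where
  "ran C e = {e \<cdot>\<^bsub>C\<^esub> t | t. t \<in> Arr C \<and> Cod C t = Dom C e}"

context additive_category begin

lemma ran_iff: "a \<in> ran C e \<longleftrightarrow> (\<exists>t. t \<in> Arr C \<and> cod t = dom e \<and> a = e \<cdot> t)"
  unfolding ran_def by blast

lemma bd_ran: "is_complex n C X \<Longrightarrow> bd C X = ran C (cdiff X 1)"
  using cx[of n X] by (auto simp: bd_def ran_def)

lemma right_ideal_ran:
  assumes "arr e"
  shows "right_ideal C (cod e) (ran C e)"
proof -
  have "Zero C A (cod e) \<in> ran C e" if "obj A" for A
    unfolding ran_iff by (rule exI[of _ "Zero C A (dom e)"]) (use that assms in simp)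
  moreover have "a \<boxplus> b \<in> ran C e" if ab: "a \<in> ran C e" "b \<in> ran C e" and D: "dom a = dom b" for a b
  proof -
    obtain s t where "arr s" "cod s = dom e" "a = e \<cdot> s"
      "arr t" "cod t = dom e" "b = e \<cdot> t"
      using ab unfolding ran_iff by blast
    then show ?thesis
      unfolding ran_iff using assms D by (intro exI[of _ "s \<boxplus> t"]) simp
  qed
  moreover have "a \<cdot> h \<in> ran C e" if a: "a \<in> ran C e" and h: "arr h" "cod h = dom a" for a h
  proof -
    obtain s where "arr s" "cod s = dom e" "a = e \<cdot> s"
      using a unfolding ran_iff by blast
    then show ?thesis
      unfolding ran_iff using assms h by (intro exI[of _ "s \<cdot> h"]) simp
  qed
  moreover have "\<forall>a\<in>ran C e. a \<in> Arr C \<and> cod a = cod e"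
    using assms by (auto simp: ran_iff)
  ultimately show ?thesis
    unfolding right_ideal_def using assms by auto
qed

lemma ranE:
  assumes "a \<in> ran C e" "arr e"
  obtains t where "arr t" "dom t = dom a" "cod t = dom e" "a = e \<cdot> t"
  using assms by (auto simp: ran_iff)

text \<open>
  The low-degree part \<open>X\<^sub>2 \<oplus> Y\<^sub>1 \<rightarrow> X\<^sub>1 \<oplus> Y\<^sub>0 \<rightarrow> X\<^sub>0\<close> of the mapping cone of \<open>Y \<rightarrow> X\<close> is
  contractible. The resulting idempotent of \<open>X\<^sub>2 \<oplus> Y\<^sub>1\<close> splits off the second term of the
  sequence starting with \<open>e : Y\<^sub>1 \<rightarrow> Y\<^sub>0\<close>; from degree \<open>3\<close> on the sequence is \<open>X\<close>.
\<close>

lemma cone_idempotent: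
  assumes X: "exact0 n C X" and n: "n \<ge> 1" and e: "e \<in> mor C Y1 Y0"
    and u: "qiso C Y0 (ran C e) (cobj X 0) (bd C X) u"
    and u1: "u1 \<in> mor C Y1 (cobj X 1)" "cdiff X 1 \<cdot> u1 = u \<cdot> e"
    and S: "biproduct C (cobj X 2) Y1 S i1 i2 p1 p2"
  obtains \<pi> where "\<pi> \<in> mor C S S"
    "\<And>k. k \<in> Arr C \<Longrightarrow> cod k = S \<Longrightarrow>
       cdiff X 2 \<cdot> (p1 \<cdot> k) \<boxplus> u1 \<cdot> (p2 \<cdot> k) = Zero C (dom k) (cobj X 1) \<Longrightarrow>
       e \<cdot> (p2 \<cdot> k) = Zero C (dom k) Y0 \<Longrightarrow> \<pi> \<cdot> k = k"
    "cdiff X 2 \<cdot> (p1 \<cdot> \<pi>) \<boxplus> u1 \<cdot> (p2 \<cdot> \<pi>) = Zero C S (cobj X 1)"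
    "e \<cdot> (p2 \<cdot> \<pi>) = Zero C S Y0"
proof -
  note x = cx[OF exact0D(1)[OF X]] and uD = qisoD[OF u] and b = bp[OF S]
  have et: "arr e" "dom e = Y1" "cod e = Y0" "obj Y0" "obj Y1" using e by (auto simp: mor_iff)
  have u1t: "arr u1" "dom u1 = Y1" "cod u1 = cobj X 1" using u1 by (auto simp: mor_iff)
  let ?d = "cdiff X (Suc 0)" and ?d2 = "cdiff X (Suc (Suc 0))"
  have d: "arr ?d" "dom ?d = cobj X 1" "cod ?d = cobj X 0"
    and d2: "arr ?d2" "dom ?d2 = cobj X 2" "cod ?d2 = cobj X 1"
    and dd: "?d \<cdot> ?d2 = Zero C (cobj X 2) (cobj X 0)" using x n by (simp_all add: numeral_2_eq_2)
  have dd': "?d \<cdot> (?d2 \<cdot> h) = Zero C (dom h) (cobj X 0)" if "arr h" "cod h = cobj X 2" for h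
    using that x(6)[of 0 h] n by (simp add: numeral_2_eq_2)
  have u1e: "?d \<cdot> u1 = u \<cdot> e" using u1(2) by simp
  have u1e': "?d \<cdot> (u1 \<cdot> h) = u \<cdot> (e \<cdot> h)" if "arr h" "cod h = Y1" for h
    using that comp_assoc[of h u1 ?d] comp_assoc[of h e u] u1t d et uD(3-5) u1e by simp
  note ty = et u1t d d2 uD(3-5)
  obtain v where v: "arr v" "dom v = cobj X 0" "cod v = Y0" "eqb C X (u \<cdot> v) (Id C (cobj X 0))"
    using u by (auto simp: qiso_def mor_iff)
  obtain t' where t': "arr t'" "cod t' = cobj X 1" "sub C (u \<cdot> v) (Id C (cobj X 0)) = ?d \<cdot> t'"
    using eqmD(5)[OF v(4)] by (auto simp: bd_iff)
  have "dom t' = dom (?d \<cdot> t')" using t'(1,2) d by simp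
  also have "\<dots> = cobj X 0" unfolding t'(3)[symmetric] using v ty x by simp
  finally have t'D: "dom t' = cobj X 0" .
  define t where "t = neg C t'"
  have t: "arr t" "dom t = cobj X 0" "cod t = cobj X 1" using t' t'D by (simp_all add: t_def)
  have uv: "u \<cdot> v = Id C (cobj X 0) \<boxplus> neg C (?d \<cdot> t)"
    using t'(3) by (subst (asm) sub_eq_iff) (use t' t'D d v ty x in \<open>simp_all add: t_def add_comm\<close>)
  have uv': "u \<cdot> (v \<cdot> h) = h \<boxplus> neg C (?d \<cdot> (t \<cdot> h))" if "arr h" "cod h = cobj X 0" for h
  proof -
    have "u \<cdot> (v \<cdot> h) = u \<cdot> v \<cdot> h" using that v ty by simp
    then show ?thesis unfolding uv using that d t x by simp
  qed
  \<comment> \<open>Cycles of the cone in \<open>X_1 + Y_0\<close> are boundaries: \<open>u\<close>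
    reflects relations, so \<open>c = e r\<close>, and then \<open>a + u1 r\<close> is a cycle of
    \<open>X\<close>.\<close>
  have ex: "\<exists>s\<in>mor C (dom a) S. ?d2 \<cdot> (p1 \<cdot> s) \<boxplus> u1 \<cdot> (p2 \<cdot> s) = a \<and> neg C (e \<cdot> (p2 \<cdot> s)) = c"
    if a: "arr a" "cod a = cobj X 1" and c: "arr c" "cod c = Y0" "dom c = dom a"
      and z: "?d \<cdot> a \<boxplus> u \<cdot> c = Zero C (dom a) (cobj X 0)" for a c
  proof -
    have "u \<cdot> c = neg C (?d \<cdot> a)" by (rule neg_unique) (use z a c ty in simp_all)
    also have "\<dots> \<in> bd C X" using right_ideal_neg[OF uD(2) bdI[of a C X]] a by simp
    finally have "c \<in> ran C e" using uD(7)[of c] c by simp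
    then obtain r where r: "arr r" "dom r = dom a" "cod r = Y1" "c = e \<cdot> r"
      by (rule ranE) (use et c in auto)
    let ?a = "a \<boxplus> u1 \<cdot> r"
    have "?d \<cdot> ?a = Zero C (dom ?a) (cobj X 0)" using z r(1-3) a ty u1e'[of r] unfolding r(4) by simp
    then have "\<exists>t\<in>mor C (dom ?a) (cobj X (Suc (Suc 0))). ?a = ?d2 \<cdot> t"
      by (intro exact0D(2)[OF X]) (use n r(1-3) a ty in simp_all)
    then obtain w where w: "arr w" "dom w = dom a" "cod w = cobj X 2" "?a = ?d2 \<cdot> w"
      using r(1-3) a ty by (auto simp: mor_iff numeral_2_eq_2)
    let ?s = "sub C (i1 \<cdot> w) (i2 \<cdot> r)"
    have "?d2 \<cdot> (p1 \<cdot> ?s) \<boxplus> u1 \<cdot> (p2 \<cdot> ?s) = ?d2 \<cdot> w \<boxplus> neg C (u1 \<cdot> r)"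
      using w(1-3) r(1-3) a b ty by simp
    also have "\<dots> = a" unfolding w(4)[symmetric] using r(1-3) a ty by simp
    finally have 1: "?d2 \<cdot> (p1 \<cdot> ?s) \<boxplus> u1 \<cdot> (p2 \<cdot> ?s) = a" .
    have 2: "neg C (e \<cdot> (p2 \<cdot> ?s)) = c" unfolding r(4) using w(1-3) r(1-3) a b ty by simp
    show ?thesis using 1 2 w(1-3) r(1-3) b by (intro bexI[of _ ?s]) (auto simp: mor_iff)
  qed
  \<comment> \<open>The pair \<open>(t, v)\<close> contracts the cone at \<open>X_0\<close>. The two
    columns of the identity of \<open>X_1 + Y_0\<close> minus this contraction are cycles, and their
    lifts \<open>s1\<close>, \<open>s2\<close> form the next stage of the contraction.\<close>
  let ?a1 = "sub C (Id C (cobj X 1)) (t \<cdot> ?d)" and ?c1 = "neg C (v \<cdot> ?d)"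
  have "\<exists>s\<in>mor C (dom ?a1) S. ?d2 \<cdot> (p1 \<cdot> s) \<boxplus> u1 \<cdot> (p2 \<cdot> s) = ?a1 \<and> neg C (e \<cdot> (p2 \<cdot> s)) = ?c1"
    by (rule ex) (use t v(1-3) ty x uv' in simp_all)
  then obtain s1 where s1: "arr s1" "dom s1 = cobj X 1" "cod s1 = S"
    "?d2 \<cdot> (p1 \<cdot> s1) \<boxplus> u1 \<cdot> (p2 \<cdot> s1) = ?a1" "neg C (e \<cdot> (p2 \<cdot> s1)) = ?c1"
    using t v(1-3) ty x by (auto simp: mor_iff)
  let ?a2 = "neg C (t \<cdot> u)" and ?c2 = "sub C (Id C Y0) (v \<cdot> u)"
  have "\<exists>s\<in>mor C (dom ?a2) S. ?d2 \<cdot> (p1 \<cdot> s) \<boxplus> u1 \<cdot> (p2 \<cdot> s) = ?a2 \<and> neg C (e \<cdot> (p2 \<cdot> s)) = ?c2"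
    by (rule ex) (use t v(1-3) ty x uv' in simp_all)
  then obtain s2 where s2: "arr s2" "dom s2 = Y0" "cod s2 = S"
    "?d2 \<cdot> (p1 \<cdot> s2) \<boxplus> u1 \<cdot> (p2 \<cdot> s2) = ?a2" "neg C (e \<cdot> (p2 \<cdot> s2)) = ?c2"
    using t v(1-3) ty x by (auto simp: mor_iff)
  define f1 where "f1 = ?d2 \<cdot> p1 \<boxplus> u1 \<cdot> p2"
  define f2 where "f2 = neg C (e \<cdot> p2)"
  have f: "arr f1" "dom f1 = S" "cod f1 = cobj X 1" "arr f2" "dom f2 = S" "cod f2 = Y0"
    unfolding f1_def f2_def using b ty by simp_all
  have f1h: "f1 \<cdot> h = ?d2 \<cdot> (p1 \<cdot> h) \<boxplus> u1 \<cdot> (p2 \<cdot> h)" if "arr h" "cod h = S" for h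
    unfolding f1_def using that b ty by simp
  have f2h: "f2 \<cdot> h = neg C (e \<cdot> (p2 \<cdot> h))" if "arr h" "cod h = S" for h
    unfolding f2_def using that b ty by simp
  have fs: "f1 \<cdot> s1 = ?a1" "f1 \<cdot> s2 = ?a2" "f2 \<cdot> s1 = ?c1" "f2 \<cdot> s2 = ?c2"
    using s1 s2 f1h f2h by auto
  have fs': "f1 \<cdot> (s1 \<cdot> f1) = ?a1 \<cdot> f1" "f1 \<cdot> (s2 \<cdot> f2) = ?a2 \<cdot> f2"
     "f2 \<cdot> (s1 \<cdot> f1) = ?c1 \<cdot> f1" "f2 \<cdot> (s2 \<cdot> f2) = ?c2 \<cdot> f2"
    unfolding fs[symmetric] using f s1(1-3) s2(1-3) by simp_all
  have df: "?d \<cdot> f1 = neg C (u \<cdot> f2)"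
    unfolding f1_def f2_def using b ty dd'[of p1] u1e'[of p2] by simp
  \<comment> \<open>With \<open>f = (f1, f2)\<close> the differential of the cone and
    \<open>s = [s1, s2]\<close>, this is \<open>1 - s f\<close>: it fixes every arrow killed by
    \<open>f\<close> and is itself killed by \<open>f\<close>.\<close>
  define \<pi> where "\<pi> = Id C S \<boxplus> (neg C (s1 \<cdot> f1) \<boxplus> neg C (s2 \<cdot> f2))"
  have p: "\<pi> \<in> Arr C" "dom \<pi> = S" "cod \<pi> = S" unfolding \<pi>_def using f s1(1-3) s2(1-3) b by simp_all
  have "f1 \<cdot> \<pi> = f1 \<boxplus> (neg C (?a1 \<cdot> f1) \<boxplus> neg C (?a2 \<cdot> f2))"
    unfolding \<pi>_def using f s1(1-3) s2(1-3) b fs' by simp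
  also have "\<dots> = t \<cdot> (?d \<cdot> f1) \<boxplus> t \<cdot> (u \<cdot> f2)"
    using f t ty x by simp
  also have "\<dots> = Zero C S (cobj X 1)" unfolding df using f t ty x by simp
  finally have 1: "f1 \<cdot> \<pi> = Zero C S (cobj X 1)" .
  have "f2 \<cdot> \<pi> = f2 \<boxplus> (neg C (?c1 \<cdot> f1) \<boxplus> neg C (?c2 \<cdot> f2))"
    unfolding \<pi>_def using f s1(1-3) s2(1-3) b fs' by simp
  also have "\<dots> = v \<cdot> (?d \<cdot> f1) \<boxplus> v \<cdot> (u \<cdot> f2)"
    using f v(1-3) ty x by (simp add: add_left_comm)
  also have "\<dots> = Zero C S Y0" unfolding df using f v(1-3) ty x by simp
  finally have 2: "f2 \<cdot> \<pi> = Zero C S Y0" .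
  have "\<pi> \<cdot> k = k" if k: "arr k" "cod k = S"
      "?d2 \<cdot> (p1 \<cdot> k) \<boxplus> u1 \<cdot> (p2 \<cdot> k) = Zero C (dom k) (cobj X 1)"
      "e \<cdot> (p2 \<cdot> k) = Zero C (dom k) Y0" for k
  proof -
    have "f1 \<cdot> k = Zero C (dom k) (cobj X 1)" using f1h[of k] k by simp
    moreover have "f2 \<cdot> k = Zero C (dom k) Y0" using f2h[of k] k et by simp
    ultimately show ?thesis unfolding \<pi>_def using k(1,2) f s1(1-3) s2(1-3) b by simp
  qed
  moreover have "?d2 \<cdot> (p1 \<cdot> \<pi>) \<boxplus> u1 \<cdot> (p2 \<cdot> \<pi>) = Zero C S (cobj X 1)" using 1 f1h[of \<pi>] p by simp
  moreover have "e \<cdot> (p2 \<cdot> \<pi>) = Zero C S Y0"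
  proof -
    have "neg C (neg C (e \<cdot> (p2 \<cdot> \<pi>))) = neg C (Zero C S Y0)" using 2 f2h[of \<pi>] p by simp
    then show ?thesis using p b ty by simp
  qed
  ultimately show ?thesis using that[of \<pi>] p by (simp add: mor_iff numeral_2_eq_2)
qed

text \<open>Coexactness is decided by the module, so only a left exact sequence ending in
  \<open>e\<close> has to be produced. The kernel of \<open>X_2 + Y_1 -> X_1 + Y_0\<close> is the
  summand \<open>B\<close> split off by the idempotent of the cone; it becomes the term of degree
  2.\<close>

lemma change_presentation:
  assumes ic: "idempotent_complete C" and n: "n \<ge> 1" and X: "n_exact n C X" and e: "e \<in> mor C Y1 Y0"
    and u: "qiso C Y0 (ran C e) (cobj X 0) (bd C X) u"
  obtains Y where "n_exact n C Y" "cdiff Y 1 = e" "cobj Y 0 = Y0" "cobj Y 1 = Y1" "bd C Y = ran C e"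
proof -
  have L: "lexact n C X" and co: "coexact n C X" using X n_exact_iff by auto
  note E = lexactD(1)[OF L] and cX = lexactD(2)[OF L]
  note x = cx[OF cX] and uD = qisoD[OF u]
  have et: "arr e" "dom e = Y1" "cod e = Y0" "obj Y0" "obj Y1" using e by (auto simp: mor_iff)
  have "e \<in> ran C e" unfolding ran_iff using et by (intro exI[of _ "Id C Y1"]) simp
  then obtain u1 where u1: "arr u1" "cod u1 = cobj X 1" "u \<cdot> e = cdiff X 1 \<cdot> u1"
    using uD(6)[of e] by (auto simp: bd_iff)
  have "dom u1 = dom (cdiff X 1 \<cdot> u1)" using u1(1,2) x by simp
  also have "\<dots> = Y1" unfolding u1(3)[symmetric] using et uD(3-5) by simp
  finally have u1D: "dom u1 = Y1" .
  obtain S i1 i2 p1 p2 where S: "biproduct C (cobj X 2) Y1 S i1 i2 p1 p2"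
    using ex_biproduct[of "cobj X 2" Y1] x n et by (metis Suc_1 Suc_le_mono One_nat_def)
  let ?d2 = "cdiff X (Suc (Suc 0))" and ?d3 = "cdiff X (Suc (Suc (Suc 0)))"
  note b = bp[OF S[unfolded numeral_2_eq_2]]
  obtain \<pi> where p: "\<pi> \<in> mor C S S" and
    pk: "\<And>k. k \<in> Arr C \<Longrightarrow> cod k = S \<Longrightarrow>
       ?d2 \<cdot> (p1 \<cdot> k) \<boxplus> u1 \<cdot> (p2 \<cdot> k) = Zero C (dom k) (cobj X 1) \<Longrightarrow>
       e \<cdot> (p2 \<cdot> k) = Zero C (dom k) Y0 \<Longrightarrow> \<pi> \<cdot> k = k"
    and p1: "?d2 \<cdot> (p1 \<cdot> \<pi>) \<boxplus> u1 \<cdot> (p2 \<cdot> \<pi>) = Zero C S (cobj X 1)"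
    and p2: "e \<cdot> (p2 \<cdot> \<pi>) = Zero C S Y0"
    using cone_idempotent[OF E n e u _ u1(3)[symmetric] S] u1 u1D by (auto simp: mor_iff numeral_2_eq_2)
  have pt: "\<pi> \<in> Arr C" "dom \<pi> = S" "cod \<pi> = S" using p by (auto simp: mor_iff)
  \<comment> \<open>\<open>\<pi>\<close> is killed by the differential of the cone, so it is one of
    the arrows that it fixes.\<close>
  have "\<pi> \<cdot> \<pi> = \<pi>" by (rule pk) (use pt p1 p2 in auto)
  then have "\<exists>B\<in>Obj C. \<exists>r\<in>mor C S B. \<exists>m\<in>mor C B S. r \<cdot> m = Id C B \<and> m \<cdot> r = \<pi>"
    using ic p b(3) unfolding idempotent_complete_def by blast
  then obtain B r m where B: "obj B" and rm0: "r \<in> mor C S B" "m \<in> mor C B S"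
    and rm: "r \<cdot> m = Id C B" and mr: "m \<cdot> r = \<pi>" by blast
  have r: "arr r" "dom r = S" "cod r = B" and m: "arr m" "dom m = B" "cod m = S"
    using rm0 by (auto simp: mor_iff)
  have rm': "r \<cdot> (m \<cdot> h) = h" if "arr h" "cod h = B" for h
    using comp_assoc[of h m r] that r m rm by simp
  have mrk: "m \<cdot> (r \<cdot> k) = k" if "arr k" "cod k = S"
       "?d2 \<cdot> (p1 \<cdot> k) \<boxplus> u1 \<cdot> (p2 \<cdot> k) = Zero C (dom k) (cobj X 1)"
       "e \<cdot> (p2 \<cdot> k) = Zero C (dom k) Y0" for k
    using pk[OF that] comp_assoc[of k r m] that(1,2) r m unfolding mr by simp
  have d2: "arr ?d2" "dom ?d2 = cobj X (Suc (Suc 0))" "cod ?d2 = cobj X (Suc 0)" using x n by simp_all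
  note ty = et u1(1,2) u1D b(1-15) r m d2
  have pm: "\<pi> \<cdot> m = m" unfolding mr[symmetric] using r m rm by simp
  have m1: "?d2 \<cdot> (p1 \<cdot> m) \<boxplus> u1 \<cdot> (p2 \<cdot> m) = Zero C B (cobj X (Suc 0))"
  proof -
    have "?d2 \<cdot> (p1 \<cdot> m) \<boxplus> u1 \<cdot> (p2 \<cdot> m) = (?d2 \<cdot> (p1 \<cdot> \<pi>) \<boxplus> u1 \<cdot> (p2 \<cdot> \<pi>)) \<cdot> m"
      using ty pt pm by simp
    then show ?thesis unfolding p1 using ty x by simp
  qed
  have m2: "e \<cdot> (p2 \<cdot> m) = Zero C B Y0"
  proof -
    have "e \<cdot> (p2 \<cdot> m) = (e \<cdot> (p2 \<cdot> \<pi>)) \<cdot> m" using ty pt pm by simp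
    then show ?thesis unfolding p2 using ty by simp
  qed
  have m2': "e \<cdot> (p2 \<cdot> (m \<cdot> h)) = Zero C (dom h) Y0" if "arr h" "cod h = B" for h
  proof -
    have "e \<cdot> (p2 \<cdot> (m \<cdot> h)) = (e \<cdot> (p2 \<cdot> m)) \<cdot> h" using ty that by simp
    then show ?thesis unfolding m2 using ty that by simp
  qed
  have d3: "arr ?d3" "dom ?d3 = cobj X (Suc (Suc (Suc 0)))" "cod ?d3 = cobj X (Suc (Suc 0))"
     "?d2 \<cdot> ?d3 = Zero C (cobj X (Suc (Suc (Suc 0)))) (cobj X (Suc 0))"
     "\<And>h. h \<in> Arr C \<Longrightarrow> cod h = cobj X (Suc (Suc (Suc 0))) \<Longrightarrow> ?d2 \<cdot> (?d3 \<cdot> h) = Zero C (dom h) (cobj X (Suc 0))"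
     if "n \<ge> 2" using x that by simp_all
  have i3: "m \<cdot> (r \<cdot> (i1 \<cdot> (?d3 \<cdot> h))) = i1 \<cdot> (?d3 \<cdot> h)"
    if "n \<ge> 2" "arr h" "cod h = cobj X (Suc (Suc (Suc 0)))" for h
    by (rule mrk) (use that d3 ty b x in simp_all)
  have i3': "m \<cdot> (r \<cdot> (i1 \<cdot> ?d3)) = i1 \<cdot> ?d3" if "n \<ge> 2"
    by (rule mrk) (use that d3 ty b x in simp_all)
  \<comment> \<open>\<open>p2 m\<close> is the \<open>Y_1\<close> part of the inclusion of
    \<open>B\<close>. The old \<open>d_3\<close> followed by \<open>i1\<close> lands in this kernel,
    and \<open>r\<close> retracts it to \<open>B\<close>.\<close>
  define Y where "Y = \<lparr>cobj = (\<lambda>k. if k = 0 then Y0 else if k = Suc 0 then Y1 else if k = Suc (Suc 0) then B else cobj X k),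
    cdiff = (\<lambda>k. if k = Suc 0 then e else if k = Suc (Suc 0) then p2 \<cdot> m else if k = Suc (Suc (Suc 0)) then r \<cdot> (i1 \<cdot> ?d3)
      else cdiff X k)\<rparr>"
  have Y[simp]: "cobj Y 0 = Y0" "cobj Y (Suc 0) = Y1" "cobj Y (Suc (Suc 0)) = B"
    "cobj Y (Suc (Suc (Suc k))) = cobj X (Suc (Suc (Suc k)))"
    "cdiff Y (Suc 0) = e" "cdiff Y (Suc (Suc 0)) = p2 \<cdot> m" "cdiff Y (Suc (Suc (Suc 0))) = r \<cdot> (i1 \<cdot> ?d3)"
    "cdiff Y (Suc (Suc (Suc (Suc k)))) = cdiff X (Suc (Suc (Suc (Suc k))))" for k
    by (simp_all add: Y_def)
  \<comment> \<open>The four patterns of the new complex: the indices 0, 1, 2 and all later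
    ones.\<close>
  have cases4: "P i" if "P 0" "P (Suc 0)" "P (Suc (Suc 0))" "\<And>k. P (Suc (Suc (Suc k)))" for i :: nat and P
    using that by (metis nat.exhaust)
  have cY: "is_complex n C Y"
    unfolding is_complex_def
  proof (intro conjI allI)
    fix i show "i \<le> n + 1 \<longrightarrow> cobj Y i \<in> Obj C" by (rule cases4[of _ i]) (use ty B x in auto)
  next
    fix i show "i \<le> n \<longrightarrow> cdiff Y (i + 1) \<in> mor C (cobj Y (i + 1)) (cobj Y i)"
      by (rule cases4[of _ i]) (use ty d3 x in \<open>auto simp: mor_iff\<close>)
  next
    fix i show "i < n \<longrightarrow> cdiff Y (i + 1) \<cdot> cdiff Y (i + 2) = Zero C (cobj Y (i + 2)) (cobj Y i)"
    proof (rule cases4[of _ i]; intro impI)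
      assume "0 < n"
      then show "cdiff Y (0 + 1) \<cdot> cdiff Y (0 + 2) = Zero C (cobj Y (0 + 2)) (cobj Y 0)"
        using m2 by (simp add: numeral_2_eq_2)
    next
      assume "Suc 0 < n"
      then show "cdiff Y (Suc 0 + 1) \<cdot> cdiff Y (Suc 0 + 2) = Zero C (cobj Y (Suc 0 + 2)) (cobj Y (Suc 0))"
        using i3' d3 ty b by (simp add: numeral_2_eq_2)
    next
      assume "Suc (Suc 0) < n"
      then show "cdiff Y (Suc (Suc 0) + 1) \<cdot> cdiff Y (Suc (Suc 0) + 2) =
          Zero C (cobj Y (Suc (Suc 0) + 2)) (cobj Y (Suc (Suc 0)))"
        using d3 ty b x by (simp add: numeral_2_eq_2)
    next
      fix k assume "Suc (Suc (Suc k)) < n"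
      then show "cdiff Y (Suc (Suc (Suc k)) + 1) \<cdot> cdiff Y (Suc (Suc (Suc k)) + 2) =
          Zero C (cobj Y (Suc (Suc (Suc k)) + 2)) (cobj Y (Suc (Suc (Suc k))))"
        using x by simp
    qed
  qed
  have low: "m \<cdot> h = i1 \<cdot> (p1 \<cdot> (m \<cdot> h)) \<and> ?d2 \<cdot> (p1 \<cdot> (m \<cdot> h)) = Zero C (dom h) (cobj X (Suc 0))"
    if h: "arr h" "cod h = B" "p2 \<cdot> (m \<cdot> h) = Zero C (dom h) Y1" for h
  proof
    show "m \<cdot> h = i1 \<cdot> (p1 \<cdot> (m \<cdot> h))"
      using bp_sum[OF S, of "m \<cdot> h"] h ty by simp
    have "(?d2 \<cdot> (p1 \<cdot> m) \<boxplus> u1 \<cdot> (p2 \<cdot> m)) \<cdot> h = ?d2 \<cdot> (p1 \<cdot> (m \<cdot> h)) \<boxplus> u1 \<cdot> (p2 \<cdot> (m \<cdot> h))"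
      using h(1,2) ty by simp
    also have "\<dots> = ?d2 \<cdot> (p1 \<cdot> (m \<cdot> h))" unfolding h(3) using h(1,2) ty by simp
    finally show "?d2 \<cdot> (p1 \<cdot> (m \<cdot> h)) = Zero C (dom h) (cobj X (Suc 0))"
      unfolding m1 using h(1,2) ty x by simp
  qed
  have zero_i: "c = Zero C (dom c) (cobj X (Suc (Suc 0)))"
    if "arr c" "cod c = cobj X (Suc (Suc 0))" "i1 \<cdot> c = Zero C (dom c) S" for c
  proof -
    have "c = p1 \<cdot> (i1 \<cdot> c)" using that(1,2) b by simp
    then show ?thesis unfolding that(3) using that(1,2) ty by simp
  qed
  have r3: "?d3 \<cdot> h = Zero C (dom h) (cobj X (Suc (Suc 0)))"
    if h: "n \<ge> 2" "arr h" "cod h = cobj X (Suc (Suc (Suc 0)))" "r \<cdot> (i1 \<cdot> ?d3) \<cdot> h = Zero C (dom h) B" for h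
  proof -
    have "i1 \<cdot> (?d3 \<cdot> h) = m \<cdot> (r \<cdot> (i1 \<cdot> ?d3) \<cdot> h)" using i3[OF h(1-3)] h(1-3) d3(1-3) ty by simp
    also have "\<dots> = Zero C (dom h) S" unfolding h(4) using h(2) ty by simp
    finally show ?thesis using zero_i[of "?d3 \<cdot> h"] h(1-3) d3(1-3) by simp
  qed
  have "exact0 n C Y"
    unfolding exact0_def
  proof (intro conjI cY allI)
    fix i
    show "i < n \<longrightarrow> (\<forall>a\<in>Arr C. cod a = cobj Y (Suc i) \<longrightarrow> cdiff Y (Suc i) \<cdot> a = Zero C (dom a) (cobj Y i) \<longrightarrow>
       (\<exists>t\<in>mor C (dom a) (cobj Y (Suc (Suc i))). a = cdiff Y (Suc (Suc i)) \<cdot> t))"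
    proof (rule cases4[of _ i]; intro impI ballI)
      fix a assume a: "arr a" "cod a = cobj Y (Suc 0)" "cdiff Y (Suc 0) \<cdot> a = Zero C (dom a) (cobj Y 0)"
      have "cdiff X (Suc 0) \<cdot> (u1 \<cdot> a) = (cdiff X (Suc 0) \<cdot> u1) \<cdot> a" using a ty x by simp
      also have "\<dots> = u \<cdot> (e \<cdot> a)" unfolding One_nat_def[symmetric] u1(3)[symmetric] using a ty uD(3-5) by simp
      also have "\<dots> = Zero C (dom a) (cobj X 0)" using a uD(3-5) by simp
      finally have "\<exists>t\<in>mor C (dom (u1 \<cdot> a)) (cobj X (Suc (Suc 0))). u1 \<cdot> a = ?d2 \<cdot> t"
        by (intro exact0D(2)[OF E]) (use n a(1,2) ty in simp_all)
      then obtain w where w: "arr w" "dom w = dom a" "cod w = cobj X (Suc (Suc 0))" "u1 \<cdot> a = ?d2 \<cdot> w"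
        using a(1,2) ty by (auto simp: mor_iff)
      \<comment> \<open>A cycle \<open>a\<close> in \<open>Y_1\<close> is completed by
        \<open>-w\<close> in \<open>X_2\<close> to an arrow killed by the differential of the cone,
        which therefore factors through \<open>B\<close>.\<close>
      let ?k = "sub C (i2 \<cdot> a) (i1 \<cdot> w)"
      have kt: "arr ?k" "dom ?k = dom a" "cod ?k = S" using w(1-3) a(1,2) ty by simp_all
      have "m \<cdot> (r \<cdot> ?k) = ?k"
      proof (rule mrk[OF kt(1,3)])
        show "?d2 \<cdot> (p1 \<cdot> ?k) \<boxplus> u1 \<cdot> (p2 \<cdot> ?k) = Zero C (dom ?k) (cobj X 1)"
          using w a(1,2) ty b by simp
        show "e \<cdot> (p2 \<cdot> ?k) = Zero C (dom ?k) Y0" using w(1-3) a ty b by simp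
      qed
      then have "a = p2 \<cdot> (m \<cdot> (r \<cdot> ?k))" using w(1-3) a(1,2) ty b by simp
      also have "\<dots> = p2 \<cdot> m \<cdot> (r \<cdot> ?k)" using kt ty by simp
      finally have "a = cdiff Y (Suc (Suc 0)) \<cdot> (r \<cdot> ?k)" by simp
      moreover have "r \<cdot> ?k \<in> mor C (dom a) (cobj Y (Suc (Suc 0)))" using kt ty by (simp add: mor_iff)
      ultimately show "\<exists>t\<in>mor C (dom a) (cobj Y (Suc (Suc 0))). a = cdiff Y (Suc (Suc 0)) \<cdot> t" by blast
    next
      fix h assume n2: "Suc 0 < n" and h: "arr h" "cod h = cobj Y (Suc (Suc 0))"
        "cdiff Y (Suc (Suc 0)) \<cdot> h = Zero C (dom h) (cobj Y (Suc 0))"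
      have h': "cod h = B" "p2 \<cdot> (m \<cdot> h) = Zero C (dom h) Y1" using h ty by simp_all
      note l = low[OF h(1) h']
      have "\<exists>t\<in>mor C (dom (p1 \<cdot> (m \<cdot> h))) (cobj X (Suc (Suc (Suc 0)))). p1 \<cdot> (m \<cdot> h) = ?d3 \<cdot> t"
        by (rule exact0D(2)[OF E n2]) (use l h' h(1) ty in simp_all)
      then obtain z where z: "arr z" "dom z = dom h" "cod z = cobj X (Suc (Suc (Suc 0)))"
        "p1 \<cdot> (m \<cdot> h) = ?d3 \<cdot> z" using h' h(1) ty by (auto simp: mor_iff)
      have "h = r \<cdot> (m \<cdot> h)" using rm'[of h] h' h by simp
      also have "m \<cdot> h = i1 \<cdot> (?d3 \<cdot> z)" using l z(4) by simp
      also have "r \<cdot> (i1 \<cdot> (?d3 \<cdot> z)) = r \<cdot> (i1 \<cdot> ?d3) \<cdot> z" using z(1-3) n2 d3(1-3) ty by simp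
      finally have "h = cdiff Y (Suc (Suc (Suc 0))) \<cdot> z" by simp
      moreover have "z \<in> mor C (dom h) (cobj Y (Suc (Suc (Suc 0))))" using z(1-3) by (simp add: mor_iff)
      ultimately show "\<exists>t\<in>mor C (dom h) (cobj Y (Suc (Suc (Suc 0)))). h = cdiff Y (Suc (Suc (Suc 0))) \<cdot> t" by blast
    next
      fix h assume n3: "Suc (Suc 0) < n" and h: "arr h" "cod h = cobj Y (Suc (Suc (Suc 0)))"
        "cdiff Y (Suc (Suc (Suc 0))) \<cdot> h = Zero C (dom h) (cobj Y (Suc (Suc 0)))"
      have "?d3 \<cdot> h = Zero C (dom h) (cobj X (Suc (Suc 0)))" by (rule r3) (use n3 h in simp_all)
      then show "\<exists>t\<in>mor C (dom h) (cobj Y (Suc (Suc (Suc (Suc 0))))). h = cdiff Y (Suc (Suc (Suc (Suc 0)))) \<cdot> t"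
        using exact0D(2)[OF E n3 h(1)] h by simp
    next
      fix k h assume n4: "Suc (Suc (Suc k)) < n" and h: "arr h" "cod h = cobj Y (Suc (Suc (Suc (Suc k))))"
        "cdiff Y (Suc (Suc (Suc (Suc k)))) \<cdot> h = Zero C (dom h) (cobj Y (Suc (Suc (Suc k))))"
      then show "\<exists>t\<in>mor C (dom h) (cobj Y (Suc (Suc (Suc (Suc (Suc k)))))).
          h = cdiff Y (Suc (Suc (Suc (Suc (Suc k))))) \<cdot> t"
        using exact0D(2)[OF E n4 h(1)] by simp
    qed
  qed
  moreover have "n \<ge> 1 \<longrightarrow> (\<forall>h\<in>Arr C. cod h = cobj Y (Suc n) \<longrightarrow> cdiff Y (Suc n) \<cdot> h = Zero C (dom h) (cobj Y n) \<longrightarrow>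
      h = Zero C (dom h) (cobj Y (Suc n)))"
  proof -
    \<comment> \<open>The index is abstracted from n so that \<open>cases4\<close> can distinguish
      the position of the last differential.\<close>
    have "\<forall>N. N = n \<longrightarrow> N \<ge> 1 \<longrightarrow> (\<forall>h\<in>Arr C. cod h = cobj Y (Suc N) \<longrightarrow> cdiff Y (Suc N) \<cdot> h = Zero C (dom h) (cobj Y N) \<longrightarrow>
      h = Zero C (dom h) (cobj Y (Suc N)))"
    proof
      fix N
      show "N = n \<longrightarrow> N \<ge> 1 \<longrightarrow> (\<forall>h\<in>Arr C. cod h = cobj Y (Suc N) \<longrightarrow> cdiff Y (Suc N) \<cdot> h = Zero C (dom h) (cobj Y N) \<longrightarrow>
      h = Zero C (dom h) (cobj Y (Suc N)))"
      proof (rule cases4[of _ N]; intro impI ballI)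
        fix h assume n1: "Suc 0 = n" and h: "arr h" "cod h = cobj Y (Suc (Suc 0))"
          "cdiff Y (Suc (Suc 0)) \<cdot> h = Zero C (dom h) (cobj Y (Suc 0))"
        have h': "cod h = B" "p2 \<cdot> (m \<cdot> h) = Zero C (dom h) Y1" using h ty by simp_all
        note l = low[OF h(1) h']
        have "p1 \<cdot> (m \<cdot> h) = Zero C (dom (p1 \<cdot> (m \<cdot> h))) (cobj X (Suc n))"
          by (rule lexactD(3)[OF L]) (use l h' h(1) ty n1 in auto)
        then have pz: "p1 \<cdot> (m \<cdot> h) = Zero C (dom h) (cobj X (Suc (Suc 0)))" using h' h(1) ty n1 by simp
        have "h = r \<cdot> (m \<cdot> h)" using rm'[of h] h' h by simp
        also have "m \<cdot> h = i1 \<cdot> (p1 \<cdot> (m \<cdot> h))" using l by blast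
        also have "r \<cdot> (i1 \<cdot> (p1 \<cdot> (m \<cdot> h))) = Zero C (dom h) B" unfolding pz using h(1) ty by simp
        finally show "h = Zero C (dom h) (cobj Y (Suc (Suc 0)))" by simp
      next
        fix h assume n3: "Suc (Suc 0) = n" and h: "arr h" "cod h = cobj Y (Suc (Suc (Suc 0)))"
          "cdiff Y (Suc (Suc (Suc 0))) \<cdot> h = Zero C (dom h) (cobj Y (Suc (Suc 0)))"
        have "?d3 \<cdot> h = Zero C (dom h) (cobj X (Suc (Suc 0)))" by (rule r3) (use n3[symmetric] h in simp_all)
        then show "h = Zero C (dom h) (cobj Y (Suc (Suc (Suc 0))))"
          using lexactD(3)[OF L h(1)] h(2) n3[symmetric] by simp
      next
        fix k h assume n4: "Suc (Suc (Suc k)) = n" and h: "arr h" "cod h = cobj Y (Suc (Suc (Suc (Suc k))))"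
          "cdiff Y (Suc (Suc (Suc (Suc k)))) \<cdot> h = Zero C (dom h) (cobj Y (Suc (Suc (Suc k))))"
        then show "h = Zero C (dom h) (cobj Y (Suc (Suc (Suc (Suc k)))))"
          using lexactD(3)[OF L h(1)] n4[symmetric] by simp
      qed (simp)
    qed
    then show ?thesis by blast
  qed
  ultimately have LY: "lexact n C Y" unfolding lexact_def using n by blast
  have bY: "bd C Y = ran C e" using bd_ran[OF cY] by simp
  have "coexact n C Y"
    by (rule coexact_transfer[OF lexactD(1)[OF LY] E _ co, of u]) (simp add: bY u)
  then have "n_exact n C Y" using LY n_exact_iff by blast
  then show ?thesis by (rule that) (simp_all add: bY)
qed

end

section \<open>Classes of exact sequences\<close>

definition closed_class :: "nat \<Rightarrow> ('o, 'm) cat \<Rightarrow> ('o, 'm) cplx set \<Rightarrow> bool" where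
  "closed_class n C \<A> \<longleftrightarrow> (\<forall>X\<in>\<A>. n_exact n C X) \<and>
     (\<forall>X\<in>\<A>. \<forall>Y. n_exact n C Y \<and> homotopy_equivalent n C X Y \<longrightarrow> Y \<in> \<A>)"

text \<open>The image of \<open>f\<close> in the module presented by \<open>X\<close>, and the quotient by it, are in the class.\<close>

definition splits :: "('o, 'm) cat \<Rightarrow> ('o, 'm) cplx set \<Rightarrow> ('o, 'm) cplx \<Rightarrow> 'm \<Rightarrow> bool" where
  "splits C \<A> X f \<longleftrightarrow> (\<exists>Y\<in>\<A>. \<exists>W\<in>\<A>. \<exists>y w.
     cses C Y y X w W \<and>
     (\<exists>a\<in>mor C (Dom C f) (cobj Y 0). eqb C X f (y \<cdot>\<^bsub>C\<^esub> a)) \<and>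
     (\<exists>b\<in>mor C (cobj Y 0) (Dom C f). eqb C X y (f \<cdot>\<^bsub>C\<^esub> b)))"

definition pb :: "('o, 'm) cat \<Rightarrow> ('o, 'm) cplx set \<Rightarrow> ('o, 'm) cplx set" where
  "pb C \<A> = {X \<in> \<A>. \<forall>f\<in>Arr C. Cod C f = cobj X 0 \<longrightarrow> splits C \<A> X f}"

text \<open>A preimage under reversal and not an image: reversed complexes have special values at
  irrelevant indices, so an image would not be closed under homotopy equivalence.\<close>

definition opc :: "nat \<Rightarrow> ('o, 'm) cat \<Rightarrow> ('o, 'm) cplx set \<Rightarrow> ('o, 'm) cplx set" where
  "opc n C \<A> = {X. n_exact n (op_cat C) X \<and> op_cplx n X \<in> \<A>}"

definition po :: "nat \<Rightarrow> ('o, 'm) cat \<Rightarrow> ('o, 'm) cplx set \<Rightarrow> ('o, 'm) cplx set" where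
  "po n C \<A> = opc n (op_cat C) (pb (op_cat C) (opc n C \<A>))"

definition ext :: "nat \<Rightarrow> ('o, 'm) cat \<Rightarrow> ('o, 'm) cplx set \<Rightarrow> ('o, 'm) cplx set" where
  "ext n C \<A> = {X. n_exact n C X \<and> (\<exists>Y\<in>\<A>. \<exists>W\<in>\<A>. \<exists>y w.
     cses C Y y X w W)}"

lemma splitsI:
  assumes "Y \<in> \<A>" "W \<in> \<A>"
    "cses C Y y X w W"
    "\<exists>a\<in>mor C (Dom C f) (cobj Y 0). eqb C X f (y \<cdot>\<^bsub>C\<^esub> a)"
    "\<exists>b\<in>mor C (cobj Y 0) (Dom C f). eqb C X y (f \<cdot>\<^bsub>C\<^esub> b)"
  shows "splits C \<A> X f"
  unfolding splits_def using assms by blast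

lemma splitsE:
  assumes "splits C \<A> X f"
  obtains Y W y w where "Y \<in> \<A>" "W \<in> \<A>"
    "cses C Y y X w W"
    "\<exists>a\<in>mor C (Dom C f) (cobj Y 0). eqb C X f (y \<cdot>\<^bsub>C\<^esub> a)"
    "\<exists>b\<in>mor C (cobj Y 0) (Dom C f). eqb C X y (f \<cdot>\<^bsub>C\<^esub> b)"
  using assms unfolding splits_def by blast

lemma pb_subset: "pb C \<A> \<subseteq> \<A>" unfolding pb_def by blast

lemma splits_mono: "splits C \<A> X f \<Longrightarrow> \<A> \<subseteq> \<B> \<Longrightarrow> splits C \<B> X f"
  unfolding splits_def by (elim bexE) (intro bexI; (rule subsetD)?; assumption)

lemma pb_mono: "\<A> \<subseteq> \<B> \<Longrightarrow> pb C \<A> \<subseteq> pb C \<B>"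
  unfolding pb_def by (auto intro: splits_mono)

lemma opc_mono: "\<A> \<subseteq> \<B> \<Longrightarrow> opc n C \<A> \<subseteq> opc n C \<B>"
  unfolding opc_def by blast

lemma po_mono: "\<A> \<subseteq> \<B> \<Longrightarrow> po n C \<A> \<subseteq> po n C \<B>"
  unfolding po_def by (intro opc_mono pb_mono)

lemma op_cplx_sel [simp]: "cobj (op_cplx n X) 0 = cobj X (Suc n)" "cobj (op_cplx n X) (Suc n) = cobj X 0"
  by (simp_all add: op_cplx_def)

section \<open>Isomorphism invariance of classes and operations\<close>

context additive_category begin

lemma n_exactD:
  assumes "n_exact n C X"
  shows "lexact n C X" "exact0 n C X" "is_complex n C X" "right_ideal C (cobj X 0) (bd C X)" "obj (cobj X 0)"
proof -
  show 1: "lexact n C X" using assms n_exact_iff by blast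
  show 2: "exact0 n C X" "is_complex n C X" using lexactD[OF 1] by auto
  show "right_ideal C (cobj X 0) (bd C X)" by (rule right_ideal_bd[OF 2(2)])
  show "obj (cobj X 0)" using cx(1)[OF 2(2)] by simp
qed

lemma closedD:
  assumes "closed_class n C \<A>" "X \<in> \<A>"
  shows "n_exact n C X"
  using assms unfolding closed_class_def by blast

lemma closed_qiso:
  assumes "closed_class n C \<A>" "X \<in> \<A>" "n_exact n C Y" "cqiso C X Y u"
  shows "Y \<in> \<A>"
proof -
  have "homotopy_equivalent n C X Y"
    using homotopy_equivalent_iff[OF n_exactD(1)[OF closedD[OF assms(1,2)]] n_exactD(1)[OF assms(3)]] assms(4)
    by blast
  then show ?thesis using assms(1-3) unfolding closed_class_def by blast
qed

lemma closed_classI: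
  assumes "\<And>X. X \<in> \<A> \<Longrightarrow> n_exact n C X"
    "\<And>X Y u. X \<in> \<A> \<Longrightarrow> n_exact n C Y \<Longrightarrow> cqiso C X Y u \<Longrightarrow> Y \<in> \<A>"
  shows "closed_class n C \<A>"
  unfolding closed_class_def
proof (intro conjI ballI allI impI)
  show "X \<in> \<A> \<Longrightarrow> n_exact n C X" for X by (rule assms(1))
next
  fix X Y assume X: "X \<in> \<A>" and Y: "n_exact n C Y \<and> homotopy_equivalent n C X Y"
  then have "\<exists>u. cqiso C X Y u"
    using homotopy_equivalent_iff[OF n_exactD(1)[OF assms(1)[OF X]] n_exactD(1)] by blast
  then show "Y \<in> \<A>" using assms(2)[OF X] Y by blast
qed

lemma cagree_qiso:
  assumes "n_exact n C X" "cagree n X Y"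
  shows "n_exact n C Y" "cqiso C X Y (Id C (cobj X 0))"
proof -
  show "n_exact n C Y" using assms cagree_n_exact[OF additive_category_axioms] by blast
  have "cobj X 0 = cobj Y 0" using assms(2) by (auto simp: cagree_def)
  moreover have "bd C X = bd C Y" by (rule cagree_bd[OF assms(2)])
  ultimately show "cqiso C X Y (Id C (cobj X 0))"
    using qiso_Id n_exactD(4)[OF assms(1)] by simp
qed

lemma cagree_sym: "cagree n X Y \<Longrightarrow> cagree n Y X"
  by (auto simp: cagree_def)

lemma closed_cagree:
  assumes "closed_class n C \<A>" "cagree n X Y" "X \<in> \<A>"
  shows "Y \<in> \<A>"
  using closed_qiso[OF assms(1,3)] cagree_qiso[OF closedD[OF assms(1,3)] assms(2)] by blast

lemma cagree_chain_map:
  assumes "cagree n X X'" "cagree n Y Y'" "chain_map n C X Y \<phi>"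
  shows "chain_map n C X' Y' \<phi>"
  using assms unfolding cagree_def chain_map_def by auto

lemma opc_iff:
  assumes "closed_class n C \<A>"
  shows "op_cplx n X \<in> opc n C \<A> \<longleftrightarrow> X \<in> \<A>"
  using closed_cagree[OF assms cagree_op_op] closed_cagree[OF assms cagree_sym[OF cagree_op_op]]
    closedD[OF assms] n_exact_op[OF additive_category_axioms] unfolding opc_def by blast

lemma qiso_op_ex:
  assumes X: "n_exact n C X" and Z: "n_exact n C Z" and u: "cqiso C X Z u"
  shows "\<exists>u'. cqiso Cop (op_cplx n Z) (op_cplx n X) u'"
proof -
  obtain \<phi> where "chain_map n C X Z \<phi>" "\<phi> 0 = u" using qiso_lift[OF n_exactD(3)[OF X] n_exactD(2)[OF Z] u] .
  then show ?thesis using qiso_op[OF X Z] u by auto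
qed

lemma closed_opc:
  assumes A: "closed_class n C \<A>"
  shows "closed_class n Cop (opc n C \<A>)"
proof -
  interpret op: additive_category "op_cat C" by (rule op_additive)
  show ?thesis
  proof (rule op.closed_classI)
    show "X \<in> opc n C \<A> \<Longrightarrow> n_exact n Cop X" for X by (simp add: opc_def)
  next
    fix X Y u assume X: "X \<in> opc n C \<A>" and Y: "n_exact n Cop Y"
      and u: "cqiso Cop X Y u"
    have nX: "n_exact n Cop X" and oX: "op_cplx n X \<in> \<A>" using X by (auto simp: opc_def)
    have nY: "n_exact n C (op_cplx n Y)" using n_exact_op[OF op_additive, of n Y] Y by simp
    obtain v where "cqiso C (op_cplx n Y) (op_cplx n X) v"
      using op.qiso_op_ex[OF nX Y u] by auto
    then obtain v' where "cqiso C (op_cplx n X) (op_cplx n Y) v'"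
      by (rule qiso_sym)
    then show "Y \<in> opc n C \<A>" using closed_qiso[OF A oX nY] Y by (simp add: opc_def)
  qed
qed

lemma opc_opc:
  assumes "closed_class n C \<A>"
  shows "opc n Cop (opc n C \<A>) = \<A>"
proof -
  have "X \<in> opc n Cop (opc n C \<A>) \<longleftrightarrow> X \<in> \<A>" for X
    using opc_iff[OF assms, of X] closedD[OF assms, of X] unfolding opc_def[of n "op_cat C"] by auto
  then show ?thesis by blast
qed

lemma eqm_reflect:
  assumes q: "qiso C P N Q M e" and "eqm C M (e \<cdot> a) (e \<cdot> b)" "arr a" "arr b" "cod a = P" "cod b = P"
  shows "eqm C N a b"
proof -
  note e = qisoD[OF q]
  have D: "dom a = dom b" using eqmD(3)[OF assms(2)] assms(3-) e(3-5) by simp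
  have "e \<cdot> sub C a b \<in> M" using eqmD(5)[OF assms(2)] assms(3-) e(3-5) D by simp
  then have "sub C a b \<in> N" using e(7)[of "sub C a b"] assms(3-) D by simp
  then show ?thesis using assms(3-) D by (simp add: eqm_def)
qed

text \<open>A test arrow is moved to \<open>X\<close> by the inverse \<open>v\<close>, and the short
  exact sequence found there is moved back by \<open>u\<close>; \<open>eqm_reflect\<close> then
  removes \<open>v\<close> from the congruences.\<close>

lemma closed_pb:
  assumes A: "closed_class n C \<A>"
  shows "closed_class n C (pb C \<A>)"
proof (rule closed_classI)
  show "X \<in> pb C \<A> \<Longrightarrow> n_exact n C X" for X using closedD[OF A] pb_subset by blast
next
  fix X Z u assume X: "X \<in> pb C \<A>" and Z: "n_exact n C Z"
    and u: "cqiso C X Z u"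
  have XA: "X \<in> \<A>" using X pb_subset by blast
  have ZA: "Z \<in> \<A>" by (rule closed_qiso[OF A XA Z u])
  note RZ = n_exactD(4)[OF Z] and RX = n_exactD(4)[OF closedD[OF A XA]]
  obtain v where v: "cqiso C Z X v"
    and uv: "eqb C X (v \<cdot> u) (Id C (cobj X 0))" "eqb C Z (u \<cdot> v) (Id C (cobj Z 0))"
    using u by (rule qiso_sym)
  note uD = qisoD[OF u] and vD = qisoD[OF v]
  have "splits C \<A> Z f" if f: "arr f" "cod f = cobj Z 0" for f
  proof -
    have "splits C \<A> X (v \<cdot> f)" using X f vD(3-5) unfolding pb_def by auto
    then obtain Y W y w a b where YW: "Y \<in> \<A>" "W \<in> \<A>"
      and S: "cses C Y y X w W"
      and a: "a \<in> mor C (dom (v \<cdot> f)) (cobj Y 0)" "eqb C X (v \<cdot> f) (y \<cdot> a)"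
      and b: "b \<in> mor C (cobj Y 0) (dom (v \<cdot> f))" "eqb C X y (v \<cdot> f \<cdot> b)"
      unfolding splits_def by blast
    note s = sesD[OF S]
    have at: "arr a" "dom a = dom f" "cod a = cobj Y 0" and
      bt: "arr b" "dom b = cobj Y 0" "cod b = dom f" using a b f vD(3-5) by (auto simp: mor_iff)
    have vu: "eqb C X (v \<cdot> (u \<cdot> h)) h" if "arr h" "cod h = cobj X 0" for h
      using eqm_comp[OF RX uv(1) that(1)] that vD(3-5) uD(3-5) by simp
    have 1: "cses C Y (u \<cdot> y) Z (w \<cdot> v) W"
    proof (rule ses_qiso[OF S v])
      show "eqb C X (v \<cdot> (u \<cdot> y)) y" by (rule vu) (use s in auto)
      show "eqb C W (w \<cdot> v) (w \<cdot> v)" by (rule eqm_refl[OF s(3)]) (use s vD(3-5) in auto)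
    qed (use s uD(3-5) vD(3-5) in \<open>auto simp: mor_iff\<close>)
    have "eqb C X (v \<cdot> f) (v \<cdot> (u \<cdot> y \<cdot> a))"
      using eqm_trans[OF RX a(2) eqm_sym[OF RX vu[of "y \<cdot> a"]]] at s(4-9) uD(3-5) by simp
    then have 2: "eqb C Z f (u \<cdot> y \<cdot> a)"
      by (rule eqm_reflect[OF v]) (use at s(4-9) uD(3-5) f in auto)
    have "eqb C X (v \<cdot> (u \<cdot> y)) (v \<cdot> (f \<cdot> b))"
      using eqm_trans[OF RX vu[of y] b(2)] bt s(4-9) vD(3-5) f by simp
    then have 3: "eqb C Z (u \<cdot> y) (f \<cdot> b)"
      by (rule eqm_reflect[OF v]) (use bt s(4-9) uD(3-5) f in auto)
    show ?thesis
    proof (rule splitsI[OF YW 1])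
      show "\<exists>a\<in>mor C (dom f) (cobj Y 0). eqb C Z f (u \<cdot> y \<cdot> a)"
        using 2 at by (intro bexI[of _ a]) (simp_all add: mor_iff)
      show "\<exists>b\<in>mor C (cobj Y 0) (dom f). eqb C Z (u \<cdot> y) (f \<cdot> b)"
        using 3 bt by (intro bexI[of _ b]) (simp_all add: mor_iff)
    qed
  qed
  then show "Z \<in> pb C \<A>" unfolding pb_def using ZA by blast
qed

text \<open>The hypothesis \<open>e\<close> says that the image of \<open>f\<close> lies in that of
  \<open>g\<close>. Applied twice, it shows that arrows factoring through each other modulo
  relations have the same image.\<close>

lemma im_cong:
  assumes R: "right_ideal C P N" and f: "arr f" "cod f = P" and g: "arr g" "cod g = P"
    and e: "\<exists>c\<in>mor C (dom f) (dom g). eqm C N f (g \<cdot> c)"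
    and x: "\<exists>s\<in>mor C A (dom f). eqm C N x (f \<cdot> s)"
  shows "\<exists>s\<in>mor C A (dom g). eqm C N x (g \<cdot> s)"
proof -
  obtain c s where c: "arr c" "dom c = dom f" "cod c = dom g" "eqm C N f (g \<cdot> c)"
    and s: "arr s" "dom s = A" "cod s = dom f" "eqm C N x (f \<cdot> s)"
    using e x by (auto simp: mor_iff)
  have "eqm C N (f \<cdot> s) (g \<cdot> c \<cdot> s)" by (rule eqm_comp[OF R c(4)]) (use c s f g in auto)
  then have "eqm C N x (g \<cdot> (c \<cdot> s))" using eqm_trans[OF R s(4)] c s f g by simp
  then show ?thesis using c s by (intro bexI[of _ "c \<cdot> s"]) (auto simp: mor_iff)
qed

text \<open>\<open>splits\<close> depends on its arrow only through the image.\<close>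

lemma splits_cong:
  assumes X: "n_exact n C X" and S: "splits C \<A> X f" and f: "arr f" "cod f = cobj X 0"
    and g: "arr g" "cod g = cobj X 0"
    and c: "\<exists>c\<in>mor C (dom f) (dom g). eqb C X f (g \<cdot> c)"
    and c': "\<exists>c\<in>mor C (dom g) (dom f). eqb C X g (f \<cdot> c)"
  shows "splits C \<A> X g"
proof -
  note R = n_exactD(4)[OF X]
  obtain Y W y w where YW: "Y \<in> \<A>" "W \<in> \<A>"
      and S: "cses C Y y X w W"
      and a: "\<exists>a\<in>mor C (dom f) (cobj Y 0). eqb C X f (y \<cdot> a)"
      and b: "\<exists>b\<in>mor C (cobj Y 0) (dom f). eqb C X y (f \<cdot> b)"
    using S by (rule splitsE)
  note s = sesD[OF S]
  have "\<exists>a\<in>mor C (dom g) (cobj Y 0). eqb C X g (y \<cdot> a)"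
    using im_cong[OF R f, of y] s(4-6) a c' by simp
  moreover have "\<exists>b\<in>mor C (cobj Y 0) (dom g). eqb C X y (g \<cdot> b)"
    using im_cong[OF R f g c] b by simp
  ultimately show ?thesis by (rule splitsI[OF YW S])
qed

text \<open>The kernel of an epimorphism onto a finitely presented module is generated by one arrow,
  made of the relations of \<open>J\<close> lifted by the section \<open>b\<close> and the defect
  \<open>1 - b a\<close> of the section.\<close>

lemma kernel_fg:
  assumes R: "right_ideal C P N" and J: "is_complex n C J" and a: "a \<in> mor C P (cobj J 0)"
    and b: "b \<in> mor C (cobj J 0) P" and m: "\<And>x. x \<in> N \<Longrightarrow> a \<cdot> x \<in> bd C J"
    and ab: "eqb C J (a \<cdot> b) (Id C (cobj J 0))"
  shows "\<exists>k\<in>Arr C. cod k = P \<and> a \<cdot> k \<in> bd C J \<and> (\<forall>x\<in>Arr C. cod x = P \<longrightarrow>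
    (a \<cdot> x \<in> bd C J \<longleftrightarrow> (\<exists>s\<in>mor C (dom x) (dom k). eqm C N x (k \<cdot> s))))"
proof -
  note j = cx[OF J] and RJ = right_ideal_bd[OF J]
  have P: "obj P" using right_idealD[OF R] by blast
  obtain S i1 i2 p1 p2 where S: "biproduct C (cobj J 1) P S i1 i2 p1 p2"
    using ex_biproduct[of "cobj J 1" P] j P by auto
  note bpS = bp[OF S]
  have t: "arr a" "dom a = P" "cod a = cobj J 0" "arr b" "dom b = cobj J 0" "cod b = P"
    using a b by (auto simp: mor_iff)
  let ?d = "cdiff J (Suc 0)"
  have d: "arr ?d" "dom ?d = cobj J 1" "cod ?d = cobj J 0" "obj (cobj J 0)" using j by simp_all
  define k where "k = b \<cdot> (?d \<cdot> p1) \<boxplus> sub C (Id C P) (b \<cdot> a) \<cdot> p2"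
  have k: "arr k" "dom k = S" "cod k = P" unfolding k_def using t d bpS P by simp_all
  have ak: "a \<cdot> k \<in> bd C J"
  proof -
    have "a \<cdot> b \<cdot> (?d \<cdot> p1) \<in> bd C J"
    proof -
      have "eqb C J (a \<cdot> b \<cdot> (?d \<cdot> p1)) (Id C (cobj J 0) \<cdot> (?d \<cdot> p1))"
        by (rule eqm_comp[OF RJ ab]) (use t d bpS in auto)
      moreover have "Id C (cobj J 0) \<cdot> (?d \<cdot> p1) \<in> bd C J" using bdI[of p1 C J] d bpS by simp
      ultimately show ?thesis using eqm_mem[OF RJ] by blast
    qed
    moreover have "neg C (sub C (a \<cdot> b) (Id C (cobj J 0))) \<cdot> (a \<cdot> p2) \<in> bd C J"
      by (rule right_idealD(6)[OF RJ right_ideal_neg[OF RJ eqmD(5)[OF ab]]]) (use t d bpS in auto)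
    ultimately have "a \<cdot> b \<cdot> (?d \<cdot> p1) \<boxplus> neg C (sub C (a \<cdot> b) (Id C (cobj J 0))) \<cdot> (a \<cdot> p2) \<in> bd C J"
      by (rule right_idealD(5)[OF RJ]) (use t d bpS in auto)
    moreover have "a \<cdot> k = a \<cdot> b \<cdot> (?d \<cdot> p1) \<boxplus> neg C (sub C (a \<cdot> b) (Id C (cobj J 0))) \<cdot> (a \<cdot> p2)"
      unfolding k_def using t d bpS P by (simp add: add_ac)
    ultimately show ?thesis by simp
  qed
  have "a \<cdot> x \<in> bd C J \<longleftrightarrow> (\<exists>s\<in>mor C (dom x) (dom k). eqm C N x (k \<cdot> s))"
    if x: "arr x" "cod x = P" for x
  proof
    assume "a \<cdot> x \<in> bd C J"
    then obtain r where r: "arr r" "cod r = cobj J 1" "a \<cdot> x = ?d \<cdot> r" by (auto simp: bd_iff)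
    have "dom r = dom (?d \<cdot> r)" using r(1,2) d by simp
    also have "\<dots> = dom x" unfolding r(3)[symmetric] using x t by simp
    finally have rD: "dom r = dom x" .
    \<comment> \<open>The first summand produces \<open>b a x\<close>, the second
      \<open>x - b a x\<close>.\<close>
    let ?s = "i1 \<cdot> r \<boxplus> i2 \<cdot> x"
    have "k \<cdot> ?s = b \<cdot> (?d \<cdot> r) \<boxplus> sub C x (b \<cdot> (a \<cdot> x))"
      unfolding k_def using x r(1,2) rD t d bpS P by simp
    also have "\<dots> = x" unfolding r(3) using x r(1,2) rD t d bpS P by simp
    finally have "eqm C N x (k \<cdot> ?s)" using eqm_refl[OF R x] by simp
    moreover have "?s \<in> mor C (dom x) (dom k)" using x r(1,2) rD bpS k by (simp add: mor_iff)
    ultimately show "\<exists>s\<in>mor C (dom x) (dom k). eqm C N x (k \<cdot> s)" by blast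
  next
    assume "\<exists>s\<in>mor C (dom x) (dom k). eqm C N x (k \<cdot> s)"
    then obtain s where s: "arr s" "dom s = dom x" "cod s = dom k" "eqm C N x (k \<cdot> s)"
      by (auto simp: mor_iff)
    have "eqb C J (a \<cdot> x) (a \<cdot> (k \<cdot> s))" by (rule eqm_map[OF s(4)]) (use t x m in auto)
    moreover have "a \<cdot> k \<cdot> s \<in> bd C J" by (rule right_idealD(6)[OF RJ ak]) (use s k t in auto)
    ultimately show "a \<cdot> x \<in> bd C J" using eqm_mem[OF RJ] s k t by simp
  qed
  then show ?thesis using k ak by blast
qed

lemma ses_lift:
  assumes Y: "n_exact n C Y" and X: "n_exact n C X" and W: "n_exact n C W"
    and S: "cses C Y y X w W"
  obtains \<phi> \<psi> where "chain_map n C Y X \<phi>" "\<phi> 0 = y" "chain_map n C X W \<psi>" "\<psi> 0 = w"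
proof -
  note s = sesD[OF S]
  have "y \<cdot> cdiff Y 1 \<in> bd C X" "w \<cdot> cdiff X 1 \<in> bd C W"
    using s(13)[OF cdiff_bd[OF n_exactD(3)[OF Y]]] s(14)[OF cdiff_bd[OF n_exactD(3)[OF X]]] by simp_all
  then show ?thesis
    using chain_lift[OF n_exactD(3)[OF Y] n_exactD(2)[OF X], of y]
      chain_lift[OF n_exactD(3)[OF X] n_exactD(2)[OF W], of w] s that by (auto simp: mor_iff)
qed

text \<open>\<open>splits\<close> returns some cokernel of the image of \<open>k\<close>. Since
  \<open>a\<close> is an epimorphism with this image as kernel, it may take the place of that
  cokernel.\<close>

lemma ses_kernel:
  assumes S: "splits C \<A> X k" and X: "n_exact n C X" and J: "n_exact n C J"
    and k: "arr k" "cod k = cobj X 0" and a: "a \<in> mor C (cobj X 0) (cobj J 0)"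
    and ker: "\<And>x. x \<in> Arr C \<Longrightarrow> cod x = cobj X 0 \<Longrightarrow>
      a \<cdot> x \<in> bd C J \<longleftrightarrow> (\<exists>s\<in>mor C (dom x) (dom k). eqb C X x (k \<cdot> s))"
    and epi: "b \<in> mor C (cobj J 0) (cobj X 0)" "eqb C J (a \<cdot> b) (Id C (cobj J 0))"
  obtains K k' where "K \<in> \<A>" "cses C K k' X a J"
    "\<exists>c\<in>mor C (dom k) (cobj K 0). eqb C X k (k' \<cdot> c)"
    "\<exists>c\<in>mor C (cobj K 0) (dom k). eqb C X k' (k \<cdot> c)"
proof -
  note R = n_exactD(4)[OF X]
  obtain K Q k' c where K: "K \<in> \<A>" and T: "cses C K k' X c Q"
    and e1: "\<exists>a\<in>mor C (dom k) (cobj K 0). eqb C X k (k' \<cdot> a)"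
    and e2: "\<exists>b\<in>mor C (cobj K 0) (dom k). eqb C X k' (k \<cdot> b)"
    using S by (rule splitsE)
  note s = sesD[OF T]
  have "a \<cdot> x \<in> bd C J \<longleftrightarrow> (\<exists>s\<in>mor C (dom x) (cobj K 0). eqb C X x (k' \<cdot> s))"
    if "arr x" "cod x = cobj X 0" for x
    unfolding ker[OF that] using im_cong[OF R k s(4,6), of "dom x" x] im_cong[OF R s(4,6) k, of "dom x" x] e1 e2
    unfolding s(5) by blast
  then have "cses C K k' X a J"
    unfolding ses_def using s(1,2,4-6,10) n_exactD(4)[OF J] a epi by (auto simp: mor_iff)
  then show ?thesis using that K e1 e2 by blast
qed

text \<open>Factor \<open>\<theta>\<close> over its image \<open>J\<close> with kernel
  \<open>K\<close>, both in the class by closure under \<open>pb\<close>. Dualising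
  \<open>K -> X -> J\<close> and \<open>J -> V -> V'\<close> turns \<open>\<theta>\<close> into an
  epimorphism onto the reversed \<open>J\<close> followed by its inclusion, so the reversed
  \<open>J\<close> and \<open>K\<close> are the required image and quotient.\<close>

lemma op_image_splits:
  assumes A: "closed_class n C \<A>" and pbA: "\<A> \<subseteq> pb C \<A>" and n: "n \<ge> 1"
    and XA: "X \<in> \<A>" and VA: "V \<in> \<A>" and th: "chain_map n C X V \<theta>"
  shows "splits Cop (opc n C \<A>) (op_cplx n X) (\<theta> (Suc n))"
proof -
  interpret op: additive_category "op_cat C" by (rule op_additive)
  note X = closedD[OF A XA] and V = closedD[OF A VA]
  note RX = n_exactD(4)[OF X] and RV = n_exactD(4)[OF V]
  note th' = cm[OF th]
  have t0: "arr (\<theta> 0)" "dom (\<theta> 0) = cobj X 0" "cod (\<theta> 0) = cobj V 0" using th' by simp_all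
  have "splits C \<A> V (\<theta> 0)" using pbA VA t0 unfolding pb_def by blast
  then obtain J V' j v a b where JA: "J \<in> \<A>" and V'A: "V' \<in> \<A>"
      and S: "cses C J j V v V'"
      and a: "arr a" "dom a = cobj X 0" "cod a = cobj J 0" "eqb C V (\<theta> 0) (j \<cdot> a)"
      and b: "arr b" "dom b = cobj J 0" "cod b = cobj X 0" "eqb C V j (\<theta> 0 \<cdot> b)"
    unfolding splits_def using t0 by (auto simp: mor_iff)
  note J = closedD[OF A JA] and V' = closedD[OF A V'A] and s = sesD[OF S]
  note RJ = n_exactD(4)[OF J]
  have thX: "\<theta> 0 \<cdot> x \<in> bd C V" if x: "x \<in> bd C X" for x
  proof -
    obtain t where t: "arr t" "cod t = cobj X 1" "x = cdiff X 1 \<cdot> t" using x by (auto simp: bd_iff)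
    then have "\<theta> 0 \<cdot> x = cdiff V 1 \<cdot> (\<theta> 1 \<cdot> t)"
      using cm_right[OF th n_exactD(3)[OF X] n_exactD(3)[OF V], of 0 t] by simp
    then show ?thesis unfolding bd_iff using t th' by (intro exI[of _ "\<theta> 1 \<cdot> t"]) simp
  qed
  have ax: "a \<cdot> x \<in> bd C J \<longleftrightarrow> \<theta> 0 \<cdot> x \<in> bd C V" if x: "arr x" "cod x = cobj X 0" for x
  proof -
    have "eqb C V (\<theta> 0 \<cdot> x) (j \<cdot> a \<cdot> x)" by (rule eqm_comp[OF RV a(4)]) (use x t0 in auto)
    then show ?thesis using eqm_mem[OF RV] s(10)[of "a \<cdot> x"] x a(1-3) s(4-6) by simp
  qed
  have ab: "eqb C J (a \<cdot> b) (Id C (cobj J 0))"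
  proof -
    have "eqb C V (\<theta> 0 \<cdot> b) (j \<cdot> a \<cdot> b)" by (rule eqm_comp[OF RV a(4)]) (use b t0 in auto)
    then have "eqb C V j (j \<cdot> (a \<cdot> b))" using eqm_trans[OF RV b(4)] a(1-3) b(1-3) s(4-6) by simp
    then have "eqb C V (j \<cdot> (a \<cdot> b)) j" by (rule eqm_sym[OF RV])
    then have "j \<cdot> sub C (a \<cdot> b) (Id C (cobj J 0)) \<in> bd C V"
      using eqmD(5) a(1-3) b(1-3) s(4-6,16) by force
    then show ?thesis using s(10)[of "sub C (a \<cdot> b) (Id C (cobj J 0))"] a(1-3) b(1-3) s(16) by (simp add: eqm_def)
  qed
  have aX: "a \<cdot> x \<in> bd C J" if "x \<in> bd C X" for x
    using ax[of x] thX[OF that] right_idealD[OF RX] that by blast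
  have am: "a \<in> mor C (cobj X 0) (cobj J 0)" "b \<in> mor C (cobj J 0) (cobj X 0)" using a b by (auto simp: mor_iff)
  \<comment> \<open>The kernel of \<open>X -> J\<close> has to be reached through an arrow into
    \<open>X_0\<close>, since closure under \<open>pb\<close> speaks of images of arrows.\<close>
  obtain k where k: "arr k" "cod k = cobj X 0" and ker: "\<And>x. x \<in> Arr C \<Longrightarrow> cod x = cobj X 0 \<Longrightarrow>
      a \<cdot> x \<in> bd C J \<longleftrightarrow> (\<exists>s\<in>mor C (dom x) (dom k). eqb C X x (k \<cdot> s))"
    using kernel_fg[OF RX n_exactD(3)[OF J] am aX ab] by blast
  have "splits C \<A> X k" using pbA XA k unfolding pb_def by blast
  then obtain K k' where KA: "K \<in> \<A>" and T: "cses C K k' X a J"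
    by (rule ses_kernel[OF _ X J k am(1) ker am(2) ab])
  note K = closedD[OF A KA]
  obtain \<kappa> \<alpha> where ka: "chain_map n C K X \<kappa>" "\<kappa> 0 = k'" and al: "chain_map n C X J \<alpha>" "\<alpha> 0 = a"
    by (rule ses_lift[OF K X J T])
  obtain \<beta> \<nu> where be: "chain_map n C J V \<beta>" "\<beta> 0 = j" and nu: "chain_map n C V V' \<nu>" "\<nu> 0 = v"
    by (rule ses_lift[OF J V V' S])
  note alD = cm[OF al(1)] and beD = cm[OF be(1)]
  have D1: "ses Cop (cobj J (Suc n)) (bd Cop (op_cplx n J)) (\<alpha> (Suc n))
    (cobj X (Suc n)) (bd Cop (op_cplx n X)) (\<kappa> (Suc n))
    (cobj K (Suc n)) (bd Cop (op_cplx n K))"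
    by (rule ses_dual[OF n K X J _ ka(1) al(1)]) (simp add: ka al T)
  have D2: "ses Cop (cobj V' (Suc n)) (bd Cop (op_cplx n V')) (\<nu> (Suc n))
    (cobj V (Suc n)) (bd Cop (op_cplx n V)) (\<beta> (Suc n))
    (cobj J (Suc n)) (bd Cop (op_cplx n J))"
    by (rule ses_dual[OF n J V V' _ be(1) nu(1)]) (simp add: be nu S)
  note d1 = op.sesD[OF D1] and d2 = op.sesD[OF D2]
  have c: "eqb Cop (op_cplx n X) (\<theta> (Suc n)) (\<beta> (Suc n) \<cdot> \<alpha> (Suc n))"
    using chain_top[OF n_exactD(3)[OF X] n_exactD(1)[OF V] th
        chain_map_comp[OF al(1) be(1) n_exactD(3)[OF X] n_exactD(3)[OF J] n_exactD(3)[OF V]]] a(4) al be by simp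
  have e1: "\<exists>c\<in>mor Cop (Dom Cop (\<theta> (Suc n))) (cobj J (Suc n)).
      eqb Cop (op_cplx n X) (\<theta> (Suc n)) (\<alpha> (Suc n) \<cdot>\<^bsub>op_cat C\<^esub> c)"
    using c beD th' by (intro bexI[of _ "\<beta> (Suc n)"]) (auto simp: mor_iff)
  \<comment> \<open>A section of the epimorphism dual to \<open>J -> V\<close>. It shows that the
    dual of \<open>X -> J\<close> factors back through the transpose of
    \<open>\<theta>\<close>.\<close>
  obtain r where r: "arr r" "dom r = cobj V (Suc n)" "cod r = cobj J (Suc n)"
    "eqb Cop (op_cplx n J) (r \<cdot> \<beta> (Suc n)) (Id C (cobj J (Suc n)))"
    using d2(12) by (auto simp: mor_iff)
  have "eqb Cop (op_cplx n X) (\<alpha> (Suc n) \<cdot>\<^bsub>op_cat C\<^esub> (r \<cdot> \<beta> (Suc n)))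
     (\<alpha> (Suc n) \<cdot>\<^bsub>op_cat C\<^esub> Id C (cobj J (Suc n)))"
    by (rule op.eqm_map[OF r(4)]) (use alD beD r d1(13) in auto)
  then have q1: "eqb Cop (op_cplx n X) (r \<cdot> \<beta> (Suc n) \<cdot> \<alpha> (Suc n)) (\<alpha> (Suc n))"
    using alD by simp
  have "eqb Cop (op_cplx n X) (\<theta> (Suc n) \<cdot>\<^bsub>op_cat C\<^esub> r) ((\<beta> (Suc n) \<cdot> \<alpha> (Suc n)) \<cdot>\<^bsub>op_cat C\<^esub> r)"
    by (rule op.eqm_comp[OF d1(2) c]) (use r th' in auto)
  then have q2: "eqb Cop (op_cplx n X) (r \<cdot> \<theta> (Suc n)) (r \<cdot> \<beta> (Suc n) \<cdot> \<alpha> (Suc n))"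
    using r beD alD by simp
  have e2: "\<exists>b\<in>mor Cop (cobj J (Suc n)) (Dom Cop (\<theta> (Suc n))).
      eqb Cop (op_cplx n X) (\<alpha> (Suc n)) (\<theta> (Suc n) \<cdot>\<^bsub>op_cat C\<^esub> b)"
    using op.eqm_sym[OF d1(2) op.eqm_trans[OF d1(2) q2 q1]] r th' by (intro bexI[of _ r]) (auto simp: mor_iff)
  have "op_cplx n J \<in> opc n C \<A>" "op_cplx n K \<in> opc n C \<A>" using opc_iff[OF A] JA KA by auto
  then show ?thesis
    by (rule splitsI[where y = "\<alpha> (Suc n)" and w = "\<kappa> (Suc n)"]) (use D1 e1 e2 in simp_all)
qed

lemma ses_reflect:
  assumes S: "ses C P1 N1 y P N w P2 N2" and "eqm C N (y \<cdot> a) (y \<cdot> b)"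
    "arr a" "arr b" "cod a = P1" "cod b = P1"
  shows "eqm C N1 a b"
proof -
  note s = sesD[OF S]
  have D: "dom a = dom b" using eqmD(3)[OF assms(2)] assms(3-) s(4-6) by simp
  have "y \<cdot> sub C a b \<in> N" using eqmD(5)[OF assms(2)] assms(3-) s(4-6) D by simp
  then have "sub C a b \<in> N1" using s(10)[of "sub C a b"] assms(3-) D by simp
  then show ?thesis using assms(3-) D by (simp add: eqm_def)
qed

text \<open>This is \<open>chain_top\<close> for the reversed complexes: congruent last components
  force congruent components in degree 0.\<close>

lemma chain_bot:
  assumes X: "n_exact n C X" and Z: "n_exact n C Z" and f: "chain_map n C X Z \<phi>" and g: "chain_map n C X Z \<psi>"
    and b: "eqb Cop (op_cplx n X) (\<phi> (Suc n)) (\<psi> (Suc n))"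
  shows "eqb C Z (\<phi> 0) (\<psi> 0)"
proof -
  interpret op: additive_category "op_cat C" by (rule op_additive)
  have L: "lexact n Cop (op_cplx n X)" using X n_exact_lexact by blast
  have "eqm (op_cat Cop) (bd (op_cat Cop) (op_cplx n (op_cplx n Z))) (\<phi> (Suc n - Suc n)) (\<psi> (Suc n - Suc n))"
    by (rule op.chain_top[OF is_complex_op[OF n_exactD(3)[OF Z]] L chain_map_op[OF f] chain_map_op[OF g]]) (use b in simp)
  then show ?thesis by (simp add: cagree_bd[OF cagree_op_op])
qed

lemma chain_map_Zero:
  assumes "is_complex n C X" "is_complex n C Z"
  shows "chain_map n C X Z (\<lambda>i. Zero C (cobj X i) (cobj Z i))"
  by (rule chain_mapI) (use cx[OF assms(1)] cx[OF assms(2)] in \<open>auto simp: mor_iff\<close>)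

section \<open>The dual operation and its compatibility with closure under \<open>pb\<close>\<close>

lemma po_iff:
  "X \<in> po n C \<A> \<longleftrightarrow> n_exact n C X \<and> op_cplx n X \<in> pb Cop (opc n C \<A>)"
  by (simp add: po_def opc_def)

lemma po_subset:
  assumes A: "closed_class n C \<A>" shows "po n C \<A> \<subseteq> \<A>"
proof
  fix X assume "X \<in> po n C \<A>"
  then have "op_cplx n X \<in> opc n C \<A>" using pb_subset po_iff by blast
  then show "X \<in> \<A>" using opc_iff[OF A] by blast
qed

lemma closed_po:
  assumes A: "closed_class n C \<A>" shows "closed_class n C (po n C \<A>)"
proof -
  interpret op: additive_category "op_cat C" by (rule op_additive)
  show ?thesis unfolding po_def
    using op.closed_opc[OF op.closed_pb[OF closed_opc[OF A]]] by simp
qed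

text \<open>Membership in \<open>po\<close> read in \<open>C\<close>: an arrow \<open>g\<close> out
  of the left end \<open>X_(n+1)\<close> may be exchanged, up to mutual factorisation modulo
  boundaries, for the last component of a chain map to a member.\<close>

lemma po_pushout:
  assumes A: "closed_class n C \<A>" and X: "X \<in> po n C \<A>" and g: "arr g" "dom g = cobj X (Suc n)"
  obtains V \<theta> c c' where "V \<in> \<A>" "chain_map n C X V \<theta>"
    "c \<in> mor C (cobj V (Suc n)) (cod g)" "eqb Cop (op_cplx n X) g (c \<cdot> \<theta> (Suc n))"
    "c' \<in> mor C (cod g) (cobj V (Suc n))" "eqb Cop (op_cplx n X) (\<theta> (Suc n)) (c' \<cdot> g)"
proof -
  interpret op: additive_category "op_cat C" by (rule op_additive)
  have "splits Cop (opc n C \<A>) (op_cplx n X) g"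
    using X g unfolding po_iff pb_def by simp
  then obtain V W y w where V: "V \<in> opc n C \<A>"
    and S: "cses Cop V y (op_cplx n X) w W"
    and e1: "\<exists>a\<in>mor Cop (Dom Cop g) (cobj V 0). eqb Cop (op_cplx n X) g (y \<cdot>\<^bsub>op_cat C\<^esub> a)"
    and e2: "\<exists>b\<in>mor Cop (cobj V 0) (Dom Cop g). eqb Cop (op_cplx n X) y (g \<cdot>\<^bsub>op_cat C\<^esub> b)"
    by (rule splitsE)
  note s = op.sesD[OF S]
  have nX: "n_exact n C X" using X po_iff by blast
  have nV: "n_exact n Cop V" and oV: "op_cplx n V \<in> \<A>" using V by (auto simp: opc_def)
  have oX: "n_exact n Cop (op_cplx n X)" using n_exact_op[OF additive_category_axioms] nX by blast
  have "y \<cdot>\<^bsub>op_cat C\<^esub> cdiff V 1 \<in> bd Cop (op_cplx n X)"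
    using s(13)[OF op.cdiff_bd[OF op.n_exactD(3)[OF nV]]] by simp
  then obtain \<chi> where c: "chain_map n Cop V (op_cplx n X) \<chi>" "\<chi> 0 = y"
    using op.chain_lift[OF op.n_exactD(3)[OF nV] op.n_exactD(2)[OF oX], of y] s(4-6) by (auto simp: mor_iff)
  have "chain_map n C (op_cplx n (op_cplx n X)) (op_cplx n V) (\<lambda>i. \<chi> (Suc n - i))"
    using op.chain_map_op[OF c(1)] by simp
  then have th: "chain_map n C X (op_cplx n V) (\<lambda>i. \<chi> (Suc n - i))"
    by (rule cagree_chain_map[OF cagree_op_op, rotated]) (simp add: cagree_def)
  show ?thesis using that[OF oV th] e1 e2 c(2) by auto
qed

text \<open>In a class closed under \<open>pb\<close> the property in \<open>po_pushout\<close>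
  already characterises \<open>po\<close>, because \<open>op_image_splits\<close> supplies the
  quotient.\<close>

lemma po_memI:
  assumes A: "closed_class n C \<A>" and pbA: "\<A> \<subseteq> pb C \<A>" and n: "n \<ge> 1" and Z: "Z \<in> \<A>"
    and V: "\<And>g. g \<in> Arr C \<Longrightarrow> dom g = cobj Z (Suc n) \<Longrightarrow> \<exists>V\<in>\<A>. \<exists>\<theta>. chain_map n C Z V \<theta> \<and>
      (\<exists>c\<in>mor C (cobj V (Suc n)) (cod g). eqb Cop (op_cplx n Z) g (c \<cdot> \<theta> (Suc n))) \<and>
      (\<exists>c\<in>mor C (cod g) (cobj V (Suc n)). eqb Cop (op_cplx n Z) (\<theta> (Suc n)) (c \<cdot> g))"
  shows "Z \<in> po n C \<A>"
proof -
  interpret op: additive_category "op_cat C" by (rule op_additive)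
  have nZ: "n_exact n C Z" by (rule closedD[OF A Z])
  have oZ: "n_exact n Cop (op_cplx n Z)" using n_exact_op[OF additive_category_axioms] nZ by blast
  have "splits Cop (opc n C \<A>) (op_cplx n Z) g" if g: "arr g" "dom g = cobj Z (Suc n)" for g
  proof -
    obtain V \<theta> where VA: "V \<in> \<A>" and th: "chain_map n C Z V \<theta>"
      and e1: "\<exists>c\<in>mor C (cobj V (Suc n)) (cod g). eqb Cop (op_cplx n Z) g (c \<cdot> \<theta> (Suc n))"
      and e2: "\<exists>c\<in>mor C (cod g) (cobj V (Suc n)). eqb Cop (op_cplx n Z) (\<theta> (Suc n)) (c \<cdot> g)"
      using V[OF g] by blast
    have "splits Cop (opc n C \<A>) (op_cplx n Z) (\<theta> (Suc n))"
      by (rule op_image_splits[OF A pbA n Z VA th])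
    then show ?thesis
      by (rule op.splits_cong[OF oZ]) (use g e1 e2 cm[OF th] in simp_all)
  qed
  then have "op_cplx n Z \<in> pb Cop (opc n C \<A>)"
    unfolding pb_def using opc_iff[OF A] Z by simp
  then show ?thesis using po_iff nZ by blast
qed

text \<open>With \<open>Y -> X -> W\<close> from closure under \<open>pb\<close>, the outer terms
  must inherit the property in \<open>po_pushout\<close> from \<open>X\<close>. For
  \<open>Y\<close>, an arrow out of \<open>Y_(n+1)\<close> extends to \<open>X_(n+1)\<close> modulo
  boundaries; for \<open>W\<close>, the chain map found for \<open>X\<close> has to descend to
  \<open>W\<close>.\<close>

lemma pb_po:
  assumes A: "closed_class n C \<A>" and pbA: "\<A> \<subseteq> pb C \<A>" and n: "n \<ge> 1"
  shows "po n C \<A> \<subseteq> pb C (po n C \<A>)"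
proof
  interpret op: additive_category "op_cat C" by (rule op_additive)
  fix X assume Xpo: "X \<in> po n C \<A>"
  have XA: "X \<in> \<A>" using po_subset[OF A] Xpo by blast
  note X = closedD[OF A XA]
  have "splits C (po n C \<A>) X f" if f: "arr f" "cod f = cobj X 0" for f
  proof -
    have "splits C \<A> X f" using pbA XA f unfolding pb_def by blast
    then obtain Y W y w where YA: "Y \<in> \<A>" and WA: "W \<in> \<A>"
      and S: "cses C Y y X w W"
      and e1: "\<exists>a\<in>mor C (dom f) (cobj Y 0). eqb C X f (y \<cdot> a)"
      and e2: "\<exists>b\<in>mor C (cobj Y 0) (dom f). eqb C X y (f \<cdot> b)"
      by (rule splitsE)
    note s = sesD[OF S] and Y = closedD[OF A YA] and W = closedD[OF A WA]
    obtain \<phi> \<psi> where ph: "chain_map n C Y X \<phi>" "\<phi> 0 = y" and ps: "chain_map n C X W \<psi>" "\<psi> 0 = w"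
      by (rule ses_lift[OF Y X W S])
    let ?bX = "bd Cop (op_cplx n X)" and ?bY = "bd Cop (op_cplx n Y)" and ?bW = "bd Cop (op_cplx n W)"
    have D: "ses Cop (cobj W (Suc n)) ?bW (\<psi> (Suc n)) (cobj X (Suc n)) ?bX (\<phi> (Suc n)) (cobj Y (Suc n)) ?bY"
      by (rule ses_dual[OF n Y X W _ ph(1) ps(1)]) (simp add: ph ps S)
    note d = op.sesD[OF D] and pD = cm[OF ph(1)] and qD = cm[OF ps(1)]
    have phi: "eqm Cop ?bY (a \<cdot> \<phi> (Suc n)) (b \<cdot> \<phi> (Suc n))" if "eqm Cop ?bX a b" "dom a = cobj X (Suc n)" for a b
      using op.eqm_map[OF that(1), of "\<phi> (Suc n)" ?bY] pD d(14) that(2) by simp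
    have "Y \<in> po n C \<A>"
    proof (rule po_memI[OF A pbA n YA])
      fix g assume g: "arr g" "dom g = cobj Y (Suc n)"
      \<comment> \<open>The dual of \<open>Y -> X\<close> is an epimorphism; its section
        \<open>v\<close> extends \<open>g\<close> to \<open>X_(n+1)\<close>.\<close>
      obtain v where v: "arr v" "dom v = cobj X (Suc n)" "cod v = cobj Y (Suc n)"
        "eqm Cop ?bY (v \<cdot> \<phi> (Suc n)) (Id C (cobj Y (Suc n)))"
        using d(12) by (auto simp: mor_iff)
      have "eqm Cop ?bY ((v \<cdot> \<phi> (Suc n)) \<cdot>\<^bsub>op_cat C\<^esub> g) (Id C (cobj Y (Suc n)) \<cdot>\<^bsub>op_cat C\<^esub> g)"
        by (rule op.eqm_comp[OF d(3) v(4)]) (use g v pD in auto)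
      then have gv: "eqm Cop ?bY (g \<cdot> v \<cdot> \<phi> (Suc n)) g" using g v pD by simp
      have g': "arr (g \<cdot> v)" "dom (g \<cdot> v) = cobj X (Suc n)" "cod (g \<cdot> v) = cod g" using g v by auto
      obtain V \<theta> c c' where V: "V \<in> \<A>" and th: "chain_map n C X V \<theta>"
        and c: "c \<in> mor C (cobj V (Suc n)) (cod (g \<cdot> v))" "eqm Cop ?bX (g \<cdot> v) (c \<cdot> \<theta> (Suc n))"
        and c': "c' \<in> mor C (cod (g \<cdot> v)) (cobj V (Suc n))" "eqm Cop ?bX (\<theta> (Suc n)) (c' \<cdot> (g \<cdot> v))"
        by (rule po_pushout[OF A Xpo g'(1,2)])
      note tD = cm[OF th]
      have ct: "arr c" "dom c = cobj V (Suc n)" "cod c = cod g"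
        "arr c'" "dom c' = cod g" "cod c' = cobj V (Suc n)" using c(1) c'(1) g' by (auto simp: mor_iff)
      have 1: "eqm Cop ?bY g (c \<cdot> (\<theta> (Suc n) \<cdot> \<phi> (Suc n)))"
        using op.eqm_trans[OF d(3) op.eqm_sym[OF d(3) gv] phi[OF c(2) g'(2)]] ct tD pD by simp
      have "eqm Cop ?bY ((g \<cdot> v \<cdot> \<phi> (Suc n)) \<cdot>\<^bsub>op_cat C\<^esub> c') (g \<cdot>\<^bsub>op_cat C\<^esub> c')"
        by (rule op.eqm_comp[OF d(3) gv]) (use g v pD ct in auto)
      then have "eqm Cop ?bY (c' \<cdot> (g \<cdot> v) \<cdot> \<phi> (Suc n)) (c' \<cdot> g)" using g v pD ct by simp
      then have 2: "eqm Cop ?bY (\<theta> (Suc n) \<cdot> \<phi> (Suc n)) (c' \<cdot> g)"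
        using op.eqm_trans[OF d(3) phi[OF c'(2)]] tD by simp
      have "chain_map n C Y V (\<lambda>i. \<theta> i \<cdot> \<phi> i)"
        by (rule chain_map_comp[OF ph(1) th n_exactD(3)[OF Y] n_exactD(3)[OF X] n_exactD(3)[OF closedD[OF A V]]])
      then show "\<exists>V\<in>\<A>. \<exists>\<theta>. chain_map n C Y V \<theta> \<and>
        (\<exists>c\<in>mor C (cobj V (Suc n)) (cod g). eqm Cop ?bY g (c \<cdot> \<theta> (Suc n))) \<and>
        (\<exists>c\<in>mor C (cod g) (cobj V (Suc n)). eqm Cop ?bY (\<theta> (Suc n)) (c \<cdot> g))"
        using V 1 2 ct by (intro bexI[of _ V] exI[of _ "\<lambda>i. \<theta> i \<cdot> \<phi> i"] conjI bexI[of _ c] bexI[of _ c']) (auto simp: mor_iff)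
    qed
    moreover have "W \<in> po n C \<A>"
    proof (rule po_memI[OF A pbA n WA])
      fix g assume g: "arr g" "dom g = cobj W (Suc n)"
      have g': "arr (g \<cdot> \<psi> (Suc n))" "dom (g \<cdot> \<psi> (Suc n)) = cobj X (Suc n)" "cod (g \<cdot> \<psi> (Suc n)) = cod g"
        using g qD by auto
      obtain V \<theta> c c' where VA: "V \<in> \<A>" and th: "chain_map n C X V \<theta>"
        and c: "c \<in> mor C (cobj V (Suc n)) (cod (g \<cdot> \<psi> (Suc n)))" "eqm Cop ?bX (g \<cdot> \<psi> (Suc n)) (c \<cdot> \<theta> (Suc n))"
        and c': "c' \<in> mor C (cod (g \<cdot> \<psi> (Suc n))) (cobj V (Suc n))" "eqm Cop ?bX (\<theta> (Suc n)) (c' \<cdot> (g \<cdot> \<psi> (Suc n)))"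
        by (rule po_pushout[OF A Xpo g'(1,2)])
      note tD = cm[OF th] and V = closedD[OF A VA]
      note RV = n_exactD(4)[OF V]
      have ct: "arr c" "dom c = cobj V (Suc n)" "cod c = cod g"
        "arr c'" "dom c' = cod g" "cod c' = cobj V (Suc n)" using c(1) c'(1) g' by (auto simp: mor_iff)
      have thp: "chain_map n C Y V (\<lambda>i. \<theta> i \<cdot> \<phi> i)"
        by (rule chain_map_comp[OF ph(1) th n_exactD(3)[OF Y] n_exactD(3)[OF X] n_exactD(3)[OF V]])
      have "(\<psi> (Suc n) \<cdot> \<phi> (Suc n)) \<cdot>\<^bsub>op_cat C\<^esub> (c' \<cdot> g) \<in> ?bY"
        by (rule right_idealD(6)[OF d(3)]) (use d(15) ct g qD pD in auto)
      then have "c' \<cdot> (g \<cdot> \<psi> (Suc n)) \<cdot> \<phi> (Suc n) \<in> ?bY" using ct g qD pD by simp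
      then have "\<theta> (Suc n) \<cdot> \<phi> (Suc n) \<in> ?bY"
        using op.eqm_mem[OF d(3) phi[OF c'(2)]] tD by simp
      then have "eqm Cop ?bY (\<theta> (Suc n) \<cdot> \<phi> (Suc n)) (Zero C (cobj Y (Suc n)) (cobj V (Suc n)))"
        using op.eqm_Zero[OF d(3), of "\<theta> (Suc n) \<cdot> \<phi> (Suc n)"] tD pD by simp
      \<comment> \<open>The last component of \<open>Y -> X -> V\<close> is a boundary, so the map
        is zero in degree 0 modulo boundaries. Hence \<open>\<theta>\<close> vanishes on
        \<open>Y\<close> and factors through \<open>W\<close>.\<close>
      then have "eqb C V (\<theta> 0 \<cdot> \<phi> 0) (Zero C (cobj Y 0) (cobj V 0))"
        using chain_bot[OF Y V thp chain_map_Zero[OF n_exactD(3)[OF Y] n_exactD(3)[OF V]]] by simp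
      then have ty: "\<theta> 0 \<cdot> y \<in> bd C V"
        using eqm_mem[OF RV] right_idealD(4)[OF RV] n_exactD(5)[OF Y] ph(2) by simp
      have t0: "arr (\<theta> 0)" "dom (\<theta> 0) = cobj X 0" "cod (\<theta> 0) = cobj V 0" using tD by simp_all
      have thX: "\<theta> 0 \<cdot> x \<in> bd C V" if x: "x \<in> bd C X" for x
      proof -
        obtain t where t: "arr t" "cod t = cobj X 1" "x = cdiff X 1 \<cdot> t" using x by (auto simp: bd_iff)
        then have "\<theta> 0 \<cdot> x = cdiff V 1 \<cdot> (\<theta> 1 \<cdot> t)"
          using cm_right[OF th n_exactD(3)[OF X] n_exactD(3)[OF V], of 0 t] by simp
        then show ?thesis unfolding bd_iff using t tD by (intro exI[of _ "\<theta> 1 \<cdot> t"]) simp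
      qed
      have ker: "\<theta> 0 \<cdot> x \<in> bd C V" if x: "arr x" "cod x = cobj X 0" "w \<cdot> x \<in> bd C W" for x
      proof -
        obtain a where a: "arr a" "dom a = dom x" "cod a = cobj Y 0" "eqb C X x (y \<cdot> a)"
          using s(11)[OF x(1,2)] x(3) by (auto simp: mor_iff)
        have "eqb C V (\<theta> 0 \<cdot> x) (\<theta> 0 \<cdot> (y \<cdot> a))" by (rule eqm_map[OF a(4)]) (use t0 x thX in auto)
        moreover have "\<theta> 0 \<cdot> y \<cdot> a \<in> bd C V" by (rule right_idealD(6)[OF RV ty]) (use a t0 s in auto)
        ultimately show ?thesis using eqm_mem[OF RV] a t0 s(4-6) by simp
      qed
      obtain v where v: "arr v" "dom v = cobj W 0" "cod v = cobj X 0" "eqb C W (w \<cdot> v) (Id C (cobj W 0))"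
        using s(12) by (auto simp: mor_iff)
      have wv: "eqb C W (w \<cdot> (v \<cdot> h)) h" if "arr h" "cod h = cobj W 0" for h
        using eqm_comp[OF s(3) v(4) that(1)] that v(1-3) s(4-9) by simp
      note cW = n_exactD(3)[OF W]
      note wx = cx[OF cW]
      have "w \<cdot> (v \<cdot> cdiff W (Suc 0)) \<in> bd C W"
        using eqm_mem[OF s(3) wv[of "cdiff W (Suc 0)"]] cdiff_bd[OF cW] wx by simp
      then have "\<theta> 0 \<cdot> (v \<cdot> cdiff W (Suc 0)) \<in> bd C V" by (intro ker) (use v wx in auto)
      then have "\<theta> 0 \<cdot> v \<cdot> cdiff W 1 \<in> bd C V" using v t0 wx by simp
      then obtain \<theta>' where th': "chain_map n C W V \<theta>'" "\<theta>' 0 = \<theta> 0 \<cdot> v"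
        using chain_lift[OF cW n_exactD(2)[OF V], of "\<theta> 0 \<cdot> v"] v t0 by (auto simp: mor_iff)
      have "w \<cdot> sub C (v \<cdot> w) (Id C (cobj X 0)) \<in> bd C W"
        using eqmD(5)[OF wv[of w]] s(4-9,17) v(1-3) by simp
      then have "\<theta> 0 \<cdot> sub C (v \<cdot> w) (Id C (cobj X 0)) \<in> bd C V"
        by (intro ker) (use v s in auto)
      then have "eqb C V (\<theta> 0 \<cdot> v \<cdot> w) (\<theta> 0)" using s(4-9,17) v(1-3) t0 by (simp add: eqm_def)
      then have q: "eqm Cop ?bX (\<theta>' (Suc n) \<cdot> \<psi> (Suc n)) (\<theta> (Suc n))"
        using chain_top[OF n_exactD(3)[OF X] n_exactD(1)[OF V] chain_map_comp[OF ps(1) th'(1) n_exactD(3)[OF X] cW n_exactD(3)[OF V]] th]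
          th'(2) ps(2) by simp
      note t'D = cm[OF th'(1)]
      have "eqm Cop ?bX ((\<theta>' (Suc n) \<cdot> \<psi> (Suc n)) \<cdot>\<^bsub>op_cat C\<^esub> c) (\<theta> (Suc n) \<cdot>\<^bsub>op_cat C\<^esub> c)"
        by (rule op.eqm_comp[OF d(2) q]) (use ct t'D qD in auto)
      then have q': "eqm Cop ?bX (c \<cdot> \<theta>' (Suc n) \<cdot> \<psi> (Suc n)) (c \<cdot> \<theta> (Suc n))" using ct t'D qD by simp
      have 1: "eqm Cop ?bW g (c \<cdot> \<theta>' (Suc n))"
        by (rule op.ses_reflect[OF D]) (use op.eqm_trans[OF d(2) c(2) op.eqm_sym[OF d(2) q']] g ct t'D in auto)
      have 2: "eqm Cop ?bW (\<theta>' (Suc n)) (c' \<cdot> g)"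
        by (rule op.ses_reflect[OF D]) (use op.eqm_trans[OF d(2) q c'(2)] g ct t'D qD in auto)
      show "\<exists>V\<in>\<A>. \<exists>\<theta>. chain_map n C W V \<theta> \<and>
        (\<exists>c\<in>mor C (cobj V (Suc n)) (cod g). eqm Cop ?bW g (c \<cdot> \<theta> (Suc n))) \<and>
        (\<exists>c\<in>mor C (cod g) (cobj V (Suc n)). eqm Cop ?bW (\<theta> (Suc n)) (c \<cdot> g))"
        using VA th'(1) 1 2 ct by (intro bexI[of _ V] exI[of _ \<theta>'] conjI bexI[of _ c] bexI[of _ c']) (auto simp: mor_iff)
    qed
    ultimately show ?thesis by (rule splitsI[OF _ _ S e1 e2])
  qed
  then show "X \<in> pb C (po n C \<A>)" unfolding pb_def using Xpo by blast
qed

section \<open>Extensions of members of a class\<close>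

lemma right_ideal_pullback:
  assumes R: "right_ideal C P N" and f: "arr f" "cod f = P"
  shows "right_ideal C (dom f) {x \<in> Arr C. cod x = dom f \<and> f \<cdot> x \<in> N}"
proof -
  have "f \<cdot> (x \<cdot> h) \<in> N" if "arr x" "cod x = dom f" "f \<cdot> x \<in> N" "arr h" "cod h = dom x" for x h
    using right_idealD(6)[OF R that(3), of h] that f by simp
  then show ?thesis
    unfolding right_ideal_def using f right_idealD(4,5)[OF R] by auto
qed

text \<open>The middle term is given as a quotient of a representable; \<open>horseshoe\<close>
  turns it into the cokernel of a sequence, which is n-exact as a degreewise split
  extension.\<close>

lemma ext_build:
  assumes A: "closed_class n C \<A>" and n: "n \<ge> 1" and Y: "Y \<in> \<A>" and W: "W \<in> \<A>"
    and S: "ses C (cobj Y 0) (bd C Y) y P N w (cobj W 0) (bd C W)"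
  obtains H u where "H \<in> ext n C \<A>" "qiso C (cobj H 0) (bd C H) P N u"
proof -
  note Y' = closedD[OF A Y] and W' = closedD[OF A W]
  obtain H i j p q u where T: "twist n C Y W H i j p q" and u: "qiso C (cobj H 0) (bd C H) P N u"
    by (rule horseshoe[OF n n_exactD(1)[OF Y'] n_exactD(1)[OF W'] S])
  have "H \<in> ext n C \<A>"
    unfolding ext_def using twist_n_exact[OF T Y' W'] twist_ses[OF T n_exactD(1)[OF Y'] n_exactD(1)[OF W'] n] Y W
    by blast
  then show ?thesis using that u by blast
qed

lemma ses_transport:
  assumes S: "ses C P1 N1 y Q M w P2 N2" and E: "qiso C P N Q M e"
  obtains y' w' where "ses C P1 N1 y' P N w' P2 N2"
proof -
  note s = sesD[OF S] and eD = qisoD[OF E]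
  obtain f where f: "qiso C Q M P N f" "eqm C M (e \<cdot> f) (Id C Q)"
    using E by (rule qiso_sym)
  note fD = qisoD[OF f(1)]
  have "eqm C M (e \<cdot> f \<cdot> y) (Id C Q \<cdot> y)" by (rule eqm_comp[OF s(2) f(2)]) (use s fD eD in auto)
  then have "eqm C M (e \<cdot> (f \<cdot> y)) y" using s(4-9) fD(3-5) eD(3-5) by simp
  moreover have "eqm C N2 (w \<cdot> e) (w \<cdot> e)" by (rule eqm_refl[OF s(3)]) (use s eD in auto)
  ultimately have "ses C P1 N1 (f \<cdot> y) P N (w \<cdot> e) P2 N2"
    by (intro ses_qiso[OF S E]) (use s(4-9) fD(3-5) eD(3-5) in \<open>auto simp: mor_iff\<close>)
  then show ?thesis by (rule that)
qed

lemma closed_ext: "closed_class n C (ext n C \<A>)"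
proof (rule closed_classI)
  show "X \<in> ext n C \<A> \<Longrightarrow> n_exact n C X" for X unfolding ext_def by blast
next
  fix X Z u assume X: "X \<in> ext n C \<A>" and Z: "n_exact n C Z"
    and u: "cqiso C X Z u"
  obtain Y W y w where YW: "Y \<in> \<A>" "W \<in> \<A>"
    and S: "cses C Y y X w W"
    using X unfolding ext_def by blast
  obtain v where "cqiso C Z X v" using u by (rule qiso_sym)
  then obtain y' w' where "cses C Y y' Z w' W"
    by (rule ses_transport[OF S])
  then show "Z \<in> ext n C \<A>" unfolding ext_def using Z YW by blast
qed

text \<open>Direct from \<open>ses_dual\<close>, under which the submodule and the quotient exchange
  places.\<close>

lemma ext_op:
  assumes A: "closed_class n C \<A>" and n: "n \<ge> 1" and X: "X \<in> ext n C \<A>"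
  shows "op_cplx n X \<in> ext n Cop (opc n C \<A>)"
proof -
  have nX: "n_exact n C X" using X unfolding ext_def by blast
  obtain Y W y w where YW: "Y \<in> \<A>" "W \<in> \<A>"
    and S: "cses C Y y X w W"
    using X unfolding ext_def by blast
  note Y' = closedD[OF A YW(1)] and W' = closedD[OF A YW(2)]
  obtain \<phi> \<psi> where ph: "chain_map n C Y X \<phi>" "\<phi> 0 = y" and ps: "chain_map n C X W \<psi>" "\<psi> 0 = w"
    by (rule ses_lift[OF Y' nX W' S])
  have D: "ses Cop (cobj (op_cplx n W) 0) (bd Cop (op_cplx n W)) (\<psi> (Suc n))
     (cobj (op_cplx n X) 0) (bd Cop (op_cplx n X)) (\<phi> (Suc n))
     (cobj (op_cplx n Y) 0) (bd Cop (op_cplx n Y))"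
    using ses_dual[OF n Y' nX W' _ ph(1) ps(1)] S ph(2) ps(2) by simp
  have "op_cplx n Y \<in> opc n C \<A>" "op_cplx n W \<in> opc n C \<A>" "n_exact n Cop (op_cplx n X)"
    using opc_iff[OF A] YW n_exact_op[OF additive_category_axioms] nX by auto
  then show ?thesis unfolding ext_def using D by blast
qed

text \<open>Let \<open>X\<close> be an extension of \<open>W\<close> by \<open>Y\<close>. The image
  of an arrow \<open>f\<close> into \<open>X\<close> meets \<open>Y\<close> in some
  \<open>Y1\<close> and has an image \<open>W1\<close> in \<open>W\<close>. So it is an extension of
  \<open>W1\<close> by \<open>Y1\<close>, and the quotient by it is one of \<open>W2 = W/W1\<close>
  by \<open>Y2 = Y/Y1\<close>; all four lie in the class.\<close>

lemma ext_pb: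
  assumes A: "closed_class n C \<A>" and pbA: "\<A> \<subseteq> pb C \<A>" and n: "n \<ge> 1"
  shows "ext n C \<A> \<subseteq> pb C (ext n C \<A>)"
proof
  fix X assume Xe: "X \<in> ext n C \<A>"
  then have X: "n_exact n C X" unfolding ext_def by blast
  obtain Y W y w where YA: "Y \<in> \<A>" and WA: "W \<in> \<A>"
    and S: "cses C Y y X w W"
    using Xe unfolding ext_def by blast
  note s = sesD[OF S] and Y = closedD[OF A YA] and W = closedD[OF A WA]
  note RX = s(2) and RY = s(1) and RW = s(3)
  have "splits C (ext n C \<A>) X f" if f: "arr f" "cod f = cobj X 0" for f
  proof -
    define B where "B = dom f"
    have B: "obj B" "dom f = B" using f by (auto simp: B_def)
    have wf: "arr (w \<cdot> f)" "cod (w \<cdot> f) = cobj W 0" "dom (w \<cdot> f) = B" using f s(4-9) B by auto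
    have "splits C \<A> W (w \<cdot> f)" using pbA WA wf unfolding pb_def by blast
    then obtain W1 W2 z t a b where W1A: "W1 \<in> \<A>" and W2A: "W2 \<in> \<A>"
      and T: "cses C W1 z W t W2"
      and a: "arr a" "dom a = B" "cod a = cobj W1 0" "eqb C W (w \<cdot> f) (z \<cdot> a)"
      and b: "arr b" "dom b = cobj W1 0" "cod b = B" "eqb C W z (w \<cdot> f \<cdot> b)"
      using wf(3) by (auto simp: mor_iff elim!: splitsE)
    note tt = sesD[OF T] and W1 = closedD[OF A W1A] and W2 = closedD[OF A W2A]
    note RW1 = tt(1) and RW2 = tt(3)
    note ty = s(4-9,16-18) tt(4-9,16-18) f a(1-3) b(1-3) B
    \<comment> \<open>The kernel of \<open>f\<close>, so that \<open>C(-, B) / Nf\<close> is the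
      image of \<open>f\<close> as a module in its own right.\<close>
    define Nf where "Nf = {x \<in> Arr C. cod x = B \<and> f \<cdot> x \<in> bd C X}"
    have Nf: "x \<in> Nf \<longleftrightarrow> arr x \<and> cod x = B \<and> f \<cdot> x \<in> bd C X" for x by (simp add: Nf_def)
    have RNf: "right_ideal C B Nf"
      using right_ideal_pullback[OF RX f] B by (simp add: Nf_def)
    have fN: "eqm C Nf x x' \<longleftrightarrow> eqb C X (f \<cdot> x) (f \<cdot> x')"
      if "arr x" "arr x'" "cod x = B" "cod x' = B" "dom x = dom x'" for x x'
      using that ty by (simp add: eqm_def Nf)
    have wN: "eqb C W (w \<cdot> x) (w \<cdot> x')" if "eqb C X x x'" "cod x = cobj X 0" for x x'
      by (rule eqm_map[OF that(1)]) (use that(2) ty s(14) in auto)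
    have yN: "eqb C X (y \<cdot> x) (y \<cdot> x')" if "eqb C Y x x'" "cod x = cobj Y 0" for x x'
      by (rule eqm_map[OF that(1)]) (use that(2) ty s(13) in auto)
    have aW: "a \<cdot> x \<in> bd C W1 \<longleftrightarrow> w \<cdot> (f \<cdot> x) \<in> bd C W" if x: "arr x" "cod x = B" for x
    proof -
      have "eqb C W (w \<cdot> f \<cdot> x) (z \<cdot> a \<cdot> x)" by (rule eqm_comp[OF RW a(4)]) (use x ty in auto)
      then show ?thesis using eqm_mem[OF RW] tt(10)[of "a \<cdot> x"] x ty by simp
    qed
    have am: "a \<in> mor C B (cobj W1 0)" and bm: "b \<in> mor C (cobj W1 0) B" using a b by (auto simp: mor_iff)
    have aN: "a \<cdot> x \<in> bd C W1" if "x \<in> Nf" for x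
      using that aW[of x] s(14)[of "f \<cdot> x"] by (auto simp: Nf)
    have ab: "eqb C W1 (a \<cdot> b) (Id C (cobj W1 0))"
    proof (rule ses_reflect[OF T])
      have "eqb C W (w \<cdot> f \<cdot> b) (z \<cdot> a \<cdot> b)" by (rule eqm_comp[OF RW a(4)]) (use ty in auto)
      then have "eqb C W z (z \<cdot> (a \<cdot> b))" using eqm_trans[OF RW b(4)] ty by simp
      then show "eqb C W (z \<cdot> (a \<cdot> b)) (z \<cdot> Id C (cobj W1 0))" using eqm_sym[OF RW] ty by simp
    qed (use ty in auto)
    \<comment> \<open>\<open>k\<close> generates the kernel of the map from the image of
      \<open>f\<close> to \<open>W1\<close>. Below, \<open>l\<close> expresses it by elements of
      \<open>Y\<close>, and \<open>splits\<close> at \<open>l\<close> yields \<open>Y1\<close> and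
      \<open>Y2\<close>.\<close>
    obtain k where k: "arr k" "cod k = B" "a \<cdot> k \<in> bd C W1"
      and ker: "\<And>x. x \<in> Arr C \<Longrightarrow> cod x = B \<Longrightarrow>
        a \<cdot> x \<in> bd C W1 \<longleftrightarrow> (\<exists>s\<in>mor C (dom x) (dom k). eqm C Nf x (k \<cdot> s))"
      using kernel_fg[OF RNf n_exactD(3)[OF W1] am bm aN ab] by blast
    define Q where "Q = dom k"
    have kQ: "dom k = Q" "obj Q" using k by (auto simp: Q_def)
    have "w \<cdot> (f \<cdot> k) \<in> bd C W" using aW[OF k(1,2)] k(3) by simp
    then obtain l where l: "arr l" "dom l = Q" "cod l = cobj Y 0" "eqb C X (f \<cdot> k) (y \<cdot> l)"
      using s(11)[of "f \<cdot> k"] k(1,2) kQ ty by (auto simp: mor_iff)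
    have "splits C \<A> Y l" using pbA YA l unfolding pb_def by blast
    then obtain Y1 Y2 y1 y2 c' c where Y1A: "Y1 \<in> \<A>" and Y2A: "Y2 \<in> \<A>"
      and U: "cses C Y1 y1 Y y2 Y2"
      and c': "arr c'" "dom c' = Q" "cod c' = cobj Y1 0" "eqb C Y l (y1 \<cdot> c')"
      and c: "arr c" "dom c = cobj Y1 0" "cod c = Q" "eqb C Y y1 (l \<cdot> c)"
      using l(2) by (auto simp: mor_iff elim!: splitsE)
    note uu = sesD[OF U]
    note RY1 = uu(1) and RY2 = uu(3)
    note ty = ty k(1,2) kQ l(1-3) uu(4-9,16-18) c(1-3) c'(1-3)
    have fk: "eqb C X (f \<cdot> (k \<cdot> x)) (y \<cdot> (l \<cdot> x))" if "arr x" "cod x = Q" for x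
      using eqm_comp[OF RX l(4) that(1)] that ty by simp
    have lc: "eqb C Y (y1 \<cdot> x) (l \<cdot> (c \<cdot> x))" if "arr x" "cod x = cobj Y1 0" for x
      using eqm_comp[OF RY c(4) that(1)] that ty by simp
    have lc': "eqb C Y (l \<cdot> x) (y1 \<cdot> (c' \<cdot> x))" if "arr x" "cod x = Q" for x
      using eqm_comp[OF RY c'(4) that(1)] that ty by simp
    have kc: "eqm C Nf k (k \<cdot> c \<cdot> c')"
    proof -
      have "eqb C Y l (l \<cdot> (c \<cdot> c'))" using eqm_trans[OF RY c'(4) lc[of c']] ty by simp
      then have "eqb C X (y \<cdot> l) (y \<cdot> (l \<cdot> (c \<cdot> c')))" by (rule yN) (use ty in auto)
      then have "eqb C X (f \<cdot> k) (y \<cdot> (l \<cdot> (c \<cdot> c')))" by (rule eqm_trans[OF RX l(4)])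
      then have "eqb C X (f \<cdot> k) (f \<cdot> (k \<cdot> (c \<cdot> c')))"
        using eqm_trans[OF RX] eqm_sym[OF RX fk[of "c \<cdot> c'"]] ty by simp
      then show ?thesis using fN[of k "k \<cdot> (c \<cdot> c')"] ty by simp
    qed
    have subS: "ses C (cobj Y1 0) (bd C Y1) (k \<cdot> c) B Nf a (cobj W1 0) (bd C W1)"
      unfolding ses_def
    proof (intro conjI ballI impI RY1 RNf RW1 am)
      show "k \<cdot> c \<in> mor C (cobj Y1 0) B" using ty by (simp add: mor_iff)
      show "\<exists>v\<in>mor C (cobj W1 0) B. eqb C W1 (a \<cdot> v) (Id C (cobj W1 0))" using bm ab by blast
    next
      fix x assume x: "arr x" "cod x = cobj Y1 0"
      have "k \<cdot> c \<cdot> x \<in> Nf \<longleftrightarrow> f \<cdot> (k \<cdot> (c \<cdot> x)) \<in> bd C X" using x ty by (simp add: Nf)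
      also have "\<dots> \<longleftrightarrow> y \<cdot> (l \<cdot> (c \<cdot> x)) \<in> bd C X" by (rule eqm_mem[OF RX fk]) (use x ty in auto)
      also have "\<dots> \<longleftrightarrow> l \<cdot> (c \<cdot> x) \<in> bd C Y" by (rule s(10)) (use x ty in auto)
      also have "\<dots> \<longleftrightarrow> y1 \<cdot> x \<in> bd C Y" by (rule eqm_mem[OF RY lc[OF x], symmetric])
      also have "\<dots> \<longleftrightarrow> x \<in> bd C Y1" by (rule uu(10)[OF x])
      finally show "k \<cdot> c \<cdot> x \<in> Nf \<longleftrightarrow> x \<in> bd C Y1" .
    next
      fix x assume x: "arr x" "cod x = B"
      have 1: "\<exists>d\<in>mor C (dom k) (dom (k \<cdot> c)). eqm C Nf k (k \<cdot> c \<cdot> d)"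
        using kc ty by (intro bexI[of _ c']) (auto simp: mor_iff)
      have 2: "\<exists>d\<in>mor C (dom (k \<cdot> c)) (dom k). eqm C Nf (k \<cdot> c) (k \<cdot> d)"
        using ty by (intro bexI[of _ c] eqm_refl[OF RNf]) (auto simp: mor_iff)
      have kct: "arr (k \<cdot> c)" "cod (k \<cdot> c) = B" "dom (k \<cdot> c) = cobj Y1 0" using ty by auto
      show "a \<cdot> x \<in> bd C W1 \<longleftrightarrow> (\<exists>r\<in>mor C (dom x) (cobj Y1 0). eqm C Nf x (k \<cdot> c \<cdot> r))"
        unfolding ker[OF x]
        using im_cong[OF RNf k(1,2) kct(1,2) 1, of "dom x" x] im_cong[OF RNf kct(1,2) k(1,2) 2, of "dom x" x]
        unfolding kct(3) by blast
    qed
    obtain H1 u1 where H1: "H1 \<in> ext n C \<A>" and u1: "qiso C (cobj H1 0) (bd C H1) B Nf u1"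
      by (rule ext_build[OF A n Y1A W1A subS])
    \<comment> \<open>The relations of the quotient: the boundaries of \<open>X\<close> enlarged by
      the image of \<open>f\<close>.\<close>
    define N' where "N' = {x \<in> Arr C. cod x = cobj X 0 \<and> (\<exists>s\<in>mor C (dom x) B. eqb C X x (f \<cdot> s))}"
    have N'I: "x \<in> N'" if "arr x" "cod x = cobj X 0" "arr s" "dom s = dom x" "cod s = B"
        "eqb C X x (f \<cdot> s)" for x s
      unfolding N'_def using that by (auto simp: mor_iff)
    have N'E: "\<exists>s. s \<in> Arr C \<and> dom s = dom x \<and> cod s = B \<and> eqb C X x (f \<cdot> s)" if "x \<in> N'" for x
      using that unfolding N'_def by (auto simp: mor_iff)
    have RN': "right_ideal C (cobj X 0) N'"
      unfolding right_ideal_def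
    proof (intro conjI ballI impI)
      show "obj (cobj X 0)" using ty by blast
      show "Zero C A (cobj X 0) \<in> N'" if "obj A" for A
        by (rule N'I[where s = "Zero C A B"]) (use that ty in \<open>auto intro!: eqm_refl[OF RX]\<close>)
    next
      fix x assume x: "x \<in> N'"
      show "arr x" "cod x = cobj X 0" using x by (auto simp: N'_def)
      note xt = this
      obtain r where r: "arr r" "dom r = dom x" "cod r = B" "eqb C X x (f \<cdot> r)" using N'E[OF x] by blast
      {
        fix x' assume x': "x' \<in> N'" and D: "dom x = dom x'"
        have xt': "arr x'" "cod x' = cobj X 0" using x' by (auto simp: N'_def)
        obtain r' where r': "arr r'" "dom r' = dom x'" "cod r' = B" "eqb C X x' (f \<cdot> r')" using N'E[OF x'] by blast
        have "eqb C X (x \<boxplus> x') (f \<cdot> r \<boxplus> f \<cdot> r')" by (rule eqm_add[OF RX r(4) r'(4) D])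
        then have "eqb C X (x \<boxplus> x') (f \<cdot> (r \<boxplus> r'))" using r r' D ty by simp
        then show "x \<boxplus> x' \<in> N'" by (rule N'I[rotated -1]) (use xt xt' r r' D in auto)
      next
        fix h assume h: "arr h" "cod h = dom x"
        have "eqb C X (x \<cdot> h) (f \<cdot> r \<cdot> h)" by (rule eqm_comp[OF RX r(4)]) (use h in auto)
        then have "eqb C X (x \<cdot> h) (f \<cdot> (r \<cdot> h))" using r h ty by simp
        then show "x \<cdot> h \<in> N'" by (rule N'I[rotated -1]) (use xt r h in auto)
      }
    qed
    have bdN': "x \<in> N'" if x: "x \<in> bd C X" for x
    proof -
      have xt: "arr x" "cod x = cobj X 0" using right_idealD[OF RX] x by auto
      have "eqb C X x (f \<cdot> Zero C (dom x) B)" using eqm_Zero[OF RX x] xt ty by simp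
      then show ?thesis by (rule N'I[rotated -1]) (use xt ty in auto)
    qed
    have eqN': "eqm C N' x x'" if "eqb C X x x'" for x x'
      using that bdN' by (auto simp: eqm_def)
    have memN': "x \<in> N' \<longleftrightarrow> x' \<in> N'" if "eqb C X x x'" for x x'
      by (rule eqm_mem[OF RN' eqN'[OF that]])
    have fN': "f \<cdot> x \<in> N'" if "arr x" "cod x = B" for x
      by (rule N'I[where s = x]) (use that ty in \<open>auto intro!: eqm_refl[OF RX]\<close>)
    have ylN': "y \<cdot> (l \<cdot> x) \<in> N'" if "arr x" "cod x = Q" for x
      using memN'[OF fk[OF that]] fN'[of "k \<cdot> x"] that ty by simp
    obtain v2 where v2: "arr v2" "dom v2 = cobj Y2 0" "cod v2 = cobj Y 0" "eqb C Y2 (y2 \<cdot> v2) (Id C (cobj Y2 0))"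
      using uu(12) by (auto simp: mor_iff)
    obtain v where v: "arr v" "dom v = cobj W 0" "cod v = cobj X 0" "eqb C W (w \<cdot> v) (Id C (cobj W 0))"
      using s(12) by (auto simp: mor_iff)
    obtain vt where vt: "arr vt" "dom vt = cobj W2 0" "cod vt = cobj W 0" "eqb C W2 (t \<cdot> vt) (Id C (cobj W2 0))"
      using tt(12) by (auto simp: mor_iff)
    note ty = ty v2(1-3) v(1-3) vt(1-3)
    have yv: "eqb C Y2 (y2 \<cdot> (v2 \<cdot> x)) x" if "arr x" "cod x = cobj Y2 0" for x
      using eqm_comp[OF RY2 v2(4) that(1)] that ty by simp
    have y2N: "eqb C Y2 (y2 \<cdot> x) (y2 \<cdot> x')" if "eqb C Y x x'" "cod x = cobj Y 0" for x x'
      by (rule eqm_map[OF that(1)]) (use that(2) ty uu(14) in auto)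
    have tN: "eqb C W2 (t \<cdot> x) (t \<cdot> x')" if "eqb C W x x'" "cod x = cobj W 0" for x x'
      by (rule eqm_map[OF that(1)]) (use that(2) ty tt(14) in auto)
    have y2l: "y2 \<cdot> (l \<cdot> x) \<in> bd C Y2" if x: "arr x" "cod x = Q" for x
    proof -
      have "eqb C Y2 (y2 \<cdot> (l \<cdot> x)) (y2 \<cdot> (y1 \<cdot> (c' \<cdot> x)))" by (rule y2N[OF lc'[OF x]]) (use x ty in auto)
      moreover have "y2 \<cdot> y1 \<cdot> (c' \<cdot> x) \<in> bd C Y2" by (rule right_idealD(6)[OF RY2 uu(15)]) (use x ty in auto)
      ultimately show ?thesis using eqm_mem[OF RY2] x ty by simp
    qed
    have twf: "t \<cdot> (w \<cdot> (f \<cdot> x)) \<in> bd C W2" if x: "arr x" "cod x = B" for x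
    proof -
      have "eqb C W (w \<cdot> f \<cdot> x) (z \<cdot> a \<cdot> x)" by (rule eqm_comp[OF RW a(4)]) (use x ty in auto)
      then have "eqb C W2 (t \<cdot> (w \<cdot> f \<cdot> x)) (t \<cdot> (z \<cdot> a \<cdot> x))" by (rule tN) (use x ty in auto)
      moreover have "t \<cdot> z \<cdot> (a \<cdot> x) \<in> bd C W2" by (rule right_idealD(6)[OF RW2 tt(15)]) (use x ty in auto)
      ultimately show ?thesis using eqm_mem[OF RW2] x ty by simp
    qed
    have quotS: "ses C (cobj Y2 0) (bd C Y2) (y \<cdot> v2) (cobj X 0) N' (t \<cdot> w) (cobj W2 0) (bd C W2)"
      unfolding ses_def
    proof (intro conjI ballI impI RY2 RN' RW2)
      show "y \<cdot> v2 \<in> mor C (cobj Y2 0) (cobj X 0)" "t \<cdot> w \<in> mor C (cobj X 0) (cobj W2 0)" using ty by (auto simp: mor_iff)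
    next
      have "eqb C W (w \<cdot> v \<cdot> vt) (Id C (cobj W 0) \<cdot> vt)" by (rule eqm_comp[OF RW v(4)]) (use ty in auto)
      then have "eqb C W2 (t \<cdot> (w \<cdot> v \<cdot> vt)) (t \<cdot> (Id C (cobj W 0) \<cdot> vt))" by (rule tN) (use ty in auto)
      then have "eqb C W2 (t \<cdot> w \<cdot> (v \<cdot> vt)) (Id C (cobj W2 0))"
        using eqm_trans[OF RW2 _ vt(4)] ty by simp
      then show "\<exists>v\<in>mor C (cobj W2 0) (cobj X 0). eqb C W2 (t \<cdot> w \<cdot> v) (Id C (cobj W2 0))"
        using ty by (intro bexI[of _ "v \<cdot> vt"]) (auto simp: mor_iff)
    next
      fix x assume x: "arr x" "cod x = cobj Y2 0"
      show "y \<cdot> v2 \<cdot> x \<in> N' \<longleftrightarrow> x \<in> bd C Y2"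
      proof
        \<comment> \<open>An element of \<open>Y\<close> lying in the image of \<open>f\<close> dies
          in \<open>W\<close>, hence comes from \<open>k\<close> and so from \<open>l\<close>, whose
          image in \<open>Y2\<close> is zero.\<close>
        assume "y \<cdot> v2 \<cdot> x \<in> N'"
        then obtain r where r: "arr r" "dom r = dom x" "cod r = B" "eqb C X (y \<cdot> v2 \<cdot> x) (f \<cdot> r)"
          using N'E x ty by fastforce
        have e: "eqb C W (w \<cdot> (y \<cdot> v2 \<cdot> x)) (w \<cdot> (f \<cdot> r))" by (rule wN[OF r(4)]) (use x ty in auto)
        have "w \<cdot> y \<cdot> (v2 \<cdot> x) \<in> bd C W" by (rule right_idealD(6)[OF RW s(15)]) (use x ty in auto)
        then have "w \<cdot> (f \<cdot> r) \<in> bd C W" using eqm_mem[OF RW e] x ty by simp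
        then obtain q where q: "arr q" "dom q = dom x" "cod q = Q" "eqm C Nf r (k \<cdot> q)"
          using aW[OF r(1,3)] ker[OF r(1,3)] r ty by (auto simp: mor_iff)
        have "eqb C X (f \<cdot> r) (f \<cdot> (k \<cdot> q))" using fN[of r "k \<cdot> q"] q r(1-3) ty by simp
        then have "eqb C X (y \<cdot> v2 \<cdot> x) (y \<cdot> (l \<cdot> q))"
          using eqm_trans[OF RX eqm_trans[OF RX r(4)] fk[OF q(1,3)]] by blast
        then have "eqb C X (y \<cdot> (v2 \<cdot> x)) (y \<cdot> (l \<cdot> q))" using x ty by simp
        then have "eqb C Y (v2 \<cdot> x) (l \<cdot> q)" by (rule ses_reflect[OF S]) (use x q ty in auto)
        then have "eqb C Y2 (y2 \<cdot> (v2 \<cdot> x)) (y2 \<cdot> (l \<cdot> q))" by (rule y2N) (use x ty in auto)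
        then have "y2 \<cdot> (v2 \<cdot> x) \<in> bd C Y2" using eqm_mem[OF RY2] y2l[OF q(1,3)] by blast
        then show "x \<in> bd C Y2" using eqm_mem[OF RY2 yv[OF x]] by blast
      next
        assume "x \<in> bd C Y2"
        then have "y2 \<cdot> (v2 \<cdot> x) \<in> bd C Y2" using eqm_mem[OF RY2 yv[OF x]] by blast
        then obtain r where r: "arr r" "dom r = dom x" "cod r = cobj Y1 0" "eqb C Y (v2 \<cdot> x) (y1 \<cdot> r)"
          using uu(11)[of "v2 \<cdot> x"] x ty by (auto simp: mor_iff)
        have "eqb C Y (v2 \<cdot> x) (l \<cdot> (c \<cdot> r))" by (rule eqm_trans[OF RY r(4) lc[OF r(1,3)]])
        then have "eqb C X (y \<cdot> (v2 \<cdot> x)) (y \<cdot> (l \<cdot> (c \<cdot> r)))" by (rule yN) (use x ty in auto)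
        then have "y \<cdot> (v2 \<cdot> x) \<in> N'" using memN' ylN'[of "c \<cdot> r"] r ty by simp
        then show "y \<cdot> v2 \<cdot> x \<in> N'" using x ty by simp
      qed
    next
      fix x assume x: "arr x" "cod x = cobj X 0"
      show "t \<cdot> w \<cdot> x \<in> bd C W2 \<longleftrightarrow> (\<exists>r\<in>mor C (dom x) (cobj Y2 0). eqm C N' x (y \<cdot> v2 \<cdot> r))"
      proof
        assume "t \<cdot> w \<cdot> x \<in> bd C W2"
        then have "t \<cdot> (w \<cdot> x) \<in> bd C W2" using x ty by simp
        then obtain r where r: "arr r" "dom r = dom x" "cod r = cobj W1 0" "eqb C W (w \<cdot> x) (z \<cdot> r)"
          using tt(11)[of "w \<cdot> x"] x ty by (auto simp: mor_iff)
        have "eqb C W (z \<cdot> r) (w \<cdot> f \<cdot> b \<cdot> r)" by (rule eqm_comp[OF RW b(4)]) (use r ty in auto)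
        then have "eqb C W (w \<cdot> x) (w \<cdot> (f \<cdot> (b \<cdot> r)))" using eqm_trans[OF RW r(4)] r ty by simp
        then have "w \<cdot> sub C x (f \<cdot> (b \<cdot> r)) \<in> bd C W" using eqmD(5) x r(1-3) ty by fastforce
        then obtain q where q: "arr q" "dom q = dom x" "cod q = cobj Y 0"
          "eqb C X (sub C x (f \<cdot> (b \<cdot> r))) (y \<cdot> q)"
          using s(11)[of "sub C x (f \<cdot> (b \<cdot> r))"] x r(1-3) ty by (auto simp: mor_iff)
        \<comment> \<open>\<open>x\<close> has been corrected by an element of the image of
          \<open>f\<close> to \<open>y q\<close>. Now \<open>q\<close> is compared with its
          representative \<open>v2 y2 q\<close>; the difference lies in \<open>Y1\<close>, so
          \<open>y\<close> takes it into the image of \<open>f\<close> again.\<close>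
        let ?q' = "sub C q (v2 \<cdot> (y2 \<cdot> q))"
        have "eqb C Y2 (y2 \<cdot> (v2 \<cdot> (y2 \<cdot> q))) (y2 \<cdot> q)" by (rule yv) (use q ty in auto)
        then have "y2 \<cdot> ?q' \<in> bd C Y2" using eqmD(5)[OF eqm_sym[OF RY2]] q(1-3) ty by fastforce
        then obtain p where p: "arr p" "dom p = dom x" "cod p = cobj Y1 0" "eqb C Y ?q' (y1 \<cdot> p)"
          using uu(11)[of ?q'] q(1-3) ty by (auto simp: mor_iff)
        have "eqb C Y ?q' (l \<cdot> (c \<cdot> p))" by (rule eqm_trans[OF RY p(4) lc[OF p(1,3)]])
        then have "eqb C X (y \<cdot> ?q') (y \<cdot> (l \<cdot> (c \<cdot> p)))" by (rule yN) (use q ty in auto)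
        then have yq: "y \<cdot> ?q' \<in> N'" using memN' ylN'[of "c \<cdot> p"] p ty by simp
        have fb: "f \<cdot> (b \<cdot> r) \<in> N'" by (rule fN') (use r ty in auto)
        have 1: "sub C (sub C x (f \<cdot> (b \<cdot> r))) (y \<cdot> q) \<in> N'" using bdN' eqmD(5)[OF q(4)] by blast
        have 2: "f \<cdot> (b \<cdot> r) \<boxplus> y \<cdot> ?q' \<in> N'"
          by (rule right_idealD(5)[OF RN' fb yq]) (use r(1-3) q(1-3) ty in simp)
        have "sub C (sub C x (f \<cdot> (b \<cdot> r))) (y \<cdot> q) \<boxplus> (f \<cdot> (b \<cdot> r) \<boxplus> y \<cdot> ?q') \<in> N'"
          by (rule right_idealD(5)[OF RN' 1 2]) (use x r(1-3) q(1-3) ty in simp)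
        moreover have "sub C (sub C x (f \<cdot> (b \<cdot> r))) (y \<cdot> q) \<boxplus> (f \<cdot> (b \<cdot> r) \<boxplus> y \<cdot> ?q') = sub C x (y \<cdot> v2 \<cdot> (y2 \<cdot> q))"
          using x r(1-3) q(1-3) ty by (simp add: add_ac)
        ultimately have "eqm C N' x (y \<cdot> v2 \<cdot> (y2 \<cdot> q))" using x q(1-3) ty by (simp add: eqm_def)
        then show "\<exists>r\<in>mor C (dom x) (cobj Y2 0). eqm C N' x (y \<cdot> v2 \<cdot> r)"
          using q(1-3) ty by (intro bexI[of _ "y2 \<cdot> q"]) (auto simp: mor_iff)
      next
        assume "\<exists>r\<in>mor C (dom x) (cobj Y2 0). eqm C N' x (y \<cdot> v2 \<cdot> r)"
        then obtain r where r: "arr r" "dom r = dom x" "cod r = cobj Y2 0" "sub C x (y \<cdot> v2 \<cdot> r) \<in> N'"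
          by (auto simp: mor_iff eqm_def)
        let ?x = "sub C x (y \<cdot> v2 \<cdot> r)"
        have xt: "arr ?x" "dom ?x = dom x" "cod ?x = cobj X 0" using x r(1-3) ty by simp_all
        obtain q where q: "arr q" "dom q = dom x" "cod q = B" "eqb C X ?x (f \<cdot> q)"
          using N'E[OF r(4)] unfolding xt(2) by blast
        have "eqb C W2 (t \<cdot> (w \<cdot> ?x)) (t \<cdot> (w \<cdot> (f \<cdot> q)))" by (rule tN[OF wN[OF q(4)]]) (use xt ty in auto)
        then have 1: "t \<cdot> (w \<cdot> ?x) \<in> bd C W2" using eqm_mem[OF RW2] twf[OF q(1,3)] by blast
        have "t \<cdot> (w \<cdot> y) \<cdot> (v2 \<cdot> r) \<in> bd C W2"
          by (rule right_idealD(6)[OF RW2 tt(14)[OF s(15)]]) (use r ty in auto)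
        then have "t \<cdot> (w \<cdot> ?x) \<boxplus> t \<cdot> (w \<cdot> y) \<cdot> (v2 \<cdot> r) \<in> bd C W2"
          by (intro right_idealD(5)[OF RW2 1]) (use x r(1-3) ty in auto)
        moreover have "t \<cdot> (w \<cdot> ?x) \<boxplus> t \<cdot> (w \<cdot> y) \<cdot> (v2 \<cdot> r) = t \<cdot> w \<cdot> x" using x r(1-3) ty by simp
        ultimately show "t \<cdot> w \<cdot> x \<in> bd C W2" by simp
      qed
    qed
    obtain H2 u2 where H2: "H2 \<in> ext n C \<A>" and u2: "qiso C (cobj H2 0) (bd C H2) (cobj X 0) N' u2"
      by (rule ext_build[OF A n Y2A W2A quotS])
    \<comment> \<open>\<open>H1\<close> and \<open>H2\<close> present the image and the quotient
      only up to isomorphism; composing with these isomorphisms gives the sequence for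
      \<open>X\<close>.\<close>
    obtain u1' where u1': "qiso C B Nf (cobj H1 0) (bd C H1) u1'" "eqm C Nf (u1 \<cdot> u1') (Id C B)"
      using u1 by (rule qiso_sym)
    obtain u2' where u2': "qiso C (cobj X 0) N' (cobj H2 0) (bd C H2) u2'" "eqb C H2 (u2' \<cdot> u2) (Id C (cobj H2 0))"
      using u2 by (rule qiso_sym)
    note u1D = qisoD[OF u1] and u2D = qisoD[OF u2] and u1D' = qisoD[OF u1'(1)] and u2D' = qisoD[OF u2'(1)]
    have fu: "eqb C X f (f \<cdot> u1 \<cdot> u1')"
    proof -
      have "eqb C X (f \<cdot> (u1 \<cdot> u1')) (f \<cdot> Id C B)" using u1'(2) fN[of "u1 \<cdot> u1'" "Id C B"] u1D(3-5) u1D'(3-5) ty by simp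
      then show ?thesis using eqm_sym[OF RX] u1D(3-5) u1D'(3-5) ty by simp
    qed
    have fut: "arr (f \<cdot> u1)" "dom (f \<cdot> u1) = cobj H1 0" "cod (f \<cdot> u1) = cobj X 0" using u1D(3-5) ty by auto
    have im1: "\<exists>d\<in>mor C (dom f) (dom (f \<cdot> u1)). eqb C X f (f \<cdot> u1 \<cdot> d)"
      using fu u1D'(3-5) fut ty by (intro bexI[of _ u1']) (auto simp: mor_iff)
    have im2: "\<exists>d\<in>mor C (dom (f \<cdot> u1)) (dom f). eqb C X (f \<cdot> u1) (f \<cdot> d)"
      using u1D(3-5) fut ty by (intro bexI[of _ u1] eqm_refl[OF RX]) (auto simp: mor_iff)
    have "cses C H1 (f \<cdot> u1) X u2' H2"
      unfolding ses_def
    proof (intro conjI ballI impI u1D(1) RX u2D(1))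
      show "f \<cdot> u1 \<in> mor C (cobj H1 0) (cobj X 0)" "u2' \<in> mor C (cobj X 0) (cobj H2 0)"
        using fut u2D'(3-5) by (auto simp: mor_iff)
      show "\<exists>v\<in>mor C (cobj H2 0) (cobj X 0). eqb C H2 (u2' \<cdot> v) (Id C (cobj H2 0))"
        using u2'(2) u2D(3-5) by (intro bexI[of _ u2]) (auto simp: mor_iff)
    next
      fix x assume x: "arr x" "cod x = cobj H1 0"
      show "f \<cdot> u1 \<cdot> x \<in> bd C X \<longleftrightarrow> x \<in> bd C H1"
        using u1D(7)[OF x] x u1D(3-5) ty by (simp add: Nf)
    next
      fix x assume x: "arr x" "cod x = cobj X 0"
      have "u2' \<cdot> x \<in> bd C H2 \<longleftrightarrow> x \<in> N'" by (rule u2D'(7)[OF x])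
      also have "\<dots> \<longleftrightarrow> (\<exists>r\<in>mor C (dom x) (dom f). eqb C X x (f \<cdot> r))" using x ty by (simp add: N'_def)
      also have "\<dots> \<longleftrightarrow> (\<exists>r\<in>mor C (dom x) (dom (f \<cdot> u1)). eqb C X x (f \<cdot> u1 \<cdot> r))"
        using im_cong[OF RX f fut(1,3) im1, of "dom x" x] im_cong[OF RX fut(1,3) f im2, of "dom x" x] by blast
      finally show "u2' \<cdot> x \<in> bd C H2 \<longleftrightarrow> (\<exists>r\<in>mor C (dom x) (cobj H1 0). eqb C X x (f \<cdot> u1 \<cdot> r))"
        unfolding fut(2) .
    qed
    then show ?thesis by (rule splitsI[OF H1 H2]) (use im1 im2 fut in simp_all)
  qed
  then show "X \<in> pb C (ext n C \<A>)" unfolding pb_def using Xe by blast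
qed

end

section \<open>The greatest stable class\<close>

text \<open>A post-fixed point of \<open>pb\<close> whose reversal is one too; for a closed class
  the second half amounts to being contained in its own \<open>po\<close>.\<close>

definition stable :: "nat \<Rightarrow> ('o, 'm) cat \<Rightarrow> ('o, 'm) cplx set \<Rightarrow> bool" where
  "stable n C \<A> \<longleftrightarrow> closed_class n C \<A> \<and> \<A> \<subseteq> pb C \<A> \<and> opc n C \<A> \<subseteq> pb (op_cat C) (opc n C \<A>)"

definition pb_inf :: "nat \<Rightarrow> ('o, 'm) cat \<Rightarrow> ('o, 'm) cplx set" where
  "pb_inf n C = (\<Inter>j. (pb C ^^ j) {X. n_exact n C X})"

definition max_class :: "nat \<Rightarrow> ('o, 'm) cat \<Rightarrow> ('o, 'm) cplx set" where
  "max_class n C = (\<Inter>i. (po n C ^^ i) (pb_inf n C))"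

text \<open>The sequences that present the zero module. They form a stable class, which brings the
  zero complexes into \<open>max_class\<close>.\<close>

definition contractible :: "nat \<Rightarrow> ('o, 'm) cat \<Rightarrow> ('o, 'm) cplx set" where
  "contractible n C = {X. n_exact n C X \<and> Id C (cobj X 0) \<in> bd C X}"

context additive_category begin

section \<open>Uniqueness of images and intersections of classes\<close>

lemma ses_unique_sub:
  assumes S: "ses C P1 N1 y P N w P2 N2" and S': "ses C P1' N1' y' P N w' P2' N2'"
    and p: "\<exists>p\<in>mor C P1 P1'. eqm C N y (y' \<cdot> p)" and q: "\<exists>q\<in>mor C P1' P1. eqm C N y' (y \<cdot> q)"
  shows "\<exists>p. qiso C P1 N1 P1' N1' p"
proof -
  note s = sesD[OF S] and s' = sesD[OF S']
  obtain p q where p: "arr p" "dom p = P1" "cod p = P1'" "eqm C N y (y' \<cdot> p)"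
    and q: "arr q" "dom q = P1'" "cod q = P1" "eqm C N y' (y \<cdot> q)" using p q by (auto simp: mor_iff)
  note t = s(4-6,16) s'(4-6,16) p(1-3) q(1-3)
  have yp: "eqm C N (y \<cdot> h) (y' \<cdot> (p \<cdot> h))" if "arr h" "cod h = P1" for h
    using eqm_comp[OF s(2) p(4) that(1)] that t by simp
  have yq: "eqm C N (y' \<cdot> h) (y \<cdot> (q \<cdot> h))" if "arr h" "cod h = P1'" for h
    using eqm_comp[OF s(2) q(4) that(1)] that t by simp
  have "qiso C P1 N1 P1' N1' p"
  proof (rule qisoI[OF s(1) s'(1), of _ q])
    show "p \<in> mor C P1 P1'" "q \<in> mor C P1' P1" using t by (auto simp: mor_iff)
  next
    fix a assume a: "a \<in> N1"
    have at: "arr a" "cod a = P1" using right_idealD[OF s(1)] a by auto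
    have "y' \<cdot> (p \<cdot> a) \<in> N" using eqm_mem[OF s(2) yp[OF at]] s(13)[OF a] by blast
    then show "p \<cdot> a \<in> N1'" using s'(10)[of "p \<cdot> a"] at t by simp
  next
    fix a assume a: "a \<in> N1'"
    have at: "arr a" "cod a = P1'" using right_idealD[OF s'(1)] a by auto
    have "y \<cdot> (q \<cdot> a) \<in> N" using eqm_mem[OF s(2) yq[OF at]] s'(13)[OF a] by blast
    then show "q \<cdot> a \<in> N1" using s(10)[of "q \<cdot> a"] at t by simp
  next
    have "eqm C N y' (y' \<cdot> (p \<cdot> q))" by (rule eqm_trans[OF s(2) q(4) yp]) (use t in auto)
    then have "eqm C N (y' \<cdot> (p \<cdot> q)) (y' \<cdot> Id C P1')" using eqm_sym[OF s(2)] t by simp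
    then show "eqm C N1' (p \<cdot> q) (Id C P1')" by (rule ses_reflect[OF S']) (use t in auto)
    have "eqm C N y (y \<cdot> (q \<cdot> p))" by (rule eqm_trans[OF s(2) p(4) yq]) (use t in auto)
    then have "eqm C N (y \<cdot> (q \<cdot> p)) (y \<cdot> Id C P1)" using eqm_sym[OF s(2)] t by simp
    then show "eqm C N1 (q \<cdot> p) (Id C P1)" by (rule ses_reflect[OF S]) (use t in auto)
  qed
  then show ?thesis by blast
qed

lemma ses_quot_map:
  assumes S: "ses C P1 N1 y P N w P2 N2" and S': "ses C P1' N1' y' P N w' P2' N2'"
    and ker: "\<And>x. x \<in> Arr C \<Longrightarrow> cod x = P \<Longrightarrow> w \<cdot> x \<in> N2 \<longleftrightarrow> w' \<cdot> x \<in> N2'"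
    and v: "arr v" "dom v = P2" "cod v = P" "eqm C N2 (w \<cdot> v) (Id C P2)"
    and v': "arr v'" "dom v' = P2'" "cod v' = P" "eqm C N2' (w' \<cdot> v') (Id C P2')"
  shows "a \<in> N2 \<Longrightarrow> w' \<cdot> v \<cdot> a \<in> N2'" "eqm C N2' (w' \<cdot> v \<cdot> (w \<cdot> v')) (Id C P2')"
proof -
  note s = sesD[OF S] and s' = sesD[OF S']
  note t = s(7-9,17,18) s'(7-9,18) v(1-3) v'(1-3)
  have wv: "eqm C N2 (w \<cdot> (v \<cdot> h)) h" if "arr h" "cod h = P2" for h
    using eqm_comp[OF s(3) v(4) that(1)] that t by simp
  show "w' \<cdot> v \<cdot> a \<in> N2'" if a: "a \<in> N2"
  proof -
    have at: "arr a" "cod a = P2" using right_idealD[OF s(3)] a by auto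
    have "w \<cdot> (v \<cdot> a) \<in> N2" using eqm_mem[OF s(3) wv[OF at]] a by blast
    then show ?thesis using ker[of "v \<cdot> a"] at t by simp
  qed
  have "eqm C N2 (w \<cdot> (v \<cdot> (w \<cdot> v'))) (w \<cdot> v')" by (rule wv) (use t in auto)
  then have "w \<cdot> sub C (v \<cdot> (w \<cdot> v')) v' \<in> N2" using eqmD(5) t by fastforce
  then have "w' \<cdot> sub C (v \<cdot> (w \<cdot> v')) v' \<in> N2'" using ker[of "sub C (v \<cdot> (w \<cdot> v')) v'"] t by simp
  then have "eqm C N2' (w' \<cdot> v \<cdot> (w \<cdot> v')) (w' \<cdot> v')" using t by (simp add: eqm_def)
  then show "eqm C N2' (w' \<cdot> v \<cdot> (w \<cdot> v')) (Id C P2')" by (rule eqm_trans[OF s'(3) _ v'(4)])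
qed

text \<open>Both quotients are taken by the same kernel, so either projection composed with a
  section of the other is an isomorphism.\<close>

lemma ses_unique_quot:
  assumes S: "ses C P1 N1 y P N w P2 N2" and S': "ses C P1' N1' y' P N w' P2' N2'"
    and ker: "\<And>x. x \<in> Arr C \<Longrightarrow> cod x = P \<Longrightarrow> w \<cdot> x \<in> N2 \<longleftrightarrow> w' \<cdot> x \<in> N2'"
  shows "\<exists>p. qiso C P2 N2 P2' N2' p"
proof -
  note s = sesD[OF S] and s' = sesD[OF S']
  obtain v where v: "arr v" "dom v = P2" "cod v = P" "eqm C N2 (w \<cdot> v) (Id C P2)"
    using s(12) by (auto simp: mor_iff)
  obtain v' where v': "arr v'" "dom v' = P2'" "cod v' = P" "eqm C N2' (w' \<cdot> v') (Id C P2')"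
    using s'(12) by (auto simp: mor_iff)
  have "qiso C P2 N2 P2' N2' (w' \<cdot> v)"
    by (rule qisoI[OF s(3) s'(3), of _ "w \<cdot> v'"])
      (use ses_quot_map[OF S S' ker v v'] ses_quot_map[OF S' S ker[symmetric] v' v] v(1-3) v'(1-3) s(7-9) s'(7-9)
        in \<open>auto simp: mor_iff\<close>)
  then show ?thesis by blast
qed

text \<open>Image and quotient are determined up to isomorphism. So the pair found in
  \<open>\<A> 0\<close> is isomorphic to the pair found in any \<open>\<A> i\<close>, which contains
  it because it is closed.\<close>

lemma splits_Inter:
  assumes A: "\<And>i::nat. closed_class n C (\<A> i)" and sp: "\<And>i. splits C (\<A> i) X f" and X: "n_exact n C X"
    and f: "arr f" "cod f = cobj X 0"
  shows "splits C (\<Inter>i. \<A> i) X f"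
proof -
  note R = n_exactD(4)[OF X]
  obtain Y W y w where Y: "Y \<in> \<A> 0" and W: "W \<in> \<A> 0"
      and S: "cses C Y y X w W"
      and e1: "\<exists>a\<in>mor C (dom f) (cobj Y 0). eqb C X f (y \<cdot> a)"
      and e2: "\<exists>b\<in>mor C (cobj Y 0) (dom f). eqb C X y (f \<cdot> b)"
    using sp[of 0] by (rule splitsE)
  note s = sesD[OF S]
  have "Y \<in> \<A> i \<and> W \<in> \<A> i" for i
  proof -
    obtain Y' W' y' w' where Y': "Y' \<in> \<A> i" and W': "W' \<in> \<A> i"
        and S': "cses C Y' y' X w' W'"
        and e1': "\<exists>a\<in>mor C (dom f) (cobj Y' 0). eqb C X f (y' \<cdot> a)"
        and e2': "\<exists>b\<in>mor C (cobj Y' 0) (dom f). eqb C X y' (f \<cdot> b)"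
      using sp[of i] by (rule splitsE)
    note s' = sesD[OF S']
    have p: "\<exists>p\<in>mor C (cobj Y' 0) (cobj Y 0). eqb C X y' (y \<cdot> p)"
      using im_cong[OF R f s(4,6), of "cobj Y' 0" y'] e1 e2' s(5) by simp
    have q: "\<exists>p\<in>mor C (cobj Y 0) (cobj Y' 0). eqb C X y (y' \<cdot> p)"
      using im_cong[OF R f s'(4,6), of "cobj Y 0" y] e1' e2 s'(5) by simp
    have ker: "w' \<cdot> x \<in> bd C W' \<longleftrightarrow> w \<cdot> x \<in> bd C W" if "arr x" "cod x = cobj X 0" for x
      using s(11)[OF that] s'(11)[OF that] im_cong[OF R s(4,6) s'(4,6), of "dom x" x] im_cong[OF R s'(4,6) s(4,6), of "dom x" x]
        p q unfolding s(5) s'(5) by blast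
    obtain u where u: "cqiso C Y' Y u"
      using ses_unique_sub[OF S' S p q] by blast
    obtain u' where u': "cqiso C W' W u'"
      using ses_unique_quot[OF S' S ker] by blast
    show ?thesis
      using closed_qiso[OF A Y' closedD[OF A Y] u] closed_qiso[OF A W' closedD[OF A W] u'] by blast
  qed
  then show ?thesis by (intro splitsI[OF _ _ S e1 e2]) auto
qed

lemma closed_Inter:
  assumes A: "\<And>i::nat. closed_class n C (\<A> i)"
  shows "closed_class n C (\<Inter>i. \<A> i)"
proof (rule closed_classI)
  show "X \<in> (\<Inter>i. \<A> i) \<Longrightarrow> n_exact n C X" for X using closedD[OF A] by blast
next
  fix X Y u assume "X \<in> (\<Inter>i. \<A> i)" "n_exact n C Y" "cqiso C X Y u"
  then show "Y \<in> (\<Inter>i. \<A> i)" using closed_qiso[OF A] by blast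
qed

lemma closed_all: "closed_class n C {X. n_exact n C X}"
  by (rule closed_classI) auto

lemma closed_pb_pow: "closed_class n C ((pb C ^^ j) {X. n_exact n C X})"
  by (induction j) (simp_all add: closed_all closed_pb)

lemma closed_pb_inf: "closed_class n C (pb_inf n C)"
  unfolding pb_inf_def by (rule closed_Inter[OF closed_pb_pow])

lemma closed_po_pow: "closed_class n C ((po n C ^^ i) (pb_inf n C))"
  by (induction i) (simp_all add: closed_pb_inf closed_po)

lemma closed_max_class: "closed_class n C (max_class n C)"
  unfolding max_class_def by (rule closed_Inter[OF closed_po_pow])

text \<open>Countably many steps suffice: membership in step j+1 gives witnesses in step j, and
  \<open>splits_Inter\<close> merges them.\<close>

lemma pb_pb_inf: "pb_inf n C \<subseteq> pb C (pb_inf n C)"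
proof
  fix X assume X: "X \<in> pb_inf n C"
  have "splits C (pb_inf n C) X f" if f: "arr f" "cod f = cobj X 0" for f
    unfolding pb_inf_def
  proof (rule splits_Inter[OF closed_pb_pow _ closedD[OF closed_pb_inf X] f])
    fix j
    have "X \<in> (pb C ^^ Suc j) {X. n_exact n C X}" using X unfolding pb_inf_def by blast
    then show "splits C ((pb C ^^ j) {X. n_exact n C X}) X f" using f by (simp add: pb_def)
  qed
  then show "X \<in> pb C (pb_inf n C)" unfolding pb_def using X by blast
qed

lemma pb_po_pow: "n \<ge> 1 \<Longrightarrow> (po n C ^^ i) (pb_inf n C) \<subseteq> pb C ((po n C ^^ i) (pb_inf n C))"
proof (induction i)
  case 0 then show ?case using pb_pb_inf by simp
next
  case (Suc i)
  then show ?case using pb_po[OF closed_po_pow] by simp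
qed

text \<open>Both properties pass to the intersection by \<open>splits_Inter\<close>, the first
  because every iterate has it by \<open>pb_po\<close>, the second because step i+1 is
  \<open>po\<close> of step i.\<close>

lemma stable_max_class:
  assumes n: "n \<ge> 1" shows "stable n C (max_class n C)"
proof -
  interpret op: additive_category "op_cat C" by (rule op_additive)
  let ?B = "\<lambda>i. (po n C ^^ i) (pb_inf n C)"
  have 1: "max_class n C \<subseteq> pb C (max_class n C)"
  proof
    fix X assume X: "X \<in> max_class n C"
    have "splits C (max_class n C) X f" if f: "arr f" "cod f = cobj X 0" for f
      unfolding max_class_def
    proof (rule splits_Inter[OF closed_po_pow _ closedD[OF closed_max_class X] f])
      fix i
      have "X \<in> pb C (?B i)" using X pb_po_pow[OF n, of i] unfolding max_class_def by blast
      then show "splits C (?B i) X f" using f by (simp add: pb_def)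
    qed
    then show "X \<in> pb C (max_class n C)" unfolding pb_def using X by blast
  qed
  have op_Int: "opc n C (max_class n C) = (\<Inter>i. opc n C (?B i))"
    unfolding max_class_def opc_def by blast
  have 2: "opc n C (max_class n C) \<subseteq> pb Cop (opc n C (max_class n C))"
  proof
    fix Z assume Z: "Z \<in> opc n C (max_class n C)"
    have nZ: "n_exact n Cop Z" using Z by (simp add: opc_def)
    have "splits Cop (opc n C (max_class n C)) Z f" if f: "f \<in> Arr Cop" "Cod Cop f = cobj Z 0" for f
      unfolding op_Int
    proof (rule op.splits_Inter[OF closed_opc[OF closed_po_pow] _ nZ f])
      fix i
      have "op_cplx n Z \<in> ?B (Suc i)" using Z unfolding opc_def max_class_def by blast
      then have "op_cplx n (op_cplx n Z) \<in> pb Cop (opc n C (?B i))" by (simp add: po_iff)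
      then have "Z \<in> pb Cop (opc n C (?B i))"
        using op.closed_cagree[OF op.closed_pb[OF closed_opc[OF closed_po_pow]] cagree_op_op] by blast
      then show "splits Cop (opc n C (?B i)) Z f" using f by (simp add: pb_def)
    qed
    then show "Z \<in> pb Cop (opc n C (max_class n C))" unfolding pb_def using Z by blast
  qed
  show ?thesis unfolding stable_def using closed_max_class 1 2 by blast
qed

text \<open>By monotonicity a post-fixed point of both operations is contained in every stage of
  both iterations.\<close>

lemma stable_le_max_class:
  assumes "stable n C \<A>" shows "\<A> \<subseteq> max_class n C"
proof -
  have A: "closed_class n C \<A>" "\<A> \<subseteq> pb C \<A>" "opc n C \<A> \<subseteq> pb Cop (opc n C \<A>)"
    using assms by (auto simp: stable_def)
  have poA: "\<A> \<subseteq> po n C \<A>"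
    using opc_mono[OF A(3), of n "op_cat C"] opc_opc[OF A(1)] unfolding po_def by simp
  have "\<A> \<subseteq> (pb C ^^ j) {X. n_exact n C X}" for j
  proof (induction j)
    case 0 show ?case using closedD[OF A(1)] by auto
  next
    case (Suc j) then show ?case using pb_mono[OF Suc] A(2) by auto
  qed
  then have "\<A> \<subseteq> pb_inf n C" unfolding pb_inf_def by blast
  then have "\<A> \<subseteq> (po n C ^^ i) (pb_inf n C)" for i
  proof (induction i)
    case (Suc i) then show ?case using po_mono[OF Suc.IH[OF Suc.prems], of n C] poA by auto
  qed simp
  then show ?thesis unfolding max_class_def by blast
qed

text \<open>Extensions dualise by \<open>ext_op\<close>, so \<open>ext\<close> commutes with
  reversal and \<open>ext_pb\<close> may be applied in both categories.\<close>

lemma stable_ext: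
  assumes n: "n \<ge> 1" and S: "stable n C \<A>" shows "stable n C (ext n C \<A>)"
proof -
  interpret op: additive_category "op_cat C" by (rule op_additive)
  have A: "closed_class n C \<A>" "\<A> \<subseteq> pb C \<A>" "opc n C \<A> \<subseteq> pb Cop (opc n C \<A>)"
    using S by (auto simp: stable_def)
  have sub: "ext n Cop (opc n C \<A>) \<subseteq> opc n C (ext n C \<A>)"
  proof
    fix Z assume Z: "Z \<in> ext n Cop (opc n C \<A>)"
    then have "op_cplx n Z \<in> ext n C \<A>"
      using op.ext_op[OF closed_opc[OF A(1)] n Z] opc_opc[OF A(1)] by simp
    moreover have "n_exact n Cop Z" using Z unfolding ext_def by blast
    ultimately show "Z \<in> opc n C (ext n C \<A>)" by (simp add: opc_def)
  qed
  have "opc n C (ext n C \<A>) \<subseteq> pb Cop (opc n C (ext n C \<A>))"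
  proof
    fix Z assume Z: "Z \<in> opc n C (ext n C \<A>)"
    then have "op_cplx n (op_cplx n Z) \<in> ext n Cop (opc n C \<A>)"
      using ext_op[OF A(1) n] by (simp add: opc_def)
    then have "Z \<in> ext n Cop (opc n C \<A>)"
      by (rule op.closed_cagree[OF op.closed_ext cagree_op_op])
    then have "Z \<in> pb Cop (ext n Cop (opc n C \<A>))"
      using op.ext_pb[OF closed_opc[OF A(1)] A(3) n] by blast
    then show "Z \<in> pb Cop (opc n C (ext n C \<A>))" using pb_mono[OF sub] by blast
  qed
  then show ?thesis unfolding stable_def using closed_ext ext_pb[OF A(1,2) n] by blast
qed

lemma ext_max_class: "n \<ge> 1 \<Longrightarrow> ext n C (max_class n C) \<subseteq> max_class n C"
  by (intro stable_le_max_class stable_ext stable_max_class)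

end

lemma weak_kernel_op [simp]: "weak_kernel (op_cat C) f g = weak_cokernel C f g"
  by (auto simp: weak_kernel_def weak_cokernel_def)

section \<open>Deflations under duality and the zero complexes\<close>

context additive_category begin

lemma deflation_opc:
  assumes "closed_class n C \<A>"
  shows "deflation (opc n C \<A>) f \<longleftrightarrow> inflation n \<A> f"
proof
  assume "deflation (opc n C \<A>) f"
  then obtain X where "X \<in> opc n C \<A>" "f = cdiff X 1" by (auto simp: deflation_def)
  then show "inflation n \<A> f" unfolding inflation_def
    by (intro bexI[of _ "op_cplx n X"]) (auto simp: opc_def op_cplx_def)
next
  assume "inflation n \<A> f"
  then obtain X where "X \<in> \<A>" "f = cdiff X (n + 1)" by (auto simp: inflation_def)
  then show "deflation (opc n C \<A>) f"
    unfolding deflation_def using opc_iff[OF assms]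
    by (intro bexI[of _ "op_cplx n X"]) (auto simp: op_cplx_def)
qed

lemma closed_contractible: "closed_class n C (contractible n C)"
proof (rule closed_classI)
  fix X Y u assume X: "X \<in> contractible n C" and Y: "n_exact n C Y"
    and u: "cqiso C X Y u"
  obtain v where v: "cqiso C Y X v" using u by (rule qiso_sym)
  note vD = qisoD[OF v] and c = n_exactD(5)[OF Y]
  have c': "obj (cobj X 0)" "Id C (cobj X 0) \<in> bd C X" using X n_exactD(5)[of n X] by (auto simp: contractible_def)
  have "Id C (cobj X 0) \<cdot> v \<in> bd C X" by (rule right_idealD(6)[OF vD(2)]) (use c' vD c in auto)
  then have "v \<cdot> Id C (cobj Y 0) \<in> bd C X" using vD c c' by simp
  then have "Id C (cobj Y 0) \<in> bd C Y" using vD(7)[of "Id C (cobj Y 0)"] c by simp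
  then show "Y \<in> contractible n C" using Y by (simp add: contractible_def)
qed (simp add: contractible_def)

lemma contractible_pb: "contractible n C \<subseteq> pb C (contractible n C)"
proof
  fix X assume X: "X \<in> contractible n C"
  then have nX: "n_exact n C X" and I: "Id C (cobj X 0) \<in> bd C X" by (auto simp: contractible_def)
  note R = n_exactD(4)[OF nX] and c = n_exactD(5)[OF nX]
  have all: "x \<in> bd C X" if "arr x" "cod x = cobj X 0" for x
    using right_idealD(6)[OF R I, of x] that c by simp
  have "splits C (contractible n C) X f" if f: "arr f" "cod f = cobj X 0" for f
  proof (rule splitsI[OF X X])
    show "cses C X (Id C (cobj X 0)) X (Id C (cobj X 0)) X"
      unfolding ses_def
    proof (intro conjI ballI impI R)
      fix x assume x: "arr x" "cod x = cobj X 0"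
      show "Id C (cobj X 0) \<cdot> x \<in> bd C X \<longleftrightarrow> x \<in> bd C X" using x by simp
      have "\<exists>a\<in>mor C (dom x) (cobj X 0). eqb C X x (Id C (cobj X 0) \<cdot> a)"
        using x eqm_refl[OF R x] by (intro bexI[of _ x]) (simp_all add: mor_iff)
      then show "Id C (cobj X 0) \<cdot> x \<in> bd C X \<longleftrightarrow> (\<exists>a\<in>mor C (dom x) (cobj X 0). eqb C X x (Id C (cobj X 0) \<cdot> a))"
        using all x by simp
    next
      show "\<exists>v\<in>mor C (cobj X 0) (cobj X 0). eqb C X (Id C (cobj X 0) \<cdot> v) (Id C (cobj X 0))"
        using c eqm_refl[OF R] by (intro bexI[of _ "Id C (cobj X 0)"]) (simp_all add: mor_iff)
    qed (use c in \<open>auto simp: mor_iff\<close>)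
    show "\<exists>a\<in>mor C (dom f) (cobj X 0). eqb C X f (Id C (cobj X 0) \<cdot> a)"
      using f eqm_refl[OF R f] by (intro bexI[of _ f]) (auto simp: mor_iff)
    show "\<exists>b\<in>mor C (cobj X 0) (dom f). eqb C X (Id C (cobj X 0)) (f \<cdot> b)"
      using f c all by (intro bexI[of _ "Zero C (cobj X 0) (dom f)"]) (auto simp: mor_iff eqm_def)
  qed
  then show "X \<in> pb C (contractible n C)" unfolding pb_def using X by blast
qed

text \<open>The identity of a contractible complex is congruent to the zero chain map in degree 0,
  hence by \<open>chain_top\<close> also in degree n+1.\<close>

lemma contractible_op:
  assumes X: "X \<in> contractible n C" shows "op_cplx n X \<in> contractible n Cop"
proof -
  interpret op: additive_category "op_cat C" by (rule op_additive)
  have nX: "n_exact n C X" and I: "Id C (cobj X 0) \<in> bd C X" using X by (auto simp: contractible_def)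
  note cX = n_exactD(3)[OF nX] and R = n_exactD(4)[OF nX]
  have oX: "n_exact n Cop (op_cplx n X)" using n_exact_op[OF additive_category_axioms] nX by blast
  note R' = op.n_exactD(4)[OF oX]
  have "eqb C X (Id C (cobj X 0)) (Zero C (cobj X 0) (cobj X 0))"
    using eqm_Zero[OF R I] n_exactD(5)[OF nX] by simp
  then have "eqb Cop (op_cplx n X) (Id C (cobj X (Suc n))) (Zero C (cobj X (Suc n)) (cobj X (Suc n)))"
    by (rule chain_top[OF cX n_exactD(1)[OF nX] chain_map_Id[OF cX] chain_map_Zero[OF cX cX]])
  then have "Id C (cobj X (Suc n)) \<in> bd Cop (op_cplx n X)"
    using op.eqm_mem[OF R'] right_idealD(4)[OF R', of "cobj X (Suc n)"] cx(1)[OF cX] by simp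
  then show ?thesis using oX by (simp add: contractible_def)
qed

lemma contractible_stable: "stable n C (contractible n C)"
proof -
  interpret op: additive_category "op_cat C" by (rule op_additive)
  have eq: "opc n C (contractible n C) = contractible n Cop"
  proof
    show "opc n C (contractible n C) \<subseteq> contractible n Cop"
    proof
      fix Z assume "Z \<in> opc n C (contractible n C)"
      then have "op_cplx n (op_cplx n Z) \<in> contractible n Cop"
        using contractible_op[of "op_cplx n Z"] by (auto simp: opc_def)
      then show "Z \<in> contractible n Cop" by (rule op.closed_cagree[OF op.closed_contractible cagree_op_op])
    qed
    show "contractible n Cop \<subseteq> opc n C (contractible n C)"
      using op.contractible_op unfolding opc_def by (auto simp: contractible_def)
  qed
  show ?thesis unfolding stable_def eq
    using closed_contractible contractible_pb op.contractible_pb by blast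
qed

lemma zero_complex_n_exact:
  assumes X: "is_complex n C X" and z: "\<And>i. i \<le> n + 1 \<Longrightarrow> zero_object C (cobj X i)"
  shows "n_exact n C X" "Id C (cobj X 0) \<in> bd C X"
proof -
  note x = cx[OF X]
  have z1: "a = Zero C (dom a) (cobj X i)" if i: "i \<le> n + 1" and "arr a" "cod a = cobj X i" for a i
  proof -
    have "\<exists>!f. f \<in> mor C (dom a) (cobj X i)" using z[OF i] that unfolding zero_object_def by simp
    moreover have "a \<in> mor C (dom a) (cobj X i)" "Zero C (dom a) (cobj X i) \<in> mor C (dom a) (cobj X i)"
      using that x by (auto simp: mor_iff)
    ultimately show ?thesis by blast
  qed
  have z2: "a = Zero C (cobj X i) (cod a)" if i: "i \<le> n + 1" and "arr a" "dom a = cobj X i" for a i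
  proof -
    have "\<exists>!f. f \<in> mor C (cobj X i) (cod a)" using z[OF i] that unfolding zero_object_def by simp
    moreover have "a \<in> mor C (cobj X i) (cod a)" "Zero C (cobj X i) (cod a) \<in> mor C (cobj X i) (cod a)"
      using that x by (auto simp: mor_iff)
    ultimately show ?thesis by blast
  qed
  have "\<exists>t\<in>mor C (dom a) (cobj X (Suc (Suc i))). a = cdiff X (Suc (Suc i)) \<cdot> t"
    if i: "i < n" and a: "arr a" "cod a = cobj X (Suc i)" for a i
    using z1[of "Suc i" a] z1[of "Suc i" "cdiff X (Suc (Suc i)) \<cdot> Zero C (dom a) (cobj X (Suc (Suc i)))"] i a x
    by (intro bexI[of _ "Zero C (dom a) (cobj X (Suc (Suc i)))"]) (simp_all add: mor_iff)
  then have "lexact n C X" unfolding lexact_def exact0_def using X z1[of "Suc n"] by auto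
  moreover have "\<exists>c\<in>mor C (cobj X i) (cod a). a = c \<cdot> cdiff X (Suc i)"
    if i: "i < n" and a: "arr a" "dom a = cobj X (Suc i)" for a i
    using z2[of "Suc i" a] z2[of "Suc i" "Zero C (cobj X i) (cod a) \<cdot> cdiff X (Suc i)"] i a x
    by (intro bexI[of _ "Zero C (cobj X i) (cod a)"]) (simp_all add: mor_iff)
  then have "coexact n C X" unfolding coexact_def using z2[of 0] by auto
  ultimately show nX: "n_exact n C X" using n_exact_iff by blast
  have "Id C (cobj X 0) = Zero C (cobj X 0) (cobj X 0)" using z1[of 0 "Id C (cobj X 0)"] x by simp
  then show "Id C (cobj X 0) \<in> bd C X" using right_idealD(4)[OF n_exactD(4)[OF nX], of "cobj X 0"] x by simp
qed

lemma zero_complex_max_class: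
  assumes "is_complex n C X" "\<And>i. i \<le> n + 1 \<Longrightarrow> zero_object C (cobj X i)"
  shows "X \<in> max_class n C"
  using stable_le_max_class[OF contractible_stable] zero_complex_n_exact[OF assms] by (auto simp: contractible_def)

end

section \<open>The greatest exact structure\<close>

context additive_category begin

lemma ran_morE:
  assumes "a \<in> ran C e" "e \<in> mor C S P"
  obtains t where "arr t" "dom t = dom a" "cod t = S" "a = e \<cdot> t"
  using assms by (auto simp: ran_iff mor_iff)

lemma deflation_cdiff:
  assumes A: "closed_class n C \<A>" and X: "X \<in> \<A>"
  shows "cdiff X 1 \<in> mor C (cobj X 1) (cobj X 0)" "bd C X = ran C (cdiff X 1)"
  using cx[OF n_exactD(3)[OF closedD[OF A X]]] bd_ran[OF n_exactD(3)[OF closedD[OF A X]]]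
  by (simp_all add: mor_iff)

text \<open>Being a deflation thereby becomes a property of the presented module: any arrow with a
  cokernel isomorphic to that of a member is the last arrow of a member.\<close>

lemma deflation_qiso:
  assumes ic: "idempotent_complete C" and n: "n \<ge> 1" and A: "closed_class n C \<A>" and X: "X \<in> \<A>"
    and e: "e \<in> mor C Y1 Y0" and u: "qiso C Y0 (ran C e) (cobj X 0) (bd C X) u"
  obtains Y where "Y \<in> \<A>" "cdiff Y 1 = e" "cobj Y 0 = Y0" "cobj Y 1 = Y1" "bd C Y = ran C e"
proof -
  obtain Y where Y: "n_exact n C Y" "cdiff Y 1 = e" "cobj Y 0 = Y0" "cobj Y 1 = Y1" "bd C Y = ran C e"
    by (rule change_presentation[OF ic n closedD[OF A X] e u])
  obtain v where "qiso C (cobj X 0) (bd C X) Y0 (ran C e) v" using u by (rule qiso_sym)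
  then have "Y \<in> \<A>" using closed_qiso[OF A X Y(1)] Y by simp
  then show ?thesis using that Y by blast
qed

lemma ses_qiso_right:
  assumes S: "ses C P1 N1 y P N w P2 N2" and M: "right_ideal C P M"
    and ker: "\<And>x. x \<in> Arr C \<Longrightarrow> cod x = P \<Longrightarrow> x \<in> M \<longleftrightarrow> (\<exists>a\<in>mor C (dom x) P1. eqm C N x (y \<cdot> a))"
  shows "qiso C P M P2 N2 w"
  unfolding qiso_def using M sesD[OF S] ker by (auto simp: mor_iff)

text \<open>The image of the row \<open>r\<close> consists of the relations of \<open>X\<close>
  together with the image of \<open>f\<close>, so \<open>r\<close> presents the quotient
  \<open>W\<close>. In a sequence ending in \<open>r\<close> the preceding differential is a weak
  kernel of \<open>r\<close>, and its part in \<open>Y\<close> presents the image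
  \<open>I\<close>.\<close>

lemma stable_pullback:
  assumes ic: "idempotent_complete C" and n: "n \<ge> 1" and A: "closed_class n C \<A>" and pbA: "\<A> \<subseteq> pb C \<A>"
    and d: "deflation \<A> d" "d \<in> mor C A B" and f: "f \<in> mor C Y B" and S: "biproduct C A Y S i1 i2 p1 p2"
  shows "let r = Add C ((inv\<^bsub>Hom C A B\<^esub> d) \<cdot> p1) (f \<cdot> p2) in
         deflation \<A> r \<and>
         (\<exists>Z\<in>Obj C. \<exists>f'\<in>mor C Z A. \<exists>d'\<in>mor C Z Y.
            weak_kernel C r (Add C (i1 \<cdot> f') (i2 \<cdot> d')) \<and> deflation \<A> d')"
proof -
  obtain X where X: "X \<in> \<A>" "d = cdiff X 1" using d(1) by (auto simp: deflation_def)
  note nX = closedD[OF A X(1)]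
  note x = cx[OF n_exactD(3)[OF nX]] and R = n_exactD(4)[OF nX]
  have dt: "arr d" "dom d = A" "cod d = B" and ft: "arr f" "dom f = Y" "cod f = B"
    using d f by (auto simp: mor_iff)
  have AB: "A = cobj X 1" "B = cobj X 0" using dt x by (auto simp: X(2))
  have BO: "obj B" using dt by auto
  note b = bp[OF S]
  define r where "r = neg C d \<cdot> p1 \<boxplus> f \<cdot> p2"
  have r': "Add C ((inv\<^bsub>Hom C A B\<^esub> d) \<cdot> p1) (f \<cdot> p2) = r"
    using dt by (simp add: r_def neg_def)
  have rt: "arr r" "dom r = S" "cod r = B" unfolding r_def using dt ft b by simp_all
  have rm: "r \<in> mor C S B" using rt by (simp add: mor_iff)
  have "splits C \<A> X f" using pbA X(1) ft AB unfolding pb_def by blast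
  then obtain I W y w where I: "I \<in> \<A>" and W: "W \<in> \<A>"
    and T: "cses C I y X w W"
    and e1: "\<exists>a\<in>mor C (dom f) (cobj I 0). eqb C X f (y \<cdot> a)"
    and e2: "\<exists>b\<in>mor C (cobj I 0) (dom f). eqb C X y (f \<cdot> b)"
    by (rule splitsE)
  note s = sesD[OF T]
  have fX: "cod f = cobj X 0" using ft AB by simp
  have bdX: "a \<in> bd C X \<longleftrightarrow> (\<exists>t. t \<in> Arr C \<and> cod t = A \<and> a = d \<cdot> t)" for a
    unfolding bd_iff AB X(2) by simp
  have ranr: "a \<in> ran C r \<longleftrightarrow> (\<exists>c\<in>mor C (dom a) (cobj I 0). eqb C X a (y \<cdot> c))"
    if a: "arr a" "cod a = cobj X 0" for a
  proof -
    have "a \<in> ran C r \<longleftrightarrow> (\<exists>c\<in>mor C (dom a) Y. eqb C X a (f \<cdot> c))"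
    proof
      assume "a \<in> ran C r"
      then obtain t where t: "arr t" "dom t = dom a" "cod t = S" "a = r \<cdot> t"
        by (rule ran_morE[OF _ rm])
      have "sub C a (f \<cdot> (p2 \<cdot> t)) = d \<cdot> neg C (p1 \<cdot> t)"
        unfolding t(4) r_def using t(1,3) dt ft b by (simp add: add_ac)
      moreover have "d \<cdot> neg C (p1 \<cdot> t) \<in> bd C X" unfolding bdX using t(1,3) b by (intro exI[of _ "neg C (p1 \<cdot> t)"]) simp
      ultimately have "eqb C X a (f \<cdot> (p2 \<cdot> t))" using t(1-3) a ft b AB by (simp add: eqm_def)
      then show "\<exists>c\<in>mor C (dom a) Y. eqb C X a (f \<cdot> c)"
        using t(1-3) b by (intro bexI[of _ "p2 \<cdot> t"]) (auto simp: mor_iff)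
    next
      assume "\<exists>c\<in>mor C (dom a) Y. eqb C X a (f \<cdot> c)"
      then obtain c where c: "arr c" "dom c = dom a" "cod c = Y" "sub C a (f \<cdot> c) \<in> bd C X"
        by (auto simp: mor_iff eqm_def)
      then obtain t where t: "arr t" "cod t = A" "sub C a (f \<cdot> c) = d \<cdot> t" unfolding bdX by blast
      have "dom t = dom (d \<cdot> t)" using t(1,2) dt by simp
      also have "\<dots> = dom a" unfolding t(3)[symmetric] using a c(1-3) ft AB by simp
      finally have tD: "dom t = dom a" .
      have "a = d \<cdot> t \<boxplus> f \<cdot> c" by (rule sub_eq_iff[THEN iffD1, OF _ _ _ _ _ _ _ t(3)]) (use t(1,2) tD a c(1-3) ft dt AB in simp_all)
      also have "\<dots> = r \<cdot> (sub C (i2 \<cdot> c) (i1 \<cdot> t))" unfolding r_def using a(1) t(1,2) tD c(1-3) ft dt b BO by (simp add: add_comm)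
      finally have ae: "a = r \<cdot> (sub C (i2 \<cdot> c) (i1 \<cdot> t))" .
      show "a \<in> ran C r" unfolding ran_iff
        by (intro exI[of _ "sub C (i2 \<cdot> c) (i1 \<cdot> t)"] conjI ae) (use t(1,2) tD c(1-3) rt b in auto)
    qed
    also have "\<dots> \<longleftrightarrow> (\<exists>c\<in>mor C (dom a) (cobj I 0). eqb C X a (y \<cdot> c))"
      by (rule iffI, erule im_cong[OF R ft(1) fX s(4,6) e1[folded s(5)], of "dom a" a, unfolded ft(2) s(5)],
        erule im_cong[OF R s(4,6) ft(1) fX e2[folded s(5)], of "dom a" a, unfolded ft(2) s(5)])
    finally show ?thesis .
  qed
  have Rr: "right_ideal C (cobj X 0) (ran C r)" using right_ideal_ran[OF rt(1)] rt AB by simp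
  have qr: "qiso C B (ran C r) (cobj W 0) (bd C W) w"
    unfolding AB by (rule ses_qiso_right[OF T Rr ranr])
  obtain V where V: "V \<in> \<A>" "cdiff V 1 = r" "cobj V 0 = B" "cobj V 1 = S" "bd C V = ran C r"
    by (rule deflation_qiso[OF ic n A W rm qr])
  have nV: "n_exact n C V" by (rule closedD[OF A V(1)])
  note vx = cx[OF n_exactD(3)[OF nV]]
  \<comment> \<open>The weak kernel is read off from the resolution by exactness in degree 1,
    available since n >= 1.\<close>
  let ?k = "cdiff V (Suc (Suc 0))" and ?Z = "cobj V (Suc (Suc 0))"
  have V1: "cobj V (Suc 0) = S" "cdiff V (Suc 0) = r" using V by auto
  have k: "arr ?k" "dom ?k = ?Z" "cod ?k = S" "obj ?Z" using vx(1,2,3,4) n V1 by auto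
  have rk: "r \<cdot> ?k = Zero C ?Z B" using vx(5)[of 0] n V1 V(3) by simp
  let ?f = "p1 \<cdot> ?k" and ?d = "p2 \<cdot> ?k"
  have sum: "i1 \<cdot> ?f \<boxplus> i2 \<cdot> ?d = ?k" by (rule bp_sum[OF S k(1,3)])
  have ker: "\<exists>t\<in>mor C (dom h) ?Z. h = ?k \<cdot> t" if "arr h" "cod h = S" "r \<cdot> h = Zero C (dom h) B" for h
    using exact0D(2)[OF n_exactD(2)[OF nV], of 0 h] that n V1 V(3) by simp
  have wk: "weak_kernel C r ?k"
    unfolding weak_kernel_def using rt k rk ker by simp
  have fd: "f \<cdot> ?d = d \<cdot> ?f"
  proof -
    have "r \<cdot> ?k = f \<cdot> ?d \<boxplus> neg C (d \<cdot> ?f)" unfolding r_def using k dt ft b by (simp add: add_comm)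
    then have "f \<cdot> ?d \<boxplus> neg C (d \<cdot> ?f) = Zero C (dom (f \<cdot> ?d)) (cod (f \<cdot> ?d))" using rk k ft b by simp
    then show ?thesis using sub_eq_Zero[of "f \<cdot> ?d" "d \<cdot> ?f"] k ft dt b by simp
  qed
  have dm: "?d \<in> mor C ?Z Y" "?f \<in> mor C ?Z A" using k b by (auto simp: mor_iff)
  \<comment> \<open>A pair \<open>(t, a)\<close> with \<open>d t = f a\<close> is killed by
    \<open>r\<close> and so factors through \<open>?k\<close>. Hence the arrows that
    \<open>f\<close> sends to boundaries are those factoring through \<open>?d\<close>.\<close>
  have rand: "f \<cdot> a \<in> bd C X \<longleftrightarrow> a \<in> ran C ?d" if a: "arr a" "cod a = Y" for a
  proof
    assume "f \<cdot> a \<in> bd C X"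
    then obtain t where t: "arr t" "cod t = A" "f \<cdot> a = d \<cdot> t" unfolding bdX by blast
    have "dom t = dom (d \<cdot> t)" using t(1,2) dt by simp
    also have "\<dots> = dom a" unfolding t(3)[symmetric] using a ft by simp
    finally have tD: "dom t = dom a" .
    let ?h = "i1 \<cdot> t \<boxplus> i2 \<cdot> a"
    have h: "arr ?h" "dom ?h = dom a" "cod ?h = S" using t(1,2) tD a b by simp_all
    have "r \<cdot> ?h = neg C (d \<cdot> t) \<boxplus> f \<cdot> a" unfolding r_def using t(1,2) tD a b dt ft BO by simp
    also have "\<dots> = Zero C (dom ?h) B" unfolding t(3) using t(1,2) tD a b dt by simp
    finally obtain q where q: "arr q" "dom q = dom a" "cod q = ?Z" "?h = ?k \<cdot> q"
      using ker[OF h(1,3)] h(2) by (auto simp: mor_iff)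
    have "a = p2 \<cdot> ?h" using t(1,2) tD a b by simp
    also have "\<dots> = ?d \<cdot> q" unfolding q(4) using q(1,3) k b by simp
    finally show "a \<in> ran C ?d" unfolding ran_iff using q(1,3) k b by (intro exI[of _ q]) simp
  next
    assume "a \<in> ran C ?d"
    then obtain t where t: "arr t" "cod t = ?Z" "a = ?d \<cdot> t" using k b by (auto simp: ran_iff)
    have "f \<cdot> a = (f \<cdot> ?d) \<cdot> t" unfolding t(3) using t(1,2) k ft b by simp
    also have "\<dots> = d \<cdot> (?f \<cdot> t)" unfolding fd using t(1,2) k dt b by simp
    finally show "f \<cdot> a \<in> bd C X" unfolding bdX using t(1,2) k b by (intro exI[of _ "?f \<cdot> t"]) simp
  qed
  obtain a0 where a0: "arr a0" "dom a0 = Y" "cod a0 = cobj I 0" "eqb C X f (y \<cdot> a0)"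
    using e1 ft by (auto simp: mor_iff)
  obtain b0 where b0: "arr b0" "dom b0 = cobj I 0" "cod b0 = Y" "eqb C X y (f \<cdot> b0)"
    using e2 ft by (auto simp: mor_iff)
  have fa: "eqb C X (f \<cdot> a) (y \<cdot> (a0 \<cdot> a))" if "arr a" "cod a = Y" for a
    using eqm_comp[OF R a0(4) that(1)] that ft a0(1-3) s(4-6) by simp
  \<comment> \<open>\<open>f\<close> induces a map from the cokernel of \<open>?d\<close> onto the
    image \<open>I\<close>, and by \<open>rand\<close> it is injective.\<close>
  have qd: "qiso C Y (ran C ?d) (cobj I 0) (bd C I) a0"
    unfolding qiso_def
  proof (intro conjI ballI impI s(1))
    show "right_ideal C Y (ran C ?d)" using right_ideal_ran[of ?d] k b by simp
    show "a0 \<in> mor C Y (cobj I 0)" using a0 by (simp add: mor_iff)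
    fix a assume a: "arr a" "cod a = Y"
    have "a0 \<cdot> a \<in> bd C I \<longleftrightarrow> y \<cdot> (a0 \<cdot> a) \<in> bd C X" using s(10)[of "a0 \<cdot> a"] a a0 by simp
    also have "\<dots> \<longleftrightarrow> a \<in> ran C ?d" using eqm_mem[OF R fa[OF a]] rand[OF a] by blast
    finally show "a0 \<cdot> a \<in> bd C I \<longleftrightarrow> a \<in> ran C ?d" .
  next
    have "eqb C X y (y \<cdot> (a0 \<cdot> b0))" by (rule eqm_trans[OF R b0(4) fa]) (use b0 in auto)
    then have "eqb C X (y \<cdot> (a0 \<cdot> b0)) (y \<cdot> Id C (cobj I 0))" using eqm_sym[OF R] s(4-6,16) by simp
    then have "eqb C I (a0 \<cdot> b0) (Id C (cobj I 0))" by (rule ses_reflect[OF T]) (use a0 b0 s in auto)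
    then show "\<exists>v\<in>mor C (cobj I 0) Y. eqb C I (a0 \<cdot> v) (Id C (cobj I 0))" using b0 by (auto simp: mor_iff)
  qed
  obtain U where U: "U \<in> \<A>" "cdiff U 1 = ?d" by (rule deflation_qiso[OF ic n A I dm(1) qd])
  have "deflation \<A> r" "deflation \<A> ?d" using V U unfolding deflation_def by metis+
  moreover have "weak_kernel C r (i1 \<cdot> ?f \<boxplus> i2 \<cdot> ?d)" unfolding sum by (rule wk)
  ultimately show ?thesis unfolding r' Let_def using k(4) dm by blast
qed

text \<open>The kernel of \<open>Cok C(-, g f) -> Cok C(-, g)\<close> is the image of
  \<open>g\<close> modulo that of \<open>g f\<close>, that is \<open>C(-, X_0)\<close> modulo the
  image of \<open>f\<close> and the kernel of \<open>g\<close>. The second differential of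
  \<open>G\<close> generates the kernel of \<open>g\<close>, so this is the quotient
  \<open>Q\<close> of \<open>Cok C(-, f)\<close> that \<open>splits\<close> gives for that
  differential.\<close>

lemma stable_deflation_comp:
  assumes ic: "idempotent_complete C" and n: "n \<ge> 1" and A: "closed_class n C \<A>" and pbA: "\<A> \<subseteq> pb C \<A>"
    and exA: "ext n C \<A> \<subseteq> \<A>" and f: "deflation \<A> f" and g: "deflation \<A> g" and fg: "cod f = dom g"
  shows "deflation \<A> (g \<cdot> f)"
proof -
  obtain X where X: "X \<in> \<A>" "f = cdiff X 1" using f by (auto simp: deflation_def)
  obtain G where G: "G \<in> \<A>" "g = cdiff G 1" using g by (auto simp: deflation_def)
  note nX = closedD[OF A X(1)] and nG = closedD[OF A G(1)]
  note xx = cx[OF n_exactD(3)[OF nX]] and gx = cx[OF n_exactD(3)[OF nG]] and R = n_exactD(4)[OF nX]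
  have ft: "arr f" "dom f = cobj X 1" "cod f = cobj X 0" using xx by (auto simp: X(2))
  have gt: "arr g" "dom g = cobj X 0" "cod g = cobj G 0" and GX: "cobj G (Suc 0) = cobj X 0"
    using gx fg ft by (auto simp: G(2))
  let ?k = "cdiff G (Suc (Suc 0))"
  have k: "arr ?k" "cod ?k = cobj X 0" "g \<cdot> ?k = Zero C (dom ?k) (cobj G 0)"
    using gx(2-5) n GX by (auto simp: G(2))
  have gk: "g \<cdot> (?k \<cdot> h) = Zero C (dom h) (cobj G 0)" if "arr h" "cod h = dom ?k" for h
    using that comp_assoc[of h ?k g] k gt gx(1) by simp
  have ker: "\<exists>t. t \<in> Arr C \<and> dom t = dom h \<and> cod t = dom ?k \<and> h = ?k \<cdot> t"
    if "arr h" "cod h = cobj X 0" "g \<cdot> h = Zero C (dom h) (cobj G 0)" for h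
    using exact0D(2)[OF n_exactD(2)[OF nG], of 0 h] that n GX gx(3)[of "Suc 0"] by (auto simp: G(2) mor_iff)
  have bdX: "a \<in> bd C X \<longleftrightarrow> (\<exists>t. t \<in> Arr C \<and> cod t = dom f \<and> a = f \<cdot> t)" for a
    unfolding bd_iff ft(2) by (simp add: X(2))
  have bdG: "a \<in> bd C G \<longleftrightarrow> (\<exists>t. t \<in> Arr C \<and> cod t = cobj X 0 \<and> a = g \<cdot> t)" for a
    unfolding bd_iff G(2) by (simp add: GX)
  have "splits C \<A> X ?k" using pbA X(1) k unfolding pb_def by blast
  then obtain L Q l c where L: "L \<in> \<A>" and Q: "Q \<in> \<A>"
    and T: "cses C L l X c Q"
    and e1: "\<exists>a\<in>mor C (dom ?k) (cobj L 0). eqb C X ?k (l \<cdot> a)"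
    and e2: "\<exists>b\<in>mor C (cobj L 0) (dom ?k). eqb C X l (?k \<cdot> b)"
    by (rule splitsE)
  note s = sesD[OF T]
  have cker: "c \<cdot> x \<in> bd C Q \<longleftrightarrow> (\<exists>a\<in>mor C (dom x) (dom ?k). eqb C X x (?k \<cdot> a))"
    if x: "arr x" "cod x = cobj X 0" for x
    unfolding s(11)[OF x]
    by (rule iffI, erule im_cong[OF R s(4,6) k(1,2) e2[folded s(5)], of "dom x" x, unfolded s(5)],
      erule im_cong[OF R k(1,2) s(4,6) e1[folded s(5)], of "dom x" x, unfolded s(5)])
  have ck: "c \<cdot> (?k \<cdot> h) \<in> bd C Q" if "arr h" "cod h = dom ?k" for h
    using cker[of "?k \<cdot> h"] that k eqm_refl[OF R, of "?k \<cdot> h"] by (auto simp: mor_iff)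
  have cf: "c \<cdot> (f \<cdot> h) \<in> bd C Q" if "arr h" "cod h = dom f" for h
    by (rule s(14)) (use that bdX in blast)
  obtain v where v: "arr v" "dom v = cobj Q 0" "cod v = cobj X 0" "eqb C Q (c \<cdot> v) (Id C (cobj Q 0))"
    using s(12) by (auto simp: mor_iff)
  have cv: "eqb C Q (c \<cdot> (v \<cdot> h)) h" if "arr h" "cod h = cobj Q 0" for h
    using eqm_comp[OF s(3) v(4) that(1)] that v(1-3) s(7-9) by simp
  note ty = ft gt k(1,2) v(1-3) s(7-9) s(17,18) n_exactD(5)[OF nG]
  define e where "e = g \<cdot> f"
  have e: "arr e" "dom e = cobj X 1" "cod e = cobj G 0" unfolding e_def using ty by simp_all
  have rane: "a \<in> ran C e \<longleftrightarrow> (\<exists>t. t \<in> Arr C \<and> cod t = dom f \<and> a = g \<cdot> (f \<cdot> t))" for a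
    unfolding ran_iff using e ty by (auto simp: e_def)
  have Re: "right_ideal C (cobj G 0) (ran C e)" using right_ideal_ran[OF e(1)] e by simp
  \<comment> \<open>What \<open>c\<close> kills is a part from \<open>f\<close> plus a part from
    \<open>?k\<close>; composition with \<open>g\<close> forgets the latter.\<close>
  have decomp: "\<exists>q r. q \<in> Arr C \<and> dom q = dom x \<and> cod q = dom ?k \<and> arr r \<and> dom r = dom x \<and> cod r = dom f
      \<and> x = f \<cdot> r \<boxplus> ?k \<cdot> q"
    if x: "arr x" "cod x = cobj X 0" "c \<cdot> x \<in> bd C Q" for x
  proof -
    obtain q where q: "arr q" "dom q = dom x" "cod q = dom ?k" "sub C x (?k \<cdot> q) \<in> bd C X"
      using cker[OF x(1,2)] x(3) by (auto simp: mor_iff eqm_def)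
    then obtain r where r: "arr r" "cod r = dom f" "sub C x (?k \<cdot> q) = f \<cdot> r" unfolding bdX by blast
    have "dom r = dom (f \<cdot> r)" using r(1,2) ty by simp
    also have "\<dots> = dom x" unfolding r(3)[symmetric] using q(1-3) x ty by simp
    finally have rD: "dom r = dom x" .
    have "x = f \<cdot> r \<boxplus> ?k \<cdot> q" by (rule sub_eq_iff[THEN iffD1, OF _ _ _ _ _ _ _ r(3)]) (use q(1-3) r(1,2) rD x ty in simp_all)
    then show ?thesis using q r rD by blast
  qed
  \<comment> \<open>The inclusion of \<open>Q\<close> is \<open>g v\<close> with \<open>v\<close> a
    section of \<open>c\<close>; another section would change \<open>g v\<close> only modulo the
    image of \<open>g f\<close>.\<close>
  have SS: "ses C (cobj Q 0) (bd C Q) (g \<cdot> v) (cobj G 0) (ran C e) (Id C (cobj G 0)) (cobj G 0) (bd C G)"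
    unfolding ses_def
  proof (intro conjI ballI impI s(3) Re n_exactD(4)[OF nG])
    show "g \<cdot> v \<in> mor C (cobj Q 0) (cobj G 0)" "Id C (cobj G 0) \<in> mor C (cobj G 0) (cobj G 0)" using ty by (auto simp: mor_iff)
    show "\<exists>v\<in>mor C (cobj G 0) (cobj G 0). eqb C G (Id C (cobj G 0) \<cdot> v) (Id C (cobj G 0))"
      using ty eqm_refl[OF n_exactD(4)[OF nG]] by (intro bexI[of _ "Id C (cobj G 0)"]) (auto simp: mor_iff)
  next
    fix a assume a: "arr a" "cod a = cobj Q 0"
    show "g \<cdot> v \<cdot> a \<in> ran C e \<longleftrightarrow> a \<in> bd C Q"
    proof
      assume "g \<cdot> v \<cdot> a \<in> ran C e"
      then obtain t where t: "arr t" "cod t = dom f" "g \<cdot> v \<cdot> a = g \<cdot> (f \<cdot> t)" unfolding rane by blast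
      have "dom t = dom (g \<cdot> (f \<cdot> t))" using t(1,2) ty by simp
      also have "\<dots> = dom a" unfolding t(3)[symmetric] using a ty by simp
      finally have tD: "dom t = dom a" .
      have e': "g \<cdot> (v \<cdot> a) = g \<cdot> (f \<cdot> t)" using t(3) a ty by simp
      have "g \<cdot> sub C (v \<cdot> a) (f \<cdot> t) = sub C (g \<cdot> (v \<cdot> a)) (g \<cdot> (f \<cdot> t))" using t(1,2) tD a ty by simp
      also have "\<dots> = Zero C (dom a) (cobj G 0)" unfolding e' using t(1,2) tD ty by simp
      finally obtain q where q: "arr q" "dom q = dom a" "cod q = dom ?k" "sub C (v \<cdot> a) (f \<cdot> t) = ?k \<cdot> q"
        using ker[of "sub C (v \<cdot> a) (f \<cdot> t)"] t(1,2) tD a ty by auto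
      have "v \<cdot> a = ?k \<cdot> q \<boxplus> f \<cdot> t" by (rule sub_eq_iff[THEN iffD1, OF _ _ _ _ _ _ _ q(4)]) (use q(1-3) t(1,2) tD a ty in simp_all)
      then have "c \<cdot> (v \<cdot> a) = c \<cdot> (?k \<cdot> q) \<boxplus> c \<cdot> (f \<cdot> t)" using q(1-3) t(1,2) tD a ty by simp
      also have "\<dots> \<in> bd C Q"
        by (rule right_idealD(5)[OF s(3) ck cf]) (use q(1-3) t(1,2) tD ty in auto)
      finally show "a \<in> bd C Q" using eqm_mem[OF s(3) cv[OF a]] by blast
    next
      assume "a \<in> bd C Q"
      then have "c \<cdot> (v \<cdot> a) \<in> bd C Q" using eqm_mem[OF s(3) cv[OF a]] by blast
      then obtain q r where q: "arr q" "dom q = dom a" "cod q = dom ?k"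
        and r: "arr r" "dom r = dom a" "cod r = dom f" "v \<cdot> a = f \<cdot> r \<boxplus> ?k \<cdot> q"
        using decomp[of "v \<cdot> a"] a ty by auto
      have "g \<cdot> v \<cdot> a = g \<cdot> (f \<cdot> r \<boxplus> ?k \<cdot> q)" using r(4) a ty by simp
      also have "\<dots> = g \<cdot> (f \<cdot> r)" using q r(1-3) ty gk[OF q(1,3)] by simp
      finally show "g \<cdot> v \<cdot> a \<in> ran C e" unfolding rane using r by blast
    qed
  next
    fix x assume x: "arr x" "cod x = cobj G 0"
    show "Id C (cobj G 0) \<cdot> x \<in> bd C G \<longleftrightarrow> (\<exists>a\<in>mor C (dom x) (cobj Q 0). eqm C (ran C e) x (g \<cdot> v \<cdot> a))"
    proof
      assume "Id C (cobj G 0) \<cdot> x \<in> bd C G"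
      then obtain t where t: "arr t" "cod t = cobj X 0" "x = g \<cdot> t" using x by (auto simp: bdG)
      let ?t = "sub C t (v \<cdot> (c \<cdot> t))"
      have "eqb C Q (c \<cdot> (v \<cdot> (c \<cdot> t))) (c \<cdot> t)" by (rule cv) (use t(1,2) ty in auto)
      then have "c \<cdot> ?t \<in> bd C Q" using eqmD(5)[OF eqm_sym[OF s(3)]] t(1,2) ty by fastforce
      then obtain q r where q: "arr q" "dom q = dom t" "cod q = dom ?k"
        and r: "arr r" "dom r = dom t" "cod r = dom f" "?t = f \<cdot> r \<boxplus> ?k \<cdot> q"
        using decomp[of ?t] t(1,2) ty by auto
      have "sub C x (g \<cdot> v \<cdot> (c \<cdot> t)) = g \<cdot> ?t" unfolding t(3) using t(1,2) ty by simp
      also have "\<dots> = g \<cdot> (f \<cdot> r)" unfolding r(4) using q r(1-3) ty gk[OF q(1,3)] by simp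
      finally have "sub C x (g \<cdot> v \<cdot> (c \<cdot> t)) \<in> ran C e" unfolding rane using r by auto
      then have "eqm C (ran C e) x (g \<cdot> v \<cdot> (c \<cdot> t))" using t ty by (simp add: eqm_def)
      then show "\<exists>a\<in>mor C (dom x) (cobj Q 0). eqm C (ran C e) x (g \<cdot> v \<cdot> a)"
        using t ty by (intro bexI[of _ "c \<cdot> t"]) (auto simp: mor_iff)
    next
      assume "\<exists>a\<in>mor C (dom x) (cobj Q 0). eqm C (ran C e) x (g \<cdot> v \<cdot> a)"
      then obtain a where a: "arr a" "dom a = dom x" "cod a = cobj Q 0" "sub C x (g \<cdot> v \<cdot> a) \<in> ran C e"
        by (auto simp: mor_iff eqm_def)
      then obtain t where t: "arr t" "cod t = dom f" "sub C x (g \<cdot> v \<cdot> a) = g \<cdot> (f \<cdot> t)" unfolding rane by blast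
      have "dom t = dom (g \<cdot> (f \<cdot> t))" using t(1,2) ty by simp
      also have "\<dots> = dom x" unfolding t(3)[symmetric] using a(1-3) x ty by simp
      finally have tD: "dom t = dom x" .
      have "x = g \<cdot> (f \<cdot> t) \<boxplus> g \<cdot> v \<cdot> a" by (rule sub_eq_iff[THEN iffD1, OF _ _ _ _ _ _ _ t(3)]) (use t(1,2) tD a(1-3) x ty in simp_all)
      also have "\<dots> = g \<cdot> (f \<cdot> t \<boxplus> v \<cdot> a)" using t(1,2) tD a(1-3) ty by simp
      finally have xe: "x = g \<cdot> (f \<cdot> t \<boxplus> v \<cdot> a)" .
      have "x \<in> bd C G" unfolding bdG by (intro exI[of _ "f \<cdot> t \<boxplus> v \<cdot> a"] conjI xe) (use t(1,2) tD a(1-3) ty in auto)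
      then show "Id C (cobj G 0) \<cdot> x \<in> bd C G" using x by simp
    qed
  qed
  obtain H u where H: "H \<in> ext n C \<A>" and u: "qiso C (cobj H 0) (bd C H) (cobj G 0) (ran C e) u"
    by (rule ext_build[OF A n Q G(1) SS])
  obtain u' where u': "qiso C (cobj G 0) (ran C e) (cobj H 0) (bd C H) u'" using u by (rule qiso_sym)
  have em: "e \<in> mor C (cobj X 1) (cobj G 0)" using e by (simp add: mor_iff)
  have "H \<in> \<A>" using H exA by blast
  then obtain Y where "Y \<in> \<A>" "cdiff Y 1 = e" by (rule deflation_qiso[OF ic n A _ em u'])
  then show ?thesis unfolding deflation_def e_def by metis
qed

text \<open>By \<open>deflation_opc\<close> the axioms on inflations are those on deflations for the
  reversed class; inclusions and projections of the biproduct exchange roles.\<close>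

lemma stable_n_exact_structure:
  assumes ic: "idempotent_complete C" and n: "n \<ge> 1" and S: "stable n C \<A>" and ex: "ext n C \<A> \<subseteq> \<A>"
    and z: "\<And>X. is_complex n C X \<Longrightarrow> (\<And>i. i \<le> n + 1 \<Longrightarrow> zero_object C (cobj X i)) \<Longrightarrow> X \<in> \<A>"
  shows "n_exact_structure n C \<A>"
proof -
  interpret op: additive_category "op_cat C" by (rule op_additive)
  have A: "closed_class n C \<A>" "\<A> \<subseteq> pb C \<A>" "opc n C \<A> \<subseteq> pb Cop (opc n C \<A>)"
    using S by (auto simp: stable_def)
  note ic' = idempotent_complete_op[OF ic] and A' = closed_opc[OF A(1)]
  have ex': "ext n Cop (opc n C \<A>) \<subseteq> opc n C \<A>"
  proof
    fix Z assume Z: "Z \<in> ext n Cop (opc n C \<A>)"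
    then have "op_cplx n Z \<in> ext n C \<A>"
      using op.ext_op[OF closed_opc[OF A(1)] n Z] opc_opc[OF A(1)] by simp
    moreover have "n_exact n Cop Z" using Z unfolding ext_def by blast
    ultimately show "Z \<in> opc n C \<A>" using ex by (auto simp: opc_def)
  qed
  note di = deflation_opc[OF A(1)]
  have E1: "inflation n \<A> (g \<cdot> f)" if "inflation n \<A> f" "inflation n \<A> g" "cod f = dom g" for f g
    using op.stable_deflation_comp[OF ic' n A' A(3) ex', of g f] that by (simp add: di)
  have E2: "let c = Add C (i1 \<cdot> (inv\<^bsub>Hom C A B\<^esub> d)) (i2 \<cdot> f) in
         inflation n \<A> c \<and>
         (\<exists>Z\<in>Obj C. \<exists>f'\<in>mor C B Z. \<exists>d'\<in>mor C Y Z.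
            weak_cokernel C c (Add C (f' \<cdot> p1) (d' \<cdot> p2)) \<and> inflation n \<A> d')"
    if "inflation n \<A> d" "d \<in> mor C A B" "f \<in> mor C A Y" "biproduct C B Y S i1 i2 p1 p2" for d f A B Y S i1 i2 p1 p2
    using op.stable_pullback[OF ic' n A' A(3), of d B A f Y S p1 p2 i1 i2] that by (simp add: di Let_def)
  show ?thesis
    unfolding n_exact_structure_def
  proof (intro conjI allI impI ballI, goal_cases)
    case (1 X) then show ?case by (rule closedD[OF A(1)])
  next
    case (2 X Y) then show ?case using A(1) unfolding closed_class_def by blast
  next
    case (3 X) then show ?case using z by blast
  next
    case (4 f g) then show ?case by (elim conjE) (rule E1)
  next
    case (5 f g) then show ?case by (elim conjE) (rule stable_deflation_comp[OF ic n A(1,2) ex])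
  next
    case (6 d f A B Y S i1 i2 p1 p2) then show ?case by (elim conjE) (rule E2)
  next
    case (7 d f A B Y S i1 i2 p1 p2) then show ?case by (elim conjE) (rule stable_pullback[OF ic n A(1,2)])
  qed
qed

section \<open>Exact structures as stable classes\<close>

text \<open>The axiom applied to \<open>d_1\<close> and \<open>f\<close> gives sequences
  \<open>V\<close> with last arrow \<open>d'\<close> and \<open>W\<close> with last arrow
  \<open>r\<close>. They present the image of \<open>f\<close> and the quotient by it: by the weak
  kernel property \<open>f a\<close> is a boundary only if \<open>a\<close> factors through
  \<open>d'\<close>.\<close>

lemma pb_of_pullbacks:
  assumes A: "closed_class n C \<A>"
    and P: "\<And>d f A B Y S i1 i2 p1 p2. deflation \<A> d \<Longrightarrow> d \<in> mor C A B \<Longrightarrow> f \<in> mor C Y B \<Longrightarrow> biproduct C A Y S i1 i2 p1 p2 \<Longrightarrow>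
        (let r = Add C ((inv\<^bsub>Hom C A B\<^esub> d) \<cdot> p1) (f \<cdot> p2) in
         deflation \<A> r \<and>
         (\<exists>Z\<in>Obj C. \<exists>f'\<in>mor C Z A. \<exists>d'\<in>mor C Z Y.
            weak_kernel C r (Add C (i1 \<cdot> f') (i2 \<cdot> d')) \<and> deflation \<A> d'))"
  shows "\<A> \<subseteq> pb C \<A>"
proof
  fix X assume XA: "X \<in> \<A>"
  note X = closedD[OF A XA]
  note xx = cx[OF n_exactD(3)[OF X]] and R = n_exactD(4)[OF X] and c = n_exactD(5)[OF X]
  have "splits C \<A> X f" if f: "arr f" "cod f = cobj X 0" for f
  proof -
    define d where "d = cdiff X 1"
    define Y where "Y = dom f"
    have dt: "arr d" "dom d = cobj X 1" "cod d = cobj X 0" using xx by (auto simp: d_def)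
    have Y: "dom f = Y" "obj Y" using f by (auto simp: Y_def)
    obtain S i1 i2 p1 p2 where S: "biproduct C (cobj X 1) Y S i1 i2 p1 p2"
      using ex_biproduct[of "cobj X 1" Y] xx Y by auto
    note b = bp[OF S]
    define r where "r = neg C d \<cdot> p1 \<boxplus> f \<cdot> p2"
    have rt: "arr r" "dom r = S" "cod r = cobj X 0" unfolding r_def using dt f Y b by simp_all
    have rm: "r \<in> mor C S (cobj X 0)" using rt by (simp add: mor_iff)
    have r': "Add C ((inv\<^bsub>Hom C (cobj X 1) (cobj X 0)\<^esub> d) \<cdot> p1) (f \<cdot> p2) = r"
      unfolding r_def neg_def using dt by simp
    have "deflation \<A> d" using XA by (auto simp: deflation_def d_def)
    from P[OF this _ _ S, of "cobj X 0" f, unfolded r' Let_def] dt f Y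
    obtain Z f' d' where rA: "deflation \<A> r" and f': "f' \<in> mor C Z (cobj X 1)" and d': "d' \<in> mor C Z Y"
      and wk: "weak_kernel C r (i1 \<cdot> f' \<boxplus> i2 \<cdot> d')" and dA: "deflation \<A> d'" by (auto simp: mor_iff)
    have t': "arr f'" "dom f' = Z" "cod f' = cobj X 1" "arr d'" "dom d' = Z" "cod d' = Y" "obj Z"
      using f' d' by (auto simp: mor_iff)
    note ty = dt f Y b(1-15) t' c
    obtain W where W: "W \<in> \<A>" "r = cdiff W 1" using rA by (auto simp: deflation_def)
    obtain V where V: "V \<in> \<A>" "d' = cdiff V 1" using dA by (auto simp: deflation_def)
    have bW: "bd C W = ran C r" "cobj W 0 = cobj X 0"
      using deflation_cdiff[OF A W(1)] rt by (auto simp: W(2) mor_iff)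
    have bV: "bd C V = ran C d'" "cobj V 0 = Y"
      using deflation_cdiff[OF A V(1)] t' by (auto simp: V(2) mor_iff)
    let ?K = "i1 \<cdot> f' \<boxplus> i2 \<cdot> d'"
    have K: "arr ?K" "dom ?K = Z" "cod ?K = S" using ty by simp_all
    have bdX: "a \<in> bd C X \<longleftrightarrow> (\<exists>t. t \<in> Arr C \<and> cod t = cobj X 1 \<and> a = d \<cdot> t)" for a
      unfolding bd_iff d_def by simp
    have fd: "f \<cdot> d' = d \<cdot> f'"
    proof -
      have "r \<cdot> ?K = f \<cdot> d' \<boxplus> neg C (d \<cdot> f')" unfolding r_def using ty b by (simp add: add_comm)
      moreover have "r \<cdot> ?K = Zero C Z (cobj X 0)" using wk K rt unfolding weak_kernel_def by simp
      ultimately have "f \<cdot> d' \<boxplus> neg C (d \<cdot> f') = Zero C (dom (f \<cdot> d')) (cod (f \<cdot> d'))" using ty by simp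
      then show ?thesis using sub_eq_Zero[of "f \<cdot> d'" "d \<cdot> f'"] ty by simp
    qed
    \<comment> \<open>The inclusion of the image is \<open>f\<close> itself, and the projection is
      the identity of \<open>X_0\<close>, since only the relations change.\<close>
    have "cses C V f X (Id C (cobj X 0)) W"
      unfolding ses_def bV bW
    proof (intro conjI ballI impI R)
      show "right_ideal C Y (ran C d')" "right_ideal C (cobj X 0) (ran C r)"
        using right_ideal_ran[of d'] right_ideal_ran[of r] t' rt by auto
      show "f \<in> mor C Y (cobj X 0)" "Id C (cobj X 0) \<in> mor C (cobj X 0) (cobj X 0)" using ty by (auto simp: mor_iff)
      have "eqm C (ran C r) (Id C (cobj X 0)) (Id C (cobj X 0))"
        by (rule eqm_refl[of "cobj X 0"]) (use right_ideal_ran[of r] rt c in auto)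
      then show "\<exists>v\<in>mor C (cobj X 0) (cobj X 0). eqm C (ran C r) (Id C (cobj X 0) \<cdot> v) (Id C (cobj X 0))"
        using c by (intro bexI[of _ "Id C (cobj X 0)"]) (auto simp: mor_iff)
    next
      fix a assume a: "arr a" "cod a = Y"
      show "f \<cdot> a \<in> bd C X \<longleftrightarrow> a \<in> ran C d'"
      proof
        assume "f \<cdot> a \<in> bd C X"
        then obtain t where t: "arr t" "cod t = cobj X 1" "f \<cdot> a = d \<cdot> t" unfolding bdX by blast
        have "dom t = dom (d \<cdot> t)" using t(1,2) dt by simp
        also have "\<dots> = dom a" unfolding t(3)[symmetric] using a ty by simp
        finally have tD: "dom t = dom a" .
        let ?h = "i1 \<cdot> t \<boxplus> i2 \<cdot> a"
        have h: "arr ?h" "dom ?h = dom a" "cod ?h = S" using t(1,2) tD a ty by simp_all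
        have "r \<cdot> ?h = neg C (d \<cdot> t) \<boxplus> f \<cdot> a" unfolding r_def using t(1,2) tD a b ty by simp
        also have "\<dots> = Zero C (dom ?h) (cobj X 0)" unfolding t(3) using t(1,2) tD a ty by simp
        finally have "\<exists>q\<in>mor C (dom ?h) (dom ?K). ?h = ?K \<cdot> q"
          using wk h(1,3) rt unfolding weak_kernel_def by simp
        then obtain q where q0: "q \<in> mor C (dom a) Z" and q4: "?h = ?K \<cdot> q" unfolding K(2) h(2) by blast
        have q: "arr q" "dom q = dom a" "cod q = Z" using q0 by (auto simp: mor_iff)
        have "a = p2 \<cdot> ?h" using t(1,2) tD a b ty by simp
        also have "\<dots> = d' \<cdot> q" unfolding q4 using q(1,3) b ty by simp
        finally show "a \<in> ran C d'" unfolding ran_iff using q(1,3) ty by (intro exI[of _ q]) simp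
      next
        assume "a \<in> ran C d'"
        then obtain t where t: "arr t" "cod t = Z" "a = d' \<cdot> t" using ty by (auto simp: ran_iff)
        have "f \<cdot> a = (f \<cdot> d') \<cdot> t" unfolding t(3) using t(1,2) ty by simp
        also have "\<dots> = d \<cdot> (f' \<cdot> t)" unfolding fd using t(1,2) ty by simp
        finally show "f \<cdot> a \<in> bd C X" unfolding bdX using t(1,2) ty by (intro exI[of _ "f' \<cdot> t"]) simp
      qed
    next
      fix x assume x: "arr x" "cod x = cobj X 0"
      show "Id C (cobj X 0) \<cdot> x \<in> ran C r \<longleftrightarrow> (\<exists>a\<in>mor C (dom x) Y. eqb C X x (f \<cdot> a))"
      proof
        assume "Id C (cobj X 0) \<cdot> x \<in> ran C r"
        then have "x \<in> ran C r" using x by simp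
        then obtain t where t: "arr t" "dom t = dom x" "cod t = S" "x = r \<cdot> t"
          by (rule ran_morE[OF _ rm])
        have "sub C x (f \<cdot> (p2 \<cdot> t)) = d \<cdot> neg C (p1 \<cdot> t)"
          unfolding t(4) r_def using t(1,3) ty by (simp add: add_ac)
        moreover have "d \<cdot> neg C (p1 \<cdot> t) \<in> bd C X" unfolding bdX using t(1,3) ty by (intro exI[of _ "neg C (p1 \<cdot> t)"]) simp
        ultimately have "eqb C X x (f \<cdot> (p2 \<cdot> t))" using t(1-3) x ty by (simp add: eqm_def)
        then show "\<exists>c\<in>mor C (dom x) Y. eqb C X x (f \<cdot> c)"
          using t(1-3) ty by (intro bexI[of _ "p2 \<cdot> t"]) (auto simp: mor_iff)
      next
        assume "\<exists>a\<in>mor C (dom x) Y. eqb C X x (f \<cdot> a)"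
        then obtain a where a: "arr a" "dom a = dom x" "cod a = Y" "sub C x (f \<cdot> a) \<in> bd C X"
          by (auto simp: mor_iff eqm_def)
        then obtain t where t: "arr t" "cod t = cobj X 1" "sub C x (f \<cdot> a) = d \<cdot> t" unfolding bdX by blast
        have "dom t = dom (d \<cdot> t)" using t(1,2) dt by simp
        also have "\<dots> = dom x" unfolding t(3)[symmetric] using a(1-3) x ty by simp
        finally have tD: "dom t = dom x" .
        have "x = d \<cdot> t \<boxplus> f \<cdot> a" by (rule sub_eq_iff[THEN iffD1, OF _ _ _ _ _ _ _ t(3)]) (use t(1,2) tD a(1-3) x ty in simp_all)
        also have "\<dots> = r \<cdot> (sub C (i2 \<cdot> a) (i1 \<cdot> t))" unfolding r_def using x(1) t(1,2) tD a(1-3) b ty by (simp add: add_comm)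
        finally have xe: "x = r \<cdot> (sub C (i2 \<cdot> a) (i1 \<cdot> t))" .
        have "x \<in> ran C r" unfolding ran_iff
          by (intro exI[of _ "sub C (i2 \<cdot> a) (i1 \<cdot> t)"] conjI xe) (use t(1,2) tD a(1-3) rt ty in auto)
        then show "Id C (cobj X 0) \<cdot> x \<in> ran C r" using x by simp
      qed
    qed
    then show ?thesis
    proof (rule splitsI[OF V(1) W(1)])
      show "\<exists>a\<in>mor C (dom f) (cobj V 0). eqb C X f (f \<cdot> a)"
        using f Y bV eqm_refl[OF R f] by (intro bexI[of _ "Id C Y"]) (auto simp: mor_iff)
      show "\<exists>a\<in>mor C (cobj V 0) (dom f). eqb C X f (f \<cdot> a)"
        using f Y bV eqm_refl[OF R f] by (intro bexI[of _ "Id C Y"]) (auto simp: mor_iff)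
    qed
  qed
  then show "X \<in> pb C \<A>" unfolding pb_def using XA by blast
qed

text \<open>The dual of Ex2 is closure under \<open>pb\<close> by \<open>pb_of_pullbacks\<close>;
  Ex2 is the same statement for the reversed class in the opposite category.\<close>

lemma n_exact_structure_stable:
  assumes E: "n_exact_structure n C \<A>"
  shows "stable n C \<A>"
proof -
  interpret op: additive_category "op_cat C" by (rule op_additive)
  note E' = E[unfolded n_exact_structure_def]
  note inf = E'[THEN conjunct2, THEN conjunct2, THEN conjunct2, THEN conjunct2, THEN conjunct2, THEN conjunct1, rule_format]
  note defl = E'[THEN conjunct2, THEN conjunct2, THEN conjunct2, THEN conjunct2, THEN conjunct2, THEN conjunct2, rule_format]
  have A: "closed_class n C \<A>" unfolding closed_class_def
    using E'[THEN conjunct1] E'[THEN conjunct2, THEN conjunct1] by blast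
  have 1: "\<A> \<subseteq> pb C \<A>"
  proof (rule pb_of_pullbacks[OF A], goal_cases)
    case (1 d f A B Y S i1 i2 p1 p2)
    show ?case by (rule defl[OF conjI[OF 1(1) conjI[OF 1(2) conjI[OF 1(3) 1(4)]]]])
  qed
  note di = deflation_opc[OF A]
  have E2: "let c = Add C (i1 \<cdot> (inv\<^bsub>Hom C A B\<^esub> d)) (i2 \<cdot> f) in
         inflation n \<A> c \<and>
         (\<exists>Z\<in>Obj C. \<exists>f'\<in>mor C B Z. \<exists>d'\<in>mor C Y Z.
            weak_cokernel C c (Add C (f' \<cdot> p1) (d' \<cdot> p2)) \<and> inflation n \<A> d')"
    if "inflation n \<A> d" "d \<in> mor C A B" "f \<in> mor C A Y" "biproduct C B Y S i1 i2 p1 p2" for d f A B Y S i1 i2 p1 p2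
    by (rule inf[OF conjI[OF that(1) conjI[OF that(2) conjI[OF that(3) that(4)]]]])
  have "opc n C \<A> \<subseteq> pb Cop (opc n C \<A>)"
  proof (rule op.pb_of_pullbacks[OF closed_opc[OF A]], goal_cases)
    case (1 d f A B Y S i1 i2 p1 p2)
    then show ?case using E2[of d B A f Y S p1 p2 i1 i2] by (simp add: di Let_def)
  qed
  then show ?thesis unfolding stable_def using A 1 by blast
qed

lemma max_class_structure:
  assumes "idempotent_complete C" "n \<ge> 1"
  shows "n_exact_structure n C (max_class n C)"
  by (rule stable_n_exact_structure[OF assms stable_max_class ext_max_class zero_complex_max_class])
    (use assms in auto)

lemma max_class_greatest: "n_exact_structure n C \<A> \<Longrightarrow> \<A> \<subseteq> max_class n C"
  by (rule stable_le_max_class[OF n_exact_structure_stable])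

end

section \<open>Modules with a generator\<close>

text \<open>The element \<open>e\<close> of \<open>F P\<close> induces an isomorphism from \<open>C(-, P) / N\<close> to \<open>F\<close>.\<close>

definition gen :: "('o, 'm) cat \<Rightarrow> 'o \<Rightarrow> 'm set \<Rightarrow> ('o, 'm, 'v) cmod \<Rightarrow> 'v \<Rightarrow> bool" where
  "gen C P N F e \<longleftrightarrow> right_ideal C P N \<and> is_module C F \<and> e \<in> carrier (val F P) \<and>
     (\<forall>A\<in>Obj C. \<forall>x\<in>carrier (val F A). \<exists>a\<in>mor C A P. x = act F a e) \<and>
     (\<forall>a\<in>Arr C. Cod C a = P \<longrightarrow> (act F a e = \<one>\<^bsub>val F (Dom C a)\<^esub> \<longleftrightarrow> a \<in> N))"

abbreviation cgen :: "('o, 'm) cat \<Rightarrow> ('o, 'm) cplx \<Rightarrow> ('o, 'm, 'v) cmod \<Rightarrow> 'v \<Rightarrow> bool" where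
  "cgen C X \<equiv> gen C (cobj X 0) (bd C X)"

text \<open>The zero submodule of \<open>C(-, P)\<close>. A generator whose only relations are these
  makes the module isomorphic to \<open>C(-, P)\<close>; such modules are the free ones
  below.\<close>

definition zeros :: "('o, 'm) cat \<Rightarrow> 'o \<Rightarrow> 'm set" where
  "zeros C P = {Zero C A P | A. A \<in> Obj C}"

text \<open>An infinite sequence of representables that is exact in all positive degrees, so that it
  resolves the cokernel of \<open>C(-, d_1)\<close>.\<close>

definition wres :: "('o, 'm) cat \<Rightarrow> (nat \<Rightarrow> 'o) \<Rightarrow> (nat \<Rightarrow> 'm) \<Rightarrow> bool" where
  "wres C X d \<longleftrightarrow> (\<forall>i. X i \<in> Obj C \<and> d (Suc i) \<in> mor C (X (Suc i)) (X i) \<and>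
     (\<forall>a\<in>Arr C. Cod C a = X (Suc i) \<longrightarrow> (d (Suc i) \<cdot>\<^bsub>C\<^esub> a = Zero C (Dom C a) (X i) \<longleftrightarrow>
       (\<exists>t\<in>mor C (Dom C a) (X (Suc (Suc i))). a = d (Suc (Suc i)) \<cdot>\<^bsub>C\<^esub> t))))"

section \<open>Arithmetic of modules and the universal property of a generator\<close>

context additive_category begin

lemma md_group: "is_module C F \<Longrightarrow> obj A \<Longrightarrow> comm_group (val F A)"
  by (simp add: is_module_def)

lemma md_hom: "is_module C F \<Longrightarrow> arr h \<Longrightarrow> act F h \<in> hom (val F (cod h)) (val F (dom h))"
  by (simp add: is_module_def mor_iff)

lemma md_act: "is_module C F \<Longrightarrow> arr h \<Longrightarrow> x \<in> carrier (val F (cod h)) \<Longrightarrow> act F h x \<in> carrier (val F (dom h))"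
  using md_hom hom_in_carrier by fastforce

lemma md_mult: "is_module C F \<Longrightarrow> arr h \<Longrightarrow> x \<in> carrier (val F (cod h)) \<Longrightarrow> y \<in> carrier (val F (cod h)) \<Longrightarrow>
    act F h (x \<otimes>\<^bsub>val F (cod h)\<^esub> y) = act F h x \<otimes>\<^bsub>val F (dom h)\<^esub> act F h y"
  using md_hom hom_mult by fastforce

lemma md_one:
  assumes "is_module C F" "arr h"
  shows "act F h \<one>\<^bsub>val F (cod h)\<^esub> = \<one>\<^bsub>val F (dom h)\<^esub>"
proof -
  interpret G: comm_group "val F (cod h)" by (rule md_group[OF assms(1)]) (use assms(2) in simp)
  interpret H: comm_group "val F (dom h)" by (rule md_group[OF assms(1)]) (use assms(2) in simp)
  show ?thesis using hom_one[OF md_hom[OF assms]] G.is_group H.is_group by simp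
qed

lemma md_Id: "is_module C F \<Longrightarrow> obj A \<Longrightarrow> x \<in> carrier (val F A) \<Longrightarrow> act F (Id C A) x = x"
  by (simp add: is_module_def)

lemma md_comp:
  assumes "is_module C F" "arr h" "arr k" "cod h = dom k" "x \<in> carrier (val F (cod k))"
  shows "act F (k \<cdot> h) x = act F h (act F k x)"
proof -
  have *: "\<And>A B D h k x. \<lbrakk>obj A; obj B; obj D; h \<in> mor C A B; k \<in> mor C B D; x \<in> carrier (val F D)\<rbrakk>
      \<Longrightarrow> act F (k \<cdot> h) x = act F h (act F k x)" using assms(1) unfolding is_module_def by blast
  show ?thesis by (rule *[of "dom h" "dom k" "cod k"]) (use assms in \<open>auto simp: mor_iff\<close>)
qed

lemma md_add:
  assumes "is_module C F" "arr h" "arr k" "dom h = dom k" "cod h = cod k" "x \<in> carrier (val F (cod h))"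
  shows "act F (h \<boxplus> k) x = act F h x \<otimes>\<^bsub>val F (dom h)\<^esub> act F k x"
proof -
  have *: "\<And>A B h k x. \<lbrakk>obj A; obj B; h \<in> mor C A B; k \<in> mor C A B; x \<in> carrier (val F B)\<rbrakk>
      \<Longrightarrow> act F (h \<boxplus> k) x = act F h x \<otimes>\<^bsub>val F A\<^esub> act F k x" using assms(1) unfolding is_module_def by blast
  show ?thesis by (rule *[of "dom h" "cod h"]) (use assms in \<open>auto simp: mor_iff\<close>)
qed

lemma md_Zero:
  assumes F: "is_module C F" "obj A" "obj B" "x \<in> carrier (val F B)"
  shows "act F (Zero C A B) x = \<one>\<^bsub>val F A\<^esub>"
proof -
  interpret G: comm_group "val F A" by (rule md_group[OF F(1,2)])
  have c: "act F (Zero C A B) x \<in> carrier (val F A)" using md_act[OF F(1), of "Zero C A B"] F by simp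
  have "act F (Zero C A B) x \<otimes>\<^bsub>val F A\<^esub> act F (Zero C A B) x = act F (Zero C A B) x"
    using md_add[OF F(1), of "Zero C A B" "Zero C A B" x] F by simp
  then show ?thesis using c by (metis G.r_cancel_one)
qed

lemma md_eq:
  assumes F: "is_module C F" "arr a" "arr b" "dom a = dom b" "cod a = cod b" "x \<in> carrier (val F (cod a))"
  shows "act F (sub C a b) x = \<one>\<^bsub>val F (dom a)\<^esub> \<longleftrightarrow> act F a x = act F b x"
proof -
  interpret G: comm_group "val F (dom a)" by (rule md_group[OF F(1)]) (use F(2) in simp)
  have c: "act F a x \<in> carrier (val F (dom a))" "act F b x \<in> carrier (val F (dom a))"
    "act F (neg C b) x \<in> carrier (val F (dom a))"
    using md_act[OF F(1)] F arr_neg by metis+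
  have "act F (b \<boxplus> neg C b) x = act F b x \<otimes>\<^bsub>val F (dom a)\<^esub> act F (neg C b) x"
    using md_add[OF F(1), of b "neg C b" x] F by simp
  then have bn: "act F b x \<otimes>\<^bsub>val F (dom a)\<^esub> act F (neg C b) x = \<one>\<^bsub>val F (dom a)\<^esub>"
    using md_Zero[OF F(1), of "dom b" "cod b" x] F by simp
  have "act F (sub C a b) x = act F a x \<otimes>\<^bsub>val F (dom a)\<^esub> act F (neg C b) x"
    using md_add[OF F(1), of a "neg C b" x] F by simp
  then show ?thesis using bn c by (metis G.right_cancel)
qed

lemma genD:
  assumes "gen C P N F e"
  shows "right_ideal C P N" "is_module C F" "e \<in> carrier (val F P)" "obj P"
    "obj A \<Longrightarrow> x \<in> carrier (val F A) \<Longrightarrow> \<exists>a\<in>mor C A P. x = act F a e"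
    "arr a \<Longrightarrow> cod a = P \<Longrightarrow> act F a e = \<one>\<^bsub>val F (dom a)\<^esub> \<longleftrightarrow> a \<in> N"
    "arr a \<Longrightarrow> cod a = P \<Longrightarrow> act F a e \<in> carrier (val F (dom a))"
proof -
  show 1: "right_ideal C P N" "is_module C F" "e \<in> carrier (val F P)"
    "obj A \<Longrightarrow> x \<in> carrier (val F A) \<Longrightarrow> \<exists>a\<in>mor C A P. x = act F a e"
    "arr a \<Longrightarrow> cod a = P \<Longrightarrow> act F a e = \<one>\<^bsub>val F (dom a)\<^esub> \<longleftrightarrow> a \<in> N"
    using assms by (auto simp: gen_def)
  show "obj P" by (rule right_idealD(1)[OF 1(1)])
  show "arr a \<Longrightarrow> cod a = P \<Longrightarrow> act F a e \<in> carrier (val F (dom a))"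
    using md_act[OF 1(2), of a e] 1(3) by simp
qed

lemma gen_eq:
  assumes G: "gen C P N F e" and a: "arr a" "arr b" "dom a = dom b" "cod a = P" "cod b = P"
  shows "act F a e = act F b e \<longleftrightarrow> eqm C N a b"
  using md_eq[OF genD(2)[OF G], of a b e] genD(6)[OF G, of "sub C a b"] a genD(3)[OF G] by (simp add: eqm_def)

lemma NatD:
  assumes "\<alpha> \<in> Nat C F G"
  shows "obj A \<Longrightarrow> x \<in> carrier (val F A) \<Longrightarrow> \<alpha> A x \<in> carrier (val G A)"
    "obj A \<Longrightarrow> \<alpha> A \<in> hom (val F A) (val G A)"
    "arr h \<Longrightarrow> x \<in> carrier (val F (cod h)) \<Longrightarrow> \<alpha> (dom h) (act F h x) = act G h (\<alpha> (cod h) x)"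
    "\<alpha> \<in> (\<Pi>\<^sub>E A\<in>Obj C. carrier (val F A) \<rightarrow>\<^sub>E carrier (val G A))"
proof -
  show 1: "obj A \<Longrightarrow> \<alpha> A \<in> hom (val F A) (val G A)"
    "\<alpha> \<in> (\<Pi>\<^sub>E A\<in>Obj C. carrier (val F A) \<rightarrow>\<^sub>E carrier (val G A))" for A
    using assms unfolding Nat_def by blast+
  show "obj A \<Longrightarrow> x \<in> carrier (val F A) \<Longrightarrow> \<alpha> A x \<in> carrier (val G A)"
    using 1(1) hom_in_carrier by fastforce
  have *: "\<And>A B h x. \<lbrakk>obj A; obj B; h \<in> mor C A B; x \<in> carrier (val F B)\<rbrakk> \<Longrightarrow> \<alpha> A (act F h x) = act G h (\<alpha> B x)"
    using assms unfolding Nat_def by blast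
  show "arr h \<Longrightarrow> x \<in> carrier (val F (cod h)) \<Longrightarrow> \<alpha> (dom h) (act F h x) = act G h (\<alpha> (cod h) x)"
    by (rule *) (auto simp: mor_iff)
qed

lemma NatI:
  assumes "\<alpha> \<in> (\<Pi>\<^sub>E A\<in>Obj C. carrier (val F A) \<rightarrow>\<^sub>E carrier (val G A))"
    "\<And>A. A \<in> Obj C \<Longrightarrow> \<alpha> A \<in> hom (val F A) (val G A)"
    "\<And>h x. h \<in> Arr C \<Longrightarrow> x \<in> carrier (val F (cod h)) \<Longrightarrow> \<alpha> (dom h) (act F h x) = act G h (\<alpha> (cod h) x)"
  shows "\<alpha> \<in> Nat C F G"
proof -
  have "\<alpha> A (act F h x) = act G h (\<alpha> B x)" if "h \<in> mor C A B" "x \<in> carrier (val F B)" for A B h x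
  proof -
    have "arr h" "dom h = A" "cod h = B" using that(1) by (auto simp: mor_iff)
    then show ?thesis using assms(3)[of h x] that(2) by simp
  qed
  then show ?thesis unfolding Nat_def using assms(1,2) by blast
qed

lemma Nat_eq:
  assumes a: "\<alpha> \<in> Nat C F G" and b: "\<beta> \<in> Nat C F G"
    and eq: "\<And>A x. A \<in> Obj C \<Longrightarrow> x \<in> carrier (val F A) \<Longrightarrow> \<alpha> A x = \<beta> A x"
  shows "\<alpha> = \<beta>"
proof (rule PiE_ext[OF NatD(4)[OF a] NatD(4)[OF b]])
  fix A assume A: "obj A"
  have 1: "\<alpha> A \<in> carrier (val F A) \<rightarrow>\<^sub>E carrier (val G A)" by (rule PiE_mem[OF NatD(4)[OF a] A])
  have 2: "\<beta> A \<in> carrier (val F A) \<rightarrow>\<^sub>E carrier (val G A)" by (rule PiE_mem[OF NatD(4)[OF b] A])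
  show "\<alpha> A = \<beta> A" by (rule PiE_ext[OF 1 2]) (rule eq[OF A])
qed

lemma Nat_gen:
  assumes a: "\<alpha> \<in> Nat C F G" and F: "gen C P N F e" and h: "arr h" "cod h = P"
  shows "\<alpha> (dom h) (act F h e) = act G h (\<alpha> P e)"
  using NatD(3)[OF a h(1), of e] genD(3)[OF F] h by simp

lemma Nat_eq_gen:
  assumes a: "\<alpha> \<in> Nat C F G" and b: "\<beta> \<in> Nat C F G" and F: "gen C P N F e" and eq: "\<alpha> P e = \<beta> P e"
  shows "\<alpha> = \<beta>"
proof (rule Nat_eq[OF a b])
  fix A x assume Ax: "obj A" "x \<in> carrier (val F A)"
  obtain h where h: "arr h" "dom h = A" "cod h = P" "x = act F h e"
    using genD(5)[OF F Ax] by (auto simp: mor_iff)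
  show "\<alpha> A x = \<beta> A x" using Nat_gen[OF a F h(1,3)] Nat_gen[OF b F h(1,3)] eq h by simp
qed

text \<open>Maps out of \<open>C(-, P) / N\<close> are elements annihilated by \<open>N\<close>. The
  value at \<open>x\<close> is computed from a chosen arrow \<open>c A x\<close> that produces
  \<open>x\<close>, and two choices differ by an arrow of \<open>N\<close>.\<close>

lemma gen_map:
  assumes F: "gen C P N F e" and G: "is_module C G" and y: "y \<in> carrier (val G P)"
    and N: "\<And>a. a \<in> N \<Longrightarrow> act G a y = \<one>\<^bsub>val G (dom a)\<^esub>"
  obtains \<alpha> where "\<alpha> \<in> Nat C F G" "\<alpha> P e = y"
proof -
  note f = genD[OF F]
  define c where "c A x = (SOME a. a \<in> mor C A P \<and> x = act F a e)" for A x
  define \<alpha> where "\<alpha> = (\<lambda>A\<in>Obj C. \<lambda>x\<in>carrier (val F A). act G (c A x) y)"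
  have val: "\<alpha> (dom a) (act F a e) = act G a y" if a: "arr a" "cod a = P" for a
  proof -
    have "a \<in> mor C (dom a) P \<and> act F a e = act F a e" using a by (simp add: mor_iff)
    then have "c (dom a) (act F a e) \<in> mor C (dom a) P \<and> act F a e = act F (c (dom a) (act F a e)) e"
      unfolding c_def by (rule someI)
    moreover define b where "b = c (dom a) (act F a e)"
    ultimately have "b \<in> mor C (dom a) P \<and> act F a e = act F b e" by (simp only:)
    then have b: "arr b" "dom b = dom a" "cod b = P" and ab: "act F a e = act F b e"
      by (auto simp: mor_iff)
    have q: "eqm C N a b" using gen_eq[OF F a(1) b(1) b(2)[symmetric] a(2) b(3)] ab by blast
    have "act G (sub C a b) y = \<one>\<^bsub>val G (dom a)\<^esub>" using N[OF eqmD(5)[OF q]] a b by simp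
    then have "act G a y = act G b y" using md_eq[OF G a(1) b(1), of y] a b y by simp
    then show ?thesis unfolding \<alpha>_def using f(7)[OF a] a b_def[symmetric] by simp
  qed
  have rep: "\<exists>a. a \<in> Arr C \<and> dom a = A \<and> cod a = P \<and> x = act F a e" if "obj A" "x \<in> carrier (val F A)" for A x
    using f(5)[OF that] by (auto simp: mor_iff)
  have cl: "\<alpha> A x \<in> carrier (val G A)" if Ax: "obj A" "x \<in> carrier (val F A)" for A x
  proof -
    obtain a where a: "arr a" "dom a = A" "cod a = P" "x = act F a e" using rep[OF Ax] by blast
    show ?thesis using val[OF a(1,3)] md_act[OF G, of a y] a y by simp
  qed
  have N: "\<alpha> \<in> Nat C F G"
  proof (rule NatI)
    show "\<alpha> \<in> (\<Pi>\<^sub>E A\<in>Obj C. carrier (val F A) \<rightarrow>\<^sub>E carrier (val G A))"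
    proof (intro PiE_I)
      fix A x assume A: "obj A"
      show "x \<in> carrier (val F A) \<Longrightarrow> \<alpha> A x \<in> carrier (val G A)" using cl A by blast
      show "x \<notin> carrier (val F A) \<Longrightarrow> \<alpha> A x = undefined" using A by (simp add: \<alpha>_def)
    qed (simp add: \<alpha>_def)
  next
    fix A assume A: "obj A"
    show "\<alpha> A \<in> hom (val F A) (val G A)"
    proof (rule homI)
      show "x \<in> carrier (val F A) \<Longrightarrow> \<alpha> A x \<in> carrier (val G A)" for x using cl A by blast
      fix x x' assume x: "x \<in> carrier (val F A)" "x' \<in> carrier (val F A)"
      obtain a where a: "arr a" "dom a = A" "cod a = P" "x = act F a e" using rep[OF A x(1)] by blast
      obtain a' where a': "arr a'" "dom a' = A" "cod a' = P" "x' = act F a' e" using rep[OF A x(2)] by blast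
      have e: "x \<otimes>\<^bsub>val F A\<^esub> x' = act F (a \<boxplus> a') e" using md_add[OF f(2), of a a' e] a a' f(3) by simp
      have "\<alpha> A (x \<otimes>\<^bsub>val F A\<^esub> x') = act G (a \<boxplus> a') y" unfolding e using val[of "a \<boxplus> a'"] a a' by simp
      also have "\<dots> = act G a y \<otimes>\<^bsub>val G A\<^esub> act G a' y" using md_add[OF G, of a a' y] a a' y by simp
      also have "\<dots> = \<alpha> A x \<otimes>\<^bsub>val G A\<^esub> \<alpha> A x'" using val[OF a(1,3)] val[OF a'(1,3)] a a' by simp
      finally show "\<alpha> A (x \<otimes>\<^bsub>val F A\<^esub> x') = \<alpha> A x \<otimes>\<^bsub>val G A\<^esub> \<alpha> A x'" .
    qed
  next
    fix h x assume h: "arr h" "x \<in> carrier (val F (cod h))"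
    obtain a where a: "arr a" "dom a = cod h" "cod a = P" "x = act F a e" using rep[OF _ h(2)] h by auto
    have "act F h x = act F (a \<cdot> h) e" using md_comp[OF f(2), of h a e] h a f(3) by simp
    then have "\<alpha> (dom h) (act F h x) = act G (a \<cdot> h) y" using val[of "a \<cdot> h"] h a by simp
    also have "\<dots> = act G h (act G a y)" using md_comp[OF G, of h a y] h a y by simp
    also have "\<dots> = act G h (\<alpha> (cod h) x)" using val[OF a(1,3)] a by simp
    finally show "\<alpha> (dom h) (act F h x) = act G h (\<alpha> (cod h) x)" .
  qed
  have "\<alpha> P e = y" using val[of "Id C P"] md_Id[OF f(2,4,3)] md_Id[OF G f(4) y] f(4) by simp
  then show ?thesis using that N by blast
qed

section \<open>Representable modules and exactness in terms of arrows\<close>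

lemma zeros_iff:
  assumes "arr a" "cod a = P"
  shows "a \<in> zeros C P \<longleftrightarrow> a = Zero C (dom a) P"
proof
  assume "a \<in> zeros C P"
  then obtain A where A: "obj A" "a = Zero C A P" by (auto simp: zeros_def)
  have "obj P" using assms by auto
  then have "dom a = A" unfolding A(2) using A(1) by simp
  then show "a = Zero C (dom a) P" using A(2) by simp
next
  assume "a = Zero C (dom a) P"
  then show "a \<in> zeros C P" unfolding zeros_def using arr_Dom[OF assms(1)] by blast
qed

lemma right_ideal_zeros: "obj P \<Longrightarrow> right_ideal C P (zeros C P)"
  unfolding right_ideal_def zeros_def by auto

lemma rep_sel [simp]: "val (rep C X) A = Hom C A X" "act (rep C X) h f = f \<cdot> h" "carrier (Hom C A X) = mor C A X"
  "\<one>\<^bsub>Hom C A X\<^esub> = Zero C A X" "f \<otimes>\<^bsub>Hom C A X\<^esub> g = f \<boxplus> g"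
  by (simp_all add: rep_def Hom_def)

lemma is_module_rep: "obj X \<Longrightarrow> is_module C (rep C X)"
  unfolding is_module_def by (auto simp: Hom_comm_group mor_iff intro!: homI)

lemma gen_rep: "obj X \<Longrightarrow> gen C X (zeros C X) (rep C X) (Id C X)"
  unfolding gen_def using right_ideal_zeros is_module_rep zeros_iff
  by (auto simp: mor_iff)

lemma Im_at_gen:
  assumes P: "gen C Z N P e" and a: "\<alpha> \<in> Nat C P G" and A: "obj A"
  shows "Im_at P \<alpha> A = {act G b (\<alpha> Z e) | b. b \<in> mor C A Z}"
proof
  show "Im_at P \<alpha> A \<subseteq> {act G b (\<alpha> Z e) | b. b \<in> mor C A Z}"
  proof
    fix y assume "y \<in> Im_at P \<alpha> A"
    then obtain x where x: "x \<in> carrier (val P A)" "y = \<alpha> A x" by (auto simp: Im_at_def)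
    obtain b where b: "arr b" "dom b = A" "cod b = Z" "x = act P b e"
      using genD(5)[OF P A x(1)] by (auto simp: mor_iff)
    have "y = act G b (\<alpha> Z e)" using Nat_gen[OF a P b(1,3)] b x by simp
    then show "y \<in> {act G b (\<alpha> Z e) | b. b \<in> mor C A Z}" using b by (auto simp: mor_iff)
  qed
  show "{act G b (\<alpha> Z e) | b. b \<in> mor C A Z} \<subseteq> Im_at P \<alpha> A"
  proof
    fix y assume "y \<in> {act G b (\<alpha> Z e) | b. b \<in> mor C A Z}"
    then obtain b where b: "arr b" "dom b = A" "cod b = Z" "y = act G b (\<alpha> Z e)" by (auto simp: mor_iff)
    then have "y = \<alpha> A (act P b e)" using Nat_gen[OF a P b(1,3)] by simp
    then show "y \<in> Im_at P \<alpha> A" using genD(7)[OF P b(1,3)] b(2) by (auto simp: Im_at_def)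
  qed
qed

text \<open>By Yoneda the elements of the free module \<open>Q\<close> at \<open>A\<close>
  correspond to the arrows from \<open>A\<close> to \<open>Y\<close>. The kernel then consists of
  the arrows annihilating \<open>\<epsilon> Y f\<close>, the image of those factoring through
  \<open>d\<close>.\<close>

lemma exact_at_iff:
  assumes P: "gen C Z N P e" and Q: "gen C Y (zeros C Y) Q f" and F: "is_module C F"
    and a: "\<alpha> \<in> Nat C P Q" and E: "\<epsilon> \<in> Nat C Q F" and d: "d \<in> mor C Z Y" "\<alpha> Z e = act Q d f"
  shows "exact_at C P Q F \<alpha> \<epsilon> \<longleftrightarrow> (\<forall>b\<in>Arr C. cod b = Y \<longrightarrow>
    (act F b (\<epsilon> Y f) = \<one>\<^bsub>val F (dom b)\<^esub> \<longleftrightarrow> (\<exists>t\<in>mor C (dom b) Z. b = d \<cdot> t)))"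
proof -
  note q = genD[OF Q]
  have dt: "arr d" "dom d = Z" "cod d = Y" using d by (auto simp: mor_iff)
  have im: "Im_at P \<alpha> A = {act Q (d \<cdot> t) f | t. t \<in> mor C A Z}" if A: "obj A" for A
  proof -
    have "act Q t (act Q d f) = act Q (d \<cdot> t) f" if "t \<in> mor C A Z" for t
      using md_comp[OF q(2), of t d f] that dt q(3) by (simp add: mor_iff)
    then show ?thesis unfolding Im_at_gen[OF P a A] d(2) by force
  qed
  have ker: "act Q b f \<in> Ker_at Q F \<epsilon> (dom b) \<longleftrightarrow> act F b (\<epsilon> Y f) = \<one>\<^bsub>val F (dom b)\<^esub>"
    if b: "arr b" "cod b = Y" for b
    using q(7)[OF b] Nat_gen[OF E Q b] by (simp add: Ker_at_def kernel_def)
  have inj: "act Q b f = act Q b' f \<longleftrightarrow> b = b'"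
    if b: "arr b" "cod b = Y" "arr b'" "cod b' = Y" "dom b = dom b'" for b b'
    using gen_eq[OF Q, of b b'] b sub_eq_Zero[of b b'] zeros_iff[of "sub C b b'" Y] by (auto simp: eqm_def)
  have im': "act Q b f \<in> Im_at P \<alpha> (dom b) \<longleftrightarrow> (\<exists>t\<in>mor C (dom b) Z. b = d \<cdot> t)"
    if b: "arr b" "cod b = Y" for b
  proof -
    have "act Q b f = act Q (d \<cdot> t) f \<longleftrightarrow> b = d \<cdot> t" if "t \<in> mor C (dom b) Z" for t
      using inj[of b "d \<cdot> t"] b that dt by (auto simp: mor_iff)
    then show ?thesis unfolding im[OF arr_Dom[OF b(1)]] by blast
  qed
  show ?thesis
  proof
    assume "exact_at C P Q F \<alpha> \<epsilon>"
    then show "\<forall>b\<in>Arr C. cod b = Y \<longrightarrow>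
      (act F b (\<epsilon> Y f) = \<one>\<^bsub>val F (dom b)\<^esub> \<longleftrightarrow> (\<exists>t\<in>mor C (dom b) Z. b = d \<cdot> t))"
      unfolding exact_at_def using ker im' arr_Dom by blast
  next
    assume R: "\<forall>b\<in>Arr C. cod b = Y \<longrightarrow>
      (act F b (\<epsilon> Y f) = \<one>\<^bsub>val F (dom b)\<^esub> \<longleftrightarrow> (\<exists>t\<in>mor C (dom b) Z. b = d \<cdot> t))"
    show "exact_at C P Q F \<alpha> \<epsilon>"
      unfolding exact_at_def
    proof
      fix A assume A: "obj A"
      have sub: "Im_at P \<alpha> A \<subseteq> carrier (val Q A)" using NatD(1)[OF a A] by (auto simp: Im_at_def)
      have sub': "Ker_at Q F \<epsilon> A \<subseteq> carrier (val Q A)" by (auto simp: Ker_at_def kernel_def)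
      have "x \<in> Im_at P \<alpha> A \<longleftrightarrow> x \<in> Ker_at Q F \<epsilon> A" if x: "x \<in> carrier (val Q A)" for x
      proof -
        obtain b where b: "arr b" "dom b = A" "cod b = Y" "x = act Q b f"
          using q(5)[OF A x] by (auto simp: mor_iff)
        show ?thesis using ker[OF b(1,3)] im'[OF b(1,3)] R b by auto
      qed
      then show "Im_at P \<alpha> A = Ker_at Q F \<epsilon> A" using sub sub' by blast
    qed
  qed
qed

lemma epi_at_iff:
  assumes Q: "gen C Y N Q f" and E: "\<epsilon> \<in> Nat C Q F"
  shows "epi_at C Q F \<epsilon> \<longleftrightarrow> (\<forall>A\<in>Obj C. \<forall>x\<in>carrier (val F A). \<exists>a\<in>mor C A Y. x = act F a (\<epsilon> Y f))"
proof -
  have "Im_at Q \<epsilon> A = carrier (val F A) \<longleftrightarrow> (\<forall>x\<in>carrier (val F A). \<exists>a\<in>mor C A Y. x = act F a (\<epsilon> Y f))"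
    if A: "obj A" for A
  proof -
    have "Im_at Q \<epsilon> A \<subseteq> carrier (val F A)" using NatD(1)[OF E A] by (auto simp: Im_at_def)
    then show ?thesis unfolding Im_at_gen[OF Q E A] by blast
  qed
  then show ?thesis unfolding epi_at_def by blast
qed

lemma mono_at_iff:
  assumes Q: "gen C Y (zeros C Y) Q f" and F: "is_module C F" and E: "\<epsilon> \<in> Nat C Q F"
  shows "mono_at C Q F \<epsilon> \<longleftrightarrow> (\<forall>a\<in>Arr C. cod a = Y \<longrightarrow> act F a (\<epsilon> Y f) = \<one>\<^bsub>val F (dom a)\<^esub> \<longrightarrow>
    a = Zero C (dom a) Y)"
proof -
  note q = genD[OF Q]
  have ker: "act Q b f \<in> Ker_at Q F \<epsilon> (dom b) \<longleftrightarrow> act F b (\<epsilon> Y f) = \<one>\<^bsub>val F (dom b)\<^esub>"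
    if b: "arr b" "cod b = Y" for b
    using q(7)[OF b] Nat_gen[OF E Q b] by (simp add: Ker_at_def kernel_def)
  have one: "act Q b f = \<one>\<^bsub>val Q (dom b)\<^esub> \<longleftrightarrow> b = Zero C (dom b) Y" if b: "arr b" "cod b = Y" for b
    using q(6)[OF b] zeros_iff[OF b] by simp
  show ?thesis
  proof
    assume M: "mono_at C Q F \<epsilon>"
    show "\<forall>a\<in>Arr C. cod a = Y \<longrightarrow> act F a (\<epsilon> Y f) = \<one>\<^bsub>val F (dom a)\<^esub> \<longrightarrow> a = Zero C (dom a) Y"
    proof (intro ballI impI)
      fix a assume a: "arr a" "cod a = Y" "act F a (\<epsilon> Y f) = \<one>\<^bsub>val F (dom a)\<^esub>"
      have "Ker_at Q F \<epsilon> (dom a) = {\<one>\<^bsub>val Q (dom a)\<^esub>}" using M a unfolding mono_at_def by simp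
      then show "a = Zero C (dom a) Y" using ker[OF a(1,2)] one[OF a(1,2)] a(3) by blast
    qed
  next
    assume R: "\<forall>a\<in>Arr C. cod a = Y \<longrightarrow> act F a (\<epsilon> Y f) = \<one>\<^bsub>val F (dom a)\<^esub> \<longrightarrow> a = Zero C (dom a) Y"
    show "mono_at C Q F \<epsilon>"
      unfolding mono_at_def
    proof (intro ballI subset_antisym subsetI)
      fix A x assume A: "obj A" and x: "x \<in> Ker_at Q F \<epsilon> A"
      then have xq: "x \<in> carrier (val Q A)" by (simp add: Ker_at_def kernel_def)
      obtain b where b: "arr b" "dom b = A" "cod b = Y" "x = act Q b f"
        using q(5)[OF A xq] by (auto simp: mor_iff)
      have "b = Zero C (dom b) Y" using R b ker[OF b(1,3)] x by blast
      then show "x \<in> {\<one>\<^bsub>val Q A\<^esub>}" using one[OF b(1,3)] b by simp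
    next
      fix A x assume A: "obj A" and x: "x \<in> {\<one>\<^bsub>val Q A\<^esub>}"
      interpret G: comm_group "val Q A" by (rule md_group[OF q(2) A])
      interpret H: comm_group "val F A" by (rule md_group[OF F A])
      show "x \<in> Ker_at Q F \<epsilon> A"
        using x hom_one[OF NatD(2)[OF E A] G.is_group H.is_group] by (simp add: Ker_at_def kernel_def)
    qed
  qed
qed

lemma rep_map_Nat:
  assumes "d \<in> mor C X Y"
  shows "rep_map C d \<in> Nat C (rep C X) (rep C Y)" "rep_map C d X (Id C X) = act (rep C Y) d (Id C Y)"
proof -
  have d: "arr d" "dom d = X" "cod d = Y" "obj X" "obj Y" using assms by (auto simp: mor_iff)
  show "rep_map C d \<in> Nat C (rep C X) (rep C Y)"
  proof (rule NatI)
    show "rep_map C d \<in> (\<Pi>\<^sub>E A\<in>Obj C. carrier (val (rep C X) A) \<rightarrow>\<^sub>E carrier (val (rep C Y) A))"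
      unfolding rep_map_def using d by (auto simp: mor_iff)
    show "rep_map C d A \<in> hom (val (rep C X) A) (val (rep C Y) A)" if "obj A" for A
      using that d by (auto simp: rep_map_def mor_iff intro!: homI)
    show "rep_map C d (dom h) (act (rep C X) h x) = act (rep C Y) h (rep_map C d (cod h) x)"
      if "arr h" "x \<in> carrier (val (rep C X) (cod h))" for h x
      using that d by (simp add: rep_map_def mor_iff)
  qed
  show "rep_map C d X (Id C X) = act (rep C Y) d (Id C Y)" using d by (simp add: rep_map_def mor_iff)
qed

lemma exact_at_free:
  assumes P: "gen C Z N P e" and Q: "gen C Y (zeros C Y) Q f" and R: "gen C X (zeros C X) R g"
    and a: "\<alpha> \<in> Nat C P Q" and b: "\<beta> \<in> Nat C Q R" and d: "d \<in> mor C Z Y" "\<alpha> Z e = act Q d f"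
    and c: "c \<in> mor C Y X" "\<beta> Y f = act R c g"
  shows "exact_at C P Q R \<alpha> \<beta> \<longleftrightarrow> (\<forall>h\<in>Arr C. cod h = Y \<longrightarrow>
    (c \<cdot> h = Zero C (dom h) X \<longleftrightarrow> (\<exists>t\<in>mor C (dom h) Z. h = d \<cdot> t)))"
proof -
  note r = genD[OF R]
  have ct: "arr c" "dom c = Y" "cod c = X" using c by (auto simp: mor_iff)
  have "act R h (act R c g) = \<one>\<^bsub>val R (dom h)\<^esub> \<longleftrightarrow> c \<cdot> h = Zero C (dom h) X" if "arr h" "cod h = Y" for h
    using that ct md_comp[OF r(2), of h c g] r(3) r(6)[of "c \<cdot> h"] zeros_iff[of "c \<cdot> h" X] by simp
  then show ?thesis unfolding exact_at_iff[OF P Q r(2) a b d] c(2) by auto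
qed

lemma mono_at_free:
  assumes Q: "gen C Y (zeros C Y) Q f" and R: "gen C X (zeros C X) R g"
    and b: "\<beta> \<in> Nat C Q R" and c: "c \<in> mor C Y X" "\<beta> Y f = act R c g"
  shows "mono_at C Q R \<beta> \<longleftrightarrow> (\<forall>h\<in>Arr C. cod h = Y \<longrightarrow> c \<cdot> h = Zero C (dom h) X \<longrightarrow> h = Zero C (dom h) Y)"
proof -
  note r = genD[OF R]
  have ct: "arr c" "dom c = Y" "cod c = X" using c by (auto simp: mor_iff)
  have "act R h (act R c g) = \<one>\<^bsub>val R (dom h)\<^esub> \<longleftrightarrow> c \<cdot> h = Zero C (dom h) X" if "arr h" "cod h = Y" for h
    using that ct md_comp[OF r(2), of h c g] r(3) r(6)[of "c \<cdot> h"] zeros_iff[of "c \<cdot> h" X] by simp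
  then show ?thesis unfolding mono_at_iff[OF Q r(2) b] c(2) by auto
qed

end

definition submod :: "('o, 'm) cat \<Rightarrow> ('o, 'm, 'v) cmod \<Rightarrow> ('o \<Rightarrow> 'v set) \<Rightarrow> bool" where
  "submod C F U \<longleftrightarrow> (\<forall>A\<in>Obj C. subgroup (U A) (val F A)) \<and>
     (\<forall>h\<in>Arr C. \<forall>x\<in>U (Cod C h). act F h x \<in> U (Dom C h))"

text \<open>
  An isomorphic copy with values in \<open>'m set\<close>, because lifting problems for projectives are only
  tested on modules with such values.
\<close>

definition sing :: "('o, 'm, 'v) cmod \<Rightarrow> ('o, 'm, 'v set) cmod" where
  "sing F = \<lparr>val = \<lambda>A. \<lparr>carrier = (\<lambda>x. {x}) ` carrier (val F A),
       mult = \<lambda>S T. {the_elem S \<otimes>\<^bsub>val F A\<^esub> the_elem T}, one = {\<one>\<^bsub>val F A\<^esub>}\<rparr>,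
     act = \<lambda>h S. {act F h (the_elem S)}\<rparr>"

lemma sing_sel [simp]:
  "carrier (val (sing F) A) = (\<lambda>x. {x}) ` carrier (val F A)"
  "{x} \<otimes>\<^bsub>val (sing F) A\<^esub> {y} = {x \<otimes>\<^bsub>val F A\<^esub> y}" "\<one>\<^bsub>val (sing F) A\<^esub> = {\<one>\<^bsub>val F A\<^esub>}"
  "act (sing F) h {x} = {act F h x}"
  by (simp_all add: sing_def)

section \<open>Submodules, quotients and annihilators\<close>

context additive_category begin

lemma is_moduleI:
  assumes "\<And>A. A \<in> Obj C \<Longrightarrow> comm_group (val F A)"
    "\<And>h. h \<in> Arr C \<Longrightarrow> act F h \<in> hom (val F (cod h)) (val F (dom h))"
    "\<And>A x. A \<in> Obj C \<Longrightarrow> x \<in> carrier (val F A) \<Longrightarrow> act F (Id C A) x = x"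
    "\<And>h k x. \<lbrakk>arr h; arr k; cod h = dom k; x \<in> carrier (val F (cod k))\<rbrakk> \<Longrightarrow>
      act F (k \<cdot> h) x = act F h (act F k x)"
    "\<And>h k x. \<lbrakk>arr h; arr k; dom h = dom k; cod h = cod k; x \<in> carrier (val F (cod k))\<rbrakk> \<Longrightarrow>
      act F (h \<boxplus> k) x = act F h x \<otimes>\<^bsub>val F (dom k)\<^esub> act F k x"
  shows "is_module C F"
  unfolding is_module_def
proof (intro conjI ballI)
  show "act F h \<in> hom (val F B) (val F A)" if "h \<in> mor C A B" for A B h
    using assms(2)[of h] that by (auto simp: mor_iff)
  show "act F (k \<cdot> h) x = act F h (act F k x)"
    if "h \<in> mor C A B" "k \<in> mor C B D" "x \<in> carrier (val F D)" for A B D h k x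
    using assms(4)[of h k x] that by (auto simp: mor_iff)
  show "act F (h \<boxplus> k) x = act F h x \<otimes>\<^bsub>val F A\<^esub> act F k x"
    if "h \<in> mor C A B" "k \<in> mor C A B" "x \<in> carrier (val F B)" for A B h k x
    using assms(5)[of h k x] that by (auto simp: mor_iff)
qed (use assms(1,3) in auto)

lemma is_module_sing:
  assumes F: "is_module C F"
  shows "is_module C (sing F)"
proof (rule is_moduleI)
  fix A assume A: "obj A"
  interpret G: comm_group "val F A" by (rule md_group[OF F A])
  show "comm_group (val (sing F) A)"
    by (rule comm_groupI) (auto simp: G.m_ac image_iff intro: G.l_inv)
next
  fix h assume h: "arr h"
  show "act (sing F) h \<in> hom (val (sing F) (cod h)) (val (sing F) (dom h))"
    by (rule homI) (auto simp: md_act[OF F h] md_mult[OF F h])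
qed (auto simp: md_Id[OF F] md_comp[OF F] md_add[OF F])

lemma gen_sing:
  assumes G: "gen C P N F e"
  shows "gen C P N (sing F) {e}"
  unfolding gen_def
proof (intro conjI ballI impI)
  note g = genD[OF G]
  show "right_ideal C P N" "is_module C (sing F)" "{e} \<in> carrier (val (sing F) P)"
    using g(1,3) is_module_sing[OF g(2)] by auto
  show "\<exists>a\<in>mor C A P. x = act (sing F) a {e}" if A: "obj A" and x: "x \<in> carrier (val (sing F) A)" for A x
  proof -
    obtain y where "y \<in> carrier (val F A)" "x = {y}" using x by auto
    then show ?thesis using g(5)[OF A, of y] by auto
  qed
  show "act (sing F) a {e} = \<one>\<^bsub>val (sing F) (dom a)\<^esub> \<longleftrightarrow> a \<in> N" if "arr a" "cod a = P" for a
    using g(6)[OF that] by simp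
qed

lemma submod_Im:
  assumes G: "is_module C G" and F: "is_module C F" and a: "\<alpha> \<in> Nat C G F"
  shows "submod C F (Im_at G \<alpha>)"
  unfolding submod_def
proof (intro conjI ballI)
  fix A assume A: "obj A"
  interpret G: comm_group "val G A" by (rule md_group[OF G A])
  interpret F: comm_group "val F A" by (rule md_group[OF F A])
  interpret h: group_hom "val G A" "val F A" "\<alpha> A"
    by unfold_locales (rule NatD(2)[OF a A])
  show "subgroup (Im_at G \<alpha> A) (val F A)" unfolding Im_at_def by (rule h.img_is_subgroup)
next
  fix h x assume h: "arr h" and "x \<in> Im_at G \<alpha> (cod h)"
  then obtain y where y: "y \<in> carrier (val G (cod h))" "x = \<alpha> (cod h) y" by (auto simp: Im_at_def)
  show "act F h x \<in> Im_at G \<alpha> (dom h)"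
    unfolding Im_at_def y(2) NatD(3)[OF a h y(1), symmetric] by (rule imageI) (rule md_act[OF G h y(1)])
qed

lemma right_ideal_ann:
  assumes F: "is_module C F" and x: "obj P" "x \<in> carrier (val F P)"
  shows "right_ideal C P {a \<in> Arr C. cod a = P \<and> act F a x = \<one>\<^bsub>val F (dom a)\<^esub>}"
  unfolding right_ideal_def
proof (intro conjI ballI impI)
  fix a b assume "a \<in> {a \<in> Arr C. cod a = P \<and> act F a x = \<one>\<^bsub>val F (dom a)\<^esub>}"
    "b \<in> {a \<in> Arr C. cod a = P \<and> act F a x = \<one>\<^bsub>val F (dom a)\<^esub>}" "dom a = dom b"
  then have a: "arr a" "cod a = P" "act F a x = \<one>\<^bsub>val F (dom b)\<^esub>" "arr b" "cod b = P"
    "act F b x = \<one>\<^bsub>val F (dom b)\<^esub>" "dom a = dom b" by auto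
  interpret G: comm_group "val F (dom b)" by (rule md_group[OF F]) (use a in simp)
  show "a \<boxplus> b \<in> {a \<in> Arr C. cod a = P \<and> act F a x = \<one>\<^bsub>val F (dom a)\<^esub>}"
    using a md_add[OF F a(1,4), of x] x by simp
next
  fix a h assume "a \<in> {a \<in> Arr C. cod a = P \<and> act F a x = \<one>\<^bsub>val F (dom a)\<^esub>}" and h: "arr h" "cod h = dom a"
  then have a: "arr a" "cod a = P" "act F a x = \<one>\<^bsub>val F (cod h)\<^esub>" by auto
  show "a \<cdot> h \<in> {a \<in> Arr C. cod a = P \<and> act F a x = \<one>\<^bsub>val F (dom a)\<^esub>}"
    using a h md_comp[OF F h(1) a(1), of x] md_one[OF F h(1)] x by simp
qed (use x md_Zero[OF F _ x] in auto)

lemma is_module_submodule: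
  assumes F: "is_module C F" and U: "submod C F U"
  shows "is_module C (submodule F U)"
proof (rule is_moduleI)
  have sg: "subgroup (U A) (val F A)" if "obj A" for A using U that by (simp add: submod_def)
  have st: "act F h x \<in> U (dom h)" if "arr h" "x \<in> U (cod h)" for h x using U that by (simp add: submod_def)
  have sub: "x \<in> carrier (val F A)" if "obj A" "x \<in> U A" for A x using subgroup.mem_carrier[OF sg] that by blast
  show "comm_group (val (submodule F U) A)" if A: "obj A" for A
  proof -
    interpret G: comm_group "val F A" by (rule md_group[OF F A])
    interpret H: group "(val F A)\<lparr>carrier := U A\<rparr>" by (rule subgroup.subgroup_is_group[OF sg[OF A] G.is_group])
    show ?thesis unfolding submodule_def
      by simp (rule group.group_comm_groupI[OF H.is_group], use sub[OF A] in \<open>simp add: G.m_comm\<close>)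
  qed
  show "act (submodule F U) h \<in> hom (val (submodule F U) (cod h)) (val (submodule F U) (dom h))" if h: "arr h" for h
    by (rule homI) (use h st[OF h] sub[of "cod h"] in \<open>simp_all add: submodule_def md_mult[OF F h]\<close>)
qed (simp_all add: submodule_def md_Id[OF F] md_comp[OF F] md_add[OF F]
   subgroup.mem_carrier[OF U[unfolded submod_def, THEN conjunct1, THEN bspec]])

text \<open>The relations of the generator of an image are its annihilator. \<open>U\<close> is
  compared with the image on objects only, so that a kernel known to be an image by exactness may be
  inserted.\<close>

lemma gen_submodule:
  assumes G: "gen C P N G g" and F: "is_module C F" and a: "\<alpha> \<in> Nat C G F"
    and U: "\<And>A. A \<in> Obj C \<Longrightarrow> U A = Im_at G \<alpha> A"
  shows "gen C P {a \<in> Arr C. cod a = P \<and> act F a (\<alpha> P g) = \<one>\<^bsub>val F (dom a)\<^esub>} (submodule F U) (\<alpha> P g)"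
  unfolding gen_def
proof (intro conjI ballI impI)
  note g = genD[OF G]
  have x: "\<alpha> P g \<in> carrier (val F P)" by (rule NatD(1)[OF a g(4,3)])
  have "submod C F U" using submod_Im[OF g(2) F a] U by (simp add: submod_def)
  then show "is_module C (submodule F U)" by (rule is_module_submodule[OF F])
  show "right_ideal C P {a \<in> Arr C. cod a = P \<and> act F a (\<alpha> P g) = \<one>\<^bsub>val F (dom a)\<^esub>}"
    by (rule right_ideal_ann[OF F g(4) x])
  show "\<alpha> P g \<in> carrier (val (submodule F U) P)" using U[OF g(4)] g(3) by (simp add: submodule_def Im_at_def)
  show "\<exists>b\<in>mor C A P. x = act (submodule F U) b (\<alpha> P g)" if A: "obj A" "x \<in> carrier (val (submodule F U) A)" for A x
    using A(2) U[OF A(1)] Im_at_gen[OF G a A(1)] by (auto simp: submodule_def)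
qed (auto simp: submodule_def)

lemma submodD:
  assumes F: "is_module C F" and U: "submod C F U"
  shows "obj A \<Longrightarrow> subgroup (U A) (val F A)" "obj A \<Longrightarrow> U A \<lhd> val F A"
    "arr h \<Longrightarrow> x \<in> U (cod h) \<Longrightarrow> act F h x \<in> U (dom h)"
    "obj A \<Longrightarrow> x \<in> U A \<Longrightarrow> x \<in> carrier (val F A)"
proof -
  show 1: "obj A \<Longrightarrow> subgroup (U A) (val F A)" for A using U by (simp add: submod_def)
  show "obj A \<Longrightarrow> U A \<lhd> val F A" using 1 comm_group.normal_iff_subgroup[OF md_group[OF F]] by blast
  show "arr h \<Longrightarrow> x \<in> U (cod h) \<Longrightarrow> act F h x \<in> U (dom h)" using U by (simp add: submod_def)
  show "obj A \<Longrightarrow> x \<in> U A \<Longrightarrow> x \<in> carrier (val F A)" using subgroup.mem_carrier[OF 1] by blast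
qed

text \<open>The action on a coset is a union over its elements. All of them are sent to the same
  coset, so the union collapses.\<close>

lemma act_quotient_module:
  assumes F: "is_module C F" and U: "submod C F U" and h: "arr h" "x \<in> carrier (val F (cod h))"
  shows "act (quotient_module C F U) h (U (cod h) #>\<^bsub>val F (cod h)\<^esub> x) = U (dom h) #>\<^bsub>val F (dom h)\<^esub> act F h x"
proof -
  note u = submodD[OF F U]
  have o: "obj (cod h)" "obj (dom h)" using h by auto
  interpret G: comm_group "val F (cod h)" by (rule md_group[OF F o(1)])
  interpret H: comm_group "val F (dom h)" by (rule md_group[OF F o(2)])
  have "U (dom h) #>\<^bsub>val F (dom h)\<^esub> act F h y = U (dom h) #>\<^bsub>val F (dom h)\<^esub> act F h x"
    if "y \<in> U (cod h) #>\<^bsub>val F (cod h)\<^esub> x" for y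
  proof -
    obtain v where v: "v \<in> U (cod h)" "y = v \<otimes>\<^bsub>val F (cod h)\<^esub> x" using \<open>y \<in> _\<close> by (auto simp: r_coset_def)
    have "act F h y = act F h v \<otimes>\<^bsub>val F (dom h)\<^esub> act F h x" unfolding v(2) using md_mult[OF F h(1) u(4)[OF o(1) v(1)] h(2)] .
    then have "act F h y \<in> U (dom h) #>\<^bsub>val F (dom h)\<^esub> act F h x" using u(3)[OF h(1) v(1)] by (auto simp: r_coset_def)
    then show ?thesis by (rule H.repr_independence[OF _ md_act[OF F h] u(1)[OF o(2)], symmetric])
  qed
  moreover have "x \<in> U (cod h) #>\<^bsub>val F (cod h)\<^esub> x" by (rule G.rcos_self[OF h(2) u(1)[OF o(1)]])
  ultimately show ?thesis unfolding quotient_module_def cmod.simps by (intro UN_constant_eq ballI)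
qed

lemma quotient_elem:
  assumes "x \<in> carrier (val (quotient_module C F U) A)"
  obtains y where "y \<in> carrier (val F A)" "x = U A #>\<^bsub>val F A\<^esub> y"
  using assms by (auto simp: quotient_module_def FactGroup_def RCOSETS_def)

lemma is_module_quotient:
  assumes F: "is_module C F" and U: "submod C F U"
  shows "is_module C (quotient_module C F U)"
proof (rule is_moduleI)
  note u = submodD[OF F U] and act = act_quotient_module[OF F U]
  have mult: "(U A #>\<^bsub>val F A\<^esub> x) \<otimes>\<^bsub>val (quotient_module C F U) A\<^esub> (U A #>\<^bsub>val F A\<^esub> y) = U A #>\<^bsub>val F A\<^esub> (x \<otimes>\<^bsub>val F A\<^esub> y)"
    if "obj A" "x \<in> carrier (val F A)" "y \<in> carrier (val F A)" for A x y
    using normal.rcos_sum[OF u(2)[OF that(1)] that(2,3)] by (simp add: quotient_module_def FactGroup_def)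
  have in_car: "U A #>\<^bsub>val F A\<^esub> x \<in> carrier (val (quotient_module C F U) A)" if "x \<in> carrier (val F A)" for A x
    using that by (auto simp: quotient_module_def FactGroup_def RCOSETS_def)
  show "comm_group (val (quotient_module C F U) A)" if A: "obj A" for A
    unfolding quotient_module_def using comm_group.abelian_FactGroup[OF md_group[OF F A] u(1)[OF A]] by simp
  show "act (quotient_module C F U) h \<in> hom (val (quotient_module C F U) (cod h)) (val (quotient_module C F U) (dom h))"
    if h: "arr h" for h
  proof (rule homI)
    fix x y assume "x \<in> carrier (val (quotient_module C F U) (cod h))" "y \<in> carrier (val (quotient_module C F U) (cod h))"
    then obtain a b where a: "a \<in> carrier (val F (cod h))" "x = U (cod h) #>\<^bsub>val F (cod h)\<^esub> a"
      and b: "b \<in> carrier (val F (cod h))" "y = U (cod h) #>\<^bsub>val F (cod h)\<^esub> b" by (meson quotient_elem)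
    interpret G: comm_group "val F (cod h)" by (rule md_group[OF F]) (use h in simp)
    have o: "obj (cod h)" "obj (dom h)" using h by auto
    show "act (quotient_module C F U) h (x \<otimes>\<^bsub>val (quotient_module C F U) (cod h)\<^esub> y) =
      act (quotient_module C F U) h x \<otimes>\<^bsub>val (quotient_module C F U) (dom h)\<^esub> act (quotient_module C F U) h y"
      unfolding a(2) b(2) mult[OF o(1) a(1) b(1)] act[OF h a(1)] act[OF h b(1)]
        mult[OF o(2) md_act[OF F h a(1)] md_act[OF F h b(1)]] act[OF h G.m_closed[OF a(1) b(1)]]
        md_mult[OF F h a(1) b(1)] ..
  next
    fix x assume "x \<in> carrier (val (quotient_module C F U) (cod h))"
    then obtain a where a: "a \<in> carrier (val F (cod h))" "x = U (cod h) #>\<^bsub>val F (cod h)\<^esub> a" by (rule quotient_elem)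
    show "act (quotient_module C F U) h x \<in> carrier (val (quotient_module C F U) (dom h))"
      unfolding a(2) act[OF h a(1)] by (rule in_car) (rule md_act[OF F h a(1)])
  qed
  show "act (quotient_module C F U) (Id C A) x = x" if A: "obj A" "x \<in> carrier (val (quotient_module C F U) A)" for A x
  proof -
    obtain a where a: "a \<in> carrier (val F A)" "x = U A #>\<^bsub>val F A\<^esub> a" using A(2) by (rule quotient_elem)
    show ?thesis using act[of "Id C A" a] md_Id[OF F A(1) a(1)] A(1) a by simp
  qed
  show "act (quotient_module C F U) (k \<cdot> h) x = act (quotient_module C F U) h (act (quotient_module C F U) k x)"
    if h: "arr h" "arr k" "cod h = dom k" and x: "x \<in> carrier (val (quotient_module C F U) (cod k))" for h k x
  proof -
    obtain a where a: "a \<in> carrier (val F (cod k))" "x = U (cod k) #>\<^bsub>val F (cod k)\<^esub> a" using x by (rule quotient_elem)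
    show ?thesis unfolding a(2)
      using act[of "k \<cdot> h" a] act[of k a] act[of h "act F k a"] md_comp[OF F h a(1)] md_act[OF F h(2) a(1)] a(1) h by simp
  qed
  show "act (quotient_module C F U) (h \<boxplus> k) x =
      act (quotient_module C F U) h x \<otimes>\<^bsub>val (quotient_module C F U) (dom k)\<^esub> act (quotient_module C F U) k x"
    if h: "arr h" "arr k" "dom h = dom k" "cod h = cod k"
      and x: "x \<in> carrier (val (quotient_module C F U) (cod k))" for h k x
  proof -
    obtain a where a: "a \<in> carrier (val F (cod k))" "x = U (cod k) #>\<^bsub>val F (cod k)\<^esub> a" using x by (rule quotient_elem)
    show ?thesis unfolding a(2)
      using act[of "h \<boxplus> k" a] act[of k a] act[of h a] md_add[OF F h(1-4), of a] md_act[OF F h(2) a(1)] md_act[OF F h(1), of a]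
        mult[of "dom k" "act F h a" "act F k a"] a(1) h by simp
  qed
qed

lemma gen_quotient:
  assumes G: "gen C P N F e" and U: "submod C F U"
  shows "gen C P {a \<in> Arr C. cod a = P \<and> act F a e \<in> U (dom a)} (quotient_module C F U) (U P #>\<^bsub>val F P\<^esub> e)"
  unfolding gen_def
proof (intro conjI ballI impI)
  note g = genD[OF G] and u = submodD[OF genD(2)[OF G] U]
  let ?Q = "quotient_module C F U" and ?e = "U P #>\<^bsub>val F P\<^esub> e"
  note act = act_quotient_module[OF g(2) U]
  show Q: "is_module C ?Q" by (rule is_module_quotient[OF g(2) U])
  show e: "?e \<in> carrier (val ?Q P)" using g(3) by (auto simp: quotient_module_def FactGroup_def RCOSETS_def)
  have acte: "act ?Q a ?e = U (dom a) #>\<^bsub>val F (dom a)\<^esub> act F a e" if "arr a" "cod a = P" for a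
    using act[of a e] that g(3) by simp
  have one: "act ?Q a ?e = \<one>\<^bsub>val ?Q (dom a)\<^esub> \<longleftrightarrow> act F a e \<in> U (dom a)" if a: "arr a" "cod a = P" for a
  proof -
    have o: "obj (dom a)" using a by simp
    interpret H: comm_group "val F (dom a)" by (rule md_group[OF g(2) o])
    have "\<one>\<^bsub>val ?Q (dom a)\<^esub> = U (dom a)" by (simp add: quotient_module_def FactGroup_def)
    then show ?thesis unfolding acte[OF a]
      using H.coset_join1[OF _ g(7)[OF a] u(1)[OF o]] H.coset_join2[OF g(7)[OF a] u(1)[OF o]] by auto
  qed
  show "act ?Q a ?e = \<one>\<^bsub>val ?Q (dom a)\<^esub> \<longleftrightarrow> a \<in> {a \<in> Arr C. cod a = P \<and> act F a e \<in> U (dom a)}"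
    if "arr a" "cod a = P" for a using one[OF that] that by simp
  have "{a \<in> Arr C. cod a = P \<and> act F a e \<in> U (dom a)} = {a \<in> Arr C. cod a = P \<and> act ?Q a ?e = \<one>\<^bsub>val ?Q (dom a)\<^esub>}"
    using one by auto
  then show "right_ideal C P {a \<in> Arr C. cod a = P \<and> act F a e \<in> U (dom a)}"
    using right_ideal_ann[OF Q g(4) e] by simp
  show "\<exists>a\<in>mor C A P. x = act ?Q a ?e" if A: "obj A" "x \<in> carrier (val ?Q A)" for A x
  proof -
    obtain y where y: "y \<in> carrier (val F A)" "x = U A #>\<^bsub>val F A\<^esub> y" using A(2) by (rule quotient_elem)
    obtain a where a: "a \<in> mor C A P" "y = act F a e" using g(5)[OF A(1) y(1)] by blast
    then show ?thesis using acte[of a] y(2) by (auto simp: mor_iff)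
  qed
qed

section \<open>Isomorphism of modules with generators\<close>

lemma gen_mod_iso_transfer:
  assumes G: "gen C P N F e" and i: "mod_iso C F F'" and F': "is_module C F'"
  shows "\<exists>e'. gen C P N F' e'"
proof -
  note g = genD[OF G]
  obtain \<alpha> where a: "\<alpha> \<in> Nat C F F'" and bij: "\<And>A. A \<in> Obj C \<Longrightarrow> bij_betw (\<alpha> A) (carrier (val F A)) (carrier (val F' A))"
    using i unfolding mod_iso_def by blast
  have "gen C P N F' (\<alpha> P e)"
    unfolding gen_def
  proof (intro conjI ballI impI)
    show "right_ideal C P N" "is_module C F'" "\<alpha> P e \<in> carrier (val F' P)"
      using g(1) F' NatD(1)[OF a g(4,3)] by auto
    show "\<exists>b\<in>mor C A P. x = act F' b (\<alpha> P e)" if A: "obj A" "x \<in> carrier (val F' A)" for A x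
    proof -
      obtain y where y: "y \<in> carrier (val F A)" "x = \<alpha> A y"
        using bij[OF A(1)] A(2) unfolding bij_betw_def by blast
      obtain b where b: "arr b" "dom b = A" "cod b = P" "y = act F b e" using g(5)[OF A(1) y(1)] by (auto simp: mor_iff)
      have "x = act F' b (\<alpha> P e)" using Nat_gen[OF a G b(1,3)] b(2,4) y(2) by simp
      then show ?thesis using b by (auto simp: mor_iff)
    qed
    fix b assume b: "arr b" "cod b = P"
    have o: "obj (dom b)" using b by simp
    interpret G: comm_group "val F (dom b)" by (rule md_group[OF g(2) o])
    interpret H: comm_group "val F' (dom b)" by (rule md_group[OF F' o])
    have "\<alpha> (dom b) \<one>\<^bsub>val F (dom b)\<^esub> = \<one>\<^bsub>val F' (dom b)\<^esub>"
      by (rule hom_one[OF NatD(2)[OF a o] G.is_group H.is_group])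
    then have "\<alpha> (dom b) (act F b e) = \<one>\<^bsub>val F' (dom b)\<^esub> \<longleftrightarrow> act F b e = \<one>\<^bsub>val F (dom b)\<^esub>"
      using bij[OF o] g(7)[OF b] G.one_closed unfolding bij_betw_def by (metis inj_on_contraD)
    then show "act F' b (\<alpha> P e) = \<one>\<^bsub>val F' (dom b)\<^esub> \<longleftrightarrow> b \<in> N" using Nat_gen[OF a G b] g(6)[OF b] by simp
  qed
  then show ?thesis by blast
qed

lemma gen_qiso:
  assumes G: "gen C P N F e" and q: "qiso C P' N' P N u"
  shows "gen C P' N' F (act F u e)"
proof -
  note g = genD[OF G] and u = qisoD[OF q]
  obtain v where v: "arr v" "dom v = P" "cod v = P'" "eqm C N (u \<cdot> v) (Id C P)"
    using q by (auto simp: qiso_def mor_iff)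
  show ?thesis unfolding gen_def
  proof (intro conjI ballI impI)
    show "right_ideal C P' N'" "is_module C F" using u g by auto
    show "act F u e \<in> carrier (val F P')" using g(7)[of u] u by simp
    show "\<exists>a\<in>mor C A P'. x = act F a (act F u e)" if A: "obj A" "x \<in> carrier (val F A)" for A x
    proof -
      obtain a where a: "arr a" "dom a = A" "cod a = P" "x = act F a e" using g(5)[OF A] by (auto simp: mor_iff)
      have "eqm C N (u \<cdot> v \<cdot> a) (Id C P \<cdot> a)" by (rule eqm_comp[OF g(1) v(4) a(1)]) (use a v u in simp)
      then have "act F (u \<cdot> v \<cdot> a) e = act F (Id C P \<cdot> a) e" using gen_eq[OF G, of "u \<cdot> v \<cdot> a" "Id C P \<cdot> a"] a u v g(4) by simp
      then have "x = act F (u \<cdot> (v \<cdot> a)) e" using a u v by simp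
      also have "\<dots> = act F (v \<cdot> a) (act F u e)" by (rule md_comp[OF g(2)]) (use a u v g(3) in simp_all)
      finally show ?thesis using a v by (intro bexI[of _ "v \<cdot> a"]) (auto simp: mor_iff)
    qed
    show "act F a (act F u e) = \<one>\<^bsub>val F (dom a)\<^esub> \<longleftrightarrow> a \<in> N'" if a: "arr a" "cod a = P'" for a
      using md_comp[OF g(2) a(1), of u e] a u(3-5) g(3) g(6)[of "u \<cdot> a"] u(7)[OF a] by simp
  qed
qed

text \<open>Each of the two generators is obtained from the other by an arrow, and these arrows are
  inverse modulo relations.\<close>

lemma gen_unique:
  assumes G: "gen C P N F e" and G': "gen C P' N' F e'"
  shows "\<exists>u. qiso C P N P' N' u"
proof -
  note g = genD[OF G] and g' = genD[OF G']
  obtain u where u: "arr u" "dom u = P" "cod u = P'" "act F u e' = e" using g'(5)[OF g(4,3)] by (auto simp: mor_iff)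
  obtain v where v: "arr v" "dom v = P'" "cod v = P" "act F v e = e'" using g(5)[OF g'(4,3)] by (auto simp: mor_iff)
  have "qiso C P N P' N' u"
    unfolding qiso_def
  proof (intro conjI ballI impI bexI[of _ v])
    show "u \<cdot> a \<in> N' \<longleftrightarrow> a \<in> N" if a: "arr a" "cod a = P" for a
      using md_comp[OF g(2) a(1), of u e'] a u g'(3) g'(6)[of "u \<cdot> a"] g(6)[OF a] by simp
    have "act F (u \<cdot> v) e' = act F v (act F u e')" by (rule md_comp[OF g(2) v(1) u(1)]) (use u(2,3) v(3) g'(3) in simp_all)
    then have "act F (u \<cdot> v) e' = act F (Id C P') e'" unfolding u(4) v(4) md_Id[OF g(2) g'(4,3)] .
    then show "eqm C N' (u \<cdot> v) (Id C P')" using gen_eq[OF G', of "u \<cdot> v" "Id C P'"] u(1-3) v(1-3) g'(4) by simp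
  qed (use g(1) g'(1) u(1-3) v(1-3) in \<open>auto simp: mor_iff\<close>)
  then show ?thesis by blast
qed

lemma gen_mod_iso:
  assumes G: "gen C P N F e" and G': "gen C P N F' e'"
  shows "mod_iso C F F'"
proof -
  note g = genD[OF G] and g' = genD[OF G']
  have "act F' a e' = \<one>\<^bsub>val F' (dom a)\<^esub>" if "a \<in> N" for a
    using g'(6)[OF right_idealD(2,3)[OF g(1) that]] that by simp
  then obtain \<alpha> where a: "\<alpha> \<in> Nat C F F'" "\<alpha> P e = e'" using gen_map[OF G g'(2,3)] by blast
  have "bij_betw (\<alpha> A) (carrier (val F A)) (carrier (val F' A))" if A: "obj A" for A
    unfolding bij_betw_def
  proof
    show "inj_on (\<alpha> A) (carrier (val F A))"
    proof (rule inj_onI)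
      fix x y assume x: "x \<in> carrier (val F A)" and y: "y \<in> carrier (val F A)" and xy: "\<alpha> A x = \<alpha> A y"
      obtain b where b: "arr b" "dom b = A" "cod b = P" "x = act F b e" using g(5)[OF A x] by (auto simp: mor_iff)
      obtain c where c: "arr c" "dom c = A" "cod c = P" "y = act F c e" using g(5)[OF A y] by (auto simp: mor_iff)
      have "act F' b e' = act F' c e'"
        using Nat_gen[OF a(1) G b(1,3)] Nat_gen[OF a(1) G c(1,3)] xy unfolding a(2) b(2,4) c(2,4) by simp
      then show "x = y" unfolding b(4) c(4) using gen_eq[OF G b(1) c(1)] gen_eq[OF G' b(1) c(1)] b(2,3) c(2,3) by simp
    qed
    show "\<alpha> A ` carrier (val F A) = carrier (val F' A)"
    proof
      show "\<alpha> A ` carrier (val F A) \<subseteq> carrier (val F' A)" using NatD(1)[OF a(1) A] by blast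
      show "carrier (val F' A) \<subseteq> \<alpha> A ` carrier (val F A)"
        using g'(5)[OF A] unfolding Im_at_gen[OF G a(1) A, unfolded Im_at_def a(2)] by blast
    qed
  qed
  then show ?thesis unfolding mod_iso_def using a(1) by blast
qed

text \<open>Makes isomorphism of modules, even with values in different types, a matter of arrows of
  \<open>C\<close>. The comparison of \<open>Pb\<close> and \<open>Tr\<close> with their arrow
  versions goes through it.\<close>

lemma gen_mod_iso_iff:
  assumes G: "gen C P N F e" and G': "gen C P' N' F' e'"
  shows "mod_iso C F F' \<longleftrightarrow> (\<exists>u. qiso C P N P' N' u)"
proof
  assume "mod_iso C F F'"
  then obtain e2 where "gen C P N F' e2" using gen_mod_iso_transfer[OF G _ genD(2)[OF G']] by blast
  then show "\<exists>u. qiso C P N P' N' u" by (rule gen_unique[OF _ G'])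
next
  assume "\<exists>u. qiso C P N P' N' u"
  then obtain u where "qiso C P N P' N' u" by blast
  then have "gen C P N F' (act F' u e')" by (rule gen_qiso[OF G'])
  then show "mod_iso C F F'" by (rule gen_mod_iso[OF G])
qed

lemma Nat_comp_val [simp]:
  "obj A \<Longrightarrow> x \<in> carrier (val F A) \<Longrightarrow> Nat_comp C F \<beta> \<alpha> A x = \<beta> A (\<alpha> A x)"
  by (simp add: Nat_comp_def compose_def)

lemma Nat_comp_Nat:
  assumes F: "is_module C F" and a: "\<alpha> \<in> Nat C F G" and b: "\<beta> \<in> Nat C G H"
  shows "Nat_comp C F \<beta> \<alpha> \<in> Nat C F H"
proof (rule NatI)
  have v: "Nat_comp C F \<beta> \<alpha> A x \<in> carrier (val H A)" if "obj A" "x \<in> carrier (val F A)" for A x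
    using NatD(1)[OF b that(1) NatD(1)[OF a that]] that by simp
  show "Nat_comp C F \<beta> \<alpha> \<in> (\<Pi>\<^sub>E A\<in>Obj C. carrier (val F A) \<rightarrow>\<^sub>E carrier (val H A))"
  proof (intro PiE_I)
    show "x \<in> carrier (val F A) \<Longrightarrow> Nat_comp C F \<beta> \<alpha> A x \<in> carrier (val H A)" if "obj A" for A x
      using v that by blast
  qed (simp_all add: Nat_comp_def compose_def)
  show "Nat_comp C F \<beta> \<alpha> A \<in> hom (val F A) (val H A)" if A: "obj A" for A
  proof (rule homI)
    fix x y assume xy: "x \<in> carrier (val F A)" "y \<in> carrier (val F A)"
    interpret G: comm_group "val F A" by (rule md_group[OF F A])
    show "Nat_comp C F \<beta> \<alpha> A (x \<otimes>\<^bsub>val F A\<^esub> y) = Nat_comp C F \<beta> \<alpha> A x \<otimes>\<^bsub>val H A\<^esub> Nat_comp C F \<beta> \<alpha> A y"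
      using A xy hom_mult[OF NatD(2)[OF a A] xy] hom_mult[OF NatD(2)[OF b A] NatD(1)[OF a A xy(1)] NatD(1)[OF a A xy(2)]]
        G.m_closed[OF xy] by simp
  qed (rule v[OF A])
  show "Nat_comp C F \<beta> \<alpha> (dom h) (act F h x) = act H h (Nat_comp C F \<beta> \<alpha> (cod h) x)"
    if h: "arr h" "x \<in> carrier (val F (cod h))" for h x
    using h md_act[OF F h] NatD(3)[OF a h] NatD(3)[OF b h(1) NatD(1)[OF a _ h(2)]] by simp
qed

section \<open>Projective modules and resolutions\<close>

text \<open>The modules \<open>P i\<close> are only isomorphic to representables. Generators
  \<open>f i\<close> turn the maps between them into arrows \<open>d\<close>, and exactness becomes
  a statement about these.\<close>

lemma resolution_iff:
  assumes P: "\<And>i. gen C (X i) (zeros C (X i)) (P i) (f i)" and F: "is_module C F"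
    and E: "\<epsilon> \<in> Nat C (P 0) F" and D: "\<And>i. \<delta> (Suc i) \<in> Nat C (P (Suc i)) (P i)"
    and d: "\<And>i. d (Suc i) \<in> mor C (X (Suc i)) (X i)" and v: "\<And>i. \<delta> (Suc i) (X (Suc i)) (f (Suc i)) = act (P i) (d (Suc i)) (f i)"
  shows "resolution C P \<delta> \<epsilon> F \<longleftrightarrow> wres C X d \<and> gen C (X 0) (ran C (d 1)) F (\<epsilon> (X 0) (f 0))"
proof -
  have ob: "obj (X i)" for i by (rule genD(4)[OF P])
  have dt: "arr (d (Suc i))" "dom (d (Suc i)) = X (Suc i)" "cod (d (Suc i)) = X i" for i using d by (auto simp: mor_iff)
  have ex: "exact_at C (P (i+2)) (P (i+1)) (P i) (\<delta> (i+2)) (\<delta> (i+1)) \<longleftrightarrow>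
      (\<forall>a\<in>Arr C. cod a = X (Suc i) \<longrightarrow> (d (Suc i) \<cdot> a = Zero C (dom a) (X i) \<longleftrightarrow>
       (\<exists>t\<in>mor C (dom a) (X (Suc (Suc i))). a = d (Suc (Suc i)) \<cdot> t)))" for i
    using exact_at_free[OF P P P D D d v d v, of i] by simp
  have ex1: "exact_at C (P 1) (P 0) F (\<delta> 1) \<epsilon> \<longleftrightarrow> (\<forall>b\<in>Arr C. cod b = X 0 \<longrightarrow>
    (act F b (\<epsilon> (X 0) (f 0)) = \<one>\<^bsub>val F (dom b)\<^esub> \<longleftrightarrow> b \<in> ran C (d 1)))"
  proof -
    have "(\<exists>t\<in>mor C (dom b) (X 1). b = d 1 \<cdot> t) \<longleftrightarrow> b \<in> ran C (d 1)" if "arr b" for b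
      unfolding ran_iff using dt[of 0] by (auto simp: mor_iff)
    then show ?thesis using exact_at_iff[OF P P F D E d v] by simp
  qed
  have R: "right_ideal C (X 0) (ran C (d 1))" using right_ideal_ran[of "d 1"] dt[of 0] by simp
  have e: "\<epsilon> (X 0) (f 0) \<in> carrier (val F (X 0))" by (rule NatD(1)[OF E ob genD(3)[OF P]])
  show ?thesis unfolding resolution_def wres_def gen_def ex ex1 epi_at_iff[OF P E] using D E d ob R F e by auto
qed

lemma finite_resolution_iff:
  assumes P: "\<And>i. i \<le> Suc n \<Longrightarrow> gen C (cobj X i) (zeros C (cobj X i)) (P i) (f i)" and F: "is_module C F"
    and E: "\<epsilon> \<in> Nat C (P 0) F" and D: "\<And>i. i \<le> n \<Longrightarrow> \<delta> (Suc i) \<in> Nat C (P (Suc i)) (P i)"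
    and d: "\<And>i. i \<le> n \<Longrightarrow> cdiff X (Suc i) \<in> mor C (cobj X (Suc i)) (cobj X i)"
    and v: "\<And>i. i \<le> n \<Longrightarrow> \<delta> (Suc i) (cobj X (Suc i)) (f (Suc i)) = act (P i) (cdiff X (Suc i)) (f i)"
  shows "finite_resolution C (n+1) P \<delta> \<epsilon> F \<longleftrightarrow> lexact n C X \<and> cgen C X F (\<epsilon> (cobj X 0) (f 0))"
proof -
  have ob: "obj (cobj X i)" if "i \<le> Suc n" for i by (rule genD(4)[OF P[OF that]])
  have dt: "arr (cdiff X (Suc i))" "dom (cdiff X (Suc i)) = cobj X (Suc i)" "cod (cdiff X (Suc i)) = cobj X i"
    if "i \<le> n" for i using d[OF that] by (auto simp: mor_iff)
  define K where "K i \<longleftrightarrow> (\<forall>a\<in>Arr C. cod a = cobj X (Suc i) \<longrightarrow> (cdiff X (Suc i) \<cdot> a = Zero C (dom a) (cobj X i) \<longleftrightarrow>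
       (\<exists>t\<in>mor C (dom a) (cobj X (Suc (Suc i))). a = cdiff X (Suc (Suc i)) \<cdot> t)))" for i
  have ex: "exact_at C (P (i+2)) (P (i+1)) (P i) (\<delta> (i+2)) (\<delta> (i+1)) \<longleftrightarrow> K i" if "i < n" for i
  proof -
    have i: "Suc (Suc i) \<le> Suc n" "Suc i \<le> Suc n" "i \<le> Suc n" "Suc i \<le> n" "i \<le> n" using that by auto
    show ?thesis unfolding K_def
      using exact_at_free[OF P[OF i(1)] P[OF i(2)] P[OF i(3)] D[OF i(4)] D[OF i(5)] d[OF i(4)] v[OF i(4)] d[OF i(5)] v[OF i(5)]]
      by simp
  qed
  have ex1: "exact_at C (P 1) (P 0) F (\<delta> 1) \<epsilon> \<longleftrightarrow> (\<forall>b\<in>Arr C. cod b = cobj X 0 \<longrightarrow>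
    (act F b (\<epsilon> (cobj X 0) (f 0)) = \<one>\<^bsub>val F (dom b)\<^esub> \<longleftrightarrow> b \<in> bd C X))"
  proof -
    have "(\<exists>t\<in>mor C (dom b) (cobj X 1). b = cdiff X 1 \<cdot> t) \<longleftrightarrow> b \<in> bd C X" if "arr b" for b
      unfolding bd_def using dt[of 0] by (auto simp: mor_iff)
    then show ?thesis using exact_at_iff[OF P[of "Suc 0"] P[of 0] F D[of 0] E d[of 0] v[of 0]] by simp
  qed
  have mo: "mono_at C (P (n+1)) (P n) (\<delta> (n+1)) \<longleftrightarrow> (\<forall>a\<in>Arr C. cod a = cobj X (Suc n) \<longrightarrow>
     cdiff X (Suc n) \<cdot> a = Zero C (dom a) (cobj X n) \<longrightarrow> a = Zero C (dom a) (cobj X (Suc n)))"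
    using mono_at_free[OF P[OF le_refl] P[OF le_SucI[OF le_refl]] D[OF le_refl] d[OF le_refl] v[OF le_refl]] by simp
  have cK: "exact0 n C X \<longleftrightarrow> (\<forall>i<n. K i)"
  proof
    assume X: "exact0 n C X"
    note x = cx[OF exact0D(1)[OF X]]
    show "\<forall>i<n. K i" unfolding K_def
    proof (intro allI impI ballI iffI)
      fix i a assume "i < n" "arr a" "cod a = cobj X (Suc i)" "cdiff X (Suc i) \<cdot> a = Zero C (dom a) (cobj X i)"
      then show "\<exists>t\<in>mor C (dom a) (cobj X (Suc (Suc i))). a = cdiff X (Suc (Suc i)) \<cdot> t" using X unfolding exact0_def by blast
    next
      fix i a assume "i < n" "\<exists>t\<in>mor C (dom a) (cobj X (Suc (Suc i))). a = cdiff X (Suc (Suc i)) \<cdot> t"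
      then obtain t where t: "i < n" "arr t" "cod t = cobj X (Suc (Suc i))" "dom t = dom a" and a: "a = cdiff X (Suc (Suc i)) \<cdot> t"
        by (auto simp: mor_iff)
      have "cdiff X (Suc i) \<cdot> (cdiff X (Suc (Suc i)) \<cdot> t) = Zero C (dom t) (cobj X i)" using x t by simp
      then show "cdiff X (Suc i) \<cdot> a = Zero C (dom a) (cobj X i)" unfolding a[symmetric] t(4) .
    qed
  next
    assume K: "\<forall>i<n. K i"
    \<comment> \<open>A differential factors through itself, so exactness makes its composite with
      the next one zero.\<close>
    have "cdiff X (Suc i) \<cdot> cdiff X (Suc (Suc i)) = Zero C (cobj X (Suc (Suc i))) (cobj X i)" if i: "i < n" for i
    proof -
      have "\<exists>t\<in>mor C (cobj X (Suc (Suc i))) (cobj X (Suc (Suc i))). cdiff X (Suc (Suc i)) = cdiff X (Suc (Suc i)) \<cdot> t"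
        by (rule bexI[of _ "Id C (cobj X (Suc (Suc i)))"]) (use dt[of "Suc i"] ob[of "Suc (Suc i)"] i in \<open>auto simp: mor_iff\<close>)
      moreover have c: "arr (cdiff X (Suc (Suc i)))" "cod (cdiff X (Suc (Suc i))) = cobj X (Suc i)"
        "dom (cdiff X (Suc (Suc i))) = cobj X (Suc (Suc i))" using dt[of "Suc i"] i by auto
      ultimately show ?thesis using K[unfolded K_def, rule_format, OF i c(1,2)] unfolding c(3) by blast
    qed
    then have "is_complex n C X" unfolding is_complex_def using ob d by auto
    then show "exact0 n C X" unfolding exact0_def using K unfolding K_def by blast
  qed
  have R: "lexact n C X \<Longrightarrow> right_ideal C (cobj X 0) (bd C X)" using right_ideal_bd lexactD(2) by blast
  have e: "\<epsilon> (cobj X 0) (f 0) \<in> carrier (val F (cobj X 0))" by (rule NatD(1)[OF E ob genD(3)[OF P]]) simp_all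
  have i2: "(\<forall>i. i + 2 \<le> n + 1 \<longrightarrow> exact_at C (P (i+2)) (P (i+1)) (P i) (\<delta> (i+2)) (\<delta> (i+1))) \<longleftrightarrow> (\<forall>i<n. K i)"
    using ex by (simp add: less_eq_Suc_le)
  have "finite_resolution C (n+1) P \<delta> \<epsilon> F \<longleftrightarrow> epi_at C (P 0) F \<epsilon> \<and> exact_at C (P 1) (P 0) F (\<delta> 1) \<epsilon> \<and> (\<forall>i<n. K i) \<and>
      mono_at C (P (n+1)) (P n) (\<delta> (n+1))"
    unfolding finite_resolution_def i2 using D E by auto
  then show ?thesis unfolding ex1 mo epi_at_iff[OF P[of 0, simplified] E] cK[symmetric] lexact_def gen_def
    using F e R unfolding lexact_def by blast
qed

lemma gen_map_free:
  assumes "gen C Z (zeros C Z) P e" "is_module C F" "y \<in> carrier (val F Z)"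
  obtains \<alpha> where "\<alpha> \<in> Nat C P F" "\<alpha> Z e = y"
proof (rule gen_map[OF assms])
  fix a assume a: "a \<in> zeros C Z"
  then obtain A where A: "obj A" "a = Zero C A Z" by (auto simp: zeros_def)
  have "dom a = A" unfolding A(2) using A(1) genD(4)[OF assms(1)] by simp
  then show "act F a y = \<one>\<^bsub>val F (dom a)\<^esub>" using md_Zero[OF assms(2) A(1) genD(4)[OF assms(1)] assms(3)] A(2) by simp
qed (use that in blast)

lemma in_mod_iff:
  "in_mod C F \<longleftrightarrow> is_module C F \<and> (\<exists>X d e. wres C X d \<and> gen C (X 0) (ran C (d 1)) F e)"
proof
  assume "in_mod C F"
  then obtain X \<delta> \<epsilon> where F: "is_module C F" and X: "\<And>i. X i \<in> Obj C" and R: "resolution C (\<lambda>i. rep C (X i)) \<delta> \<epsilon> F"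
    unfolding in_mod_def by blast
  define d where "d i = \<delta> i (X i) (Id C (X i))" for i
  have E: "\<epsilon> \<in> Nat C (rep C (X 0)) F" and D: "\<delta> (Suc i) \<in> Nat C (rep C (X (Suc i))) (rep C (X i))" for i
    using R unfolding resolution_def by auto
  have d: "d (Suc i) \<in> mor C (X (Suc i)) (X i)" for i
    using NatD(1)[OF D X, of "Id C (X (Suc i))"] X by (simp add: d_def mor_iff)
  have "\<delta> (Suc i) (X (Suc i)) (Id C (X (Suc i))) = act (rep C (X i)) (d (Suc i)) (Id C (X i))" for i
    using d[of i] by (simp add: d_def mor_iff)
  then have "wres C X d \<and> gen C (X 0) (ran C (d 1)) F (\<epsilon> (X 0) (Id C (X 0)))"
    using resolution_iff[OF gen_rep[OF X] F E D d] R by blast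
  then show "is_module C F \<and> (\<exists>X d e. wres C X d \<and> gen C (X 0) (ran C (d 1)) F e)" using F by blast
next
  assume "is_module C F \<and> (\<exists>X d e. wres C X d \<and> gen C (X 0) (ran C (d 1)) F e)"
  then obtain X d e where F: "is_module C F" and w: "wres C X d" and G: "gen C (X 0) (ran C (d 1)) F e" by blast
  have X: "obj (X i)" and d: "d (Suc i) \<in> mor C (X (Suc i)) (X i)" for i using w unfolding wres_def by auto
  obtain \<epsilon> where E: "\<epsilon> \<in> Nat C (rep C (X 0)) F" "\<epsilon> (X 0) (Id C (X 0)) = e"
    using gen_map_free[OF gen_rep[OF X] F genD(3)[OF G]] by blast
  have "resolution C (\<lambda>i. rep C (X i)) (\<lambda>i. rep_map C (d i)) \<epsilon> F"
    using resolution_iff[where P = "\<lambda>i. rep C (X i)" and \<delta> = "\<lambda>i. rep_map C (d i)", OF gen_rep[OF X] F E(1) rep_map_Nat(1)[OF d] d rep_map_Nat(2)[OF d]] w G E(2) by simp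
  then show "in_mod C F" unfolding in_mod_def using F X by blast
qed

lemma zero_objectD:
  assumes "zero_object C Z"
  shows "obj Z" "arr a \<Longrightarrow> cod a = Z \<Longrightarrow> a = Zero C (dom a) Z"
    "arr a \<Longrightarrow> dom a = Z \<Longrightarrow> a = Zero C Z (cod a)"
proof -
  show Z: "obj Z" using assms by (simp add: zero_object_def)
  have u: "\<exists>!f. f \<in> mor C A Z" "\<exists>!f. f \<in> mor C Z A" if "obj A" for A using assms that by (auto simp: zero_object_def)
  show "a = Zero C (dom a) Z" if a: "arr a" "cod a = Z"
  proof -
    have "a \<in> mor C (dom a) Z" "Zero C (dom a) Z \<in> mor C (dom a) Z" using a Z by (auto simp: mor_iff)
    then show ?thesis using u(1)[OF arr_Dom[OF a(1)]] by blast
  qed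
  show "a = Zero C Z (cod a)" if a: "arr a" "dom a = Z"
  proof -
    have "a \<in> mor C Z (cod a)" "Zero C Z (cod a) \<in> mor C Z (cod a)" using a Z by (auto simp: mor_iff)
    then show ?thesis using u(2)[OF arr_Cod[OF a(1)]] by blast
  qed
qed

text \<open>The resolution has \<open>Z\<close> in degree 0 and a zero object in all other
  degrees.\<close>

lemma in_mod_free:
  assumes G: "gen C Z (zeros C Z) P e"
  shows "in_mod C P"
proof -
  note g = genD[OF G]
  obtain O0 where z: "zero_object C O0" using ex_zero_object by blast
  note O = zero_objectD[OF z]
  define X where "X i = (if i = 0 then Z else O0)" for i :: nat
  define d where "d i = Zero C (X i) (X (i - 1))" for i :: nat
  have X: "obj (X i)" for i using O(1) g(4) by (simp add: X_def)
  have "wres C X d"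
    unfolding wres_def
  proof (intro allI conjI ballI impI)
    fix i a assume a: "arr a" "cod a = X (Suc i)"
    have az: "a = Zero C (dom a) O0" using O(2)[OF a(1)] a(2) by (simp add: X_def)
    have "d (Suc (Suc i)) \<cdot> Zero C (dom a) (X (Suc (Suc i))) = Zero C (dom a) O0" using a(1) O(1) by (simp add: d_def X_def)
    then have "a = d (Suc (Suc i)) \<cdot> Zero C (dom a) (X (Suc (Suc i)))" using az by (simp only:)
    then have "\<exists>t\<in>mor C (dom a) (X (Suc (Suc i))). a = d (Suc (Suc i)) \<cdot> t" using X a(1)
      by (intro bexI) (auto simp: mor_iff)
    moreover have "d (Suc i) \<cdot> a = Zero C (dom a) (X i)" using a X by (simp add: d_def)
    ultimately show "(d (Suc i) \<cdot> a = Zero C (dom a) (X i)) = (\<exists>t\<in>mor C (dom a) (X (Suc (Suc i))). a = d (Suc (Suc i)) \<cdot> t)" by blast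
  qed (use X in \<open>auto simp: d_def mor_iff\<close>)
  moreover have "ran C (d 1) = zeros C Z"
  proof (intro Set.set_eqI iffI)
    fix a assume "a \<in> ran C (d 1)"
    then obtain t where t: "arr t" "cod t = O0" "a = d 1 \<cdot> t" using O(1) g(4) by (auto simp: ran_iff d_def X_def)
    then have "a = Zero C (dom t) Z" using O(1) g(4) by (simp add: d_def X_def)
    then show "a \<in> zeros C Z" using t(1) by (auto simp: zeros_def)
  next
    fix a assume "a \<in> zeros C Z"
    then obtain A where A: "obj A" "a = Zero C A Z" by (auto simp: zeros_def)
    then have "a = d 1 \<cdot> Zero C A O0" using O(1) g(4) by (simp add: d_def X_def)
    then show "a \<in> ran C (d 1)" unfolding ran_iff using A(1) O(1) g(4) by (intro exI[of _ "Zero C A O0"]) (simp add: d_def X_def)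
  qed
  ultimately show ?thesis unfolding in_mod_iff using G g(2) by (metis (full_types) X_def)
qed

text \<open>A map out of a free module is the choice of an element, and elements lift along
  pointwise epimorphisms.\<close>

lemma free_projective:
  assumes G: "gen C Z (zeros C Z) P e"
  shows "projective C P"
  unfolding projective_def
proof (intro conjI allI impI ballI)
  note g = genD[OF G]
  show "in_mod C P" by (rule in_mod_free[OF G])
  fix E B :: "('a, 'b, 'b set) cmod" and p f assume D: "mod_deflation C E B p" and f: "f \<in> Nat C P B"
  have E: "is_module C E" and p: "p \<in> Nat C E B" and epi: "epi_at C E B p" using D unfolding mod_deflation_def in_mod_def by auto
  have "f Z e \<in> carrier (val B Z)" by (rule NatD(1)[OF f g(4,3)])
  then obtain x where x: "x \<in> carrier (val E Z)" "p Z x = f Z e" using epi g(4) unfolding epi_at_def Im_at_def by (metis imageE)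
  obtain h where h: "h \<in> Nat C P E" "h Z e = x" using gen_map_free[OF G E x(1)] by blast
  have "Nat_comp C P p h = f"
    by (rule Nat_eq_gen[OF Nat_comp_Nat[OF g(2) h(1) p] f G]) (use g h x in simp)
  then show "\<exists>h\<in>Nat C P E. Nat_comp C P p h = f" using h(1) by blast
qed

lemma wres_shift: "wres C X d \<Longrightarrow> wres C (\<lambda>i. X (Suc i)) (\<lambda>i. d (Suc i))"
  unfolding wres_def by simp

text \<open>A projective is a direct summand of its cover \<open>C(-, X_0)\<close>: lifting through
  the cover yields an endomorphism \<open>q\<close> of \<open>X_0\<close>, which turns out to be
  idempotent, and the object split off by \<open>q\<close> represents the module.\<close>

lemma projective_free:
  fixes P :: "('a, 'b, 'b) cmod"
  assumes ic: "idempotent_complete C" and P: "projective C P"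
  shows "\<exists>Z e. gen C Z (zeros C Z) P e"
proof -
  obtain X d e where w: "wres C X d" and G: "gen C (X 0) (ran C (d 1)) P e"
    using P unfolding projective_def in_mod_iff by blast
  note g = genD[OF G]
  have X: "obj (X i)" and d: "d (Suc i) \<in> mor C (X (Suc i)) (X i)" for i using w unfolding wres_def by auto
  have dt: "arr (d (Suc i))" "dom (d (Suc i)) = X (Suc i)" "cod (d (Suc i)) = X i" for i using d[of i] by (auto simp: mor_iff)
  let ?E = "sing (rep C (X 0))" and ?B = "sing P"
  have GE: "gen C (X 0) (zeros C (X 0)) ?E {Id C (X 0)}" by (rule gen_sing[OF gen_rep[OF X]])
  have GB: "gen C (X 0) (ran C (d 1)) ?B {e}" by (rule gen_sing[OF G])
  note gE = genD[OF GE] and gB = genD[OF GB]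
  obtain p where p: "p \<in> Nat C ?E ?B" "p (X 0) {Id C (X 0)} = {e}" using gen_map_free[OF GE gB(2,3)] by blast
  have epi: "epi_at C ?E ?B p" unfolding epi_at_iff[OF GE p(1)] p(2) using gB(5) by blast
  have "{d 1} \<in> carrier (val ?E (X 1))" using d[of 0] by simp
  then obtain \<alpha> where a: "\<alpha> \<in> Nat C (rep C (X 1)) ?E" "\<alpha> (X 1) (Id C (X 1)) = {d 1}"
    using gen_map_free[OF gen_rep[OF X] gE(2)] by blast
  have ad: "\<alpha> (X 1) (Id C (X 1)) = act ?E (d 1) {Id C (X 0)}" unfolding a(2) using dt[of 0] by simp
  have d1: "d 1 \<in> mor C (X 1) (X 0)" using d[of 0] by simp
  have "exact_at C (rep C (X 1)) ?E ?B \<alpha> p"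
    unfolding exact_at_iff[OF gen_rep[OF X] GE gB(2) a(1) p(1) d1 ad] p(2)
  proof (intro ballI impI)
    fix b assume b: "arr b" "cod b = X 0"
    show "(act ?B b {e} = \<one>\<^bsub>val ?B (dom b)\<^esub>) = (\<exists>t\<in>mor C (dom b) (X 1). b = d 1 \<cdot> t)"
      unfolding gB(6)[OF b] ran_iff using dt[of 0] b by (auto simp: mor_iff)
  qed
  then have im: "Ker_at ?E ?B p A = Im_at (rep C (X 1)) \<alpha> A" if "obj A" for A using that by (simp add: exact_at_def)
  have "{b \<in> Arr C. cod b = X 1 \<and> act ?E b {d 1} = \<one>\<^bsub>val ?E (dom b)\<^esub>} = ran C (d (Suc 1))"
  proof (intro Set.set_eqI)
    fix b
    have "d 1 \<cdot> b = Zero C (dom b) (X 0) \<longleftrightarrow> (\<exists>t\<in>mor C (dom b) (X (Suc 1)). b = d (Suc 1) \<cdot> t)" if "arr b" "cod b = X 1"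
      using w that unfolding wres_def by (metis One_nat_def)
    moreover have "(\<exists>t\<in>mor C (dom b) (X (Suc 1)). b = d (Suc 1) \<cdot> t) \<longleftrightarrow> b \<in> ran C (d (Suc 1))"
      unfolding ran_iff using dt[of 1] by (auto simp: mor_iff)
    moreover have "b \<in> ran C (d (Suc 1)) \<Longrightarrow> arr b \<and> cod b = X 1" using dt[of 1] by (auto simp: ran_iff)
    ultimately show "b \<in> {b \<in> Arr C. cod b = X 1 \<and> act ?E b {d 1} = \<one>\<^bsub>val ?E (dom b)\<^esub>} \<longleftrightarrow> b \<in> ran C (d (Suc 1))"
      by auto
  qed
  \<comment> \<open>The kernel of the cover is generated by \<open>d 1\<close> and resolved by the
    shifted sequence, which makes the cover a deflation of \<open>mod C\<close>.\<close>
  then have K: "gen C (X (Suc 0)) (ran C (d (Suc 1))) (submodule ?E (Ker_at ?E ?B p)) {d 1}" (is "gen C _ _ ?K _")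
    using gen_submodule[OF gen_rep[OF X] gE(2) a(1) im] a(2) by simp
  have "in_mod C ?K" unfolding in_mod_iff using wres_shift[OF w] genD(2)[OF K] K
    by (intro conjI exI[of _ "\<lambda>i. X (Suc i)"] exI[of _ "\<lambda>i. d (Suc i)"] exI[of _ "{d 1}"]) auto
  moreover have "in_mod C ?B" unfolding in_mod_iff using gB(2) w GB by blast
  ultimately have D: "mod_deflation C ?E ?B p" unfolding mod_deflation_def using in_mod_free[OF GE] p(1) epi by simp
  have "act ?B b {e} = \<one>\<^bsub>val ?B (dom b)\<^esub>" if "b \<in> ran C (d 1)" for b
    using gB(6)[OF right_idealD(2,3)[OF gB(1) that]] that by simp
  then obtain f where f: "f \<in> Nat C P ?B" "f (X 0) e = {e}" using gen_map[OF G gB(2,3)] by blast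
  obtain h where h: "h \<in> Nat C P ?E" "Nat_comp C P p h = f" using P D f(1) unfolding projective_def by blast
  have "h (X 0) e \<in> carrier (val ?E (X 0))" by (rule NatD(1)[OF h(1) X g(3)])
  then obtain q where q: "arr q" "dom q = X 0" "cod q = X 0" and hq: "h (X 0) e = {q}" by (auto simp: mor_iff)
  have "p (X 0) (h (X 0) e) = {e}" using h(2) f(2) Nat_comp_val[OF X g(3), of p h] by simp
  moreover have "p (X 0) {q} = act ?B q {e}" using Nat_gen[OF p(1) GE q(1,3)] q p(2) X by simp
  ultimately have qe: "act P q e = e" unfolding hq by simp
  have d1e: "act P (d 1) e = \<one>\<^bsub>val P (X 1)\<^esub>"
  proof -
    have "d 1 \<in> ran C (d 1)" unfolding ran_iff by (rule exI[of _ "Id C (X 1)"]) (use dt[of 0] X in simp)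
    then show ?thesis using g(6)[of "d 1"] dt[of 0] by simp
  qed
  have qd: "q \<cdot> d 1 = Zero C (X 1) (X 0)"
  proof -
    interpret G: comm_group "val P (X 1)" by (rule md_group[OF g(2) X])
    interpret H: comm_group "val ?E (X 1)" by (rule md_group[OF gE(2) X])
    have "h (X 1) (act P (d 1) e) = {q \<cdot> d 1}" using Nat_gen[OF h(1) G, of "d 1"] dt[of 0] hq by simp
    moreover have "h (X 1) \<one>\<^bsub>val P (X 1)\<^esub> = \<one>\<^bsub>val ?E (X 1)\<^esub>"
      by (rule hom_one[OF NatD(2)[OF h(1) X] G.is_group H.is_group])
    ultimately show ?thesis unfolding d1e by simp
  qed
  have "act P q e = act P (Id C (X 0)) e" unfolding qe md_Id[OF g(2) X g(3)] ..
  then have "eqm C (ran C (d 1)) q (Id C (X 0))" using gen_eq[OF G q(1), of "Id C (X 0)"] q X by simp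
  then have "sub C q (Id C (X 0)) \<in> ran C (d 1)" by (rule eqmD(5))
  then obtain t where t: "arr t" "cod t = X 1" "sub C q (Id C (X 0)) = d 1 \<cdot> t" using dt[of 0] by (auto simp: ran_iff)
  have tD: "dom t = X 0"
  proof -
    have "dom (sub C q (Id C (X 0))) = dom (d 1 \<cdot> t)" unfolding t(3) ..
    then show ?thesis using t(1,2) dt[of 0] q X[of 0] by simp
  qed
  \<comment> \<open>\<open>q\<close> fixes the generator, so \<open>q - 1\<close> factors through
    \<open>d 1\<close>, and \<open>q d_1 = 0\<close> because the lift respects relations. Together
    these give \<open>q q = q\<close>.\<close>
  have "q \<cdot> sub C q (Id C (X 0)) = q \<cdot> d 1 \<cdot> t" unfolding t(3) using q t(1,2) dt[of 0] by simp
  also have "\<dots> = Zero C (X 0) (X 0)" unfolding qd using t(1,2) tD X by simp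
  finally have "sub C (q \<cdot> q) q = Zero C (X 0) (X 0)" using q X[of 0] by simp
  then have qq: "q \<cdot> q = q" using sub_eq_Zero[of "q \<cdot> q" q] q by simp
  obtain Z r s where Z: "obj Z" and r: "r \<in> mor C (X 0) Z" and s: "s \<in> mor C Z (X 0)" and rs: "r \<cdot> s = Id C Z" "s \<cdot> r = q"
    using ic[unfolded idempotent_complete_def, rule_format, OF X[of 0] _ qq] q by (auto simp: mor_iff)
  have rt: "arr r" "dom r = X 0" "cod r = Z" "arr s" "dom s = Z" "cod s = X 0" using r s by (auto simp: mor_iff)
  have qs: "q \<cdot> s = s" unfolding rs(2)[symmetric] using rt rs(1) Z by simp
  have "gen C Z (zeros C Z) P (act P s e)"
    unfolding gen_def
  proof (intro conjI ballI impI)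
    show "right_ideal C Z (zeros C Z)" by (rule right_ideal_zeros[OF Z])
    show "is_module C P" by (rule g(2))
    show "act P s e \<in> carrier (val P Z)" using g(7)[of s] rt by simp
    show "\<exists>a\<in>mor C A Z. x = act P a (act P s e)" if A: "obj A" "x \<in> carrier (val P A)" for A x
    proof -
      obtain a where a: "arr a" "dom a = A" "cod a = X 0" "x = act P a e" using g(5)[OF A] by (auto simp: mor_iff)
      have "act P (r \<cdot> a) (act P s e) = act P (s \<cdot> (r \<cdot> a)) e" by (rule md_comp[OF g(2), symmetric]) (use a rt g(3) in simp_all)
      also have "s \<cdot> (r \<cdot> a) = q \<cdot> a" unfolding rs(2)[symmetric] using a rt by simp
      also have "act P (q \<cdot> a) e = act P a (act P q e)" by (rule md_comp[OF g(2)]) (use a q g(3) in simp_all)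
      finally have "x = act P (r \<cdot> a) (act P s e)" unfolding qe a(4) ..
      then show ?thesis using a(1-3) rt by (intro bexI[of _ "r \<cdot> a"]) (auto simp: mor_iff)
    qed
    fix a assume a: "arr a" "cod a = Z"
    have "act P a (act P s e) = act P (s \<cdot> a) e" by (rule md_comp[OF g(2), symmetric]) (use a rt g(3) in simp_all)
    then have 1: "act P a (act P s e) = \<one>\<^bsub>val P (dom a)\<^esub> \<longleftrightarrow> s \<cdot> a \<in> ran C (d 1)" using g(6)[of "s \<cdot> a"] a rt by simp
    have 2: "a = Zero C (dom a) Z" if sa: "s \<cdot> a \<in> ran C (d 1)"
    proof -
      obtain t where t: "arr t" "cod t = X 1" "s \<cdot> a = d 1 \<cdot> t" using sa dt[of 0] by (auto simp: ran_iff)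
      have "dom (s \<cdot> a) = dom (d 1 \<cdot> t)" unfolding t(3) ..
      then have tD: "dom t = dom a" using t(1,2) dt[of 0] a rt by simp
      have "s \<cdot> a = q \<cdot> (s \<cdot> a)" using comp_assoc[of a s q] a rt(4-6) q unfolding qs by simp
      also have "\<dots> = q \<cdot> d 1 \<cdot> t" unfolding t(3) using t(1,2) dt[of 0] q by simp
      also have "\<dots> = Zero C (dom a) (X 0)" unfolding qd using t(1,2) tD X by simp
      finally have sa0: "s \<cdot> a = Zero C (dom a) (X 0)" .
      have "r \<cdot> (s \<cdot> a) = a" using comp_assoc[of a s r] rt a unfolding rs(1) by simp
      then show ?thesis unfolding sa0 using rt a by simp
    qed
    have 3: "s \<cdot> a \<in> ran C (d 1)" if "a = Zero C (dom a) Z"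
    proof -
      have "s \<cdot> Zero C (dom a) Z = Zero C (dom a) (X 0)" using rt a(1) Z by simp
      then have "s \<cdot> a = Zero C (dom a) (X 0)" using that by (simp only:)
      then show ?thesis using right_idealD(4)[OF g(1), of "dom a"] a(1) by simp
    qed
    show "act P a (act P s e) = \<one>\<^bsub>val P (dom a)\<^esub> \<longleftrightarrow> a \<in> zeros C Z"
      unfolding 1 zeros_iff[OF a] using 2 3 by blast
  qed
  then show ?thesis by blast
qed

text \<open>Representables are projective, so of a finite projective resolution only exactness is
  left to state: left exactness of \<open>X\<close> and a presentation of \<open>F\<close> by
  \<open>d_1\<close>.\<close>

lemma yoneda_resolves_iff:
  assumes X: "is_complex n C X" and F: "is_module C F"
  shows "yoneda_resolves n C X F \<longleftrightarrow> lexact n C X \<and> (\<exists>e. cgen C X F e)"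
proof -
  have ob: "obj (cobj X i)" if "i \<le> Suc n" for i using cx(1)[OF X that] .
  have d: "cdiff X (Suc i) \<in> mor C (cobj X (Suc i)) (cobj X i)" if "i \<le> n" for i using cx(2-4)[OF X that] by (simp add: mor_iff)
  have fr: "finite_resolution C (n+1) (\<lambda>i. rep C (cobj X i)) (\<lambda>i. rep_map C (cdiff X i)) \<epsilon> F \<longleftrightarrow>
      lexact n C X \<and> cgen C X F (\<epsilon> (cobj X 0) (Id C (cobj X 0)))"
    if "\<epsilon> \<in> Nat C (rep C (cobj X 0)) F" for \<epsilon>
    by (rule finite_resolution_iff[where f = "\<lambda>i. Id C (cobj X i)"])
       (use gen_rep[OF ob] F that rep_map_Nat[OF d] d in auto)
  have pr: "projective C (rep C (cobj X i))" if "i \<le> Suc n" for i by (rule free_projective[OF gen_rep[OF ob[OF that]]])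
  show ?thesis
  proof
    assume "yoneda_resolves n C X F"
    then obtain \<epsilon> where e: "finite_resolution C (n+1) (\<lambda>i. rep C (cobj X i)) (\<lambda>i. rep_map C (cdiff X i)) \<epsilon> F"
      unfolding yoneda_resolves_def finite_projective_resolution_def by blast
    then have "\<epsilon> \<in> Nat C (rep C (cobj X 0)) F" by (simp add: finite_resolution_def)
    then show "lexact n C X \<and> (\<exists>e. cgen C X F e)" using fr e by blast
  next
    assume "lexact n C X \<and> (\<exists>e. cgen C X F e)"
    then obtain e where L: "lexact n C X" and G: "cgen C X F e" by blast
    obtain \<epsilon> where E: "\<epsilon> \<in> Nat C (rep C (cobj X 0)) F" "\<epsilon> (cobj X 0) (Id C (cobj X 0)) = e"
      using gen_map_free[OF gen_rep[OF genD(4)[OF G]] F genD(3)[OF G]] by blast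
    show "yoneda_resolves n C X F"
      unfolding yoneda_resolves_def finite_projective_resolution_def using fr[OF E(1)] L G E(2) pr by auto
  qed
qed

lemma gen_Fun:
  assumes X: "is_complex n C X"
  shows "\<exists>e. cgen C X (Fun C X) e"
proof -
  have o: "obj (cobj X 0)" "obj (cobj X 1)" using cx(1)[OF X] by auto
  have d: "cdiff X 1 \<in> mor C (cobj X 1) (cobj X 0)" using cx(2-4)[OF X, of 0] by (simp add: mor_iff)
  note N = rep_map_Nat(1)[OF d]
  let ?U = "Im_at (rep C (cobj X 1)) (rep_map C (cdiff X 1))"
  have U: "submod C (rep C (cobj X 0)) ?U" by (rule submod_Im[OF is_module_rep[OF o(2)] is_module_rep[OF o(1)] N])
  have "{a \<in> Arr C. cod a = cobj X 0 \<and> act (rep C (cobj X 0)) a (Id C (cobj X 0)) \<in> ?U (dom a)} = bd C X"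
  proof (intro Set.set_eqI)
    fix a
    have 1: "a \<in> ?U (dom a) \<longleftrightarrow> a \<in> bd C X" if "arr a"
      unfolding Im_at_def bd_iff rep_map_def using that d by (auto simp: mor_iff image_iff)
    have 2: "a \<in> bd C X \<Longrightarrow> arr a \<and> cod a = cobj X 0" using right_idealD(2,3)[OF right_ideal_bd[OF X]] by blast
    show "a \<in> {a \<in> Arr C. cod a = cobj X 0 \<and> act (rep C (cobj X 0)) a (Id C (cobj X 0)) \<in> ?U (dom a)} \<longleftrightarrow> a \<in> bd C X"
      using 1 2 by auto
  qed
  then show ?thesis using gen_quotient[OF gen_rep[OF o(1)] U] unfolding Fun_def by metis
qed

end

section \<open>Extension groups\<close>

lemma trivial_FactGroup_iff:
  assumes "comm_group M" "subgroup B M"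
  shows "trivial_group (M Mod B) \<longleftrightarrow> carrier M \<subseteq> B"
proof -
  interpret M: comm_group M by fact
  interpret Q: comm_group "M Mod B" by (rule M.abelian_FactGroup[OF assms(2)])
  have "trivial_group (M Mod B) \<longleftrightarrow> (\<forall>x\<in>carrier M. B #>\<^bsub>M\<^esub> x = B)"
    unfolding Q.trivial_group_subset by (auto simp: FactGroup_def RCOSETS_def)
  also have "\<dots> \<longleftrightarrow> carrier M \<subseteq> B"
    using M.coset_join1[OF _ _ assms(2)] M.coset_join2[OF _ assms(2)] by blast
  finally show ?thesis .
qed

text \<open>The essential image of \<open>\<A>\<close> under \<open>Fun\<close>, for modules with
  values in any type. Each step in the definition of \<open>max_cat\<close> is shown to be of this
  form.\<close>

definition coker_class :: "('o, 'm) cat \<Rightarrow> ('o, 'm) cplx set \<Rightarrow> ('o, 'm, 'v) cmod set" where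
  "coker_class C \<A> = {F. \<exists>X\<in>\<A>. \<exists>e. cgen C X F e}"

lemma Nat_group_sel:
  "carrier (Nat_group C F G) = Nat C F G"
  "A \<in> Obj C \<Longrightarrow> x \<in> carrier (val F A) \<Longrightarrow> (\<alpha> \<otimes>\<^bsub>Nat_group C F G\<^esub> \<beta>) A x = \<alpha> A x \<otimes>\<^bsub>val G A\<^esub> \<beta> A x"
  "A \<in> Obj C \<Longrightarrow> x \<in> carrier (val F A) \<Longrightarrow> \<one>\<^bsub>Nat_group C F G\<^esub> A x = \<one>\<^bsub>val G A\<^esub>"
  by (simp_all add: Nat_group_def)

context additive_category begin

lemma comm_group_Nat:
  assumes F: "is_module C F" and G: "is_module C G"
  shows "comm_group (Nat_group C F G)"
proof (rule comm_groupI; (unfold Nat_group_sel(1))?)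
  have grp: "comm_group (val G A)" if "obj A" for A by (rule md_group[OF G that])
  \<comment> \<open>Members of \<open>Nat\<close> are extensional, so a family of maps has to be cut
    down to the carriers.\<close>
  have lam: "(\<lambda>A\<in>Obj C. \<lambda>x\<in>carrier (val F A). f A x) \<in> Nat C F G"
    if f: "\<And>A x. A \<in> Obj C \<Longrightarrow> x \<in> carrier (val F A) \<Longrightarrow> f A x \<in> carrier (val G A)"
      and m: "\<And>A x y. \<lbrakk>obj A; x \<in> carrier (val F A); y \<in> carrier (val F A)\<rbrakk> \<Longrightarrow>
        f A (x \<otimes>\<^bsub>val F A\<^esub> y) = f A x \<otimes>\<^bsub>val G A\<^esub> f A y"
      and n: "\<And>h x. h \<in> Arr C \<Longrightarrow> x \<in> carrier (val F (cod h)) \<Longrightarrow> f (dom h) (act F h x) = act G h (f (cod h) x)" for f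
  proof (rule NatI)
    show "(\<lambda>A\<in>Obj C. \<lambda>x\<in>carrier (val F A). f A x) \<in> (\<Pi>\<^sub>E A\<in>Obj C. carrier (val F A) \<rightarrow>\<^sub>E carrier (val G A))"
      using f by auto
    show "(\<lambda>A\<in>Obj C. \<lambda>x\<in>carrier (val F A). f A x) A \<in> hom (val F A) (val G A)" if A: "obj A" for A
    proof -
      interpret comm_group "val F A" by (rule md_group[OF F A])
      show ?thesis by (rule homI) (use A f m in auto)
    qed
  qed (use n md_act[OF F] in auto)
  show "\<alpha> \<otimes>\<^bsub>Nat_group C F G\<^esub> \<beta> \<in> Nat C F G" if a: "\<alpha> \<in> Nat C F G" and b: "\<beta> \<in> Nat C F G" for \<alpha> \<beta>
  proof -
    have "(\<lambda>A\<in>Obj C. \<lambda>x\<in>carrier (val F A). \<alpha> A x \<otimes>\<^bsub>val G A\<^esub> \<beta> A x) \<in> Nat C F G"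
    proof (rule lam)
      fix A x assume A: "obj A" and x: "x \<in> carrier (val F A)"
      interpret G: comm_group "val G A" by (rule grp[OF A])
      show "\<alpha> A x \<otimes>\<^bsub>val G A\<^esub> \<beta> A x \<in> carrier (val G A)" using NatD(1)[OF a A x] NatD(1)[OF b A x] by simp
      fix y assume y: "y \<in> carrier (val F A)"
      show "\<alpha> A (x \<otimes>\<^bsub>val F A\<^esub> y) \<otimes>\<^bsub>val G A\<^esub> \<beta> A (x \<otimes>\<^bsub>val F A\<^esub> y) =
          \<alpha> A x \<otimes>\<^bsub>val G A\<^esub> \<beta> A x \<otimes>\<^bsub>val G A\<^esub> (\<alpha> A y \<otimes>\<^bsub>val G A\<^esub> \<beta> A y)"
        using hom_mult[OF NatD(2)[OF a A] x y] hom_mult[OF NatD(2)[OF b A] x y] NatD(1)[OF a A x] NatD(1)[OF b A x]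
          NatD(1)[OF a A y] NatD(1)[OF b A y] by (simp add: G.m_ac)
    next
      fix h x assume h: "arr h" "x \<in> carrier (val F (cod h))"
      show "\<alpha> (dom h) (act F h x) \<otimes>\<^bsub>val G (dom h)\<^esub> \<beta> (dom h) (act F h x) =
          act G h (\<alpha> (cod h) x \<otimes>\<^bsub>val G (cod h)\<^esub> \<beta> (cod h) x)"
        using NatD(3)[OF a h] NatD(3)[OF b h] md_mult[OF G h(1) NatD(1)[OF a _ h(2)] NatD(1)[OF b _ h(2)]] h by simp
    qed
    then show ?thesis by (simp add: Nat_group_def)
  qed
  note cl = this
  show one: "\<one>\<^bsub>Nat_group C F G\<^esub> \<in> Nat C F G"
  proof -
    have "(\<lambda>A\<in>Obj C. \<lambda>x\<in>carrier (val F A). \<one>\<^bsub>val G A\<^esub>) \<in> Nat C F G"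
    proof (rule lam)
      fix A assume A: "obj A"
      interpret G: comm_group "val G A" by (rule grp[OF A])
      show "\<one>\<^bsub>val G A\<^esub> \<in> carrier (val G A)" "\<one>\<^bsub>val G A\<^esub> = \<one>\<^bsub>val G A\<^esub> \<otimes>\<^bsub>val G A\<^esub> \<one>\<^bsub>val G A\<^esub>" by simp_all
    qed (simp add: md_one[OF G])
    then show ?thesis by (simp add: Nat_group_def)
  qed
  show "\<alpha> \<otimes>\<^bsub>Nat_group C F G\<^esub> \<beta> \<otimes>\<^bsub>Nat_group C F G\<^esub> \<gamma> = \<alpha> \<otimes>\<^bsub>Nat_group C F G\<^esub> (\<beta> \<otimes>\<^bsub>Nat_group C F G\<^esub> \<gamma>)"
    if a: "\<alpha> \<in> Nat C F G" and b: "\<beta> \<in> Nat C F G" and c: "\<gamma> \<in> Nat C F G" for \<alpha> \<beta> \<gamma>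
  proof (rule Nat_eq[OF cl[OF cl[OF a b] c] cl[OF a cl[OF b c]]])
    fix A x assume A: "obj A" "x \<in> carrier (val F A)"
    interpret G: comm_group "val G A" by (rule grp[OF A(1)])
    show "(\<alpha> \<otimes>\<^bsub>Nat_group C F G\<^esub> \<beta> \<otimes>\<^bsub>Nat_group C F G\<^esub> \<gamma>) A x = (\<alpha> \<otimes>\<^bsub>Nat_group C F G\<^esub> (\<beta> \<otimes>\<^bsub>Nat_group C F G\<^esub> \<gamma>)) A x"
      using NatD(1)[OF a A] NatD(1)[OF b A] NatD(1)[OF c A] by (simp add: Nat_group_sel A G.m_ac)
  qed
  show "\<alpha> \<otimes>\<^bsub>Nat_group C F G\<^esub> \<beta> = \<beta> \<otimes>\<^bsub>Nat_group C F G\<^esub> \<alpha>" if a: "\<alpha> \<in> Nat C F G" and b: "\<beta> \<in> Nat C F G" for \<alpha> \<beta>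
  proof (rule Nat_eq[OF cl[OF a b] cl[OF b a]])
    fix A x assume A: "obj A" "x \<in> carrier (val F A)"
    interpret G: comm_group "val G A" by (rule grp[OF A(1)])
    show "(\<alpha> \<otimes>\<^bsub>Nat_group C F G\<^esub> \<beta>) A x = (\<beta> \<otimes>\<^bsub>Nat_group C F G\<^esub> \<alpha>) A x"
      using NatD(1)[OF a A] NatD(1)[OF b A] by (simp add: Nat_group_sel A G.m_ac)
  qed
  show "\<one>\<^bsub>Nat_group C F G\<^esub> \<otimes>\<^bsub>Nat_group C F G\<^esub> \<alpha> = \<alpha>" if a: "\<alpha> \<in> Nat C F G" for \<alpha>
  proof (rule Nat_eq[OF cl[OF one a] a])
    fix A x assume A: "obj A" "x \<in> carrier (val F A)"
    interpret G: comm_group "val G A" by (rule grp[OF A(1)])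
    show "(\<one>\<^bsub>Nat_group C F G\<^esub> \<otimes>\<^bsub>Nat_group C F G\<^esub> \<alpha>) A x = \<alpha> A x"
      using NatD(1)[OF a A] by (simp add: Nat_group_sel A)
  qed
  show "\<exists>\<beta>\<in>Nat C F G. \<beta> \<otimes>\<^bsub>Nat_group C F G\<^esub> \<alpha> = \<one>\<^bsub>Nat_group C F G\<^esub>" if a: "\<alpha> \<in> Nat C F G" for \<alpha>
  proof -
    define \<beta> where "\<beta> = (\<lambda>A\<in>Obj C. \<lambda>x\<in>carrier (val F A). inv\<^bsub>val G A\<^esub> (\<alpha> A x))"
    have b: "\<beta> \<in> Nat C F G" unfolding \<beta>_def
    proof (rule lam)
      fix A x assume A: "obj A" and x: "x \<in> carrier (val F A)"
      interpret G: comm_group "val G A" by (rule grp[OF A])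
      show "inv\<^bsub>val G A\<^esub> (\<alpha> A x) \<in> carrier (val G A)" using NatD(1)[OF a A x] by simp
      fix y assume y: "y \<in> carrier (val F A)"
      show "inv\<^bsub>val G A\<^esub> (\<alpha> A (x \<otimes>\<^bsub>val F A\<^esub> y)) = inv\<^bsub>val G A\<^esub> (\<alpha> A x) \<otimes>\<^bsub>val G A\<^esub> inv\<^bsub>val G A\<^esub> (\<alpha> A y)"
        using hom_mult[OF NatD(2)[OF a A] x y] G.inv_mult[OF NatD(1)[OF a A x] NatD(1)[OF a A y]] by simp
    next
      fix h x assume h: "arr h" "x \<in> carrier (val F (cod h))"
      have o: "obj (cod h)" "obj (dom h)" using h by auto
      interpret G: comm_group "val G (cod h)" by (rule grp[OF o(1)])
      interpret H: comm_group "val G (dom h)" by (rule grp[OF o(2)])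
      interpret f: group_hom "val G (cod h)" "val G (dom h)" "act G h"
        by unfold_locales (rule md_hom[OF G h(1)])
      show "inv\<^bsub>val G (dom h)\<^esub> (\<alpha> (dom h) (act F h x)) = act G h (inv\<^bsub>val G (cod h)\<^esub> (\<alpha> (cod h) x))"
        unfolding NatD(3)[OF a h] using f.hom_inv[OF NatD(1)[OF a o(1) h(2)]] by simp
    qed
    have "\<beta> \<otimes>\<^bsub>Nat_group C F G\<^esub> \<alpha> = \<one>\<^bsub>Nat_group C F G\<^esub>"
    proof (rule Nat_eq[OF cl[OF b a] one])
      fix A x assume A: "obj A" "x \<in> carrier (val F A)"
      interpret G: comm_group "val G A" by (rule grp[OF A(1)])
      show "(\<beta> \<otimes>\<^bsub>Nat_group C F G\<^esub> \<alpha>) A x = \<one>\<^bsub>Nat_group C F G\<^esub> A x"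
        using NatD(1)[OF a A] by (simp add: Nat_group_sel A \<beta>_def)
    qed
    then show ?thesis using b by blast
  qed
qed

lemma Nat_comp_hom:
  assumes F: "is_module C F" and G: "is_module C G" and H: "is_module C H" and a: "\<alpha> \<in> Nat C F G"
  shows "group_hom (Nat_group C G H) (Nat_group C F H) (\<lambda>\<beta>. Nat_comp C F \<beta> \<alpha>)"
proof -
  interpret S: comm_group "Nat_group C G H" by (rule comm_group_Nat[OF G H])
  interpret T: comm_group "Nat_group C F H" by (rule comm_group_Nat[OF F H])
  have "(\<lambda>\<beta>. Nat_comp C F \<beta> \<alpha>) \<in> hom (Nat_group C G H) (Nat_group C F H)"
  proof (rule homI; unfold Nat_group_sel(1))
    show 1: "Nat_comp C F \<beta> \<alpha> \<in> Nat C F H" if "\<beta> \<in> Nat C G H" for \<beta> by (rule Nat_comp_Nat[OF F a that])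
    fix \<beta> \<gamma> assume b: "\<beta> \<in> Nat C G H" and c: "\<gamma> \<in> Nat C G H"
    show "Nat_comp C F (\<beta> \<otimes>\<^bsub>Nat_group C G H\<^esub> \<gamma>) \<alpha> = Nat_comp C F \<beta> \<alpha> \<otimes>\<^bsub>Nat_group C F H\<^esub> Nat_comp C F \<gamma> \<alpha>"
    proof (rule Nat_eq)
      show "Nat_comp C F (\<beta> \<otimes>\<^bsub>Nat_group C G H\<^esub> \<gamma>) \<alpha> \<in> Nat C F H"
        using 1 S.m_closed b c unfolding Nat_group_sel(1) by blast
      show "Nat_comp C F \<beta> \<alpha> \<otimes>\<^bsub>Nat_group C F H\<^esub> Nat_comp C F \<gamma> \<alpha> \<in> Nat C F H"
        using 1 T.m_closed b c unfolding Nat_group_sel(1) by blast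
    qed (simp add: Nat_group_sel NatD(1)[OF a])
  qed
  then show ?thesis by unfold_locales
qed

text \<open>By Yoneda a map \<open>P_i -> C(-, T)\<close> is an arrow \<open>t\<close> from
  \<open>X_i\<close> to \<open>T\<close>. Cocycles are the arrows with \<open>t d_(i+1) = 0\<close>,
  coboundaries those of the form \<open>c d_i\<close>, or just zero in degree 0.\<close>

lemma Ext_group_trivial_iff:
  assumes P: "\<And>i. gen C (X i) (zeros C (X i)) (P i) (f i)" and D: "\<And>i. \<delta> (Suc i) \<in> Nat C (P (Suc i)) (P i)"
    and w: "wres C X d" and v: "\<And>i. \<delta> (Suc i) (X (Suc i)) (f (Suc i)) = act (P i) (d (Suc i)) (f i)"
    and T: "obj T"
  shows "trivial_group ((Nat_group C (P i) (rep C T))\<lparr>carrier := cocycles C P \<delta> (rep C T) i\<rparr> Mod coboundaries C P \<delta> (rep C T) i)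
    \<longleftrightarrow> (\<forall>t\<in>mor C (X i) T. t \<cdot> d (Suc i) = Zero C (X (Suc i)) T \<longrightarrow>
      (case i of 0 \<Rightarrow> t = Zero C (X i) T | Suc j \<Rightarrow> \<exists>c\<in>mor C (X j) T. t = c \<cdot> d i))"
proof -
  let ?G = "rep C T"
  note p = genD[OF P]
  have G: "is_module C ?G" by (rule is_module_rep[OF T])
  have X: "obj (X i)" for i by (rule p(4))
  have dt: "arr (d (Suc i))" "dom (d (Suc i)) = X (Suc i)" "cod (d (Suc i)) = X i" for i
    using w by (auto simp: wres_def mor_iff)
  have dd: "d (Suc i) \<cdot> d (Suc (Suc i)) = Zero C (X (Suc (Suc i))) (X i)" for i
  proof -
    have "d (Suc (Suc i)) = d (Suc (Suc i)) \<cdot> Id C (X (Suc (Suc i)))" using dt[of "Suc i"] X by simp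
    moreover have "Id C (X (Suc (Suc i))) \<in> mor C (dom (d (Suc (Suc i)))) (X (Suc (Suc i)))" using dt[of "Suc i"] X by (simp add: mor_iff)
    ultimately show ?thesis using w dt[of "Suc i"] unfolding wres_def by metis
  qed
  interpret M: comm_group "Nat_group C (P k) ?G" for k by (rule comm_group_Nat[OF p(2) G])
  interpret h: group_hom "Nat_group C (P k) ?G" "Nat_group C (P (Suc k)) ?G" "\<lambda>\<alpha>. Nat_comp C (P (Suc k)) \<alpha> (\<delta> (Suc k))" for k
    by (rule Nat_comp_hom[OF p(2) p(2) G D])
  have val: "\<alpha> (X i) (f i) \<in> mor C (X i) T" if "\<alpha> \<in> Nat C (P i) ?G" for \<alpha> i
    using NatD(1)[OF that X p(3)] by simp
  have comp: "Nat_comp C (P (Suc i)) \<alpha> (\<delta> (Suc i)) (X (Suc i)) (f (Suc i)) = \<alpha> (X i) (f i) \<cdot> d (Suc i)"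
    if "\<alpha> \<in> Nat C (P i) ?G" for \<alpha> i
    using Nat_gen[OF that P dt(1,3)] by (simp add: Nat_comp_val[OF X p(3)] v dt(2))
  have one: "\<one>\<^bsub>Nat_group C (P i) ?G\<^esub> (X i) (f i) = Zero C (X i) T" for i by (simp add: Nat_group_sel(3)[OF X p(3)])
  have inN: "Nat_comp C (P (Suc i)) \<alpha> (\<delta> (Suc i)) \<in> Nat C (P (Suc i)) ?G" if "\<alpha> \<in> Nat C (P i) ?G" for \<alpha> i
    by (rule Nat_comp_Nat[OF p(2) D that])
  have oneN: "\<one>\<^bsub>Nat_group C (P i) ?G\<^esub> \<in> Nat C (P i) ?G" for i using M.one_closed unfolding Nat_group_sel(1) .
  have coc: "\<alpha> \<in> cocycles C P \<delta> ?G i \<longleftrightarrow> \<alpha> \<in> Nat C (P i) ?G \<and> \<alpha> (X i) (f i) \<cdot> d (Suc i) = Zero C (X (Suc i)) T" for \<alpha> i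
  proof -
    have "Nat_comp C (P (Suc i)) \<alpha> (\<delta> (Suc i)) = \<one>\<^bsub>Nat_group C (P (Suc i)) ?G\<^esub> \<longleftrightarrow> \<alpha> (X i) (f i) \<cdot> d (Suc i) = Zero C (X (Suc i)) T"
      if a: "\<alpha> \<in> Nat C (P i) ?G"
      using Nat_eq_gen[OF inN[OF a] oneN P] comp[OF a] one[of "Suc i"] by metis
    then show ?thesis by (auto simp: cocycles_def kernel_def Nat_group_sel(1))
  qed
  have cob: "\<alpha> \<in> coboundaries C P \<delta> ?G (Suc j) \<longleftrightarrow> \<alpha> \<in> Nat C (P (Suc j)) ?G \<and> (\<exists>c\<in>mor C (X j) T. \<alpha> (X (Suc j)) (f (Suc j)) = c \<cdot> d (Suc j))" for \<alpha> j
  proof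
    assume "\<alpha> \<in> coboundaries C P \<delta> ?G (Suc j)"
    then obtain \<beta> where b: "\<beta> \<in> Nat C (P j) ?G" "\<alpha> = Nat_comp C (P (Suc j)) \<beta> (\<delta> (Suc j))" by auto
    show "\<alpha> \<in> Nat C (P (Suc j)) ?G \<and> (\<exists>c\<in>mor C (X j) T. \<alpha> (X (Suc j)) (f (Suc j)) = c \<cdot> d (Suc j))"
      unfolding b(2) using inN[OF b(1)] comp[OF b(1)] val[OF b(1)] by blast
  next
    assume "\<alpha> \<in> Nat C (P (Suc j)) ?G \<and> (\<exists>c\<in>mor C (X j) T. \<alpha> (X (Suc j)) (f (Suc j)) = c \<cdot> d (Suc j))"
    then obtain c where a: "\<alpha> \<in> Nat C (P (Suc j)) ?G" and c: "c \<in> mor C (X j) T" "\<alpha> (X (Suc j)) (f (Suc j)) = c \<cdot> d (Suc j)" by blast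
    obtain \<beta> where b: "\<beta> \<in> Nat C (P j) ?G" "\<beta> (X j) (f j) = c" using gen_map_free[OF P G, of c] c(1) by auto
    have "\<alpha> = Nat_comp C (P (Suc j)) \<beta> (\<delta> (Suc j))"
      by (rule Nat_eq_gen[OF a inN[OF b(1)] P]) (use comp[OF b(1)] b(2) c(2) in simp)
    then show "\<alpha> \<in> coboundaries C P \<delta> ?G (Suc j)" using b(1) by simp
  qed
  have Z: "subgroup (cocycles C P \<delta> ?G i) (Nat_group C (P i) ?G)"
    using h.subgroup_kernel[of i] by (simp add: cocycles_def)
  have B: "subgroup (coboundaries C P \<delta> ?G i) (Nat_group C (P i) ?G)"
  proof (cases i)
    case 0 then show ?thesis using M.triv_subgroup[of 0] by simp
  next
    case (Suc j) then show ?thesis using h.img_is_subgroup[of j] by (simp add: Nat_group_sel(1))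
  qed
  have BZ: "coboundaries C P \<delta> ?G i \<subseteq> cocycles C P \<delta> ?G i"
  proof (cases i)
    case 0 then show ?thesis using subgroup.one_closed[OF Z] by simp
  next
    case (Suc j)
    show ?thesis
    proof
      fix \<alpha> assume "\<alpha> \<in> coboundaries C P \<delta> ?G i"
      then obtain c where a: "\<alpha> \<in> Nat C (P i) ?G" and c: "c \<in> mor C (X j) T" "\<alpha> (X i) (f i) = c \<cdot> d i"
        unfolding Suc cob by blast
      have ct: "arr c" "dom c = X j" "cod c = T" using c(1) by (auto simp: mor_iff)
      have "c \<cdot> d i \<cdot> d (Suc i) = Zero C (X (Suc i)) T"
        unfolding Suc using dd[of j] dt[of j] dt[of "Suc j"] ct X T by simp
      then show "\<alpha> \<in> cocycles C P \<delta> ?G i" unfolding coc c(2) using a by blast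
    qed
  qed
  have cg: "comm_group ((Nat_group C (P i) ?G)\<lparr>carrier := cocycles C P \<delta> ?G i\<rparr>)"
  proof -
    interpret N: group "(Nat_group C (P i) ?G)\<lparr>carrier := cocycles C P \<delta> ?G i\<rparr>" by (rule subgroup.subgroup_is_group[OF Z M.is_group])
    show ?thesis
      by (rule N.group_comm_groupI) (use M.m_comm[of _ i] coc in \<open>simp add: Nat_group_sel(1)\<close>)
  qed
  have "trivial_group ((Nat_group C (P i) ?G)\<lparr>carrier := cocycles C P \<delta> ?G i\<rparr> Mod coboundaries C P \<delta> ?G i)
      \<longleftrightarrow> cocycles C P \<delta> ?G i \<subseteq> coboundaries C P \<delta> ?G i"
    using trivial_FactGroup_iff[OF cg M.subgroup_incl[OF B Z BZ]] by simp
  also have "\<dots> \<longleftrightarrow> (\<forall>t\<in>mor C (X i) T. t \<cdot> d (Suc i) = Zero C (X (Suc i)) T \<longrightarrow>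
      (case i of 0 \<Rightarrow> t = Zero C (X i) T | Suc j \<Rightarrow> \<exists>c\<in>mor C (X j) T. t = c \<cdot> d i))"
  proof -
    have cob': "\<alpha> \<in> coboundaries C P \<delta> ?G i \<longleftrightarrow>
        (case i of 0 \<Rightarrow> \<alpha> (X i) (f i) = Zero C (X i) T | Suc j \<Rightarrow> \<exists>c\<in>mor C (X j) T. \<alpha> (X i) (f i) = c \<cdot> d i)"
      if a: "\<alpha> \<in> Nat C (P i) ?G" for \<alpha>
    proof (cases i)
      case 0
      then show ?thesis using Nat_eq_gen[OF a oneN P] one[of i] by auto
    next
      case (Suc j)
      then show ?thesis using cob[of \<alpha> j] a by simp
    qed
    show ?thesis
    proof
      assume s: "cocycles C P \<delta> ?G i \<subseteq> coboundaries C P \<delta> ?G i"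
      show "\<forall>t\<in>mor C (X i) T. t \<cdot> d (Suc i) = Zero C (X (Suc i)) T \<longrightarrow>
        (case i of 0 \<Rightarrow> t = Zero C (X i) T | Suc j \<Rightarrow> \<exists>c\<in>mor C (X j) T. t = c \<cdot> d i)"
      proof (intro ballI impI)
        fix t assume t: "t \<in> mor C (X i) T" "t \<cdot> d (Suc i) = Zero C (X (Suc i)) T"
        obtain \<alpha> where a: "\<alpha> \<in> Nat C (P i) ?G" "\<alpha> (X i) (f i) = t" using gen_map_free[OF P G, of t] t(1) by auto
        then have "\<alpha> \<in> coboundaries C P \<delta> ?G i" using s coc t(2) by blast
        then show "case i of 0 \<Rightarrow> t = Zero C (X i) T | Suc j \<Rightarrow> \<exists>c\<in>mor C (X j) T. t = c \<cdot> d i"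
          using cob'[OF a(1)] unfolding a(2) by blast
      qed
    next
      assume R: "\<forall>t\<in>mor C (X i) T. t \<cdot> d (Suc i) = Zero C (X (Suc i)) T \<longrightarrow>
        (case i of 0 \<Rightarrow> t = Zero C (X i) T | Suc j \<Rightarrow> \<exists>c\<in>mor C (X j) T. t = c \<cdot> d i)"
      show "cocycles C P \<delta> ?G i \<subseteq> coboundaries C P \<delta> ?G i"
      proof
        fix \<alpha> assume "\<alpha> \<in> cocycles C P \<delta> ?G i"
        then have a: "\<alpha> \<in> Nat C (P i) ?G" "\<alpha> (X i) (f i) \<cdot> d (Suc i) = Zero C (X (Suc i)) T" unfolding coc by auto
        show "\<alpha> \<in> coboundaries C P \<delta> ?G i" unfolding cob'[OF a(1)] using R[rule_format, OF val[OF a(1)] a(2)] .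
      qed
    qed
  qed
  finally show ?thesis .
qed

text \<open>\<open>Ext\<close> refers to a chosen resolution by abstract projectives. Each of these
  is representable, so the choice itself becomes an infinite complex \<open>Y\<close> in
  \<open>C\<close>, the same for all n, and vanishing of Ext up to n is its coexactness up to
  n.\<close>

lemma Ext_trivial_iff_coexact:
  assumes ic: "idempotent_complete C" and F: "in_mod C F"
  shows "\<exists>Y e. (\<forall>n. exact0 n C Y) \<and> cgen C Y F e \<and>
    (\<forall>n. (\<forall>i\<le>n. \<forall>T\<in>Obj C. trivial_group (Ext C i F (rep C T))) \<longleftrightarrow> coexact n C Y)"
proof -
  have Fm: "is_module C F" using F by (simp add: in_mod_def)
  \<comment> \<open>The very choice made inside \<open>Ext\<close>, so that the definition of
    \<open>Ext\<close> can later be folded to \<open>c\<close>.\<close>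
  define c :: "(nat \<Rightarrow> ('a, 'b, 'b) cmod) \<times> (nat \<Rightarrow> 'a \<Rightarrow> 'b \<Rightarrow> 'b) \<times> ('a \<Rightarrow> 'b \<Rightarrow> 'c)" where
    "c = (SOME (P, \<delta>, \<epsilon>). projective_resolution C P \<delta> \<epsilon> F)"
  obtain P \<delta> \<epsilon> where c: "c = (P, \<delta>, \<epsilon>)" by (cases c)
  obtain X \<delta>0 \<epsilon>0 where X: "\<And>i. X i \<in> Obj C" and "resolution C (\<lambda>i. rep C (X i)) \<delta>0 \<epsilon>0 F"
    using F unfolding in_mod_def by blast
  then have "projective_resolution C (\<lambda>i. rep C (X i)) \<delta>0 \<epsilon>0 F"
    unfolding projective_resolution_def using free_projective[OF gen_rep[OF X]] by blast
  then have "case (\<lambda>i. rep C (X i), \<delta>0, \<epsilon>0) of (P, \<delta>, \<epsilon>) \<Rightarrow> projective_resolution C P \<delta> \<epsilon> F" by simp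
  then have "case c of (P, \<delta>, \<epsilon>) \<Rightarrow> projective_resolution C P \<delta> \<epsilon> F" unfolding c_def by (rule someI)
  then have pr: "projective C (P i)" and res: "resolution C P \<delta> \<epsilon> F" for i unfolding c by (auto simp: projective_resolution_def)
  obtain Z f where P: "\<And>i. gen C (Z i) (zeros C (Z i)) (P i) (f i)" using projective_free[OF ic pr] by metis
  have E: "\<epsilon> \<in> Nat C (P 0) F" and D: "\<delta> (Suc i) \<in> Nat C (P (Suc i)) (P i)" for i using res unfolding resolution_def by auto
  have "\<exists>a\<in>mor C (Z (Suc i)) (Z i). \<delta> (Suc i) (Z (Suc i)) (f (Suc i)) = act (P i) a (f i)" for i
    by (rule genD(5)[OF P genD(4)[OF P] NatD(1)[OF D genD(4,3)[OF P]]])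
  then obtain g where g: "\<And>i. g i \<in> mor C (Z (Suc i)) (Z i)" "\<And>i. \<delta> (Suc i) (Z (Suc i)) (f (Suc i)) = act (P i) (g i) (f i)" by metis
  define d where "d i = g (i - 1)" for i
  have d: "d (Suc i) \<in> mor C (Z (Suc i)) (Z i)" "\<delta> (Suc i) (Z (Suc i)) (f (Suc i)) = act (P i) (d (Suc i)) (f i)" for i
    using g by (simp_all add: d_def)
  have w: "wres C Z d" and G: "gen C (Z 0) (ran C (d 1)) F (\<epsilon> (Z 0) (f 0))"
    using resolution_iff[where d = d, OF P Fm E D d] res by auto
  define Y where "Y = \<lparr>cobj = Z, cdiff = d\<rparr>"
  have dt: "arr (d (Suc i))" "dom (d (Suc i)) = Z (Suc i)" "cod (d (Suc i)) = Z i" for i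
    using d(1)[of i] by (auto simp: mor_iff)
  have Zo: "obj (Z i)" for i by (rule genD(4)[OF P])
  have ex: "exact0 n C Y" for n
  proof -
    have "d (Suc i) \<cdot> d (Suc (Suc i)) = Zero C (Z (Suc (Suc i))) (Z i)" for i
    proof -
      have "d (Suc (Suc i)) = d (Suc (Suc i)) \<cdot> Id C (Z (Suc (Suc i)))" using dt[of "Suc i"] Zo by simp
      moreover have "Id C (Z (Suc (Suc i))) \<in> mor C (dom (d (Suc (Suc i)))) (Z (Suc (Suc i)))" using dt[of "Suc i"] Zo by (simp add: mor_iff)
      ultimately show ?thesis using w dt[of "Suc i"] unfolding wres_def by metis
    qed
    then have "is_complex n C Y" unfolding is_complex_def Y_def using Zo d(1) by simp
    then show ?thesis unfolding exact0_def using w by (simp add: wres_def Y_def)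
  qed
  have "bd C Y = ran C (d 1)" using bd_ran[OF exact0D(1)[OF ex]] by (simp add: Y_def)
  then have G': "cgen C Y F (\<epsilon> (Z 0) (f 0))" using G by (simp add: Y_def)
  have Ext: "Ext C i F (rep C T) = (Nat_group C (P i) (rep C T))\<lparr>carrier := cocycles C P \<delta> (rep C T) i\<rparr> Mod coboundaries C P \<delta> (rep C T) i" for i T
    unfolding Ext_def Let_def c_def[symmetric] c by simp
  have tr: "trivial_group (Ext C i F (rep C T)) \<longleftrightarrow> (\<forall>t\<in>mor C (Z i) T. t \<cdot> d (Suc i) = Zero C (Z (Suc i)) T \<longrightarrow>
      (case i of 0 \<Rightarrow> t = Zero C (Z i) T | Suc j \<Rightarrow> \<exists>c\<in>mor C (Z j) T. t = c \<cdot> d i))" if "obj T" for i T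
    unfolding Ext by (rule Ext_group_trivial_iff[where d = d, OF P D w d(2) that])
  have "(\<forall>i\<le>n. \<forall>T\<in>Obj C. trivial_group (Ext C i F (rep C T))) \<longleftrightarrow> coexact n C Y" for n
  proof
    assume R: "\<forall>i\<le>n. \<forall>T\<in>Obj C. trivial_group (Ext C i F (rep C T))"
    show "coexact n C Y"
      unfolding coexact_def Y_def cplx.simps
    proof (intro conjI ballI impI allI)
      fix b assume b: "arr b" "dom b = Z 0" "b \<cdot> d 1 = Zero C (Z 1) (cod b)"
      have "trivial_group (Ext C 0 F (rep C (cod b)))" using R b(1) by simp
      then show "b = Zero C (Z 0) (cod b)" using b unfolding tr[OF arr_Cod[OF b(1)]] by (auto simp: mor_iff)
    next
      fix i b assume i: "i < n" and b: "arr b" "dom b = Z (Suc i)" "b \<cdot> d (Suc (Suc i)) = Zero C (Z (Suc (Suc i))) (cod b)"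
      have "trivial_group (Ext C (Suc i) F (rep C (cod b)))" using R b(1) i by simp
      then show "\<exists>c\<in>mor C (Z i) (cod b). b = c \<cdot> d (Suc i)" using b unfolding tr[OF arr_Cod[OF b(1)]] by (auto simp: mor_iff)
    qed
  next
    assume K: "coexact n C Y"
    show "\<forall>i\<le>n. \<forall>T\<in>Obj C. trivial_group (Ext C i F (rep C T))"
    proof (intro allI impI ballI)
      fix i T assume i: "i \<le> n" and T: "obj T"
      show "trivial_group (Ext C i F (rep C T))"
        unfolding tr[OF T]
      proof (intro ballI impI)
        fix t assume t: "t \<in> mor C (Z i) T" "t \<cdot> d (Suc i) = Zero C (Z (Suc i)) T"
        then have t': "arr t" "dom t = Z i" "cod t = T" by (auto simp: mor_iff)
        show "case i of 0 \<Rightarrow> t = Zero C (Z i) T | Suc j \<Rightarrow> \<exists>c\<in>mor C (Z j) T. t = c \<cdot> d i"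
        proof (cases i)
          case 0
          then show ?thesis using coexactD(1)[OF K, of t] t(2) t' by (simp add: Y_def)
        next
          case (Suc j)
          then show ?thesis using coexactD(2)[OF K, of j t] t(2) t' i by (simp add: Y_def)
        qed
      qed
    qed
  qed
  then show ?thesis using ex G' by blast
qed

text \<open>The finite resolution is continued by zero objects above degree n+1.\<close>

lemma in_mod_lexact:
  assumes L: "lexact n C X" and G: "cgen C X F e"
  shows "in_mod C F"
proof -
  note cX = lexactD(2)[OF L]
  note x = cx[OF cX]
  obtain O0 where z: "zero_object C O0" using ex_zero_object by blast
  note O = zero_objectD[OF z]
  define Z where "Z i = (if i \<le> Suc n then cobj X i else O0)" for i
  define d where "d i = (if i \<le> Suc n then cdiff X i else Zero C (Z i) (Z (i - 1)))" for i
  have Z: "obj (Z i)" for i using x(1) O(1) by (simp add: Z_def)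
  have dm: "d (Suc i) \<in> mor C (Z (Suc i)) (Z i)" for i
    using x(2-4)[of i] Z by (auto simp: d_def mor_iff) (auto simp: Z_def)
  have "wres C Z d"
    unfolding wres_def
  proof (intro allI conjI ballI impI iffI)
    fix i a assume a: "arr a" "cod a = Z (Suc i)" and z: "d (Suc i) \<cdot> a = Zero C (dom a) (Z i)"
    consider "i < n" | "i = n" | "i > n" by linarith
    then show "\<exists>t\<in>mor C (dom a) (Z (Suc (Suc i))). a = d (Suc (Suc i)) \<cdot> t"
    proof cases
      case 1
      then show ?thesis using exact0D(2)[OF lexactD(1)[OF L] 1, of a] a z by (simp add: Z_def d_def)
    next
      case 2
      have "a = Zero C (dom a) (Z (Suc i))" using lexactD(3)[OF L, of a] a z 2 by (simp add: Z_def d_def)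
      moreover have "d (Suc (Suc i)) \<cdot> Zero C (dom a) (Z (Suc (Suc i))) = Zero C (dom a) (Z (Suc i))"
        using 2 a(1) Z by (simp add: d_def)
      ultimately have "a = d (Suc (Suc i)) \<cdot> Zero C (dom a) (Z (Suc (Suc i)))" by (simp only:)
      then show ?thesis using a(1) Z by (intro bexI[of _ "Zero C (dom a) (Z (Suc (Suc i)))"]) (auto simp: mor_iff)
    next
      case 3
      have "a = Zero C (dom a) (Z (Suc i))" using O(2)[OF a(1)] a(2) 3 by (simp add: Z_def)
      moreover have "d (Suc (Suc i)) \<cdot> Zero C (dom a) (Z (Suc (Suc i))) = Zero C (dom a) (Z (Suc i))"
        using 3 a(1) Z by (simp add: d_def)
      ultimately have "a = d (Suc (Suc i)) \<cdot> Zero C (dom a) (Z (Suc (Suc i)))" by (simp only:)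
      then show ?thesis using a(1) Z by (intro bexI[of _ "Zero C (dom a) (Z (Suc (Suc i)))"]) (auto simp: mor_iff)
    qed
  next
    fix i a assume "\<exists>t\<in>mor C (dom a) (Z (Suc (Suc i))). a = d (Suc (Suc i)) \<cdot> t"
    then obtain t where t: "arr t" "cod t = Z (Suc (Suc i))" "dom t = dom a" and a: "a = d (Suc (Suc i)) \<cdot> t" by (auto simp: mor_iff)
    have dt: "arr (d (Suc j))" "dom (d (Suc j)) = Z (Suc j)" "cod (d (Suc j)) = Z j" for j using dm[of j] by (auto simp: mor_iff)
    have "d (Suc i) \<cdot> (d (Suc (Suc i)) \<cdot> t) = Zero C (dom t) (Z i)"
    proof (cases "i < n")
      case True then show ?thesis using x(6)[OF True, of t] t(1,2) by (simp add: Z_def d_def)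
    next
      case False
      then have "d (Suc (Suc i)) \<cdot> t = Zero C (dom t) (Z (Suc i))" using t(1,2) Z by (simp add: d_def)
      then show ?thesis using dt[of i] t(1) by simp
    qed
    then show "d (Suc i) \<cdot> a = Zero C (dom a) (Z i)" unfolding a[symmetric] t(3) .
  qed (use Z dm in auto)
  moreover have "gen C (Z 0) (ran C (d 1)) F e" using G bd_ran[OF cX] by (simp add: Z_def d_def)
  ultimately show ?thesis unfolding in_mod_iff using genD(2)[OF G] by blast
qed

text \<open>The bound on the projective dimension and the vanishing of Ext refer to different
  resolutions: the former gives a left exact \<open>X\<close>, the latter a coexact
  \<open>Y\<close>. They present the same module, so \<open>coexact_transfer\<close> carries
  coexactness from one to the other.\<close>

lemma ex_cat_eq:
  assumes ic: "idempotent_complete C"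
  shows "ex_cat n C = coker_class C {X. n_exact n C X}"
proof (intro Set.set_eqI iffI)
  fix F :: "('a, 'b, 'b set) cmod" assume "F \<in> ex_cat n C"
  then have F: "in_mod C F" and pd: "pdim_le C F (n+1)" and ext: "\<forall>i\<le>n. \<forall>T\<in>Obj C. trivial_group (Ext C i F (rep C T))"
    by (auto simp: ex_cat_def mod_cat_def)
  have Fm: "is_module C F" using F by (simp add: in_mod_def)
  obtain Y e where Y: "exact0 n C Y" and GY: "cgen C Y F e" and co: "coexact n C Y"
    using Ext_trivial_iff_coexact[OF ic F] ext by blast
  obtain P \<delta> \<epsilon> where pr: "\<And>i. i \<le> n + 1 \<Longrightarrow> projective C (P i :: ('a, 'b, 'b) cmod)" and R: "finite_resolution C (n+1) P \<delta> \<epsilon> F"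
    using pd unfolding pdim_le_def finite_projective_resolution_def by blast
  have "\<forall>i. \<exists>Z f. i \<le> Suc n \<longrightarrow> gen C Z (zeros C Z) (P i) f" using projective_free[OF ic pr] by auto
  then obtain Z f where P: "\<And>i. i \<le> Suc n \<Longrightarrow> gen C (Z i) (zeros C (Z i)) (P i) (f i)" by metis
  have E: "\<epsilon> \<in> Nat C (P 0) F" and D: "\<And>i. i \<le> n \<Longrightarrow> \<delta> (Suc i) \<in> Nat C (P (Suc i)) (P i)"
    using R unfolding finite_resolution_def by auto
  have "\<exists>a\<in>mor C (Z (Suc i)) (Z i). \<delta> (Suc i) (Z (Suc i)) (f (Suc i)) = act (P i) a (f i)" if i: "i \<le> n" for i
  proof -
    have i': "Suc i \<le> Suc n" "i \<le> Suc n" using i by auto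
    show ?thesis by (rule genD(5)[OF P[OF i'(2)] genD(4)[OF P[OF i'(1)]] NatD(1)[OF D[OF i] genD(4,3)[OF P[OF i'(1)]]]])
  qed
  then obtain g where g: "\<And>i. i \<le> n \<Longrightarrow> g i \<in> mor C (Z (Suc i)) (Z i)"
    "\<And>i. i \<le> n \<Longrightarrow> \<delta> (Suc i) (Z (Suc i)) (f (Suc i)) = act (P i) (g i) (f i)" by metis
  define X where "X = \<lparr>cobj = Z, cdiff = \<lambda>i. g (i - 1)\<rparr>"
  have "finite_resolution C (n+1) P \<delta> \<epsilon> F \<longleftrightarrow> lexact n C X \<and> cgen C X F (\<epsilon> (cobj X 0) (f 0))"
    by (rule finite_resolution_iff) (use P Fm E D g in \<open>auto simp: X_def\<close>)
  then have L: "lexact n C X" and GX: "cgen C X F (\<epsilon> (cobj X 0) (f 0))" using R by auto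
  obtain u where "cqiso C X Y u" using gen_unique[OF GX GY] by blast
  then have "coexact n C X" by (rule coexact_transfer[OF lexactD(1)[OF L] Y _ co])
  then have "n_exact n C X" using L n_exact_iff by blast
  then show "F \<in> coker_class C {X. n_exact n C X}" unfolding coker_class_def using GX by blast
next
  fix F :: "('a, 'b, 'b set) cmod" assume "F \<in> coker_class C {X. n_exact n C X}"
  then obtain X e where X: "n_exact n C X" and G: "cgen C X F e" unfolding coker_class_def by blast
  have L: "lexact n C X" and co: "coexact n C X" using X n_exact_iff by auto
  have F: "in_mod C F" by (rule in_mod_lexact[OF L G])
  have "yoneda_resolves n C X F" using yoneda_resolves_iff[OF n_exactD(3)[OF X] genD(2)[OF G]] L G by blast
  then have pd: "pdim_le C F (n+1)" unfolding yoneda_resolves_def pdim_le_def by blast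
  obtain Y e' where Y: "exact0 n C Y" and GY: "cgen C Y F e'"
    and ext: "(\<forall>i\<le>n. \<forall>T\<in>Obj C. trivial_group (Ext C i F (rep C T))) \<longleftrightarrow> coexact n C Y"
    using Ext_trivial_iff_coexact[OF ic F] by blast
  obtain u where "cqiso C Y X u" using gen_unique[OF GY G] by blast
  then have "coexact n C Y" by (rule coexact_transfer[OF Y n_exactD(2)[OF X] _ co])
  then show "F \<in> ex_cat n C" using ext F pd by (auto simp: ex_cat_def mod_cat_def)
qed

section \<open>The operations on classes of modules\<close>

lemma coker_classI: "X \<in> \<A> \<Longrightarrow> cgen C X F e \<Longrightarrow> F \<in> coker_class C \<A>"
  unfolding coker_class_def by blast

lemma coker_class_mem:
  assumes A: "closed_class n C \<A>" and X: "n_exact n C X" and G: "cgen C X F e"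
  shows "F \<in> coker_class C \<A> \<longleftrightarrow> X \<in> \<A>"
proof
  assume "F \<in> coker_class C \<A>"
  then obtain Y e' where Y: "Y \<in> \<A>" and GY: "cgen C Y F e'" unfolding coker_class_def by blast
  show "X \<in> \<A>" using gen_unique[OF GY G] closed_qiso[OF A Y X] by blast
qed (rule coker_classI[OF _ G])

lemma Im_at_mem:
  assumes F: "gen C Q M F e" and G: "gen C P N G g" and a: "\<alpha> \<in> Nat C G F"
    and f: "f \<in> mor C P Q" "\<alpha> P g = act F f e" and x: "arr x" "cod x = Q"
  shows "act F x e \<in> Im_at G \<alpha> (dom x) \<longleftrightarrow> (\<exists>a\<in>mor C (dom x) P. eqm C M x (f \<cdot> a))"
proof -
  have ft: "arr f" "dom f = P" "cod f = Q" using f(1) by (auto simp: mor_iff)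
  have "act F x e = act F b (act F f e) \<longleftrightarrow> eqm C M x (f \<cdot> b)" if "b \<in> mor C (dom x) P" for b
  proof -
    have b: "arr b" "dom b = dom x" "cod b = P" using that by (auto simp: mor_iff)
    have "act F (f \<cdot> b) e = act F b (act F f e)"
      by (rule md_comp[OF genD(2)[OF F]]) (use b ft genD(3)[OF F] in simp_all)
    then show ?thesis using gen_eq[OF F x(1), of "f \<cdot> b"] b ft x by simp
  qed
  then show ?thesis unfolding Im_at_gen[OF G a arr_Dom[OF x(1)]] f(2) by blast
qed

text \<open>A map from a module of \<open>mod C\<close> to \<open>F\<close> is determined on a
  generator, hence by one arrow \<open>f\<close> into \<open>X_0\<close>, and its image is that of
  \<open>f\<close>. Conversely every \<open>f\<close> comes from a map out of the representable of
  its source.\<close>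

lemma Pb_coker_class:
  assumes A: "closed_class n C \<A>"
  shows "Pb C (coker_class C \<A>) = coker_class C (pb C \<A>)"
proof (intro Set.set_eqI iffI)
  fix F :: "('a, 'b, 'b set) cmod" assume FP: "F \<in> Pb C (coker_class C \<A>)"
  then obtain X e where X: "X \<in> \<A>" and F: "cgen C X F e" unfolding Pb_def coker_class_def by blast
  note fD = genD[OF F] and R = genD(1)[OF F]
  have "splits C \<A> X f" if f: "arr f" "cod f = cobj X 0" for f
  proof -
    let ?P = "dom f"
    have P: "obj ?P" using f by simp
    \<comment> \<open>The test module must have values in \<open>'m set\<close> to belong to
      \<open>mod_cat\<close>.\<close>
    let ?G = "sing (rep C ?P)"
    have G: "gen C ?P (zeros C ?P) ?G {Id C ?P}" by (rule gen_sing[OF gen_rep[OF P]])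
    obtain \<alpha> where a: "\<alpha> \<in> Nat C ?G F" "\<alpha> ?P {Id C ?P} = act F f e"
      using gen_map_free[OF G fD(2) fD(7)[OF f]] by blast
    have fm: "f \<in> mor C ?P (cobj X 0)" using f by (simp add: mor_iff)
    let ?U = "Im_at ?G \<alpha>"
    note mem = Im_at_mem[OF F G a(1) fm a(2)]
    have U: "submod C F ?U" by (rule submod_Im[OF genD(2)[OF G] fD(2) a(1)])
    have "?G \<in> mod_cat C" using in_mod_free[OF G] by (simp add: mod_cat_def)
    then have S: "submodule F ?U \<in> coker_class C \<A>" and Q: "\<exists>H\<in>coker_class C \<A>. mod_iso C (quotient_module C F ?U) (H :: ('a, 'b, 'b set) cmod)"
      using FP a(1) unfolding Pb_def by blast+
    obtain Y ey where Y: "Y \<in> \<A>" and GY: "cgen C Y (submodule F ?U) ey" using S unfolding coker_class_def by blast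
    obtain H W ew where W: "W \<in> \<A>" and GW: "cgen C W (H :: ('a, 'b, 'b set) cmod) ew" and iso: "mod_iso C (quotient_module C F ?U) H"
      using Q unfolding coker_class_def by blast
    note gY = genD[OF GY]
    \<comment> \<open>\<open>F\<close> modulo the image is presented by \<open>X_0\<close> with
      enlarged relations, so its isomorphism with \<open>H\<close> is given by an arrow
      \<open>w\<close>.\<close>
    obtain w where w: "qiso C (cobj X 0) {a \<in> Arr C. cod a = cobj X 0 \<and> act F a e \<in> ?U (dom a)} (cobj W 0) (bd C W) w"
      using gen_mod_iso_iff[OF gen_quotient[OF F U] GW] iso by blast
    have sub: "carrier (val (submodule F ?U) B) = ?U B" "\<one>\<^bsub>val (submodule F ?U) B\<^esub> = \<one>\<^bsub>val F B\<^esub>" "act (submodule F ?U) = act F" for B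
      by (simp_all add: submodule_def)
    have eyU: "ey \<in> ?U (cobj Y 0)" using gY(3) sub by simp
    have "ey \<in> carrier (val F (cobj Y 0))" by (rule submodD(4)[OF fD(2) U gY(4) eyU])
    then obtain y where y: "arr y" "dom y = cobj Y 0" "cod y = cobj X 0" and ey: "ey = act F y e"
      using fD(5)[OF gY(4), of ey] by (auto simp: mor_iff)
    have ya: "act F (y \<cdot> a) e = act F a ey" if "arr a" "cod a = cobj Y 0" for a
      unfolding ey by (rule md_comp[OF fD(2)]) (use that y fD(3) in simp_all)
    have xa: "act F x e \<in> ?U (dom x) \<longleftrightarrow> (\<exists>a\<in>mor C (dom x) (cobj Y 0). eqb C X x (y \<cdot> a))"
      if x: "arr x" "cod x = cobj X 0" for x
    proof -
      have 1: "act F x e = act F a ey \<longleftrightarrow> eqb C X x (y \<cdot> a)" if "a \<in> mor C (dom x) (cobj Y 0)" for a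
        using gen_eq[OF F x(1), of "y \<cdot> a"] ya[of a] that x y by (auto simp: mor_iff)
      show ?thesis
      proof
        assume "act F x e \<in> ?U (dom x)"
        then show "\<exists>a\<in>mor C (dom x) (cobj Y 0). eqb C X x (y \<cdot> a)"
          using gY(5)[OF arr_Dom[OF x(1)], of "act F x e"] 1 unfolding sub by blast
      next
        assume "\<exists>a\<in>mor C (dom x) (cobj Y 0). eqb C X x (y \<cdot> a)"
        then obtain a where a: "arr a" "dom a = dom x" "cod a = cobj Y 0" "act F x e = act F a ey"
          using 1 by (auto simp: mor_iff)
        have "act F a ey \<in> ?U (dom x)" using gY(7)[OF a(1,3)] unfolding sub a(2) .
        then show "act F x e \<in> ?U (dom x)" unfolding a(4) .
      qed
    qed
    have q: "w \<in> mor C (cobj X 0) (cobj W 0)"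
      "\<And>x. x \<in> Arr C \<Longrightarrow> cod x = cobj X 0 \<Longrightarrow> w \<cdot> x \<in> bd C W \<longleftrightarrow> (\<exists>a\<in>mor C (dom x) (cobj Y 0). eqb C X x (y \<cdot> a))"
      "\<exists>v\<in>mor C (cobj W 0) (cobj X 0). eqb C W (w \<cdot> v) (Id C (cobj W 0))"
      using w xa unfolding qiso_def by auto
    have yb: "y \<cdot> a \<in> bd C X \<longleftrightarrow> a \<in> bd C Y" if a: "arr a" "cod a = cobj Y 0" for a
      using fD(6)[of "y \<cdot> a"] gY(6)[OF a] ya[OF a] y a unfolding sub by simp
    have ym: "y \<in> mor C (cobj Y 0) (cobj X 0)" using y by (simp add: mor_iff)
    have ses: "cses C Y y X w W"
      unfolding ses_def using gY(1) R genD(1)[OF GW] ym q yb by blast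
    show ?thesis
    proof (rule splitsI[OF Y W ses])
      have "\<exists>s\<in>mor C ?P ?P. eqb C X f (f \<cdot> s)"
        by (rule bexI[of _ "Id C ?P"]) (use eqm_refl[OF R f] f in \<open>auto simp: mor_iff\<close>)
      then show "\<exists>a\<in>mor C ?P (cobj Y 0). eqb C X f (y \<cdot> a)" using xa[OF f] mem[OF f] by blast
      show "\<exists>b\<in>mor C (cobj Y 0) ?P. eqb C X y (f \<cdot> b)" using mem[OF y(1,3)] eyU unfolding ey y(2) by blast
    qed
  qed
  then have "X \<in> pb C \<A>" using X by (simp add: pb_def)
  then show "F \<in> coker_class C (pb C \<A>)" using F by (rule coker_classI)
next
  fix F :: "('a, 'b, 'b set) cmod" assume "F \<in> coker_class C (pb C \<A>)"
  then obtain X e where Xp: "X \<in> pb C \<A>" and F: "cgen C X F e" unfolding coker_class_def by blast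
  then have X: "X \<in> \<A>" using pb_subset by blast
  note fD = genD[OF F] and R = genD(1)[OF F]
  have "submodule F (Im_at G \<alpha>) \<in> coker_class C \<A> \<and> (\<exists>H\<in>coker_class C \<A>. mod_iso C (quotient_module C F (Im_at G \<alpha>)) (H :: ('a, 'b, 'b set) cmod))"
    if G: "in_mod C G" and a: "\<alpha> \<in> Nat C G F" for G :: "('a, 'b, 'b set) cmod" and \<alpha>
  proof -
    obtain P N g where GG: "gen C P N G g" using G unfolding in_mod_iff by (elim conjE exE) (rule that)
    note gD = genD[OF GG]
    obtain f where f: "f \<in> mor C P (cobj X 0)" "\<alpha> P g = act F f e" using fD(5)[OF gD(4) NatD(1)[OF a gD(4,3)]] by blast
    have ft: "arr f" "dom f = P" "cod f = cobj X 0" using f(1) by (auto simp: mor_iff)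
    let ?U = "Im_at G \<alpha>"
    note mem = Im_at_mem[OF F GG a f]
    have U: "submod C F ?U" by (rule submod_Im[OF gD(2) fD(2) a])
    have "splits C \<A> X f" using Xp ft by (simp add: pb_def)
    then obtain Y W y w where Y: "Y \<in> \<A>" and W: "W \<in> \<A>"
      and S: "cses C Y y X w W"
      and fy: "\<exists>a\<in>mor C (dom f) (cobj Y 0). eqb C X f (y \<cdot> a)"
      and yf: "\<exists>b\<in>mor C (cobj Y 0) (dom f). eqb C X y (f \<cdot> b)" by (rule splitsE)
    note s = sesD[OF S]
    have yt: "arr y" "dom y = cobj Y 0" "cod y = cobj X 0" using S by (auto simp: ses_def mor_iff)
    have sub: "carrier (val (submodule F ?U) B) = ?U B" "\<one>\<^bsub>val (submodule F ?U) B\<^esub> = \<one>\<^bsub>val F B\<^esub>" "act (submodule F ?U) = act F" for B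
      by (simp_all add: submodule_def)
    have mem': "act F x e \<in> ?U (dom x) \<longleftrightarrow> (\<exists>a\<in>mor C (dom x) (cobj Y 0). eqb C X x (y \<cdot> a))"
      if x: "arr x" "cod x = cobj X 0" for x
      using im_cong[OF R ft(1,3) yt(1,3) fy[folded yt(2)], where x = x and A = "dom x"] im_cong[OF R yt(1,3) ft(1,3) yf[folded yt(2)], where x = x and A = "dom x"]
      unfolding mem[OF x] ft(2) yt(2) by blast
    have ya: "act F (y \<cdot> a) e = act F a (act F y e)" if "arr a" "cod a = cobj Y 0" for a
      by (rule md_comp[OF fD(2)]) (use that yt fD(3) in simp_all)
    have yU: "act F y e \<in> ?U (cobj Y 0)" using mem[OF yt(1,3)] yf unfolding yt(2) ft(2) by blast
    \<comment> \<open>The image is generated by the element of \<open>F\<close> that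
      \<open>y\<close> produces, and its relations are the boundaries of \<open>Y\<close> because
      \<open>y\<close> reflects boundaries.\<close>
    have "cgen C Y (submodule F ?U) (act F y e)"
      unfolding gen_def
    proof (intro conjI ballI impI; (unfold sub)?)
      show "right_ideal C (cobj Y 0) (bd C Y)" using S by (simp add: ses_def)
      show "is_module C (submodule F ?U)" by (rule is_module_submodule[OF fD(2) U])
      show "act F y e \<in> ?U (cobj Y 0)" by (rule yU)
      show "\<exists>a\<in>mor C A (cobj Y 0). x = act F a (act F y e)" if A: "obj A" "x \<in> ?U A" for A x
      proof -
        obtain b where b: "arr b" "dom b = A" "cod b = cobj X 0" and x: "x = act F b e"
          using fD(5)[OF A(1) submodD(4)[OF fD(2) U A]] by (auto simp: mor_iff)
        have "act F b e \<in> ?U (dom b)" using A(2) unfolding x b(2) .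
        then obtain a where a: "arr a" "dom a = A" "cod a = cobj Y 0" "eqb C X b (y \<cdot> a)"
          using mem'[OF b(1,3)] b(2) by (auto simp: mor_iff)
        have "act F b e = act F (y \<cdot> a) e" using gen_eq[OF F b(1), of "y \<cdot> a"] a b yt by simp
        then have "x = act F a (act F y e)" unfolding x ya[OF a(1,3)] .
        then show ?thesis using a(1-3) by (auto simp: mor_iff)
      qed
      show "act F a (act F y e) = \<one>\<^bsub>val F (dom a)\<^esub> \<longleftrightarrow> a \<in> bd C Y" if a: "arr a" "cod a = cobj Y 0" for a
      proof -
        have "act F a (act F y e) = \<one>\<^bsub>val F (dom a)\<^esub> \<longleftrightarrow> y \<cdot> a \<in> bd C X"
          using fD(6)[of "y \<cdot> a"] ya[OF a] a yt by simp
        also have "\<dots> \<longleftrightarrow> a \<in> bd C Y" using S a unfolding ses_def by blast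
        finally show ?thesis .
      qed
    qed
    then have 1: "submodule F ?U \<in> coker_class C \<A>" by (rule coker_classI[OF Y])
    note GQ = gen_quotient[OF F U]
    have "qiso C (cobj X 0) {a \<in> Arr C. cod a = cobj X 0 \<and> act F a e \<in> ?U (dom a)} (cobj W 0) (bd C W) w"
      by (rule ses_qiso_right[OF S genD(1)[OF GQ]]) (use mem' in auto)
    moreover obtain ew where GW: "cgen C W (Fun C W) ew"
      using gen_Fun[OF n_exactD(3)[OF closedD[OF A W]]] by blast
    ultimately have "mod_iso C (quotient_module C F ?U) (Fun C W)" using gen_mod_iso_iff[OF GQ GW] by blast
    then show ?thesis using 1 coker_classI[OF W GW] by blast
  qed
  then show "F \<in> Pb C (coker_class C \<A>)" unfolding Pb_def mod_cat_def using coker_classI[OF X F] by blast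
qed

text \<open>\<open>Res\<close> picks some sequence presenting \<open>F\<close>. Whatever it picks is
  isomorphic to a member and hence a member, so \<open>Tr\<close> is reversal up to
  isomorphism.\<close>

lemma Tr_image_coker_class:
  assumes ic: "idempotent_complete C" and A: "closed_class n C \<A>"
  shows "Tr_image n C (coker_class C \<A>) = coker_class Cop (opc n C \<A>)"
proof -
  interpret op: additive_category "op_cat C" by (rule op_additive)
  have ic': "idempotent_complete Cop" using ic by (simp add: idempotent_complete_op)
  have Res: "\<exists>X' e'. X' \<in> \<A> \<and> cgen C X' F e' \<and> Tr n C F = Fun Cop (op_cplx n X')"
    if X: "X \<in> \<A>" and G: "cgen C X F e" for F :: "('a, 'b, 'b set) cmod" and X e
  proof -
    have nX: "n_exact n C X" by (rule closedD[OF A X])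
    have "yoneda_resolves n C X F" using yoneda_resolves_iff[OF n_exactD(3)[OF nX] genD(2)[OF G]] n_exactD(1)[OF nX] G by blast
    then have "\<exists>X. n_exact n C X \<and> yoneda_resolves n C X F" using nX by blast
    then have "n_exact n C (Res n C F) \<and> yoneda_resolves n C (Res n C F) F" unfolding Res_def by (rule someI_ex)
    then have nR: "n_exact n C (Res n C F)" and "yoneda_resolves n C (Res n C F) F" by auto
    then obtain e' where G': "cgen C (Res n C F) F e'"
      using yoneda_resolves_iff[OF n_exactD(3)[OF nR] genD(2)[OF G]] by blast
    have "Res n C F \<in> \<A>" using coker_class_mem[OF A nR G'] coker_classI[OF X G] by blast
    then show ?thesis using G' unfolding Tr_def by blast
  qed
  have opF: "\<exists>e. cgen Cop (op_cplx n X) (Fun Cop (op_cplx n X)) e"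
    if "X \<in> \<A>" for X by (rule op.gen_Fun[OF is_complex_op[OF n_exactD(3)[OF closedD[OF A that]]]])
  show ?thesis
  proof (intro Set.set_eqI iffI)
    fix H :: "('a, 'b, 'b set) cmod" assume "H \<in> Tr_image n C (coker_class C \<A>)"
    then obtain F X e where H: "H \<in> ex_cat n Cop" and X: "X \<in> \<A>" "cgen C X F e"
      and iso: "mod_iso Cop (Tr n C F) H" unfolding Tr_image_def coker_class_def by blast
    have Hm: "is_module Cop H" using H by (simp add: ex_cat_def mod_cat_def in_mod_def)
    obtain X' where X': "X' \<in> \<A>" "Tr n C F = Fun Cop (op_cplx n X')" using Res[OF X] by blast
    obtain e2 where "cgen Cop (op_cplx n X') H e2"
      using opF[OF X'(1)] op.gen_mod_iso_transfer[OF _ iso[unfolded X'(2)] Hm] by blast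
    then show "H \<in> coker_class Cop (opc n C \<A>)" by (rule op.coker_classI[rotated]) (use opc_iff[OF A] X'(1) in blast)
  next
    fix H :: "('a, 'b, 'b set) cmod" assume "H \<in> coker_class Cop (opc n C \<A>)"
    then obtain Z e where Z: "Z \<in> opc n C \<A>" and GH: "cgen Cop Z H e" unfolding coker_class_def by blast
    have nZ: "n_exact n Cop Z" and ZA: "op_cplx n Z \<in> \<A>" using Z by (auto simp: opc_def)
    have H: "H \<in> ex_cat n Cop" unfolding op.ex_cat_eq[OF ic'] using op.coker_classI[OF _ GH] nZ by blast
    let ?F = "Fun C (op_cplx n Z)"
    obtain eF where GF: "cgen C (op_cplx n Z) ?F eF"
      using gen_Fun[OF n_exactD(3)[OF closedD[OF A ZA]]] by blast
    obtain X' e' where X': "X' \<in> \<A>" and G': "cgen C X' ?F e'" and Tr: "Tr n C ?F = Fun Cop (op_cplx n X')"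
      using Res[OF ZA GF] by blast
    obtain u where "cqiso C (op_cplx n Z) X' u" using gen_unique[OF GF G'] by blast
    then obtain u' where u': "cqiso Cop (op_cplx n X') (op_cplx n (op_cplx n Z)) u'"
      using qiso_op_ex[OF closedD[OF A ZA] closedD[OF A X']] by blast
    \<comment> \<open>Double reversal returns \<open>Z\<close> up to irrelevant indices, which
      neither \<open>bd\<close> nor \<open>cobj\<close> at 0 can see.\<close>
    have "bd Cop (op_cplx n (op_cplx n Z)) = bd Cop Z" by (rule cagree_bd[OF cagree_op_op])
    moreover have "cobj (op_cplx n (op_cplx n Z)) 0 = cobj Z 0" by simp
    ultimately have "cqiso Cop (op_cplx n X') Z u'"
      using u' by simp
    moreover obtain e3 where G3: "cgen Cop (op_cplx n X') (Fun Cop (op_cplx n X')) e3"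
      using opF[OF X'] by blast
    ultimately have "mod_iso Cop (Tr n C ?F) H" unfolding Tr op.gen_mod_iso_iff[OF G3 GH] by blast
    then show "H \<in> Tr_image n C (coker_class C \<A>)" unfolding Tr_image_def using H coker_classI[OF ZA GF] by blast
  qed
qed

lemma Po_coker_class:
  assumes ic: "idempotent_complete C" and A: "closed_class n C \<A>"
  shows "Po n C (coker_class C \<A>) = coker_class C (po n C \<A>)"
proof -
  interpret op: additive_category "op_cat C" by (rule op_additive)
  have ic': "idempotent_complete Cop" using ic by (simp add: idempotent_complete_op)
  show ?thesis
    unfolding Po_def Tr_image_coker_class[OF ic A] op.Pb_coker_class[OF closed_opc[OF A]] op.Tr_image_coker_class[OF ic' op.closed_pb[OF closed_opc[OF A]]]
    by (simp add: po_def)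
qed

text \<open>A module in all the classes is presented by a member of \<open>\<A> 0\<close>, and
  closedness puts this same sequence into every \<open>\<A> i\<close>.\<close>

lemma coker_class_Inter:
  assumes A: "\<And>i::nat. closed_class n C (\<A> i)"
  shows "coker_class C (\<Inter>i. \<A> i) = (\<Inter>i. coker_class C (\<A> i))"
proof (intro Set.set_eqI iffI)
  fix F assume "F \<in> (\<Inter>i. coker_class C (\<A> i))"
  then have F: "F \<in> coker_class C (\<A> i)" for i by blast
  then obtain X e where X: "X \<in> \<A> 0" and G: "cgen C X F e" unfolding coker_class_def by blast
  have "X \<in> \<A> i" for i using coker_class_mem[OF A closedD[OF A X] G] F by blast
  then show "F \<in> coker_class C (\<Inter>i. \<A> i)" using coker_classI[OF _ G] by blast
qed (auto simp: coker_class_def)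

section \<open>The class \<open>max_cat\<close> in terms of sequences\<close>

lemma max_cat_eq:
  assumes ic: "idempotent_complete C"
  shows "max_cat n C = coker_class C (max_class n C)"
proof -
  have "(Pb C ^^ i) (ex_cat n C) = coker_class C ((pb C ^^ i) {X. n_exact n C X})" for i
    by (induction i) (simp_all add: ex_cat_eq[OF ic] Pb_coker_class[OF closed_pb_pow])
  then have 1: "Pb_inf C (ex_cat n C) = coker_class C (pb_inf n C)"
    unfolding Pb_inf_def pb_inf_def coker_class_Inter[OF closed_pb_pow] by simp
  have "(Po n C ^^ i) (coker_class C (pb_inf n C)) = coker_class C ((po n C ^^ i) (pb_inf n C))" for i
    by (induction i) (simp_all add: Po_coker_class[OF ic closed_po_pow])
  then show ?thesis
    unfolding max_cat_def 1 Po_inf_def max_class_def coker_class_Inter[OF closed_po_pow] by simp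
qed

text \<open>In the first description n-exactness is a consequence: a complex resolving a module of
  \<open>max_cat\<close> is left exact, and it is coexact because coexactness depends on the module
  alone.\<close>

lemma max_class_eq:
  assumes ic: "idempotent_complete C"
  shows "max_class n C = {X. is_complex n C X \<and> (\<exists>F\<in>max_cat n C. yoneda_resolves n C X F)}"
    "max_class n C = {X. n_exact n C X \<and> Fun C X \<in> max_cat n C}"
proof -
  show 2: "max_class n C = {X. n_exact n C X \<and> Fun C X \<in> max_cat n C}"
  proof -
    have 1: "Fun C X \<in> max_cat n C \<longleftrightarrow> X \<in> max_class n C" if X: "n_exact n C X" for X
    proof -
      obtain e where "cgen C X (Fun C X) e" using gen_Fun[OF n_exactD(3)[OF X]] by blast
      then show ?thesis unfolding max_cat_eq[OF ic] by (rule coker_class_mem[OF closed_max_class X])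
    qed
    have "X \<in> max_class n C \<longleftrightarrow> n_exact n C X \<and> Fun C X \<in> max_cat n C" for X
      using closedD[OF closed_max_class, of X n] 1[of X] by blast
    then show ?thesis by blast
  qed
  show "max_class n C = {X. is_complex n C X \<and> (\<exists>F\<in>max_cat n C. yoneda_resolves n C X F)}"
  proof (intro Set.set_eqI iffI)
    fix X assume X: "X \<in> max_class n C"
    then have n: "n_exact n C X" and F: "Fun C X \<in> max_cat n C" using 2 by auto
    obtain e where G: "cgen C X (Fun C X) e" using gen_Fun[OF n_exactD(3)[OF n]] by blast
    have "yoneda_resolves n C X (Fun C X)"
      using yoneda_resolves_iff[OF n_exactD(3)[OF n] genD(2)[OF G]] n_exactD(1)[OF n] G by blast
    then show "X \<in> {X. is_complex n C X \<and> (\<exists>F\<in>max_cat n C. yoneda_resolves n C X F)}" using F n_exactD(3)[OF n] by blast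
  next
    fix X assume "X \<in> {X. is_complex n C X \<and> (\<exists>F\<in>max_cat n C. yoneda_resolves n C X F)}"
    then obtain F :: "('a, 'b, 'b set) cmod" where X: "is_complex n C X" and F: "F \<in> coker_class C (max_class n C)" and y: "yoneda_resolves n C X F"
      unfolding max_cat_eq[OF ic] by blast
    obtain V e' where V: "V \<in> max_class n C" and GV: "cgen C V F e'" using F unfolding coker_class_def by blast
    obtain e where L: "lexact n C X" and G: "cgen C X F e"
      using yoneda_resolves_iff[OF X genD(2)[OF GV]] y by blast
    have nV: "n_exact n C V" by (rule closedD[OF closed_max_class V])
    then have "coexact n C V" using n_exact_iff by blast
    then have "coexact n C X" using gen_unique[OF G GV] coexact_transfer[OF lexactD(1)[OF L] n_exactD(2)[OF nV]] by blast
    then have "n_exact n C X" using L n_exact_iff by blast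
    then show "X \<in> max_class n C" using coker_class_mem[OF closed_max_class _ G] F by blast
  qed
qed

end

theorem theorem2:
  fixes C :: "('o, 'm) cat" and n :: nat
  assumes "additive_category C"
    and "idempotent_complete C"
    and "n \<ge> 1"
  shows "(\<exists>!\<X>. maximal_n_exact_structure n C \<X>) \<and>
    (\<forall>\<X>. maximal_n_exact_structure n C \<X> \<longrightarrow>
      \<X> = {X. is_complex n C X \<and> (\<exists>F\<in>max_cat n C. yoneda_resolves n C X F)} \<and>
      \<X> = {X. n_exact n C X \<and> Fun C X \<in> max_cat n C})"
proof -
  interpret additive_category C by fact
  \<comment> \<open>\<open>max_class\<close> is the greatest n-exact structure, hence the only
    maximal one.\<close>
  have "maximal_n_exact_structure n C \<X> \<longleftrightarrow> \<X> = max_class n C" for \<X>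
    unfolding maximal_n_exact_structure_def
    using max_class_structure[OF assms(2,3)] max_class_greatest by blast
  then show ?thesis using max_class_eq[OF assms(2)] by auto
qed

end
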